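(* Let $P$ be a finite connected poset with $|P|\ge2$, and let $\mathcal{A}(P)$ be the $P$-associahedron. Identify polytopes that are combinatorially equivalent. Then: (i) $\mathcal{A}(P)$ is a simple polytope of dimension $|P|-2$. (ii) Its polar dual $\mathcal{A}(P)^*$ is simplicial, but in general not flag (i.e. there exists a finite connected poset $P$ for which the boundary complex of $\mathcal{A}(P)^*$ is not a flag simplicial complex). (iii) For each proper piping $\mathbf{T}$, the corresponding face of $\mathcal{A}(P)$ has dimension $|P|-|\mathbf{T}|-2$. (iv) The vertices of $\mathcal{A}(P)$ are in bijection with proper pipings of size $|P|-2$. (v) The facets of $\mathcal{A}(P)$ are in bijection with proper pipes. (vi) Each (nonempty) face of $\mathcal{A}(P)$ is a product of polytopes of the form $\mathcal{A}(P')$, where the $P'$ are finite connected posets with at least two elements. (vii) When $P$ is a chain, $\mathcal{A}(P)$ is the $(|P|-2)$-dimensional associahedron. (viii) When $P$ is a claw, $\mathcal{A}(P)$ is the $(|P|-2)$-dimensional permutohedron.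
   Context: A finite poset $(P,\preceq)$ is connected if its Hasse diagram is a connected graph. A subset $\tau\subseteq P$ is convex if $i\prec j\prec k$ with $i,k\in\tau$ implies $j\in\tau$; it is connected if the subgraph of the Hasse diagram of $P$ induced by $\tau$ is connected. A pipe is a nonempty convex connected subset of $P$. A piping is a collection $\mathbf{T}$ of pipes, any two of which are nested (one contains the other) or disjoint, such that the directed graph with vertex set $\mathbf{T}$ and edges $(\tau,\tau')$ whenever $\tau\cap\tau'=\emptyset$ and $i\prec j$ for some $i\in\tau,j\in\tau'$ has no directed cycles. A pipe $\tau$ is proper if $1<|\tau|<|P|$; a piping is proper if all its elements are proper (the empty collection is allowed). $\mathcal{A}(P)$ is the polar dual of a simplicial $(|P|-2)$-dimensional polytope $\mathcal{A}(P)^*$ whose boundary complex is isomorphic to the simplicial complex with vertices the proper pipes and simplices the proper pipings (such a polytope exists; it is considered up to combinatorial equivalence). The face of $\mathcal{A}(P)$ corresponding to a proper piping $\mathbf{T}$ is the face dual to the simplex $\mathbf{T}$ (with $\mathbf{T}=\emptyset$ corresponding to $\mathcal{A}(P)$ itself). A poset is a chain if its covering relations are $1\lessdot2\lessdot\cdots\lessdot n$, and a claw if its covering relations are $\hat0\lessdot1,\hat0\lessdot2,\dots,\hat0\lessdot n$. The $(n-2)$-dimensional associahedron has nonempty faces in bijection with plane rooted trees with $n$ leaves in which every non-leaf vertex has at least two children, with face closure relations corresponding to edge contractions. The $(n-1)$-dimensional permutohedron is the convex hull of all vectors obtained from $(1,2,\dots,n)$ by permuting the coordinates. A simplicial complex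 is flag if every set of vertices that are pairwise joined by edges spans a simplex. *)

theory Defs
  imports "HOL-Analysis.Analysis"
begin

section \<open>Finite posets, pipes and pipings\<close>

text \<open>
  A poset is given by its reflexive order relation \<open>r\<close>; its ground set is \<^term>\<open>Field r\<close>.
\<close>

definition prec :: "'p rel \<Rightarrow> 'p \<Rightarrow> 'p \<Rightarrow> bool" where
  "prec r i j \<longleftrightarrow> (i, j) \<in> r \<and> i \<noteq> j"

definition covered_by :: "'p rel \<Rightarrow> 'p \<Rightarrow> 'p \<Rightarrow> bool" where
  "covered_by r i j \<longleftrightarrow> prec r i j \<and> (\<nexists>k. prec r i k \<and> prec r k j)"

text \<open>Edges of the subgraph of the (undirected) Hasse diagram of the poset induced by \<open>\<tau>\<close>.\<close>

definition hasse_edges_on :: "'p rel \<Rightarrow> 'p set \<Rightarrow> 'p rel" where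
  "hasse_edges_on r \<tau> = {(i, j). i \<in> \<tau> \<and> j \<in> \<tau> \<and> (covered_by r i j \<or> covered_by r j i)}"

definition hasse_connected :: "'p rel \<Rightarrow> 'p set \<Rightarrow> bool" where
  "hasse_connected r \<tau> \<longleftrightarrow> (\<forall>i\<in>\<tau>. \<forall>j\<in>\<tau>. (i, j) \<in> (hasse_edges_on r \<tau>)\<^sup>*)"

definition finite_connected_poset :: "'p rel \<Rightarrow> bool" where
  "finite_connected_poset r \<longleftrightarrow>
     Partial_order r \<and> finite (Field r) \<and> hasse_connected r (Field r)"

definition poset_convex :: "'p rel \<Rightarrow> 'p set \<Rightarrow> bool" where
  "poset_convex r \<tau> \<longleftrightarrow> (\<forall>i\<in>\<tau>. \<forall>k\<in>\<tau>. \<forall>j. prec r i j \<and> prec r j k \<longrightarrow> j \<in> \<tau>)"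

definition pipe :: "'p rel \<Rightarrow> 'p set \<Rightarrow> bool" where
  "pipe r \<tau> \<longleftrightarrow> \<tau> \<noteq> {} \<and> \<tau> \<subseteq> Field r \<and> poset_convex r \<tau> \<and> hasse_connected r \<tau>"

definition piping_digraph :: "'p rel \<Rightarrow> 'p set set \<Rightarrow> 'p set rel" where
  "piping_digraph r T =
     {(\<tau>, \<tau>'). \<tau> \<in> T \<and> \<tau>' \<in> T \<and> \<tau> \<inter> \<tau>' = {} \<and> (\<exists>i\<in>\<tau>. \<exists>j\<in>\<tau>'. prec r i j)}"

definition piping :: "'p rel \<Rightarrow> 'p set set \<Rightarrow> bool" where
  "piping r T \<longleftrightarrow>
     (\<forall>\<tau>\<in>T. pipe r \<tau>) \<and>
     (\<forall>\<tau>\<in>T. \<forall>\<tau>'\<in>T. \<tau> \<subseteq> \<tau>' \<or> \<tau>' \<subseteq> \<tau> \<or> \<tau> \<inter> \<tau>' = {}) \<and>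
     acyclic (piping_digraph r T)"

definition proper_pipes :: "'p rel \<Rightarrow> 'p set set" where
  "proper_pipes r = {\<tau>. pipe r \<tau> \<and> 1 < card \<tau> \<and> card \<tau> < card (Field r)}"

definition proper_pipings :: "'p rel \<Rightarrow> 'p set set set" where
  "proper_pipings r = {T. piping r T \<and> T \<subseteq> proper_pipes r}"

definition chain_poset :: "'p rel \<Rightarrow> bool" where
  "chain_poset r \<longleftrightarrow> (\<exists>n g. bij_betw g {1..n::nat} (Field r) \<and>
     (\<forall>x y. covered_by r x y \<longleftrightarrow> (\<exists>i\<in>{1..<n}. x = g i \<and> y = g (Suc i))))"

text \<open>Here \<open>g 0\<close> is the minimum of the claw.\<close>

definition claw_poset :: "'p rel \<Rightarrow> bool" where
  "claw_poset r \<longleftrightarrow> (\<exists>n g. bij_betw g {0..n::nat} (Field r) \<and>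
     (\<forall>x y. covered_by r x y \<longleftrightarrow> (\<exists>i\<in>{1..n}. x = g 0 \<and> y = g i)))"


section \<open>Simplicial complexes\<close>

text \<open>A simplicial complex is a set \<open>K\<close> of simplices, with vertex set \<^term>\<open>\<Union>K\<close>.\<close>

definition simplicial_iso :: "('u \<Rightarrow> 'v) \<Rightarrow> 'u set set \<Rightarrow> 'v set set \<Rightarrow> bool" where
  "simplicial_iso f K L \<longleftrightarrow> bij_betw f (\<Union>K) (\<Union>L) \<and> L = (\<lambda>S. f ` S) ` K"

definition flag_complex :: "'v set set \<Rightarrow> bool" where
  "flag_complex K \<longleftrightarrow>
     (\<forall>S. S \<subseteq> \<Union>K \<and> (\<forall>u\<in>S. \<forall>v\<in>S. u \<noteq> v \<longrightarrow> {u, v} \<in> K) \<longrightarrow> S \<in> K)"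


section \<open>Polytopes\<close>

text \<open>Faces include the empty face and the polytope itself.\<close>

definition combinatorially_equivalent ::
    "'a::euclidean_space set \<Rightarrow> 'b::euclidean_space set \<Rightarrow> bool" where
  "combinatorially_equivalent A B \<longleftrightarrow> polytope A \<and> polytope B \<and>
     (\<exists>\<phi>. bij_betw \<phi> {F. F face_of A} {G. G face_of B} \<and>
          (\<forall>F F'. F face_of A \<and> F' face_of A \<longrightarrow> (F \<subseteq> F' \<longleftrightarrow> \<phi> F \<subseteq> \<phi> F')))"

definition simple_polytope :: "'a::euclidean_space set \<Rightarrow> bool" where
  "simple_polytope A \<longleftrightarrow> polytope A \<and>
     (\<forall>v. v extreme_point_of A \<longrightarrow> int (card {F. F facet_of A \<and> v \<in> F}) = aff_dim A)"

definition simplicial_polytope :: "'a::euclidean_space set \<Rightarrow> bool" where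
  "simplicial_polytope D \<longleftrightarrow> polytope D \<and>
     (\<forall>F. F face_of D \<and> F \<noteq> D \<longrightarrow> (\<exists>k. k simplex F))"

text \<open>
  The boundary complex of a simplicial polytope, each proper face (including the empty one)
  being recorded by its set of vertices.
\<close>

definition boundary_complex :: "'a::euclidean_space set \<Rightarrow> 'a set set" where
  "boundary_complex D = {{x. x extreme_point_of F} |F. F face_of D \<and> F \<noteq> D}"

text \<open>
  The polar is taken inside the linear span of the polytope, so that polytopes need not be
  full-dimensional in the ambient space.  It is the usual polar dual of \<open>D\<close> whenever
  \<^prop>\<open>0 \<in> rel_interior D\<close>.
\<close>

definition polar_dual :: "'a::euclidean_space set \<Rightarrow> 'a set" where
  "polar_dual D = {y \<in> span D. \<forall>x\<in>D. x \<bullet> y \<le> 1}"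

text \<open>The face of \<open>A\<close> dual to the face \<open>G\<close> of \<^term>\<open>polar_dual A\<close>.\<close>

definition dual_face :: "'a::euclidean_space set \<Rightarrow> 'a set \<Rightarrow> 'a set" where
  "dual_face A G = {y \<in> A. \<forall>x\<in>G. x \<bullet> y = 1}"


section \<open>Poset associahedra\<close>

text \<open>
  \<open>D\<close> is a realization of the dual of the poset associahedron of \<open>r\<close>, and \<open>f\<close> identifies the
  complex of proper pipings with the boundary complex of \<open>D\<close>.  The condition on the origin is
  what makes the polar dual of \<open>D\<close> a polytope; it can be achieved by a translation.
\<close>

definition poset_associahedron_dual ::
    "'p rel \<Rightarrow> 'a::euclidean_space set \<Rightarrow> ('p set \<Rightarrow> 'a) \<Rightarrow> bool" where
  "poset_associahedron_dual r D f \<longleftrightarrow>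
     simplicial_polytope D \<and>
     aff_dim D = int (card (Field r)) - 2 \<and>
     0 \<in> rel_interior D \<and>
     simplicial_iso f (proper_pipings r) (boundary_complex D)"

definition poset_associahedron ::
    "'p rel \<Rightarrow> 'a::euclidean_space set \<Rightarrow> ('p set \<Rightarrow> 'a) \<Rightarrow> bool" where
  "poset_associahedron r A f \<longleftrightarrow> (\<exists>D. poset_associahedron_dual r D f \<and> A = polar_dual D)"

text \<open>\<open>f ` T\<close> is the vertex set of the simplex of the dual polytope labelled by \<open>T\<close>.\<close>

definition piping_face ::
    "'a::euclidean_space set \<Rightarrow> ('p set \<Rightarrow> 'a) \<Rightarrow> 'p set set \<Rightarrow> 'a set" where
  "piping_face A f T = dual_face A (convex hull (f ` T))"

text \<open>
  \<open>associahedra_product [r\<^sub>1, \<dots>, r\<^sub>k] F\<close>: up to combinatorial equivalence, \<open>F\<close> is the product of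
  the poset associahedra of \<open>r\<^sub>1\<close>, ..., \<open>r\<^sub>k\<close>, the empty product being a point.  The partial
  products are replaced by combinatorially equivalent polytopes so as to stay in one
  Euclidean space.
\<close>

primrec associahedra_product :: "'p rel list \<Rightarrow> 'a::euclidean_space set \<Rightarrow> bool" where
  "associahedra_product [] F \<longleftrightarrow> (\<exists>v. F = {v})"
| "associahedra_product (r # rs) F \<longleftrightarrow>
     (\<exists>(A::'a set) f G. poset_associahedron r A f \<and> associahedra_product rs G \<and>
        combinatorially_equivalent F (A \<times> G))"


section \<open>Classical associahedra and permutohedra\<close>

datatype plane_tree = Leaf | Node "plane_tree list"

fun num_leaves :: "plane_tree \<Rightarrow> nat" where
  "num_leaves Leaf = 1"
| "num_leaves (Node ts) = sum_list (map num_leaves ts)"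

fun branching :: "plane_tree \<Rightarrow> bool" where
  "branching Leaf \<longleftrightarrow> True"
| "branching (Node ts) \<longleftrightarrow> 2 \<le> length ts \<and> (\<forall>t\<in>set ts. branching t)"

definition plane_trees :: "nat \<Rightarrow> plane_tree set" where
  "plane_trees n = {t. branching t \<and> num_leaves t = n}"

text \<open>Contraction of one edge between non-leaf vertices: at the root, or inside a subtree.\<close>

inductive contract_edge :: "plane_tree \<Rightarrow> plane_tree \<Rightarrow> bool" where
  "contract_edge (Node (us @ Node ts # vs)) (Node (us @ ts @ vs))"
| "contract_edge t t' \<Longrightarrow> contract_edge (Node (us @ t # vs)) (Node (us @ t' # vs))"

text \<open>\<open>A\<close> is an associahedron of dimension \<open>n - 2\<close>.\<close>

definition is_associahedron :: "nat \<Rightarrow> 'a::euclidean_space set \<Rightarrow> bool" where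
  "is_associahedron n A \<longleftrightarrow> polytope A \<and> aff_dim A = int n - 2 \<and>
     (\<exists>\<phi>. bij_betw \<phi> {F. F face_of A \<and> F \<noteq> {}} (plane_trees n) \<and>
          (\<forall>F F'. F face_of A \<and> F \<noteq> {} \<and> F' face_of A \<and> F' \<noteq> {} \<longrightarrow>
             (F \<subseteq> F' \<longleftrightarrow> contract_edge\<^sup>*\<^sup>* (\<phi> F) (\<phi> F'))))"

text \<open>With \<open>n = CARD('k)\<close>, the permutohedron of dimension \<open>n - 1\<close>.\<close>

definition permutohedron :: "(real ^ 'k) set" where
  "permutohedron =
     convex hull {(\<chi> i. real (\<sigma> i)) |\<sigma>. bij_betw \<sigma> (UNIV :: 'k set) {1..CARD('k)}}"

end

(*
  The polytope is realized as {p. spread_P(p) = c_P, spread_t(p) >= c_t for every proper pipe t},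
  where p ranges over real functions on P modulo constants, spread_t(p) is the sum of p(j) - p(i)
  over the comparable pairs i < j in t, and the thresholds c_t grow so fast with |t| that a family
  of tight pipes that is not a piping would force too small a spread on the convex closure of its
  union. Conversely every piping is exactly the set of tight pipes of some point, built recursively
  by placing the points of the children of each pipe far apart along a rank function. Since the
  sets of tight constraints form a simplicial complex, polar duality is explicit, and all claims
  reduce to the combinatorics of pipings: the facet of t is A(t) x A(P/t), the pipings of a chain
  are the laminar families of intervals, i.e. plane trees, and those of a claw are the chains of
  subsets, which are also the sets of tight constraints of the permutohedron.
*)
theory Submission
  imports Defs
begin


section \<open>Polyhedra and their tight sets\<close>

text \<open>The theorem concerns every polytope whose dual has the proper pipings as boundary
  complex, so the explicit polytope only settles existence, including that of the factors in (vi)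
  and of the crown example. The other claims are read off an arbitrary realization: the vertices of
  its dual are the normals of inequalities whose sets of simultaneously tight indices are exactly
  the proper pipings. \<open>simple_system\<close> is the interface reached from both sides. What
  shapes the construction is that acyclicity is a global condition while each inequality sees a
  single pipe. The remedy is a gap of scales: on a union of tight pipes of size at most
  \<open>m\<close>, held together by overlaps or by a directed cycle, the values differ by at most a
  polynomial in \<open>N\<close> times \<open>growth ^ m\<close>, whereas feasibility demands a
  spread of \<open>growth ^ Suc m\<close> on the larger pipe that it generates. The same gap leaves
  room for the recursion: one comparable pair in different children already exceeds the threshold of
  every pipe strictly inside the parent.\<close>

locale inequality_system =
  fixes L :: "'a::euclidean_space set" and I :: "'i set" and a :: "'i \<Rightarrow> 'a" and b :: "'i \<Rightarrow> real"
  assumes affine_L: "affine L" and finite_I: "finite I"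
begin

definition sol :: "'a set" where
  "sol = {x \<in> L. \<forall>i\<in>I. a i \<bullet> x \<le> b i}"

definition tight :: "'a \<Rightarrow> 'i set" where
  "tight x = {i \<in> I. a i \<bullet> x = b i}"

definition tight_face :: "'i set \<Rightarrow> 'a set" where
  "tight_face T = {x \<in> sol. \<forall>i\<in>T. a i \<bullet> x = b i}"

text \<open>The inequalities are dropped and only the equations of \<open>T\<close> are kept. For
  the tight set of a solution this is the affine hull of the face, so dimensions can be computed
  here by linear algebra.\<close>

definition tight_flat :: "'i set \<Rightarrow> 'a set" where
  "tight_flat T = {x \<in> L. \<forall>i\<in>T. a i \<bullet> x = b i}"

lemma polyhedron_sol: "polyhedron sol"
proof -
  have "sol = L \<inter> \<Inter>((\<lambda>i. {x. a i \<bullet> x \<le> b i}) ` I)"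
    by (auto simp: sol_def)
  moreover have "polyhedron (\<Inter>((\<lambda>i. {x. a i \<bullet> x \<le> b i}) ` I))"
    using finite_I by (intro polyhedron_Inter) (auto simp: polyhedron_halfspace_le)
  ultimately show ?thesis
    using affine_L by (simp add: affine_imp_polyhedron polyhedron_Int)
qed

lemma polytope_sol: "bounded sol \<Longrightarrow> polytope sol"
  by (simp add: polyhedron_sol polytope_eq_bounded_polyhedron)

lemma convex_sol: "convex sol"
  by (simp add: polyhedron_imp_convex polyhedron_sol)

lemma tight_face_face_of:
  assumes "T \<subseteq> I" shows "tight_face T face_of sol"
proof -
  have "finite T" using assms finite_I finite_subset by blast
  then show ?thesis using assms
  proof (induction T)
    case empty
    then show ?case by (simp add: tight_face_def face_of_refl convex_sol)
  next
    case (insert i T)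
    have "sol \<inter> {x. a i \<bullet> x = b i} face_of sol"
      using insert.prems by (intro face_of_Int_supporting_hyperplane_le convex_sol) (auto simp: sol_def)
    moreover have "tight_face (insert i T) = tight_face T \<inter> (sol \<inter> {x. a i \<bullet> x = b i})"
      by (auto simp: tight_face_def)
    ultimately show ?case using insert by (simp add: face_of_Int)
  qed
qed

lemma tight_face_mono: "T' \<subseteq> T \<Longrightarrow> tight_face T \<subseteq> tight_face T'"
  by (auto simp: tight_face_def)

lemma tight_subset: "tight x \<subseteq> I"
  by (auto simp: tight_def)

lemma mem_tight_face_iff: "T \<subseteq> I \<Longrightarrow> x \<in> tight_face T \<longleftrightarrow> x \<in> sol \<and> T \<subseteq> tight x"
  by (auto simp: tight_face_def tight_def)

lemma affine_tight_flat: "affine (tight_flat T)"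
proof -
  have "tight_flat T = L \<inter> \<Inter>((\<lambda>i. {x. a i \<bullet> x = b i}) ` T)"
    by (auto simp: tight_flat_def)
  then show ?thesis using affine_L
    by (auto intro!: affine_Int affine_Inter simp: affine_hyperplane)
qed

text \<open>The finitely many inequalities that are strict at \<open>x\<close> stay strict nearby,
  so close to \<open>x\<close> the face is cut out of \<open>L\<close> by equations alone.\<close>

lemma tight_face_neighbourhood:
  assumes "x \<in> sol"
  obtains U where "open U" "x \<in> U" "U \<inter> tight_flat (tight x) \<subseteq> tight_face (tight x)"
proof
  let ?U = "\<Inter>i\<in>I - tight x. {y. a i \<bullet> y < b i}"
  show "open ?U" using finite_I by (auto simp: open_halfspace_lt)
  show "x \<in> ?U" using assms by (force simp: sol_def tight_def)
  show "?U \<inter> tight_flat (tight x) \<subseteq> tight_face (tight x)"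
  proof
    fix y assume y: "y \<in> ?U \<inter> tight_flat (tight x)"
    then have "a i \<bullet> y \<le> b i" if "i \<in> I" for i
      using that by (cases "i \<in> tight x") (auto simp: tight_flat_def intro: less_imp_le)
    with y show "y \<in> tight_face (tight x)"
      by (simp add: tight_flat_def tight_face_def sol_def)
  qed
qed

lemma tight_face_subset_flat: "tight_face T \<subseteq> tight_flat T"
  by (auto simp: tight_face_def tight_flat_def sol_def)

lemma mem_tight_face_tight: "x \<in> sol \<Longrightarrow> x \<in> tight_face (tight x)"
  by (simp add: mem_tight_face_iff tight_subset)

lemma mem_rel_interior_tight_face:
  assumes "x \<in> sol" shows "x \<in> rel_interior (tight_face (tight x))"
proof -
  obtain U where U: "open U" "x \<in> U" "U \<inter> tight_flat (tight x) \<subseteq> tight_face (tight x)"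
    by (rule tight_face_neighbourhood[OF assms])
  have "affine hull (tight_face (tight x)) \<subseteq> tight_flat (tight x)"
    by (simp add: affine_tight_flat hull_minimal tight_face_subset_flat)
  then show ?thesis
    unfolding mem_rel_interior using U mem_tight_face_tight[OF assms] by blast
qed

lemma affine_hull_tight_face:
  assumes "x \<in> sol" shows "affine hull (tight_face (tight x)) = tight_flat (tight x)"
proof -
  obtain U where U: "open U" "x \<in> U" "U \<inter> tight_flat (tight x) \<subseteq> tight_face (tight x)"
    by (rule tight_face_neighbourhood[OF assms])
  have x: "x \<in> tight_flat (tight x)"
    using mem_tight_face_tight[OF assms] tight_face_subset_flat by blast
  have "affine hull (tight_flat (tight x) \<inter> U) = affine hull (tight_flat (tight x))"
    using U x by (intro affine_hull_convex_Int_open) (auto intro: affine_imp_convex affine_tight_flat)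
  then have "tight_flat (tight x) \<subseteq> affine hull (tight_face (tight x))"
    by (metis Int_commute U(3) affine_hull_eq affine_tight_flat hull_mono)
  then show ?thesis
    by (simp add: affine_tight_flat hull_minimal subset_antisym tight_face_subset_flat)
qed

text \<open>A relative interior point \<open>x\<close> of \<open>F\<close> is also one of the face
  cut out by \<open>tight x\<close>, and two faces whose relative interiors meet coincide.\<close>

lemma face_eq_tight_face:
  assumes "F face_of sol" "F \<noteq> {}"
  obtains x where "x \<in> sol" "x \<in> rel_interior F" "F = tight_face (tight x)"
proof -
  obtain x where x: "x \<in> rel_interior F"
    using assms face_of_imp_convex rel_interior_eq_empty by blast
  then have "x \<in> sol" using assms face_of_imp_subset rel_interior_subset by blast
  moreover have "F = tight_face (tight x)"
    using mem_rel_interior_tight_face[OF \<open>x \<in> sol\<close>] x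
    by (intro face_of_eq[OF assms(1) tight_face_face_of[OF tight_subset]]) blast
  ultimately show ?thesis using x that by blast
qed

text \<open>A solution whose tight set is exactly \<open>T\<close> witnesses the nontrivial
  direction: it lies in \<open>tight_face T'\<close> only if all of \<open>T'\<close> is tight at
  it.\<close>

lemma tight_face_subset_iff:
  assumes "T \<in> tight ` sol" "T' \<in> tight ` sol"
  shows "tight_face T \<subseteq> tight_face T' \<longleftrightarrow> T' \<subseteq> T"
proof
  obtain x where x: "x \<in> sol" "T = tight x" using assms by blast
  have "T' \<subseteq> I" using assms tight_subset by blast
  moreover assume "tight_face T \<subseteq> tight_face T'"
  ultimately show "T' \<subseteq> T" using x mem_tight_face_tight mem_tight_face_iff by blast
qed (rule tight_face_mono)

text \<open>Together with \<open>tight_face_subset_iff\<close>, the face poset is that of the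
  realized tight sets under reverse inclusion. This determines the combinatorial type here and later
  that of the permutohedron.\<close>

lemma bij_betw_tight_face: "bij_betw tight_face (tight ` sol) {F. F face_of sol \<and> F \<noteq> {}}"
  unfolding bij_betw_def
proof
  show "inj_on tight_face (tight ` sol)"
  proof (rule inj_onI)
    fix T T' assume "T \<in> tight ` sol" "T' \<in> tight ` sol" "tight_face T = tight_face T'"
    then show "T = T'" using tight_face_subset_iff[of T T'] tight_face_subset_iff[of T' T] by simp
  qed
  show "tight_face ` tight ` sol = {F. F face_of sol \<and> F \<noteq> {}}"
  proof (intro equalityI subsetI)
    fix F assume "F \<in> tight_face ` tight ` sol"
    then obtain x where "x \<in> sol" "F = tight_face (tight x)" by blast
    then show "F \<in> {F. F face_of sol \<and> F \<noteq> {}}"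
      using mem_tight_face_tight tight_face_face_of[OF tight_subset] by blast
  next
    fix F assume "F \<in> {F. F face_of sol \<and> F \<noteq> {}}"
    then have "F face_of sol" "F \<noteq> {}" by auto
    then obtain x where "x \<in> sol" "F = tight_face (tight x)" by (rule face_eq_tight_face)
    then show "F \<in> tight_face ` tight ` sol" by blast
  qed
qed

end

section \<open>Polytopes with a simplicial complex of tight sets\<close>

text \<open>All right-hand sides are 1, so the origin is strictly feasible and polarity applies.
  \<open>tight_sets\<close> says that \<open>K\<close> consists of exactly the tight sets that
  occur, \<open>down_closed\<close> makes them a simplicial complex, which yields simplicity of the
  polytope, and \<open>singleton_in_K\<close> gives each inequality a facet of its own.\<close>

locale simple_system =
  fixes S :: "'a::euclidean_space set" and I :: "'i set" and v :: "'i \<Rightarrow> 'a" and K :: "'i set set"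
  assumes subspace_S: "subspace S" and finite_index: "finite I" and v_S: "i \<in> I \<Longrightarrow> v i \<in> S"
    and bounded_primal: "bounded {y \<in> S. \<forall>i\<in>I. v i \<bullet> y \<le> 1}"
    and tight_sets: "K = (\<lambda>y. {i \<in> I. v i \<bullet> y = 1}) ` {y \<in> S. \<forall>i\<in>I. v i \<bullet> y \<le> 1}"
    and down_closed: "T \<in> K \<Longrightarrow> T' \<subseteq> T \<Longrightarrow> T' \<in> K"
    and singleton_in_K: "i \<in> I \<Longrightarrow> {i} \<in> K"

sublocale simple_system \<subseteq> inequality_system S I v "\<lambda>_. 1"
  by unfold_locales (simp_all add: subspace_S finite_index subspace_imp_affine)

section \<open>Dimensions, vertices and facets of a simple system\<close>

context simple_system
begin

lemma K_eq: "K = tight ` sol"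
  by (simp add: tight_sets tight_def[abs_def] sol_def)

lemma K_subset: "T \<in> K \<Longrightarrow> T \<subseteq> I"
  by (auto simp: K_eq tight_def)

lemma finite_K: "T \<in> K \<Longrightarrow> finite T"
  using K_subset finite_index finite_subset by blast

lemma bounded_sol: "bounded sol"
  using bounded_primal by (simp add: sol_def)

lemma empty_in_K: "{} \<in> K"
proof -
  have "0 \<in> sol" "tight 0 = {}"
    by (auto simp: sol_def tight_def subspace_0 subspace_S)
  then show ?thesis unfolding K_eq by force
qed

lemma Union_K: "\<Union>K = I"
  using K_subset singleton_in_K by fastforce

lemma inj_v: "inj_on v I"
proof (rule inj_onI)
  fix i j assume ij: "i \<in> I" "j \<in> I" "v i = v j"
  then obtain x where "tight x = {i}" using singleton_in_K unfolding K_eq by fastforce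
  then have "v i \<bullet> x = 1" "j \<in> tight x \<longleftrightarrow> j = i" by (auto simp: tight_def set_eq_iff)
  then show "i = j" using ij by (simp add: tight_def)
qed

text \<open>Each new index lowers the dimension by exactly one: the hyperplane of \<open>i\<close>
  meets the flat in a point with tight set \<open>insert i T\<close>, and does not contain the flat
  because a point with tight set exactly \<open>T\<close> exists by
  \<open>down_closed\<close>.\<close>

lemma aff_dim_tight_flat:
  assumes "T \<in> K" shows "aff_dim (tight_flat T) = int (dim S) - int (card T)"
  using finite_K[OF assms] assms
proof (induction T)
  case empty
  then show ?case by (simp add: tight_flat_def aff_dim_subspace subspace_S)
next
  case (insert i T)
  then have T: "T \<in> K" using down_closed by blast
  obtain x y where x: "x \<in> sol" "tight x = insert i T" and y: "y \<in> sol" "tight y = T"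
    using insert.prems T unfolding K_eq by auto
  have "tight_flat (insert i T) = tight_flat T \<inter> {z. v i \<bullet> z = 1}"
    by (auto simp: tight_flat_def)
  moreover have "x \<in> tight_flat T \<inter> {z. v i \<bullet> z = 1}"
    using x by (auto simp: tight_flat_def sol_def tight_def)
  moreover have "i \<in> I" using K_subset[OF insert.prems] by simp
  then have "v i \<bullet> y \<noteq> 1" using y(2) insert.hyps(2) by (auto simp: tight_def)
  moreover have "y \<in> tight_flat T"
    using y by (auto simp: tight_flat_def sol_def tight_def)
  ultimately have "aff_dim (tight_flat (insert i T)) = aff_dim (tight_flat T) - 1"
    unfolding aff_dim_affine_Int_hyperplane[OF affine_tight_flat] \<open>tight_flat (insert i T) = _\<close> by auto
  then show ?case using insert.IH[OF T] insert.hyps by simp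
qed

lemma aff_dim_tight_face:
  assumes "T \<in> K" shows "aff_dim (tight_face T) = int (dim S) - int (card T)"
proof -
  obtain x where x: "x \<in> sol" "tight x = T" using assms unfolding K_eq by auto
  have "aff_dim (tight_face T) = aff_dim (affine hull (tight_face T))" by (simp add: aff_dim_affine_hull)
  also have "\<dots> = aff_dim (tight_flat T)" using affine_hull_tight_face[OF x(1)] x(2) by simp
  finally show ?thesis using aff_dim_tight_flat[OF assms] by simp
qed

lemma tight_face_empty: "tight_face {} = sol"
  by (simp add: tight_face_def)

lemma aff_dim_sol: "aff_dim sol = int (dim S)"
  using aff_dim_tight_face[OF empty_in_K] by (simp add: tight_face_empty)

lemma bij_betw_tight_face_K: "bij_betw tight_face K {F. F face_of sol \<and> F \<noteq> {}}"
  using bij_betw_tight_face unfolding K_eq .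

lemma tight_face_subset_iff_K:
  "T \<in> K \<Longrightarrow> T' \<in> K \<Longrightarrow> tight_face T \<subseteq> tight_face T' \<longleftrightarrow> T' \<subseteq> T"
  using tight_face_subset_iff K_eq by simp

lemma tight_face_K: "T \<in> K \<Longrightarrow> tight_face T face_of sol \<and> tight_face T \<noteq> {}"
  using bij_betw_tight_face_K unfolding bij_betw_def by blast

lemma bij_betw_tight_face_vertices:
  "bij_betw tight_face {T \<in> K. card T = dim S} {{x} |x. x extreme_point_of sol}"
  unfolding bij_betw_def
proof
  show "inj_on tight_face {T \<in> K. card T = dim S}"
    using bij_betw_tight_face_K by (auto simp: bij_betw_def intro: inj_on_subset)
  have *: "card T = dim S \<longleftrightarrow> (\<exists>x. tight_face T = {x})" if "T \<in> K" for T
    using aff_dim_tight_face[OF that] aff_dim_eq_0[of "tight_face T"] by auto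
  show "tight_face ` {T \<in> K. card T = dim S} = {{x} |x. x extreme_point_of sol}"
  proof (intro equalityI subsetI)
    fix F assume "F \<in> tight_face ` {T \<in> K. card T = dim S}"
    then obtain T x where "T \<in> K" "tight_face T = {x}" "F = {x}" using * by blast
    then show "F \<in> {{x} |x. x extreme_point_of sol}"
      using tight_face_K[of T] by (simp add: face_of_singleton)
  next
    fix F assume "F \<in> {{x} |x. x extreme_point_of sol}"
    then obtain x where x: "F = {x}" "{x} face_of sol" by (auto simp: face_of_singleton)
    then have "{x} \<in> tight_face ` K" using bij_betw_tight_face_K unfolding bij_betw_def by blast
    then obtain T where "T \<in> K" "tight_face T = {x}" by force
    then show "F \<in> tight_face ` {T \<in> K. card T = dim S}" using * x by blast
  qed
qed

lemma bij_betw_tight_face_facets: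
  "bij_betw (\<lambda>i. tight_face {i}) I {F. F facet_of sol}"
  unfolding bij_betw_def
proof
  show "inj_on (\<lambda>i. tight_face {i}) I"
  proof (rule inj_onI)
    fix i j assume "i \<in> I" "j \<in> I" "tight_face {i} = tight_face {j}"
    then show "i = j" using tight_face_subset_iff_K[of "{i}" "{j}"] singleton_in_K by simp
  qed
  have *: "tight_face T facet_of sol \<longleftrightarrow> card T = 1" if "T \<in> K" for T
    using aff_dim_tight_face[OF that] tight_face_K[OF that] by (auto simp: facet_of_def aff_dim_sol)
  show "(\<lambda>i. tight_face {i}) ` I = {F. F facet_of sol}"
  proof (intro equalityI subsetI)
    fix F assume "F \<in> (\<lambda>i. tight_face {i}) ` I"
    then obtain i where "i \<in> I" "F = tight_face {i}" by blast
    then show "F \<in> {F. F facet_of sol}" using *[OF singleton_in_K] by simp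
  next
    fix F assume F: "F \<in> {F. F facet_of sol}"
    then have "F \<in> tight_face ` K"
      using bij_betw_tight_face_K unfolding bij_betw_def facet_of_def by blast
    then obtain T where T: "T \<in> K" "tight_face T = F" by force
    then obtain i where "T = {i}" using * F by (auto simp: card_1_singleton_iff)
    then show "F \<in> (\<lambda>i. tight_face {i}) ` I" using T K_subset by blast
  qed
qed

text \<open>A vertex with tight set \<open>T\<close> lies on exactly the facets of the members of
  \<open>T\<close>, and \<open>T\<close> has \<open>dim S\<close> elements because its face has
  dimension 0.\<close>

lemma simple_polytope_sol: "simple_polytope sol"
  unfolding simple_polytope_def
proof (intro conjI allI impI polytope_sol bounded_sol)
  fix x assume "x extreme_point_of sol"
  then have "{x} \<in> tight_face ` {T \<in> K. card T = dim S}"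
    using bij_betw_tight_face_vertices unfolding bij_betw_def by blast
  then obtain T where T: "T \<in> K" "card T = dim S" "tight_face T = {x}" by auto
  have "x \<in> tight_face {i} \<longleftrightarrow> i \<in> T" if "i \<in> I" for i
    using tight_face_subset_iff_K[OF T(1) singleton_in_K[OF that]] T by auto
  moreover have "{F. F facet_of sol} = (\<lambda>i. tight_face {i}) ` I"
    using bij_betw_tight_face_facets unfolding bij_betw_def by blast
  ultimately have "{F. F facet_of sol \<and> x \<in> F} = (\<lambda>i. tight_face {i}) ` T"
    using K_subset[OF T(1)] by blast
  moreover have "inj_on (\<lambda>i. tight_face {i}) T"
    using bij_betw_tight_face_facets K_subset[OF T(1)] unfolding bij_betw_def
    by (blast intro: inj_on_subset)
  ultimately show "int (card {F. F facet_of sol \<and> x \<in> F}) = aff_dim sol"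
    using T(2) by (simp add: card_image aff_dim_sol)
qed

section \<open>The polar dual as the convex hull of the normals\<close>

text \<open>The origin turns out to be a relative interior point. Listing it keeps the hull nonempty
  when there are no inequalities, as for a poset with two elements.\<close>

definition dual :: "'a set" where
  "dual = convex hull (insert 0 (v ` I))"

lemma zero_in_dual: "0 \<in> dual"
  by (simp add: dual_def hull_inc)

lemma v_in_dual: "i \<in> I \<Longrightarrow> v i \<in> dual"
  by (simp add: dual_def hull_inc)

lemma polytope_dual: "polytope dual"
  unfolding dual_def using finite_index by (intro polytope_convex_hull) simp

lemma dual_subset_S: "dual \<subseteq> S"
  unfolding dual_def using v_S subspace_S
  by (intro hull_minimal) (auto simp: subspace_0 subspace_imp_convex)

lemma le_1_on_dual:
  assumes "\<And>i. i \<in> I \<Longrightarrow> v i \<bullet> y \<le> 1" "x \<in> dual" shows "x \<bullet> y \<le> 1"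
proof -
  have "convex {x. x \<bullet> y \<le> 1}" using convex_halfspace_le[of y 1] by (simp add: inner_commute)
  then have "dual \<subseteq> {x. x \<bullet> y \<le> 1}"
    unfolding dual_def using assms(1) by (intro hull_minimal) auto
  then show ?thesis using assms(2) by blast
qed

lemma mem_sol_iff: "y \<in> sol \<longleftrightarrow> y \<in> S \<and> (\<forall>x\<in>dual. x \<bullet> y \<le> 1)"
  using le_1_on_dual v_in_dual by (auto simp: sol_def)

text \<open>The bipolar theorem inside \<open>S\<close>: the normal provided by the separation
  theorem is a difference of two points of \<open>S\<close>, and since the origin lies in
  \<open>dual\<close> the separating constant \<open>b\<close> is negative, so dividing by it yields
  a point of the polar.\<close>

lemma separate_from_dual:
  assumes "z \<in> S" "z \<notin> dual" obtains y where "y \<in> sol" "z \<bullet> y > 1"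
proof -
  have "convex dual" "closed dual" "dual \<noteq> {}"
    using polytope_dual zero_in_dual by (auto simp: polytope_imp_convex polytope_imp_closed)
  then obtain a b where ab: "a \<in> dual" "(a - z) \<bullet> z < b" "\<And>x. x \<in> dual \<Longrightarrow> b < (a - z) \<bullet> x"
    using separating_hyperplane_closed_point_inset[OF _ _ _ assms(2)] by blast
  have "b < 0" using ab(3)[OF zero_in_dual] by simp
  let ?y = "(1 / b) *\<^sub>R (a - z)"
  have "?y \<in> S" using ab(1) assms(1) dual_subset_S subspace_S
    by (intro subspace_scale subspace_diff) auto
  moreover have "x \<bullet> ?y \<le> 1" if "x \<in> dual" for x
    using ab(3)[OF that] \<open>b < 0\<close> by (simp add: divide_simps inner_commute)
  moreover have "z \<bullet> ?y > 1"
    using ab(2) \<open>b < 0\<close> by (simp add: divide_simps inner_commute)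
  ultimately show ?thesis using that mem_sol_iff by blast
qed

text \<open>Boundedness of \<open>sol\<close> dualizes: if \<open>R\<close> bounds the norms on
  \<open>sol\<close>, a point of \<open>S\<close> of norm below \<open>1 / R\<close> cannot be
  separated from \<open>dual\<close>.\<close>

lemma ball_subset_dual: obtains e where "e > 0" "ball 0 e \<inter> S \<subseteq> dual"
proof -
  obtain R where R: "R > 0" "\<And>y. y \<in> sol \<Longrightarrow> norm y \<le> R"
    using bounded_sol bounded_pos by blast
  have "z \<in> dual" if "z \<in> S" "norm z < 1 / R" for z
  proof (rule ccontr)
    assume "z \<notin> dual"
    then obtain y where y: "y \<in> sol" "z \<bullet> y > 1" using separate_from_dual \<open>z \<in> S\<close> by blast
    have "z \<bullet> y \<le> norm z * norm y" using norm_cauchy_schwarz by blast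
    also have "\<dots> \<le> norm z * R" using R(2)[OF y(1)] by (simp add: mult_left_mono)
    also have "\<dots> < 1" using that R(1) by (simp add: field_simps)
    finally show False using y by simp
  qed
  then have "ball 0 (1 / R) \<inter> S \<subseteq> dual" by (auto simp: dist_norm)
  then show ?thesis using that R(1) by (metis zero_less_divide_1_iff)
qed

lemma span_dual: "span dual = S"
proof -
  obtain e where e: "e > 0" "ball 0 e \<inter> S \<subseteq> dual" by (rule ball_subset_dual)
  have "z \<in> span dual" if "z \<in> S" for z
  proof (cases "z = 0")
    case False
    let ?w = "(e / (2 * norm z)) *\<^sub>R z"
    have "?w \<in> dual" using e that False subspace_S by (auto simp: dist_norm subspace_scale)
    then have "(2 * norm z / e) *\<^sub>R ?w \<in> span dual" by (simp add: span_base span_mul del: scaleR_scaleR)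
    then show ?thesis using False e by simp
  qed (simp add: span_zero)
  then show ?thesis using dual_subset_S span_minimal subspace_S by blast
qed

lemma affine_hull_dual: "affine hull dual = S"
  using affine_hull_span_0 span_dual zero_in_dual hull_inc by metis

lemma rel_interior_dual: "0 \<in> rel_interior dual"
  using ball_subset_dual zero_in_dual affine_hull_dual by (metis mem_rel_interior_ball)

lemma aff_dim_dual: "aff_dim dual = int (dim S)"
  by (metis aff_dim_affine_hull aff_dim_subspace affine_hull_dual subspace_S)

lemma span_sol: "span sol = S"
proof -
  obtain U where "open U" "0 \<in> U" "U \<inter> tight_flat (tight 0) \<subseteq> tight_face (tight 0)"
    using tight_face_neighbourhood[of 0] subspace_S by (auto simp: sol_def subspace_0)
  have 0: "0 \<in> sol" "tight 0 = {}"
    by (auto simp: sol_def tight_def subspace_0 subspace_S)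
  then have "affine hull sol = S"
    using affine_hull_tight_face[of 0] by (simp add: tight_face_empty tight_flat_def)
  then show ?thesis using 0 affine_hull_span_0 hull_inc by metis
qed

lemma polar_dual_sol: "polar_dual sol = dual"
proof
  show "polar_dual sol \<subseteq> dual"
    using separate_from_dual unfolding polar_dual_def span_sol
    by (smt (verit) inner_commute mem_Collect_eq subsetI)
  show "dual \<subseteq> polar_dual sol"
  proof
    fix x assume x: "x \<in> dual"
    have "y \<bullet> x \<le> 1" if "y \<in> sol" for y
      using that x unfolding mem_sol_iff by (simp add: inner_commute)
    then show "x \<in> polar_dual sol" using x dual_subset_S by (auto simp: polar_dual_def span_sol)
  qed
qed

lemma dual_face_sol:
  "dual_face sol (convex hull (v ` T)) = tight_face T"
proof -
  have "(\<forall>x\<in>convex hull (v ` T). x \<bullet> y = 1) \<longleftrightarrow> (\<forall>i\<in>T. v i \<bullet> y = 1)" for y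
  proof
    assume "\<forall>i\<in>T. v i \<bullet> y = 1"
    moreover have "convex {x. x \<bullet> y = 1}" using convex_hyperplane[of y 1] by (simp add: inner_commute)
    ultimately have "convex hull (v ` T) \<subseteq> {x. x \<bullet> y = 1}" by (intro hull_minimal) auto
    then show "\<forall>x\<in>convex hull (v ` T). x \<bullet> y = 1" by blast
  qed (simp add: hull_inc)
  then show ?thesis by (simp add: dual_face_def tight_face_def)
qed

text \<open>The extreme points of the supporting face are generators of \<open>dual\<close> on the
  hyperplane, and the generator 0 is not among them since its inner product with \<open>x\<close> is
  0.\<close>

lemma supporting_face:
  assumes "x \<in> sol"
  shows "dual \<inter> {z. z \<bullet> x = 1} = convex hull (v ` tight x)" (is "?F = _")
    and "convex hull (v ` tight x) face_of dual"
proof -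
  have face: "?F face_of dual"
    using face_of_Int_supporting_hyperplane_le[of dual x 1] assms mem_sol_iff polytope_dual
    by (auto simp: inner_commute polytope_imp_convex)
  have "{w. w extreme_point_of ?F} \<subseteq> v ` tight x"
  proof
    fix w assume "w \<in> {w. w extreme_point_of ?F}"
    then have "w \<in> insert 0 (v ` I)" "w \<bullet> x = 1"
      using extreme_point_of_convex_hull extreme_point_of_face[OF face] by (auto simp: dual_def)
    then show "w \<in> v ` tight x" by (auto simp: tight_def)
  qed
  moreover have "polytope ?F" using face face_of_polytope_polytope polytope_dual by blast
  ultimately have "?F \<subseteq> convex hull (v ` tight x)"
    using Krein_Milman_Minkowski[of ?F] hull_mono by (metis polytope_imp_compact polytope_imp_convex)
  moreover have "v ` tight x \<subseteq> ?F" using v_in_dual by (auto simp: tight_def)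
  then have "convex hull (v ` tight x) \<subseteq> ?F"
    using face face_of_imp_convex by (intro hull_minimal) auto
  ultimately show eq: "?F = convex hull (v ` tight x)" by blast
  then show "convex hull (v ` tight x) face_of dual" using face by simp
qed

text \<open>A proper face is exposed, and its hyperplane avoids the origin, a relative interior
  point. Projecting the normal to \<open>S\<close> and scaling the offset to 1 turns it into a
  solution, whose tight set is the required \<open>T\<close>.\<close>

lemma proper_face_of_dual_eq:
  assumes "F face_of dual" "F \<noteq> dual"
  obtains T where "T \<in> K" "F = convex hull (v ` T)"
proof (cases "F = {}")
  case True
  then show ?thesis using that[OF empty_in_K] by simp
next
  case False
  have "F exposed_face_of dual"
    using assms exposed_face_of_polyhedron polytope_dual polytope_imp_polyhedron by blast
  then obtain a b where ab: "dual \<subseteq> {x. a \<bullet> x \<le> b}" "F = dual \<inter> {x. a \<bullet> x = b}"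
    unfolding exposed_face_of_def by blast
  have "0 \<notin> F" using assms rel_interior_dual face_of_disjoint_rel_interior by blast
  then have "b > 0" using ab zero_in_dual by force
  obtain y z where yz: "y \<in> span S" "\<And>w. w \<in> span S \<Longrightarrow> orthogonal z w" "a = y + z"
    using orthogonal_subspace_decomp_exists[of S a] by metis
  let ?y = "(1 / b) *\<^sub>R y"
  have span: "span S = S" using subspace_S by (simp add: span_eq_iff)
  have inner: "x \<bullet> ?y = (a \<bullet> x) / b" if "x \<in> dual" for x
    using yz(2)[of x] yz(3) that dual_subset_S
    by (auto simp: span orthogonal_def inner_add_left inner_add_right inner_commute)
  have "?y \<in> S" using yz(1) span subspace_S subspace_scale by metis
  then have "?y \<in> sol" using inner ab(1) \<open>b > 0\<close> by (auto simp: mem_sol_iff divide_simps)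
  moreover have "F = dual \<inter> {z. z \<bullet> ?y = 1}"
    using inner \<open>b > 0\<close> unfolding ab(2) by (auto simp: divide_simps)
  ultimately show ?thesis using that supporting_face(1) K_eq by (metis imageI)
qed

lemma hull_in_faces:
  assumes "T \<in> K"
  shows "convex hull (v ` T) face_of dual" "convex hull (v ` T) \<noteq> dual"
proof -
  obtain x where x: "x \<in> sol" "tight x = T" using assms K_eq by auto
  show "convex hull (v ` T) face_of dual" using supporting_face(2)[OF x(1)] x(2) by simp
  show "convex hull (v ` T) \<noteq> dual"
  proof
    assume "convex hull (v ` T) = dual"
    then have "0 \<in> dual \<inter> {z. z \<bullet> x = 1}"
      using supporting_face(1)[OF x(1)] x(2) zero_in_dual by simp
    then show False by simp
  qed
qed

text \<open>Each normal is a vertex of \<open>dual\<close> because \<open>{i}\<close> belongs to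
  \<open>K\<close>, and a vertex of \<open>dual\<close> that lies in a face is a vertex of that
  face.\<close>

lemma extreme_points_hull:
  assumes "T \<in> K" shows "{x. x extreme_point_of (convex hull (v ` T))} = v ` T"
proof (intro equalityI subsetI)
  fix x assume "x \<in> v ` T"
  then obtain i where i: "i \<in> T" "x = v i" by auto
  then have "i \<in> I" using K_subset assms by blast
  then have "{x} face_of dual" using hull_in_faces(1)[OF singleton_in_K[OF \<open>i \<in> I\<close>]] i by simp
  then have "x extreme_point_of dual" by (simp add: face_of_singleton)
  moreover have "x \<in> convex hull (v ` T)" using \<open>x \<in> v ` T\<close> by (rule hull_inc)
  ultimately show "x \<in> {x. x extreme_point_of (convex hull (v ` T))}"
    by (simp add: extreme_point_of_face[OF hull_in_faces(1)[OF assms]])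
qed (use extreme_point_of_convex_hull in blast)

lemma boundary_complex_dual: "boundary_complex dual = (\<lambda>T. v ` T) ` K"
proof -
  have "{F. F face_of dual \<and> F \<noteq> dual} = (\<lambda>T. convex hull (v ` T)) ` K"
  proof (intro equalityI subsetI)
    fix F assume "F \<in> {F. F face_of dual \<and> F \<noteq> dual}"
    then obtain T where "T \<in> K" "F = convex hull (v ` T)" using proper_face_of_dual_eq[of F] by auto
    then show "F \<in> (\<lambda>T. convex hull (v ` T)) ` K" by simp
  qed (use hull_in_faces in auto)
  moreover have "boundary_complex dual =
      (\<lambda>F. {x. x extreme_point_of F}) ` {F. F face_of dual \<and> F \<noteq> dual}"
    unfolding boundary_complex_def by blast
  ultimately have "boundary_complex dual = (\<lambda>T. {x. x extreme_point_of (convex hull (v ` T))}) ` K"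
    by (simp only: image_image)
  also have "\<dots> = (\<lambda>T. v ` T) ` K" by (intro image_cong refl extreme_points_hull)
  finally show ?thesis .
qed

lemma simplicial_iso_dual: "simplicial_iso v K (boundary_complex dual)"
  using inj_v Union_K by (auto simp: simplicial_iso_def boundary_complex_dual bij_betw_def)

text \<open>By Radon, an affine dependence splits the points into two parts \<open>M\<close> and
  \<open>P\<close> whose hulls meet. The indices belonging to \<open>M\<close> form a member of
  \<open>K\<close> by \<open>down_closed\<close>, so some solution puts \<open>M\<close> on its
  hyperplane and \<open>P\<close> strictly below it.\<close>

lemma independent_K:
  assumes "T \<in> K" shows "\<not> affine_dependent (v ` T)"
proof
  assume "affine_dependent (v ` T)"
  then obtain M P where MP: "M \<inter> P = {}" "M \<union> P = v ` T" "convex hull M \<inter> convex hull P \<noteq> {}"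
    using Radon_partition finite_K[OF assms] by (metis finite_imageI)
  define T' where "T' = {i \<in> T. v i \<in> M}"
  have T': "T' \<in> K" using down_closed[OF assms] by (auto simp: T'_def)
  then obtain x where x: "x \<in> sol" "tight x = T'" using K_eq by auto
  obtain z where z: "z \<in> convex hull M" "z \<in> convex hull P" using MP by blast
  have "M \<subseteq> {z. z \<bullet> x = 1}"
  proof
    fix w assume "w \<in> M"
    then have "w \<in> v ` T" using MP(2) by blast
    then obtain i where "i \<in> T'" "v i = w" using \<open>w \<in> M\<close> by (auto simp: T'_def)
    then show "w \<in> {z. z \<bullet> x = 1}" using x(2) by (auto simp: tight_def)
  qed
  then have "convex hull M \<subseteq> {z. z \<bullet> x = 1}"
    using convex_hyperplane[of x 1] by (simp add: inner_commute subset_hull)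
  moreover have "P \<subseteq> {z. z \<bullet> x < 1}"
  proof
    fix w assume "w \<in> P"
    then have "w \<in> v ` T" "w \<notin> M" using MP by blast+
    then obtain i where i: "i \<in> T" "v i = w" "i \<notin> T'" by (auto simp: T'_def)
    then have "i \<in> I" using K_subset assms by blast
    then have "v i \<bullet> x \<le> 1" "v i \<bullet> x \<noteq> 1"
      using x i(3) by (auto simp: sol_def tight_def)
    then show "w \<in> {z. z \<bullet> x < 1}" using i by simp
  qed
  then have "convex hull P \<subseteq> {z. z \<bullet> x < 1}"
    using convex_halfspace_lt[of x 1] by (simp add: inner_commute subset_hull)
  ultimately show False using z by force
qed

lemma simplicial_polytope_dual: "simplicial_polytope dual"
  unfolding simplicial_polytope_def
proof (intro conjI allI impI polytope_dual)
  fix F assume "F face_of dual \<and> F \<noteq> dual"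
  then obtain T where T: "T \<in> K" "F = convex hull (v ` T)" using proper_face_of_dual_eq by blast
  have "(int (card (v ` T)) - 1) simplex F"
    unfolding simplex_def using independent_K[OF T(1)] T(2) by auto
  then show "\<exists>k. k simplex F" by blast
qed

end

section \<open>From an arbitrary realization back to a simple system\<close>

text \<open>Transfers all results to every polytope with the prescribed boundary complex. A point
  \<open>y\<close> of the polar cuts out the face of \<open>D\<close> where
  \<open>x \<bullet> y = 1\<close>; this face misses the origin, hence is proper, and its vertex set
  is a simplex.\<close>

lemma simple_system_of_simplicial_polytope:
  fixes D :: "'a::euclidean_space set"
  assumes D: "simplicial_polytope D" "0 \<in> rel_interior D"
    and iso: "simplicial_iso f K (boundary_complex D)"
    and K: "\<And>T T'. T \<in> K \<Longrightarrow> T' \<subseteq> T \<Longrightarrow> T' \<in> K" "finite (\<Union>K)"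
  shows "simple_system (span D) (\<Union>K) f K"
    and "polar_dual D = {y \<in> span D. \<forall>i\<in>\<Union>K. f i \<bullet> y \<le> 1}"
proof -
  have poly: "polytope D" using D by (simp add: simplicial_polytope_def)
  have inj: "inj_on f (\<Union>K)" and bc: "boundary_complex D = (\<lambda>T. f ` T) ` K"
    using iso by (auto simp: simplicial_iso_def bij_betw_def)
  have 0: "0 \<in> D" using D(2) rel_interior_subset by blast
  have f_ext: "f i extreme_point_of D" if i: "i \<in> \<Union>K" for i
  proof -
    obtain T where T: "T \<in> K" "i \<in> T" using i by blast
    then have "f ` T \<in> boundary_complex D" by (simp add: bc)
    then obtain F where F: "F face_of D" "f ` T = {x. x extreme_point_of F}"
      by (auto simp: boundary_complex_def)
    have "f i extreme_point_of F" using F(2) T(2) by blast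
    then show ?thesis using extreme_point_of_face[OF F(1)] by blast
  qed
  \<comment> \<open>The exceptional value 0 covers the degenerate case \<open>D = {0}\<close>, whose
    only vertex is not recorded in the boundary complex.\<close>
  have ext_f: "x = 0 \<or> x \<in> f ` \<Union>K" if x: "x extreme_point_of D" for x
  proof (cases "{x} = D")
    case False
    moreover have "{x} face_of D" by (simp add: face_of_singleton x)
    ultimately have "{y. y extreme_point_of {x}} \<in> boundary_complex D"
      unfolding boundary_complex_def by blast
    moreover have "{y. y extreme_point_of {x}} = {x}" by auto
    ultimately show ?thesis unfolding bc by blast
  qed (use 0 in blast)
  have hull: "D = convex hull {x. x extreme_point_of D}"
    by (intro Krein_Milman_Minkowski polytope_imp_compact polytope_imp_convex poly)
  show polar: "polar_dual D = {y \<in> span D. \<forall>i\<in>\<Union>K. f i \<bullet> y \<le> 1}"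
  proof -
    have "x \<bullet> y \<le> 1" if "\<forall>i\<in>\<Union>K. f i \<bullet> y \<le> 1" "x \<in> D" for x y
    proof -
      have "convex {x. x \<bullet> y \<le> 1}" using convex_halfspace_le[of y 1] by (simp add: inner_commute)
      moreover have "{x. x extreme_point_of D} \<subseteq> {x. x \<bullet> y \<le> 1}" using ext_f that(1) by fastforce
      ultimately have "convex hull {x. x extreme_point_of D} \<subseteq> {x. x \<bullet> y \<le> 1}"
        by (intro hull_minimal) auto
      then show ?thesis using that(2) hull by blast
    qed
    moreover have "f i \<in> D" if "i \<in> \<Union>K" for i using f_ext[OF that] by (simp add: extreme_point_of_def)
    ultimately show ?thesis unfolding polar_dual_def by blast
  qed
  let ?A = "{y \<in> span D. \<forall>i\<in>\<Union>K. f i \<bullet> y \<le> 1}"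
  \<comment> \<open>A small multiple of \<open>y\<close> lies in \<open>D\<close>, and pairing it
    with \<open>y\<close> bounds the norm of \<open>y\<close>.\<close>
  have bounded: "bounded ?A"
  proof -
    have "affine hull D = span D" using 0 by (simp add: affine_hull_span_0 hull_inc)
    then obtain e where e: "e > 0" "ball 0 e \<inter> span D \<subseteq> D"
      using D(2) mem_rel_interior_ball by metis
    have "norm y \<le> 2 / e" if "y \<in> ?A" for y
    proof (cases "y = 0")
      case False
      let ?x = "(e / (2 * norm y)) *\<^sub>R y"
      have "?x \<in> span D" using that by (simp add: span_mul)
      then have "?x \<in> D" using e False by (auto simp: dist_norm)
      then have "?x \<bullet> y \<le> 1" using that unfolding polar[symmetric] polar_dual_def by blast
      then show ?thesis using False e(1) by (simp add: field_simps dot_square_norm power2_eq_square)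
    qed (use e in simp)
    then show ?thesis unfolding bounded_iff by blast
  qed
  have tight_in: "{i \<in> \<Union>K. f i \<bullet> y = 1} \<in> K" if y: "y \<in> ?A" for y
  proof -
    let ?F = "D \<inter> {x. x \<bullet> y = 1}"
    have F: "?F face_of D"
      using y face_of_Int_supporting_hyperplane_le[of D y 1] poly
      unfolding polar[symmetric] polar_dual_def by (auto simp: inner_commute polytope_imp_convex)
    moreover have "0 \<notin> ?F" by simp
    then have "?F \<noteq> D" using 0 by blast
    ultimately have "{x. x extreme_point_of ?F} \<in> boundary_complex D"
      unfolding boundary_complex_def by blast
    then obtain T where T: "T \<in> K" "{x. x extreme_point_of ?F} = f ` T" using bc by auto
    have "{x. x extreme_point_of ?F} = f ` {i \<in> \<Union>K. f i \<bullet> y = 1}"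
    proof (intro equalityI subsetI)
      fix x assume "x \<in> {x. x extreme_point_of ?F}"
      then have "x extreme_point_of D" "x \<bullet> y = 1" using extreme_point_of_face[OF F] by auto
      moreover from this have "x \<noteq> 0" by (metis inner_zero_left zero_neq_one)
      ultimately obtain i where "i \<in> \<Union>K" "x = f i" "f i \<bullet> y = 1" using ext_f[of x] by auto
      then show "x \<in> f ` {i \<in> \<Union>K. f i \<bullet> y = 1}" by (intro image_eqI) auto
    next
      fix x assume "x \<in> f ` {i \<in> \<Union>K. f i \<bullet> y = 1}"
      then obtain i where i: "i \<in> \<Union>K" "f i \<bullet> y = 1" "x = f i" by blast
      have "f i \<in> D" using f_ext[OF i(1)] by (simp add: extreme_point_of_def)
      then show "x \<in> {x. x extreme_point_of ?F}"
        using extreme_point_of_face[OF F] f_ext[OF i(1)] i by blast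
    qed
    then have "f ` T = f ` {i \<in> \<Union>K. f i \<bullet> y = 1}" using T by simp
    then have "T = {i \<in> \<Union>K. f i \<bullet> y = 1}"
      using inj_on_image_eq_iff[OF inj, of T "{i \<in> \<Union>K. f i \<bullet> y = 1}"] T(1) by blast
    then show ?thesis using T by simp
  qed
  \<comment> \<open>Conversely a simplex is the vertex set of a proper exposed face; its normal,
    projected to \<open>span D\<close> and rescaled to offset 1, is a polar point tight exactly at
    \<open>T\<close>. The empty face is realized by the origin.\<close>
  have tight_out: "\<exists>y\<in>?A. T = {i \<in> \<Union>K. f i \<bullet> y = 1}" if T: "T \<in> K" for T
  proof -
    have "f ` T \<in> boundary_complex D" using T bc by blast
    then obtain F where F: "F face_of D" "F \<noteq> D" "f ` T = {x. x extreme_point_of F}"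
      by (auto simp: boundary_complex_def)
    show ?thesis
    proof (cases "F = {}")
      case True
      then have "T = {}" using F(3) by simp
      then show ?thesis by (intro bexI[of _ 0]) (auto simp: span_zero)
    next
      case False
      have "F exposed_face_of D"
        using F exposed_face_of_polyhedron poly polytope_imp_polyhedron by blast
      then obtain a b where ab: "D \<subseteq> {x. a \<bullet> x \<le> b}" "F = D \<inter> {x. a \<bullet> x = b}"
        unfolding exposed_face_of_def by blast
      have "0 \<notin> F" using F D(2) face_of_disjoint_rel_interior by blast
      then have "b > 0" using ab 0 by force
      obtain y z where yz: "y \<in> span D" "\<And>w. w \<in> span D \<Longrightarrow> orthogonal z w" "a = y + z"
        using orthogonal_subspace_decomp_exists[of D a] by metis
      let ?y = "(1 / b) *\<^sub>R y"
      have inner: "x \<bullet> ?y = (a \<bullet> x) / b" if "x \<in> D" for x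
        using yz(2)[of x] yz(3) that
        by (auto simp: span_base orthogonal_def inner_add_left inner_add_right inner_commute)
      have "?y \<in> span D" using yz(1) span_mul by blast
      then have "?y \<in> ?A" unfolding polar[symmetric] polar_dual_def
        using inner ab(1) \<open>b > 0\<close> by (auto simp: divide_simps)
      moreover have "T = {i \<in> \<Union>K. f i \<bullet> ?y = 1}"
      proof -
        have "f i \<bullet> ?y = 1 \<longleftrightarrow> i \<in> T" if i: "i \<in> \<Union>K" for i
        proof -
          have fi: "f i \<in> D" using f_ext[OF i] by (simp add: extreme_point_of_def)
          have "f i \<bullet> ?y = 1 \<longleftrightarrow> f i \<in> F"
            using inner[OF fi] fi \<open>b > 0\<close> unfolding ab(2) by auto
          also have "\<dots> \<longleftrightarrow> f i \<in> f ` T"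
            unfolding F(3) using extreme_point_of_face[OF F(1)] f_ext[OF i] by blast
          also have "\<dots> \<longleftrightarrow> i \<in> T"
            using inj_on_image_mem_iff[OF inj i] T by blast
          finally show ?thesis .
        qed
        then show ?thesis using T by blast
      qed
      ultimately show ?thesis by blast
    qed
  qed
  show "simple_system (span D) (\<Union>K) f K"
  proof
    show "f i \<in> span D" if "i \<in> \<Union>K" for i
      using f_ext[OF that] by (simp add: extreme_point_of_def span_base)
    show "K = (\<lambda>y. {i \<in> \<Union>K. f i \<bullet> y = 1}) ` ?A"
      using tight_in tight_out by blast
    show "{i} \<in> K" if "i \<in> \<Union>K" for i using that K(1) by blast
  qed (use bounded K in auto)
qed

section \<open>Combinatorial equivalence\<close>

text \<open>Pipings, plane trees and chains of sets all index the nonempty faces, so the empty face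
  is split off once and for all.\<close>

definition nonempty_faces :: "'a::euclidean_space set \<Rightarrow> 'a set set" where
  "nonempty_faces A = {F. F face_of A \<and> F \<noteq> {}}"

lemma mem_nonempty_faces: "F \<in> nonempty_faces A \<longleftrightarrow> F face_of A \<and> F \<noteq> {}"
  by (simp add: nonempty_faces_def)

lemma self_in_nonempty_faces: "polytope A \<Longrightarrow> A \<noteq> {} \<Longrightarrow> A \<in> nonempty_faces A"
  by (simp add: mem_nonempty_faces face_of_refl polytope_imp_convex)

lemma nonempty_faces_subset_iff:
  "G face_of A \<Longrightarrow> nonempty_faces G = {F \<in> nonempty_faces A. F \<subseteq> G}"
  by (auto simp: nonempty_faces_def face_of_face)

text \<open>The two face posets are compared through a common index set \<open>X\<close>, typically
  of pipings or of chains of sets, which avoids writing down a map from faces to faces. The empty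
  face is sent to the empty face.\<close>

lemma combinatorially_equivalentI:
  fixes A :: "'a::euclidean_space set" and B :: "'b::euclidean_space set"
  assumes "polytope A" "polytope B"
    and \<Phi>: "bij_betw \<Phi> X (nonempty_faces A)" and \<Psi>: "bij_betw \<Psi> X (nonempty_faces B)"
    and mono: "\<And>x y. x \<in> X \<Longrightarrow> y \<in> X \<Longrightarrow> \<Phi> x \<subseteq> \<Phi> y \<longleftrightarrow> \<Psi> x \<subseteq> \<Psi> y"
  shows "combinatorially_equivalent A B"
proof -
  let ?g = "the_inv_into X \<Phi>"
  define \<phi> where "\<phi> F = (if F = {} then {} else \<Psi> (?g F))" for F
  have g: "bij_betw ?g (nonempty_faces A) X" using \<Phi> by (rule bij_betw_the_inv_into)
  have \<Phi>g: "\<Phi> (?g F) = F" if "F \<in> nonempty_faces A" for F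
    using \<Phi> that by (simp add: f_the_inv_into_f_bij_betw)
  have "bij_betw (\<Psi> \<circ> ?g) (nonempty_faces A) (nonempty_faces B)"
    by (rule bij_betw_trans[OF g \<Psi>])
  then have "bij_betw \<phi> (nonempty_faces A) (nonempty_faces B)"
    by (rule bij_betw_cong[THEN iffD1, rotated]) (auto simp: \<phi>_def mem_nonempty_faces)
  moreover have "bij_betw \<phi> {{}} {{}}" by (simp add: bij_betw_def \<phi>_def)
  ultimately have "bij_betw \<phi> (nonempty_faces A \<union> {{}}) (nonempty_faces B \<union> {{}})"
    by (rule bij_betw_combine) (simp add: nonempty_faces_def)
  moreover have faces: "nonempty_faces A \<union> {{}} = {F. F face_of A}"
    "nonempty_faces B \<union> {{}} = {F. F face_of B}" by (auto simp: nonempty_faces_def)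
  moreover have "F \<subseteq> F' \<longleftrightarrow> \<phi> F \<subseteq> \<phi> F'" if "F face_of A \<and> F' face_of A" for F F'
  proof -
    have ne: "\<phi> G \<noteq> {}" if "G \<in> nonempty_faces A" for G
      using bij_betwE[OF \<open>bij_betw \<phi> (nonempty_faces A) (nonempty_faces B)\<close>] that
      by (simp add: mem_nonempty_faces)
    show ?thesis
    proof (cases "F = {} \<or> F' = {}")
      case True
      then show ?thesis using ne[of F] that by (auto simp: \<phi>_def mem_nonempty_faces)
    next
      case False
      then have F: "F \<in> nonempty_faces A" "F' \<in> nonempty_faces A"
        using that by (simp_all add: mem_nonempty_faces)
      then have "?g F \<in> X" "?g F' \<in> X" using g bij_betwE by blast+
      then show ?thesis using mono[of "?g F" "?g F'"] \<Phi>g F False by (simp add: \<phi>_def)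
    qed
  qed
  ultimately show ?thesis unfolding combinatorially_equivalent_def using assms(1,2) by auto
qed

text \<open>An order isomorphism sends the least face to the least face, so it restricts to the
  nonempty faces.\<close>

lemma combinatorially_equivalentE:
  fixes A :: "'a::euclidean_space set" and B :: "'b::euclidean_space set"
  assumes "combinatorially_equivalent A B"
  obtains \<phi> where "polytope A" "polytope B" "bij_betw \<phi> (nonempty_faces A) (nonempty_faces B)"
    "\<And>F F'. F \<in> nonempty_faces A \<Longrightarrow> F' \<in> nonempty_faces A \<Longrightarrow> F \<subseteq> F' \<longleftrightarrow> \<phi> F \<subseteq> \<phi> F'"
proof -
  obtain \<phi> where \<phi>: "polytope A" "polytope B" "bij_betw \<phi> {F. F face_of A} {G. G face_of B}"
    "\<forall>F F'. F face_of A \<and> F' face_of A \<longrightarrow> (F \<subseteq> F' \<longleftrightarrow> \<phi> F \<subseteq> \<phi> F')"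
    using assms unfolding combinatorially_equivalent_def by (elim conjE exE)
  have "{} \<in> \<phi> ` {F. F face_of A}" using bij_betw_imp_surj_on[OF \<phi>(3)] by simp
  then obtain G where "{} = \<phi> G" "G \<in> {F. F face_of A}" by (rule imageE)
  then have G: "G face_of A" "\<phi> G = {}" by simp_all
  then have "\<phi> {} = {}" using \<phi>(4)[rule_format, of "{}" G] by simp
  moreover have "nonempty_faces A = {F. F face_of A} - {{}}"
    "nonempty_faces B = {F. F face_of B} - {{}}" by (auto simp: nonempty_faces_def)
  ultimately have "bij_betw \<phi> (nonempty_faces A) (nonempty_faces B)"
    using bij_betw_DiffI[OF \<phi>(3), of "{{}}" "{{}}"] by (simp add: bij_betw_def)
  then show ?thesis
    by (rule that[OF \<phi>(1,2)]) (use \<phi>(4) in \<open>simp add: mem_nonempty_faces\<close>)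
qed

lemma combinatorially_equivalent_refl: "polytope A \<Longrightarrow> combinatorially_equivalent A A"
  by (rule combinatorially_equivalentI[of _ _ id "nonempty_faces A" id]) auto

lemma combinatorially_equivalent_sym:
  assumes "combinatorially_equivalent A B" shows "combinatorially_equivalent B A"
proof -
  obtain \<phi> where \<phi>: "polytope A" "polytope B" "bij_betw \<phi> (nonempty_faces A) (nonempty_faces B)"
    "\<And>F F'. F \<in> nonempty_faces A \<Longrightarrow> F' \<in> nonempty_faces A \<Longrightarrow> F \<subseteq> F' \<longleftrightarrow> \<phi> F \<subseteq> \<phi> F'"
    by (rule combinatorially_equivalentE[OF assms]) (rule that; assumption)
  show ?thesis
    by (rule combinatorially_equivalentI[OF \<phi>(2,1,3), of id]) (simp_all add: \<phi>(4))
qed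

lemma combinatorially_equivalent_trans:
  assumes "combinatorially_equivalent A B" "combinatorially_equivalent B C"
  shows "combinatorially_equivalent A C"
proof -
  obtain \<phi> where \<phi>: "polytope A" "polytope B" "bij_betw \<phi> (nonempty_faces A) (nonempty_faces B)"
    "\<And>F F'. F \<in> nonempty_faces A \<Longrightarrow> F' \<in> nonempty_faces A \<Longrightarrow> F \<subseteq> F' \<longleftrightarrow> \<phi> F \<subseteq> \<phi> F'"
    by (rule combinatorially_equivalentE[OF assms(1)]) (rule that; assumption)
  obtain \<psi> where \<psi>: "polytope B" "polytope C" "bij_betw \<psi> (nonempty_faces B) (nonempty_faces C)"
    "\<And>F F'. F \<in> nonempty_faces B \<Longrightarrow> F' \<in> nonempty_faces B \<Longrightarrow> F \<subseteq> F' \<longleftrightarrow> \<psi> F \<subseteq> \<psi> F'"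
    by (rule combinatorially_equivalentE[OF assms(2)]) (rule that; assumption)
  show ?thesis
  proof (rule combinatorially_equivalentI[OF \<phi>(1) \<psi>(2), of id "nonempty_faces A" "\<psi> \<circ> \<phi>"])
    show "bij_betw (\<psi> \<circ> \<phi>) (nonempty_faces A) (nonempty_faces C)"
      using \<phi>(3) \<psi>(3) by (rule bij_betw_trans)
    show "id F \<subseteq> id F' \<longleftrightarrow> (\<psi> \<circ> \<phi>) F \<subseteq> (\<psi> \<circ> \<phi>) F'"
      if "F \<in> nonempty_faces A" "F' \<in> nonempty_faces A" for F F'
      using that \<phi>(4) \<psi>(4) bij_betwE[OF \<phi>(3)] by simp
  qed simp
qed

lemma combinatorially_equivalent_polytope:
  "combinatorially_equivalent A B \<Longrightarrow> polytope A \<and> polytope B"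
  by (simp add: combinatorially_equivalent_def)

lemma combinatorially_equivalent_empty:
  assumes "combinatorially_equivalent A B" shows "A = {} \<longleftrightarrow> B = {}"
proof -
  obtain \<phi> where \<phi>: "polytope A" "polytope B" "bij_betw \<phi> (nonempty_faces A) (nonempty_faces B)"
    by (rule combinatorially_equivalentE[OF assms]) (rule that; assumption)
  have neA: "A = {} \<longleftrightarrow> nonempty_faces A = {}" and neB: "B = {} \<longleftrightarrow> nonempty_faces B = {}"
    using self_in_nonempty_faces[OF \<phi>(1)] self_in_nonempty_faces[OF \<phi>(2)]
    by (auto simp: nonempty_faces_def)
  have "nonempty_faces A = {} \<longleftrightarrow> nonempty_faces B = {}"
    using \<phi>(3) unfolding bij_betw_def by auto
  then show ?thesis using neA neB by simp
qed

text \<open>The faces of \<open>G\<close> are the faces of \<open>A\<close> contained in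
  \<open>G\<close>, so the isomorphism restricts to the interval below \<open>G\<close>.\<close>

lemma combinatorially_equivalent_face:
  assumes "combinatorially_equivalent A B" "G face_of A" "G \<noteq> {}"
  obtains G' where "G' face_of B" "G' \<noteq> {}" "combinatorially_equivalent G G'"
proof -
  obtain \<phi> where \<phi>: "polytope A" "polytope B" "bij_betw \<phi> (nonempty_faces A) (nonempty_faces B)"
    "\<And>F F'. F \<in> nonempty_faces A \<Longrightarrow> F' \<in> nonempty_faces A \<Longrightarrow> F \<subseteq> F' \<longleftrightarrow> \<phi> F \<subseteq> \<phi> F'"
    by (rule combinatorially_equivalentE[OF assms(1)]) (rule that; assumption)
  have G: "G \<in> nonempty_faces A" using assms by (simp add: mem_nonempty_faces)
  then have "\<phi> G \<in> nonempty_faces B" using bij_betwE[OF \<phi>(3)] by blast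
  then have \<phi>G: "\<phi> G face_of B" "\<phi> G \<noteq> {}" by (auto simp: mem_nonempty_faces)
  have "\<phi> ` nonempty_faces G = nonempty_faces (\<phi> G)"
  proof (intro equalityI subsetI)
    fix F' assume F': "F' \<in> nonempty_faces (\<phi> G)"
    then have "F' \<in> \<phi> ` nonempty_faces A" "F' \<subseteq> \<phi> G"
      using \<phi>(3) unfolding nonempty_faces_subset_iff[OF \<phi>G(1)] bij_betw_def by simp_all
    then show "F' \<in> \<phi> ` nonempty_faces G"
      unfolding nonempty_faces_subset_iff[OF assms(2)] using \<phi>(4) G by blast
  next
    fix F' assume "F' \<in> \<phi> ` nonempty_faces G"
    then obtain F where F: "F' = \<phi> F" "F \<in> nonempty_faces A" "F \<subseteq> G"
      unfolding nonempty_faces_subset_iff[OF assms(2)] by blast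
    then show "F' \<in> nonempty_faces (\<phi> G)"
      unfolding nonempty_faces_subset_iff[OF \<phi>G(1)] using bij_betwE[OF \<phi>(3)] \<phi>(4)[OF F(2) G] by simp
  qed
  moreover have sub: "nonempty_faces G \<subseteq> nonempty_faces A"
    unfolding nonempty_faces_subset_iff[OF assms(2)] by blast
  ultimately have "bij_betw \<phi> (nonempty_faces G) (nonempty_faces (\<phi> G))"
    using \<phi>(3) unfolding bij_betw_def by (blast intro: inj_on_subset)
  then have "combinatorially_equivalent G (\<phi> G)"
    using face_of_polytope_polytope[OF \<phi>(1) assms(2)] face_of_polytope_polytope[OF \<phi>(2) \<phi>G(1)] \<phi>(4) sub
    by (intro combinatorially_equivalentI[of _ _ id "nonempty_faces G" \<phi>]) (auto simp: subset_iff)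
  then show ?thesis using that \<phi>G by blast
qed

text \<open>Faces of a product are products of faces. Only nonempty factors are determined by their
  product, which is why the indexing is by nonempty faces.\<close>

lemma bij_betw_nonempty_faces_Times:
  fixes A :: "'a::euclidean_space set" and B :: "'b::euclidean_space set"
  assumes \<Phi>: "bij_betw \<Phi> X (nonempty_faces A)" and \<Psi>: "bij_betw \<Psi> Y (nonempty_faces B)"
  shows "bij_betw (\<lambda>(x, y). \<Phi> x \<times> \<Psi> y) (X \<times> Y) (nonempty_faces (A \<times> B))"
    and "\<And>x y x' y'. x \<in> X \<Longrightarrow> y \<in> Y \<Longrightarrow> x' \<in> X \<Longrightarrow> y' \<in> Y \<Longrightarrow>
      \<Phi> x \<times> \<Psi> y \<subseteq> \<Phi> x' \<times> \<Psi> y' \<longleftrightarrow> \<Phi> x \<subseteq> \<Phi> x' \<and> \<Psi> y \<subseteq> \<Psi> y'"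
proof -
  have X: "\<Phi> x face_of A" "\<Phi> x \<noteq> {}" if "x \<in> X" for x
    using bij_betwE[OF \<Phi>] that by (auto simp: mem_nonempty_faces)
  have Y: "\<Psi> y face_of B" "\<Psi> y \<noteq> {}" if "y \<in> Y" for y
    using bij_betwE[OF \<Psi>] that by (auto simp: mem_nonempty_faces)
  show mono: "\<Phi> x \<times> \<Psi> y \<subseteq> \<Phi> x' \<times> \<Psi> y' \<longleftrightarrow> \<Phi> x \<subseteq> \<Phi> x' \<and> \<Psi> y \<subseteq> \<Psi> y'"
    if "x \<in> X" "y \<in> Y" "x' \<in> X" "y' \<in> Y" for x y x' y'
    using X(2)[OF that(1)] Y(2)[OF that(2)] by (auto simp: times_subset_iff)
  show "bij_betw (\<lambda>(x, y). \<Phi> x \<times> \<Psi> y) (X \<times> Y) (nonempty_faces (A \<times> B))"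
    unfolding bij_betw_def
  proof
    show "inj_on (\<lambda>(x, y). \<Phi> x \<times> \<Psi> y) (X \<times> Y)"
    proof (rule inj_onI, clarify)
      fix x y x' y' assume xy: "x \<in> X" "y \<in> Y" "x' \<in> X" "y' \<in> Y" "\<Phi> x \<times> \<Psi> y = \<Phi> x' \<times> \<Psi> y'"
      then have "\<Phi> x = \<Phi> x'" "\<Psi> y = \<Psi> y'"
        using X(2)[OF xy(1)] Y(2)[OF xy(2)] by (simp_all add: times_eq_iff)
      then show "x = x' \<and> y = y'"
        using xy \<Phi> \<Psi> unfolding bij_betw_def by (metis inj_onD)
    qed
    show "(\<lambda>(x, y). \<Phi> x \<times> \<Psi> y) ` (X \<times> Y) = nonempty_faces (A \<times> B)"
    proof (intro equalityI subsetI)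
      fix C assume "C \<in> (\<lambda>(x, y). \<Phi> x \<times> \<Psi> y) ` (X \<times> Y)"
      then obtain x y where xy: "x \<in> X" "y \<in> Y" "C = \<Phi> x \<times> \<Psi> y" by auto
      then show "C \<in> nonempty_faces (A \<times> B)"
        using X[OF xy(1)] Y[OF xy(2)] by (simp add: mem_nonempty_faces face_of_Times)
    next
      fix C assume "C \<in> nonempty_faces (A \<times> B)"
      then have C: "C face_of A \<times> B" "C \<noteq> {}" by (simp_all add: mem_nonempty_faces)
      obtain F F' where F: "F face_of A" "F' face_of B" "C = F \<times> F'"
        using C(1) unfolding face_of_Times_decomp by (elim exE conjE)
      then have "F \<in> \<Phi> ` X" "F' \<in> \<Psi> ` Y"
        using C(2) \<Phi> \<Psi> by (simp_all add: bij_betw_def mem_nonempty_faces)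
      then obtain x y where "x \<in> X" "F = \<Phi> x" "y \<in> Y" "F' = \<Psi> y"
        by (elim imageE)
      then show "C \<in> (\<lambda>(x, y). \<Phi> x \<times> \<Psi> y) ` (X \<times> Y)"
        using F(3) by (intro image_eqI[of _ _ "(x, y)"]) simp_all
    qed
  qed
qed

lemma combinatorially_equivalent_Times:
  fixes A :: "'a::euclidean_space set" and B :: "'b::euclidean_space set"
    and A' :: "'c::euclidean_space set" and B' :: "'d::euclidean_space set"
  assumes "combinatorially_equivalent A A'" "combinatorially_equivalent B B'"
  shows "combinatorially_equivalent (A \<times> B) (A' \<times> B')"
proof -
  obtain \<phi> where \<phi>: "polytope A" "polytope A'" "bij_betw \<phi> (nonempty_faces A) (nonempty_faces A')"
    "\<And>F F'. F \<in> nonempty_faces A \<Longrightarrow> F' \<in> nonempty_faces A \<Longrightarrow> F \<subseteq> F' \<longleftrightarrow> \<phi> F \<subseteq> \<phi> F'"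
    by (rule combinatorially_equivalentE[OF assms(1)]) (rule that; assumption)
  obtain \<psi> where \<psi>: "polytope B" "polytope B'" "bij_betw \<psi> (nonempty_faces B) (nonempty_faces B')"
    "\<And>F F'. F \<in> nonempty_faces B \<Longrightarrow> F' \<in> nonempty_faces B \<Longrightarrow> F \<subseteq> F' \<longleftrightarrow> \<psi> F \<subseteq> \<psi> F'"
    by (rule combinatorially_equivalentE[OF assms(2)]) (rule that; assumption)
  have id: "bij_betw (\<lambda>x. x) X X" for X :: "'x set" by (simp add: bij_betw_def)
  show ?thesis
  proof (rule combinatorially_equivalentI[OF _ _ bij_betw_nonempty_faces_Times(1)[OF id id]
        bij_betw_nonempty_faces_Times(1)[OF \<phi>(3) \<psi>(3)]])
    fix x y assume "x \<in> nonempty_faces A \<times> nonempty_faces B" "y \<in> nonempty_faces A \<times> nonempty_faces B"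
    then obtain F G F' G' where xy: "x = (F, G)" "y = (F', G')"
      and F: "F \<in> nonempty_faces A" "F' \<in> nonempty_faces A"
      and G: "G \<in> nonempty_faces B" "G' \<in> nonempty_faces B" by auto
    have "F \<times> G \<subseteq> F' \<times> G' \<longleftrightarrow> F \<subseteq> F' \<and> G \<subseteq> G'"
      using bij_betw_nonempty_faces_Times(2)[OF id id F(1) G(1) F(2) G(2)] by simp
    moreover have "\<phi> F \<times> \<psi> G \<subseteq> \<phi> F' \<times> \<psi> G' \<longleftrightarrow> \<phi> F \<subseteq> \<phi> F' \<and> \<psi> G \<subseteq> \<psi> G'"
      by (rule bij_betw_nonempty_faces_Times(2)[OF \<phi>(3) \<psi>(3) F(1) G(1) F(2) G(2)])
    ultimately show "(case x of (x, y) \<Rightarrow> x \<times> y) \<subseteq> (case y of (x, y) \<Rightarrow> x \<times> y) \<longleftrightarrow>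
        (case x of (x, y) \<Rightarrow> \<phi> x \<times> \<psi> y) \<subseteq> (case y of (x, y) \<Rightarrow> \<phi> x \<times> \<psi> y)"
      using \<phi>(4)[OF F] \<psi>(4)[OF G] by (simp add: xy)
  qed (simp_all add: polytope_Times \<phi> \<psi>)
qed

lemma bij_betw_ident: "bij_betw (\<lambda>x. x) X X"
  by (simp add: bij_betw_def)

lemma combinatorially_equivalent_Times_assoc:
  fixes A :: "'a::euclidean_space set" and B :: "'b::euclidean_space set" and C :: "'c::euclidean_space set"
  assumes "polytope A" "polytope B" "polytope C"
  shows "combinatorially_equivalent ((A \<times> B) \<times> C) (A \<times> (B \<times> C))"
proof -
  let ?X = "nonempty_faces A \<times> nonempty_faces B \<times> nonempty_faces C"
  have 1: "bij_betw (\<lambda>(x, y). (case x of (F, G) \<Rightarrow> F \<times> G) \<times> y)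
      ((nonempty_faces A \<times> nonempty_faces B) \<times> nonempty_faces C) (nonempty_faces ((A \<times> B) \<times> C))"
    by (rule bij_betw_nonempty_faces_Times(1)[OF bij_betw_nonempty_faces_Times(1)[OF bij_betw_ident bij_betw_ident] bij_betw_ident])
  have 2: "bij_betw (\<lambda>(x, y). x \<times> (case y of (G, H) \<Rightarrow> G \<times> H)) ?X (nonempty_faces (A \<times> (B \<times> C)))"
    by (rule bij_betw_nonempty_faces_Times(1)[OF bij_betw_ident bij_betw_nonempty_faces_Times(1)[OF bij_betw_ident bij_betw_ident]])
  have "bij_betw (\<lambda>(F, G, H). ((F, G), H)) ?X ((nonempty_faces A \<times> nonempty_faces B) \<times> nonempty_faces C)"
    by (rule bij_betw_byWitness[where f' = "\<lambda>((F, G), H). (F, G, H)"]) auto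
  from bij_betw_trans[OF this 1]
  have 3: "bij_betw (\<lambda>(F, G, H). (F \<times> G) \<times> H) ?X (nonempty_faces ((A \<times> B) \<times> C))"
    by (rule bij_betw_cong[THEN iffD1, rotated]) auto
  show ?thesis
  proof (rule combinatorially_equivalentI[OF _ _ 3 2])
    fix x y assume "x \<in> ?X" "y \<in> ?X"
    then obtain F G H F' G' H' where xy: "x = (F, G, H)" "y = (F', G', H')"
      and "F \<noteq> {}" "G \<noteq> {}" "H \<noteq> {}" by (auto simp: mem_nonempty_faces)
    then show "(case x of (F, G, H) \<Rightarrow> (F \<times> G) \<times> H) \<subseteq> (case y of (F, G, H) \<Rightarrow> (F \<times> G) \<times> H) \<longleftrightarrow>
       (case x of (x, y) \<Rightarrow> x \<times> (case y of (G, H) \<Rightarrow> G \<times> H)) \<subseteq> (case y of (x, y) \<Rightarrow> x \<times> (case y of (G, H) \<Rightarrow> G \<times> H))"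
      by (simp add: times_subset_iff)
  qed (simp_all add: polytope_Times assms)
qed

lemma nonempty_faces_singleton: "nonempty_faces {v} = {{v}}"
proof -
  have "F = {v}" if "F face_of {v}" "F \<noteq> {}" for F
    using face_of_imp_subset[OF that(1)] that(2) by (auto simp: subset_singleton_iff)
  then show ?thesis by (auto simp: nonempty_faces_def face_of_refl)
qed

lemma combinatorially_equivalent_singleton_Times:
  fixes v :: "'a::euclidean_space" and B :: "'b::euclidean_space set"
  assumes "polytope B" shows "combinatorially_equivalent B ({v} \<times> B)"
proof -
  have 1: "bij_betw (\<lambda>(x, y). x \<times> y) ({{v}} \<times> nonempty_faces B) (nonempty_faces ({v} \<times> B))"
    using bij_betw_nonempty_faces_Times(1)[OF bij_betw_ident[of "nonempty_faces {v}"] bij_betw_ident]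
    by (simp add: nonempty_faces_singleton)
  have "bij_betw (\<lambda>G. ({v}, G)) (nonempty_faces B) ({{v}} \<times> nonempty_faces B)"
    by (rule bij_betw_byWitness[where f' = snd]) auto
  from bij_betw_trans[OF this 1] have 2: "bij_betw (\<lambda>G. {v} \<times> G) (nonempty_faces B) (nonempty_faces ({v} \<times> B))"
    by (simp add: comp_def)
  show ?thesis
    by (rule combinatorially_equivalentI[OF assms _ bij_betw_ident 2]) (auto simp: polytope_Times polytope_sing assms)
qed

text \<open>The polytope and each of its vertices are nonempty faces, of which there is only
  one.\<close>

lemma combinatorially_equivalent_singleton:
  assumes "combinatorially_equivalent F {v}" shows "\<exists>w. F = {w}"
proof -
  obtain \<phi> where \<phi>: "polytope F" "bij_betw \<phi> (nonempty_faces F) {{v}}"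
    using combinatorially_equivalentE[OF assms] nonempty_faces_singleton by metis
  have "F \<noteq> {}" using combinatorially_equivalent_empty[OF assms] by simp
  then obtain x where "x extreme_point_of F"
    using \<phi>(1) extreme_point_exists_convex polytope_imp_compact polytope_imp_convex by blast
  then have "{x} \<in> nonempty_faces F" by (simp add: mem_nonempty_faces face_of_singleton)
  moreover have "F \<in> nonempty_faces F" using self_in_nonempty_faces \<phi>(1) \<open>F \<noteq> {}\<close> by blast
  ultimately have "{x} = F" using \<phi>(2) unfolding bij_betw_def by (metis imageI inj_onD singletonD)
  then show ?thesis by blast
qed

section \<open>Products of associahedra\<close>

lemma zero_in_poset_associahedron: "poset_associahedron r A f \<Longrightarrow> 0 \<in> A"
  by (auto simp: poset_associahedron_def polar_dual_def span_zero)

lemma associahedra_product_polytope: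
  fixes F :: "'a::euclidean_space set"
  shows "associahedra_product rs F \<Longrightarrow> polytope F \<and> F \<noteq> {}"
proof (induction rs arbitrary: F)
  case (Cons r rs)
  then obtain A :: "'a set" and f and G :: "'a set" where *: "poset_associahedron r A f" "associahedra_product rs G"
    "combinatorially_equivalent F (A \<times> G)" by auto
  then have "A \<times> G \<noteq> {}" using zero_in_poset_associahedron Cons.IH by blast
  then show ?case
    using *(3) combinatorially_equivalent_polytope combinatorially_equivalent_empty by blast
qed (auto simp: polytope_sing)

lemma associahedra_product_cong:
  fixes F F' :: "'a::euclidean_space set"
  shows "associahedra_product rs F \<Longrightarrow> combinatorially_equivalent F' F \<Longrightarrow> associahedra_product rs F'"
proof (cases rs)
  case Nil
  assume "associahedra_product rs F" "combinatorially_equivalent F' F"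
  then show ?thesis using Nil combinatorially_equivalent_singleton by auto
next
  case (Cons r rs')
  assume F: "associahedra_product rs F" "combinatorially_equivalent F' F"
  then obtain A :: "'a set" and f and G :: "'a set" where "poset_associahedron r A f" "associahedra_product rs' G"
    "combinatorially_equivalent F (A \<times> G)" using Cons by auto
  moreover from this have "combinatorially_equivalent F' (A \<times> G)"
    using F(2) combinatorially_equivalent_trans by blast
  ultimately show ?thesis using Cons by auto
qed

text \<open>Reassociating gives \<open>F\<close> the shape
  \<open>A \<times> (G \<times> F2)\<close>; the induction hypothesis handles the second factor once
  it has been replaced by an equivalent polytope in the type \<open>'a\<close>.\<close>

lemma associahedra_product_append:
  fixes F F1 F2 :: "'a::euclidean_space set"
  assumes "associahedra_product rs1 F1" "associahedra_product rs2 F2"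
    "combinatorially_equivalent F (F1 \<times> F2)"
  shows "associahedra_product (rs1 @ rs2) F"
  using assms
proof (induction rs1 arbitrary: F F1)
  case Nil
  then obtain v where "F1 = {v}" by auto
  then have "combinatorially_equivalent F2 (F1 \<times> F2)"
    using combinatorially_equivalent_singleton_Times Nil.prems(2) associahedra_product_polytope by blast
  then have "combinatorially_equivalent F F2"
    using Nil.prems(3) combinatorially_equivalent_sym combinatorially_equivalent_trans by blast
  then show ?case using associahedra_product_cong Nil.prems(2) by simp
next
  case (Cons r rs)
  have "\<exists>(A::'a set) f (G::'a set). poset_associahedron r A f \<and> associahedra_product rs G \<and>
      combinatorially_equivalent F1 (A \<times> G)" using Cons.prems(1) by simp
  then obtain A :: "'a set" and f and G :: "'a set" where A: "poset_associahedron r A f" and G: "associahedra_product rs G"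
    and F1: "combinatorially_equivalent F1 (A \<times> G)" by blast
  have poly: "polytope G" "G \<noteq> {}" "polytope F2" "F2 \<noteq> {}"
    using G Cons.prems(2) associahedra_product_polytope by blast+
  have "A \<noteq> {}" using zero_in_poset_associahedron[OF A] by blast
  \<comment> \<open>Nothing is known about \<open>r\<close> here, so \<open>A\<close> is recognized
    as a polytope by projecting the polytope \<open>A \<times> G\<close>, whose other factor is
    nonempty.\<close>
  have "polytope A"
  proof -
    have "fst ` (A \<times> G) = A" using poly(2) by (simp add: fst_image_times)
    moreover have "polytope (fst ` (A \<times> G))"
      using F1 combinatorially_equivalent_polytope polytope_linear_image linear_fst by blast
    ultimately show ?thesis by simp
  qed
  have F: "combinatorially_equivalent F (A \<times> (G \<times> F2))"
  proof -
    have 1: "combinatorially_equivalent (F1 \<times> F2) ((A \<times> G) \<times> F2)"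
      using F1 poly(3) by (intro combinatorially_equivalent_Times combinatorially_equivalent_refl)
    have 2: "combinatorially_equivalent ((A \<times> G) \<times> F2) (A \<times> (G \<times> F2))"
      using \<open>polytope A\<close> poly by (intro combinatorially_equivalent_Times_assoc)
    show ?thesis
      by (rule combinatorially_equivalent_trans[OF Cons.prems(3) combinatorially_equivalent_trans[OF 1 2]])
  qed
  \<comment> \<open>A copy of \<open>G \<times> F2\<close> in the ambient space of \<open>F\<close> is found as a face of \<open>F\<close>.\<close>
  obtain x where x: "x extreme_point_of A"
    using \<open>polytope A\<close> \<open>A \<noteq> {}\<close> extreme_point_exists_convex polytope_imp_compact polytope_imp_convex by blast
  have "polytope (G \<times> F2)" using poly by (simp add: polytope_Times)
  then have "{x} \<times> (G \<times> F2) face_of A \<times> (G \<times> F2)"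
    by (intro face_of_Times face_of_refl polytope_imp_convex) (simp add: x face_of_singleton)
  moreover have "{x} \<times> (G \<times> F2) \<noteq> {}" using poly by simp
  ultimately obtain G' where G': "G' face_of F" "combinatorially_equivalent ({x} \<times> (G \<times> F2)) G'"
    using combinatorially_equivalent_face[OF combinatorially_equivalent_sym[OF F]] by metis
  then have eq: "combinatorially_equivalent (G \<times> F2) G'"
    by (intro combinatorially_equivalent_trans[OF
          combinatorially_equivalent_singleton_Times[OF \<open>polytope (G \<times> F2)\<close>, of x]])
  then have "associahedra_product (rs @ rs2) G'"
    using Cons.IH[OF G Cons.prems(2)] combinatorially_equivalent_sym by blast
  moreover have "combinatorially_equivalent F (A \<times> G')"
    by (rule combinatorially_equivalent_trans[OF F combinatorially_equivalent_Times[OF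
            combinatorially_equivalent_refl[OF \<open>polytope A\<close>] eq]])
  ultimately show ?case using A by auto
qed

section \<open>Ranks of acyclic relations\<close>

text \<open>The rank of a vertex is the number of its strict predecessors. The bound by
  \<open>card T\<close> matters for the construction of points, where ranks enter as
  coordinates.\<close>

lemma acyclic_rank:
  assumes "acyclic E" "E \<subseteq> T \<times> T" "finite T"
  obtains h :: "'v \<Rightarrow> nat" where "\<And>x y. (x, y) \<in> E \<Longrightarrow> h x < h y" "\<And>x. h x \<le> card T"
proof
  define h where "h y = card {x. (x, y) \<in> E\<^sup>+}" for y
  have E: "E\<^sup>+ \<subseteq> T \<times> T" using assms(2) by (rule trancl_subset_Sigma)
  then have sub: "{x. (x, y) \<in> E\<^sup>+} \<subseteq> T" for y by blast
  show "h x \<le> card T" for x unfolding h_def by (rule card_mono[OF assms(3) sub])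
  fix x y assume xy: "(x, y) \<in> E"
  then have "{z. (z, x) \<in> E\<^sup>+} \<subseteq> {z. (z, y) \<in> E\<^sup>+}" by (auto intro: trancl_into_trancl)
  moreover have "x \<in> {z. (z, y) \<in> E\<^sup>+}" "x \<notin> {z. (z, x) \<in> E\<^sup>+}"
    using xy assms(1) by (auto simp: acyclic_def)
  ultimately have "{z. (z, x) \<in> E\<^sup>+} \<subset> {z. (z, y) \<in> E\<^sup>+}" by blast
  then show "h x < h y"
    unfolding h_def by (rule psubset_card_mono[OF finite_subset[OF sub assms(3)]])
qed

lemma acyclic_if_rank:
  fixes h :: "'v \<Rightarrow> 'w::wellorder"
  assumes "\<And>x y. (x, y) \<in> E \<Longrightarrow> h x < h y" shows "acyclic E"
proof -
  have "wf (inv_image {(x :: 'w, y). x < y} h)" by (simp add: wf wf_inv_image)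
  moreover have "E \<subseteq> inv_image {(x, y). x < y} h" using assms by auto
  ultimately show ?thesis using wf_acyclic acyclic_subset by blast
qed

text \<open>A path may be shortened to at most \<open>card E\<close> steps, and each step costs at
  most \<open>M\<close>. The hypothesis bounds \<open>f\<close> in the direction of the edges only;
  inside a strongly connected component the reverse estimate follows by going around.\<close>

lemma rtrancl_drift_le:
  fixes f :: "'v \<Rightarrow> real"
  assumes "finite E" "(x, y) \<in> E\<^sup>*" "M \<ge> 0" and step: "\<And>x y. (x, y) \<in> E \<Longrightarrow> f x \<le> f y + M"
  shows "f x \<le> f y + real (card E) * M"
proof -
  have pow: "f x \<le> f y + real k * M" if "(x, y) \<in> E ^^ k" for k y
    using that
  proof (induction k arbitrary: y)
    case (Suc k)
    then obtain z where z: "(x, z) \<in> E ^^ k" "(z, y) \<in> E" by auto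
    have "f x \<le> f z + real k * M" using Suc.IH z(1) .
    also have "f z \<le> f y + M" using step z(2) .
    finally show ?case by (simp add: algebra_simps)
  qed simp
  obtain k where k: "k \<le> card E" "(x, y) \<in> E ^^ k"
    using assms(1,2) by (auto simp: rtrancl_finite_eq_relpow)
  have "real k * M \<le> real (card E) * M" using k(1) assms(3) by (simp add: mult_right_mono)
  then show ?thesis using pow[OF k(2)] by linarith
qed

section \<open>Pipes and pipings of finite posets\<close>

definition comparable :: "'p rel \<Rightarrow> 'p \<Rightarrow> 'p \<Rightarrow> bool" where
  "comparable r i j \<longleftrightarrow> prec r i j \<or> prec r j i"

text \<open>No proper nonempty part of the set is closed under comparability. In contrast to Hasse
  connectedness this does not mention coverings, which are awkward under contraction; on convex sets
  the two notions agree.\<close>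

definition cut_connected :: "'p rel \<Rightarrow> 'p set \<Rightarrow> bool" where
  "cut_connected r \<tau> \<longleftrightarrow>
     (\<forall>X. X \<subseteq> \<tau> \<and> X \<noteq> {} \<and> (\<forall>i\<in>X. \<forall>j\<in>\<tau>. comparable r i j \<longrightarrow> j \<in> X) \<longrightarrow> X = \<tau>)"

lemma cut_connectedI:
  "(\<And>X. X \<subseteq> \<tau> \<Longrightarrow> X \<noteq> {} \<Longrightarrow> (\<And>i j. i \<in> X \<Longrightarrow> j \<in> \<tau> \<Longrightarrow> comparable r i j \<Longrightarrow> j \<in> X) \<Longrightarrow> \<tau> \<subseteq> X) \<Longrightarrow>
    cut_connected r \<tau>"
  unfolding cut_connected_def by (metis subset_antisym)

lemma cut_connectedD:
  "cut_connected r \<tau> \<Longrightarrow> X \<subseteq> \<tau> \<Longrightarrow> X \<noteq> {} \<Longrightarrow>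
    (\<And>i j. i \<in> X \<Longrightarrow> j \<in> \<tau> \<Longrightarrow> comparable r i j \<Longrightarrow> j \<in> X) \<Longrightarrow> X = \<tau>"
  unfolding cut_connected_def by blast

lemma cut_connected_crossing:
  assumes "cut_connected r \<tau>" "i \<in> \<tau>" "i \<in> X" "\<not> \<tau> \<subseteq> X"
  obtains x y where "x \<in> \<tau>" "x \<in> X" "y \<in> \<tau>" "y \<notin> X" "comparable r x y"
proof (rule ccontr)
  assume "\<not> thesis"
  then have "\<And>x y. x \<in> \<tau> \<inter> X \<Longrightarrow> y \<in> \<tau> \<Longrightarrow> comparable r x y \<Longrightarrow> y \<in> \<tau> \<inter> X" using that by blast
  then have "\<tau> \<inter> X = \<tau>" by (intro cut_connectedD[OF assms(1)]) (use assms(2,3) in auto)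
  then show False using assms(4) by blast
qed

lemma comparable_sym: "comparable r i j \<Longrightarrow> comparable r j i"
  by (auto simp: comparable_def)

lemma cut_connected_rtrancl:
  assumes "cut_connected r \<tau>" "i \<in> \<tau>" "j \<in> \<tau>"
  shows "(i, j) \<in> {(x, y). x \<in> \<tau> \<and> y \<in> \<tau> \<and> comparable r x y}\<^sup>*" (is "_ \<in> ?R\<^sup>*")
proof -
  have "{k \<in> \<tau>. (i, k) \<in> ?R\<^sup>*} = \<tau>"
  proof (rule cut_connectedD[OF assms(1)])
    fix x y assume "x \<in> {k \<in> \<tau>. (i, k) \<in> ?R\<^sup>*}" "y \<in> \<tau>" "comparable r x y"
    then show "y \<in> {k \<in> \<tau>. (i, k) \<in> ?R\<^sup>*}" by (auto intro: rtrancl_into_rtrancl)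
  qed (use assms(2) in auto)
  then show ?thesis using assms(3) by blast
qed

lemma pipe_nonempty: "pipe r \<tau> \<Longrightarrow> \<tau> \<noteq> {}"
  and pipe_subset: "pipe r \<tau> \<Longrightarrow> \<tau> \<subseteq> Field r"
  and pipe_convex: "pipe r \<tau> \<Longrightarrow> poset_convex r \<tau>"
  by (auto simp: pipe_def)

lemma pipingI:
  "(\<And>\<tau>. \<tau> \<in> T \<Longrightarrow> pipe r \<tau>) \<Longrightarrow>
    (\<And>\<tau> \<tau>'. \<tau> \<in> T \<Longrightarrow> \<tau>' \<in> T \<Longrightarrow> \<tau> \<subseteq> \<tau>' \<or> \<tau>' \<subseteq> \<tau> \<or> \<tau> \<inter> \<tau>' = {}) \<Longrightarrow>
    acyclic (piping_digraph r T) \<Longrightarrow> piping r T"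
  by (simp add: piping_def)

lemma piping_pipe: "piping r T \<Longrightarrow> \<tau> \<in> T \<Longrightarrow> pipe r \<tau>"
  and piping_laminar:
    "piping r T \<Longrightarrow> \<tau> \<in> T \<Longrightarrow> \<tau>' \<in> T \<Longrightarrow> \<tau> \<subseteq> \<tau>' \<or> \<tau>' \<subseteq> \<tau> \<or> \<tau> \<inter> \<tau>' = {}"
  and piping_acyclic: "piping r T \<Longrightarrow> acyclic (piping_digraph r T)"
  by (simp_all add: piping_def)

lemma prec_Field: "prec r i j \<Longrightarrow> i \<in> Field r \<and> j \<in> Field r"
  by (auto simp: prec_def Field_def)

lemma poset_convexD: "poset_convex r \<tau> \<Longrightarrow> i \<in> \<tau> \<Longrightarrow> k \<in> \<tau> \<Longrightarrow> prec r i j \<Longrightarrow> prec r j k \<Longrightarrow> j \<in> \<tau>"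
  unfolding poset_convex_def by blast

lemma poset_convex_Field: "poset_convex r (Field r)"
  unfolding poset_convex_def using prec_Field by metis

text \<open>One round of adding intermediate elements suffices, by transitivity of the
  order.\<close>

definition convex_closure :: "'p rel \<Rightarrow> 'p set \<Rightarrow> 'p set" where
  "convex_closure r U = U \<union> {j. \<exists>i\<in>U. \<exists>k\<in>U. prec r i j \<and> prec r j k}"

locale finite_poset =
  fixes r :: "'p rel"
  assumes partial_order: "Partial_order r" and finite_Field: "finite (Field r)"
begin

lemma prec_trans: "prec r i j \<Longrightarrow> prec r j k \<Longrightarrow> prec r i k"
  using partial_order unfolding prec_def partial_order_on_def preorder_on_def
  by (metis antisymD transD)

lemma prec_irrefl: "\<not> prec r i i"
  by (simp add: prec_def)

lemma prec_asym: "prec r i j \<Longrightarrow> \<not> prec r j i"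
  using prec_trans prec_irrefl by blast

text \<open>Induction on the number of elements strictly between \<open>i\<close> and
  \<open>j\<close>; an intermediate element splits the interval into two smaller ones.\<close>

lemma prec_induct [consumes 1, case_names cover trans]:
  assumes "prec r i j"
    and cover: "\<And>x y. covered_by r x y \<Longrightarrow> P x y"
    and trans: "\<And>x y z. prec r x y \<Longrightarrow> prec r y z \<Longrightarrow> P x y \<Longrightarrow> P y z \<Longrightarrow> P x z"
  shows "P i j"
  using assms(1)
proof (induction "card {k. prec r i k \<and> prec r k j}" arbitrary: i j rule: less_induct)
  case less
  show ?case
  proof (cases "covered_by r i j")
    case False
    then obtain k where k: "prec r i k" "prec r k j" using less.prems by (auto simp: covered_by_def)
    have fin: "finite {k. prec r i k \<and> prec r k j}"
      by (rule finite_subset[OF _ finite_Field]) (use prec_Field in fast)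
    have "{l. prec r i l \<and> prec r l k} \<subset> {k. prec r i k \<and> prec r k j}"
      "{l. prec r k l \<and> prec r l j} \<subset> {k. prec r i k \<and> prec r k j}"
      using k prec_trans prec_irrefl by blast+
    then have "P i k" "P k j" using less.hyps k psubset_card_mono[OF fin] by blast+
    then show ?thesis using trans k by blast
  qed (rule cover)
qed

text \<open>Convexity keeps the saturated chains between two elements of the set inside it, so a
  comparability can be replaced by a path of coverings.\<close>

lemma hasse_connected_iff:
  assumes "poset_convex r \<tau>" shows "hasse_connected r \<tau> \<longleftrightarrow> cut_connected r \<tau>"
proof
  assume conn: "hasse_connected r \<tau>"
  show "cut_connected r \<tau>"
  proof (rule cut_connectedI, rule subsetI)
    fix X j assume X: "X \<subseteq> \<tau>" "X \<noteq> {}" "\<And>i j. i \<in> X \<Longrightarrow> j \<in> \<tau> \<Longrightarrow> comparable r i j \<Longrightarrow> j \<in> X"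
      and j: "j \<in> \<tau>"
    then obtain i where i: "i \<in> X" by blast
    then have "(i, j) \<in> (hasse_edges_on r \<tau>)\<^sup>*" using conn j X(1) unfolding hasse_connected_def by blast
    then show "j \<in> X"
    proof (induction rule: rtrancl_induct)
      case (step y z)
      then have "z \<in> \<tau>" "comparable r y z"
        by (auto simp: hasse_edges_on_def comparable_def covered_by_def)
      then show ?case using X(3) step.IH by blast
    qed (rule i)
  qed
next
  assume conn: "cut_connected r \<tau>"
  have sym: "sym ((hasse_edges_on r \<tau>)\<^sup>*)"
    by (intro sym_rtrancl) (auto simp: sym_def hasse_edges_on_def)
  have *: "x \<in> \<tau> \<Longrightarrow> y \<in> \<tau> \<Longrightarrow> (x, y) \<in> (hasse_edges_on r \<tau>)\<^sup>*" if "prec r x y" for x y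
    using that
  proof (induction rule: prec_induct)
    case (trans x y z)
    then have "y \<in> \<tau>" using poset_convexD[OF assms] by blast
    then show ?case using trans by (meson rtrancl_trans)
  qed (auto simp: hasse_edges_on_def)
  show "hasse_connected r \<tau>"
    unfolding hasse_connected_def
  proof (intro ballI)
    fix i j assume i: "i \<in> \<tau>" and j: "j \<in> \<tau>"
    have "{k \<in> \<tau>. (i, k) \<in> (hasse_edges_on r \<tau>)\<^sup>*} = \<tau>"
    proof (rule cut_connectedD[OF conn])
      fix x y assume x: "x \<in> {k \<in> \<tau>. (i, k) \<in> (hasse_edges_on r \<tau>)\<^sup>*}" and y: "y \<in> \<tau>" "comparable r x y"
      have "(x, y) \<in> (hasse_edges_on r \<tau>)\<^sup>*"
        using * x y symD[OF sym] by (auto simp: comparable_def)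
      then show "y \<in> {k \<in> \<tau>. (i, k) \<in> (hasse_edges_on r \<tau>)\<^sup>*}"
        using x y(1) by (auto intro: rtrancl_trans)
    qed (use i in auto)
    then show "(i, j) \<in> (hasse_edges_on r \<tau>)\<^sup>*" using j by blast
  qed
qed

lemma pipe_iff:
  "pipe r \<tau> \<longleftrightarrow> \<tau> \<noteq> {} \<and> \<tau> \<subseteq> Field r \<and> poset_convex r \<tau> \<and> cut_connected r \<tau>"
  unfolding pipe_def using hasse_connected_iff by blast

lemma pipe_cut_connected: "pipe r \<tau> \<Longrightarrow> cut_connected r \<tau>"
  by (simp add: pipe_iff)

lemma pipe_finite: "pipe r \<tau> \<Longrightarrow> finite \<tau>"
  using pipe_subset finite_Field finite_subset by blast

lemma pipe_singleton: "x \<in> Field r \<Longrightarrow> pipe r {x}"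
  unfolding pipe_iff poset_convex_def cut_connected_def using prec_trans prec_irrefl by blast

lemma pipe_cover:
  assumes "covered_by r i j" shows "pipe r {i, j}"
proof -
  have ij: "prec r i j" "\<nexists>k. prec r i k \<and> prec r k j" using assms by (auto simp: covered_by_def)
  have "poset_convex r {i, j}"
    unfolding poset_convex_def using ij prec_trans prec_irrefl by blast
  moreover have "cut_connected r {i, j}"
    using ij by (intro cut_connectedI) (auto simp: comparable_def)
  ultimately show ?thesis using prec_Field[OF ij(1)] by (simp add: pipe_iff)
qed

lemma convex_convex_closure: "poset_convex r (convex_closure r U)"
proof -
  have up: "\<exists>k'\<in>U. k = k' \<or> prec r k k'" and down: "\<exists>k'\<in>U. k = k' \<or> prec r k' k"
    if "k \<in> convex_closure r U" for k
    using that by (auto simp: convex_closure_def)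
  show ?thesis
    unfolding poset_convex_def
  proof (intro ballI allI impI, elim conjE)
    fix i k j assume *: "i \<in> convex_closure r U" "k \<in> convex_closure r U" "prec r i j" "prec r j k"
    obtain i' k' where "i' \<in> U" "k' \<in> U" "i = i' \<or> prec r i' i" "k = k' \<or> prec r k k'"
      using up[OF *(2)] down[OF *(1)] by blast
    then have "prec r i' j" "prec r j k'" using *(3,4) prec_trans by blast+
    then show "j \<in> convex_closure r U" using \<open>i' \<in> U\<close> \<open>k' \<in> U\<close> by (auto simp: convex_closure_def)
  qed
qed

lemma convex_closure_subset_Field: "U \<subseteq> Field r \<Longrightarrow> convex_closure r U \<subseteq> Field r"
  using prec_Field by (fastforce simp: convex_closure_def)

lemma finite_pipings: "piping r T \<Longrightarrow> finite T"
  unfolding piping_def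
  by (meson finite_Field finite_Pow_iff finite_subset PowI pipe_subset subsetI)

lemma piping_digraph_Times: "piping_digraph r T \<subseteq> T \<times> T"
  by (auto simp: piping_digraph_def)

lemma piping_mono: "piping r T \<Longrightarrow> T' \<subseteq> T \<Longrightarrow> piping r T'"
proof -
  assume T: "piping r T" "T' \<subseteq> T"
  have "piping_digraph r T' \<subseteq> piping_digraph r T" using T(2) by (auto simp: piping_digraph_def)
  then have "acyclic (piping_digraph r T')" by (rule acyclic_subset[OF piping_acyclic[OF T(1)]])
  then show "piping r T'"
    using piping_pipe[OF T(1)] piping_laminar[OF T(1)] T(2) by (intro pipingI) (simp_all add: subset_eq)
qed

text \<open>A singleton never crosses a pipe, so only acyclicity is at stake. Sending an old rank
  \<open>h\<close> to the odd number \<open>2 * h + 1\<close> leaves the even number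
  \<open>2 * m\<close> free for the singleton.\<close>

lemma piping_insert_singleton:
  assumes T: "piping r T" and x: "x \<in> Field r" shows "piping r (insert {x} T)"
proof (cases "{x} \<in> T")
  case False
  let ?E = "piping_digraph r T"
  obtain h where h: "\<And>\<sigma> \<sigma>'. (\<sigma>, \<sigma>') \<in> ?E \<Longrightarrow> h \<sigma> < (h \<sigma>' :: nat)"
    using acyclic_rank[OF _ piping_digraph_Times finite_pipings[OF T]] T unfolding piping_def by metis
  define B where "B = {\<sigma> \<in> T. x \<notin> \<sigma> \<and> (\<exists>i\<in>\<sigma>. prec r i x)}"
  \<comment> \<open>The least value above the ranks of all pipes that avoid \<open>x\<close> and
    have an element below it; the 0 is used when there are none.\<close>
  define m where "m = Max (insert 0 ((\<lambda>\<sigma>. Suc (h \<sigma>)) ` B))"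
  have fin: "finite ((\<lambda>\<sigma>. Suc (h \<sigma>)) ` B)" using finite_pipings[OF T] by (simp add: B_def)
  \<comment> \<open>Whatever lies below \<open>x\<close> lies below whatever lies above \<open>x\<close>, by convexity.\<close>
  have sep: "m \<le> h \<sigma>" if "\<sigma> \<in> T" "x \<notin> \<sigma>" "j \<in> \<sigma>" "prec r x j" for \<sigma> j
  proof -
    have "Suc (h \<rho>) \<le> h \<sigma>" if \<rho>B: "\<rho> \<in> B" for \<rho>
    proof -
      obtain i where \<rho>: "\<rho> \<in> T" "x \<notin> \<rho>" "i \<in> \<rho>" "prec r i x" using \<rho>B by (auto simp: B_def)
      have conv: "poset_convex r \<rho>" "poset_convex r \<sigma>"
        using T \<rho>(1) \<open>\<sigma> \<in> T\<close> pipe_convex unfolding piping_def by blast+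
      have "\<not> \<rho> \<subseteq> \<sigma>" "\<not> \<sigma> \<subseteq> \<rho>"
        using poset_convexD[OF conv(1)] poset_convexD[OF conv(2)] \<rho> \<open>x \<notin> \<sigma>\<close> \<open>j \<in> \<sigma>\<close> \<open>prec r x j\<close> by blast+
      then have "\<rho> \<inter> \<sigma> = {}" using T \<rho>(1) \<open>\<sigma> \<in> T\<close> unfolding piping_def by blast
      moreover have "prec r i j" using prec_trans \<rho>(4) \<open>prec r x j\<close> by blast
      ultimately have "(\<rho>, \<sigma>) \<in> ?E"
        unfolding piping_digraph_def using \<rho> \<open>\<sigma> \<in> T\<close> \<open>j \<in> \<sigma>\<close> by blast
      then show ?thesis using h by (simp add: Suc_leI)
    qed
    then show ?thesis using fin by (simp add: m_def)
  qed
  have pred: "Suc (h \<sigma>) \<le> m" if "\<sigma> \<in> B" for \<sigma>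
    unfolding m_def using that fin by (intro Max_ge) auto
  have "acyclic (piping_digraph r (insert {x} T))"
  proof (rule acyclic_if_rank)
    fix \<sigma> \<sigma>' assume *: "(\<sigma>, \<sigma>') \<in> piping_digraph r (insert {x} T)"
    then obtain i j where ij: "i \<in> \<sigma>" "j \<in> \<sigma>'" "prec r i j" "\<sigma> \<inter> \<sigma>' = {}"
      by (auto simp: piping_digraph_def)
    let ?h = "\<lambda>\<sigma>. if \<sigma> = {x} then 2 * m else 2 * h \<sigma> + 1"
    consider "\<sigma> = {x}" "\<sigma>' \<in> T" "\<sigma>' \<noteq> {x}" | "\<sigma> \<in> T" "\<sigma> \<noteq> {x}" "\<sigma>' = {x}"
      | "\<sigma> \<in> T" "\<sigma>' \<in> T" "\<sigma> \<noteq> {x}" "\<sigma>' \<noteq> {x}"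
      using * False ij(4) by (auto simp: piping_digraph_def)
    then show "?h \<sigma> < ?h \<sigma>'"
    proof cases
      case 1
      then have "m \<le> h \<sigma>'" using ij by (intro sep) auto
      then show ?thesis using 1 by simp
    next
      case 2
      then have "\<sigma> \<in> B" using ij by (auto simp: B_def)
      then have "2 * h \<sigma> + 1 < 2 * m" using pred[of \<sigma>] by linarith
      then show ?thesis using 2 by simp
    next
      case 3
      then have "(\<sigma>, \<sigma>') \<in> ?E" using ij by (auto simp: piping_digraph_def)
      then show ?thesis using h 3 by simp
    qed
  qed
  then show ?thesis
  proof (intro pipingI)
    show "pipe r \<tau>" if "\<tau> \<in> insert {x} T" for \<tau>
      using that piping_pipe[OF T] pipe_singleton[OF x] by auto
    show "\<tau> \<subseteq> \<tau>' \<or> \<tau>' \<subseteq> \<tau> \<or> \<tau> \<inter> \<tau>' = {}" if "\<tau> \<in> insert {x} T" "\<tau>' \<in> insert {x} T" for \<tau> \<tau>'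
      using that piping_laminar[OF T, of \<tau> \<tau>'] by auto
  qed
qed (simp add: T insert_absorb)

lemma piping_Un_singletons:
  assumes "piping r T" "X \<subseteq> Field r" shows "piping r (T \<union> (\<lambda>x. {x}) ` X)"
proof -
  have "finite X" using assms finite_Field finite_subset by blast
  then show ?thesis using assms(2)
  proof (induction X)
    case (insert x X)
    then show ?case using piping_insert_singleton[of "T \<union> (\<lambda>x. {x}) ` X" x] by simp
  qed (simp add: assms(1))
qed

text \<open>The whole poset meets every pipe, so it has no edges in the digraph.\<close>

lemma piping_insert_Field:
  assumes T: "piping r T" and P: "pipe r (Field r)" shows "piping r (insert (Field r) T)"
proof -
  have pipes: "\<sigma> \<subseteq> Field r" "\<sigma> \<noteq> {}" if "\<sigma> \<in> insert (Field r) T" for \<sigma>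
  proof -
    have "pipe r \<sigma>" using that P piping_pipe[OF T] by auto
    then show "\<sigma> \<subseteq> Field r" "\<sigma> \<noteq> {}" by (rule pipe_subset, rule pipe_nonempty)
  qed
  have "piping_digraph r (insert (Field r) T) \<subseteq> piping_digraph r T"
  proof
    fix e assume "e \<in> piping_digraph r (insert (Field r) T)"
    then obtain \<sigma> \<sigma>' where e: "e = (\<sigma>, \<sigma>')" "\<sigma> \<in> insert (Field r) T" "\<sigma>' \<in> insert (Field r) T"
      "\<sigma> \<inter> \<sigma>' = {}" "\<exists>i\<in>\<sigma>. \<exists>j\<in>\<sigma>'. prec r i j"
      by (auto simp: piping_digraph_def)
    then have "\<sigma> \<noteq> Field r" "\<sigma>' \<noteq> Field r"
      using pipes[OF e(2)] pipes[OF e(3)] by blast+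
    then show "e \<in> piping_digraph r T" using e by (simp add: piping_digraph_def)
  qed
  then have "acyclic (piping_digraph r (insert (Field r) T))"
    by (rule acyclic_subset[OF piping_acyclic[OF T]])
  then show ?thesis
  proof (intro pipingI)
    show "pipe r \<tau>" if "\<tau> \<in> insert (Field r) T" for \<tau>
      using that piping_pipe[OF T] P by auto
    show "\<tau> \<subseteq> \<tau>' \<or> \<tau>' \<subseteq> \<tau> \<or> \<tau> \<inter> \<tau>' = {}"
      if "\<tau> \<in> insert (Field r) T" "\<tau>' \<in> insert (Field r) T" for \<tau> \<tau>'
      using that piping_laminar[OF T, of \<tau> \<tau>'] pipes(1)[OF that(1)] pipes(1)[OF that(2)] by auto
  qed
qed

text \<open>With the singletons and the whole poset added, a piping becomes a rooted tree of pipes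
  in which the children of every non-singleton pipe partition it. The recursive construction of
  points runs along this tree.\<close>

definition full_piping :: "'p set set \<Rightarrow> bool" where
  "full_piping T \<longleftrightarrow> piping r T \<and> Field r \<in> T \<and> (\<forall>x\<in>Field r. {x} \<in> T)"

lemma full_piping_completion:
  "piping r T \<Longrightarrow> pipe r (Field r) \<Longrightarrow>
    full_piping (insert (Field r) (T \<union> (\<lambda>x. {x}) ` Field r))"
  unfolding full_piping_def using piping_insert_Field piping_Un_singletons by auto

text \<open>The child containing \<open>i\<close> is the union of the members of \<open>T\<close>
  that contain \<open>i\<close> and lie strictly inside \<open>\<tau>\<close>: they form a chain by
  laminarity, and \<open>{i}\<close> is one of them.\<close>

lemma full_piping_children:
  assumes T: "full_piping T" and \<tau>: "\<tau> \<in> T" "1 < card \<tau>"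
  obtains C where "\<And>i. i \<in> \<tau> \<Longrightarrow> C i \<in> T \<and> i \<in> C i \<and> C i \<subset> \<tau>"
    "\<And>i \<sigma>. i \<in> \<sigma> \<Longrightarrow> \<sigma> \<in> T \<Longrightarrow> \<sigma> \<subset> \<tau> \<Longrightarrow> \<sigma> \<subseteq> C i"
    "\<And>i j. i \<in> \<tau> \<Longrightarrow> j \<in> C i \<Longrightarrow> C j = C i"
proof -
  have piping: "piping r T" using T by (simp add: full_piping_def)
  have sub: "\<tau> \<subseteq> Field r" using piping \<tau> pipe_subset unfolding piping_def by blast
  define C where "C i = \<Union>{\<sigma> \<in> T. i \<in> \<sigma> \<and> \<sigma> \<subset> \<tau>}" for i
  have 1: "C i \<in> T \<and> i \<in> C i \<and> C i \<subset> \<tau>" if i: "i \<in> \<tau>" for i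
  proof -
    let ?A = "{\<sigma> \<in> T. i \<in> \<sigma> \<and> \<sigma> \<subset> \<tau>}"
    have "{i} \<in> ?A" using T i sub \<tau>(2) unfolding full_piping_def by auto
    moreover have "finite ?A" using finite_pipings[OF piping] by simp
    moreover have "\<sigma> \<subseteq> \<sigma>' \<or> \<sigma>' \<subseteq> \<sigma>" if "\<sigma> \<in> ?A" "\<sigma>' \<in> ?A" for \<sigma> \<sigma>'
      using that piping unfolding piping_def by blast
    ultimately have "\<Union>?A \<in> ?A"
      by (intro Union_in_chain) (auto simp: subset_chain_def)
    then show ?thesis by (auto simp: C_def)
  qed
  have 2: "\<sigma> \<subseteq> C i" if "i \<in> \<sigma>" "\<sigma> \<in> T" "\<sigma> \<subset> \<tau>" for i \<sigma>
    using that by (auto simp: C_def)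
  have 3: "C j = C i" if "i \<in> \<tau>" "j \<in> C i" for i j
  proof
    have "C i \<in> T" "C i \<subset> \<tau>" "j \<in> \<tau>" using 1[OF that(1)] that(2) by auto
    then show "C i \<subseteq> C j" using 2 that(2) by blast
    then have "i \<in> C j" using 1[OF that(1)] by blast
    then show "C j \<subseteq> C i" using 2[of i "C j"] 1[OF \<open>j \<in> \<tau>\<close>] by blast
  qed
  show ?thesis by (rule that[of C]) (fact 1, fact 2, fact 3)
qed

lemma proper_pipings_subset: "T \<in> proper_pipings r \<Longrightarrow> T' \<subseteq> T \<Longrightarrow> T' \<in> proper_pipings r"
  unfolding proper_pipings_def using piping_mono by blast

lemma singleton_proper_piping: "\<tau> \<in> proper_pipes r \<Longrightarrow> {\<tau>} \<in> proper_pipings r"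
proof -
  assume \<tau>: "\<tau> \<in> proper_pipes r"
  then have "pipe r \<tau>" by (simp add: proper_pipes_def)
  moreover have "piping_digraph r {\<tau>} = {}"
    using pipe_nonempty[OF \<open>pipe r \<tau>\<close>] by (auto simp: piping_digraph_def)
  ultimately show "{\<tau>} \<in> proper_pipings r"
    using \<tau> by (simp add: proper_pipings_def piping_def acyclic_def)
qed

lemma Union_proper_pipings: "\<Union>(proper_pipings r) = proper_pipes r"
proof
  show "\<Union>(proper_pipings r) \<subseteq> proper_pipes r" unfolding proper_pipings_def by blast
  show "proper_pipes r \<subseteq> \<Union>(proper_pipings r)" using singleton_proper_piping by blast
qed

lemma finite_proper_pipes: "finite (proper_pipes r)"
  by (rule finite_subset[of _ "Pow (Field r)"]) (auto simp: proper_pipes_def pipe_def finite_Field)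

end

lemma finite_poset_if_connected: "finite_connected_poset r \<Longrightarrow> finite_poset r"
  by (simp add: finite_connected_poset_def finite_poset_def)

lemma finite_connected_poset_iff:
  "finite_connected_poset r \<longleftrightarrow> finite_poset r \<and> cut_connected r (Field r)"
  unfolding finite_connected_poset_def finite_poset_def
  using finite_poset.hasse_connected_iff[OF _ poset_convex_Field] finite_poset_def by blast

lemma pipe_Field: "finite_connected_poset r \<Longrightarrow> Field r \<noteq> {} \<Longrightarrow> pipe r (Field r)"
  by (simp add: pipe_def finite_connected_poset_def poset_convex_Field)

section \<open>Point configurations realizing pipings\<close>

definition comparable_pairs :: "'p rel \<Rightarrow> 'p set \<Rightarrow> ('p \<times> 'p) set" where
  "comparable_pairs r \<tau> = {(i, j). i \<in> \<tau> \<and> j \<in> \<tau> \<and> prec r i j}"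

text \<open>Adding a constant to \<open>p\<close> does not change it. The value type is general
  because the spread is also taken of a vector-valued coordinate function \<open>b\<close>; by
  \<open>spread_inner\<close> the result is then the normal vector of a linear functional.\<close>

definition spread :: "'p rel \<Rightarrow> 'p set \<Rightarrow> ('p \<Rightarrow> 'b::ab_group_add) \<Rightarrow> 'b" where
  "spread r \<tau> p = (\<Sum>(i, j)\<in>comparable_pairs r \<tau>. p j - p i)"

lemma comparable_pairs_subset: "comparable_pairs r \<tau> \<subseteq> \<tau> \<times> \<tau>"
  by (auto simp: comparable_pairs_def)

lemma spread_cong_shift:
  assumes "\<And>i. i \<in> \<tau> \<Longrightarrow> p i = q i + k" shows "spread r \<tau> p = spread r \<tau> q"
  unfolding spread_def by (rule sum.cong) (auto simp: comparable_pairs_def assms)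

lemma spread_add: "spread r \<tau> (\<lambda>i. p i + q i) = spread r \<tau> p + spread r \<tau> q"
  unfolding spread_def by (simp add: sum.distrib[symmetric] case_prod_unfold algebra_simps)

lemma spread_scale: "spread r \<tau> (\<lambda>i. c * p i) = c * spread r \<tau> (p :: 'p \<Rightarrow> real)"
  unfolding spread_def by (simp add: sum_distrib_left case_prod_unfold algebra_simps)

lemma spread_inner: "spread r \<tau> (\<lambda>i. x \<bullet> b i) = x \<bullet> spread r \<tau> b"
  unfolding spread_def by (simp add: inner_sum_right case_prod_unfold inner_diff_right)

section \<open>Thresholds, and estimates between spreads and diameters\<close>

context finite_poset
begin

text \<open>A common crude bound for the number of elements, the number of pipes and all ranks; its
  square bounds the number of comparable pairs.\<close>

definition N :: real where "N = 2 ^ card (Field r)"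
text \<open>Has to exceed \<open>2 * N ^ 4\<close> (two overlapping pipes), \<open>4 * N ^ 6\<close>
  (a directed cycle) and \<open>2 * N ^ 4 + N ^ 3 + 2 * N ^ 5\<close> (the recursive
  construction).\<close>

definition growth :: real where "growth = 10 * N ^ 6"
text \<open>A singleton has no comparable pairs and spread 0, so with threshold 0 it is tight at
  every point.\<close>

definition threshold :: "'p set \<Rightarrow> real" where
  "threshold \<tau> = (if card \<tau> \<le> 1 then 0 else growth ^ card \<tau>)"

lemma N_ge_1: "1 \<le> N"
  by (simp add: N_def)

lemma N_power_mono: "k \<le> l \<Longrightarrow> N ^ k \<le> N ^ l"
  using N_ge_1 by (rule power_increasing[rotated])

lemma growth_gt: "1 < growth" "4 * N ^ 6 < growth" "2 * N ^ 4 + N ^ 3 + 2 * N ^ 5 < growth"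
proof -
  have "1 \<le> N ^ 6" "N ^ 4 \<le> N ^ 6" "N ^ 3 \<le> N ^ 6" "N ^ 5 \<le> N ^ 6"
    using N_power_mono[of 0 6] by (simp_all add: N_power_mono)
  then show "1 < growth" "4 * N ^ 6 < growth" "2 * N ^ 4 + N ^ 3 + 2 * N ^ 5 < growth"
    unfolding growth_def by linarith+
qed

lemma threshold_ge_0: "0 \<le> threshold \<tau>"
  using growth_gt by (simp add: threshold_def)

lemma threshold_le: "card \<tau> \<le> m \<Longrightarrow> threshold \<tau> \<le> growth ^ m"
  using growth_gt by (auto simp: threshold_def power_increasing)

lemma card_pipings_le:
  assumes "T \<subseteq> Pow (Field r)" shows "real (card T) \<le> N"
proof -
  have "card T \<le> card (Pow (Field r))" using assms finite_Field by (intro card_mono) auto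
  then have "real (card T) \<le> real (2 ^ card (Field r))"
    using finite_Field by (simp only: of_nat_le_iff card_Pow)
  then show ?thesis by (simp add: N_def)
qed

lemma card_square_le:
  assumes "\<tau> \<subseteq> Field r" "E \<subseteq> \<tau> \<times> \<tau>" shows "real (card E) \<le> N ^ 2"
proof -
  have fin: "finite \<tau>" using assms(1) finite_Field finite_subset by blast
  have "card E \<le> card \<tau> * card \<tau>"
    using card_mono[OF _ assms(2)] fin by (simp add: card_cartesian_product)
  also have "\<dots> \<le> card (Field r) * card (Field r)"
    using card_mono[OF finite_Field assms(1)] by (rule mult_le_mono) (rule card_mono[OF finite_Field assms(1)])
  finally have "real (card E) \<le> real (card (Field r)) * real (card (Field r))"
    by (simp flip: of_nat_mult)
  also have "\<dots> \<le> N * N"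
  proof -
    have "card (Field r) \<le> 2 ^ card (Field r)" using less_exp less_imp_le by blast
    then have "real (card (Field r)) \<le> N"
      unfolding N_def by (simp flip: of_nat_le_iff)
    then show ?thesis by (intro mult_mono) (use N_ge_1 in auto)
  qed
  finally show ?thesis by (simp add: power2_eq_square)
qed

lemma finite_comparable_pairs: "\<tau> \<subseteq> Field r \<Longrightarrow> finite (comparable_pairs r \<tau>)"
  by (rule finite_subset[OF comparable_pairs_subset]) (use finite_Field finite_subset in blast)

lemma card_comparable_pairs: "\<tau> \<subseteq> Field r \<Longrightarrow> real (card (comparable_pairs r \<tau>)) \<le> N ^ 2"
  by (rule card_square_le[OF _ comparable_pairs_subset])

lemma spread_le:
  fixes p :: "'p \<Rightarrow> real"
  assumes "\<tau> \<subseteq> Field r" "\<And>i j. i \<in> \<tau> \<Longrightarrow> j \<in> \<tau> \<Longrightarrow> prec r i j \<Longrightarrow> p j - p i \<le> M" "0 \<le> M"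
  shows "spread r \<tau> p \<le> N ^ 2 * M"
proof -
  have "spread r \<tau> p \<le> real (card (comparable_pairs r \<tau>)) * M"
    unfolding spread_def by (rule sum_bounded_above) (auto simp: comparable_pairs_def assms(2))
  also have "\<dots> \<le> N ^ 2 * M"
    using card_comparable_pairs[OF assms(1)] assms(3) by (rule mult_right_mono)
  finally show ?thesis .
qed

text \<open>For monotone \<open>p\<close> all summands are nonnegative, so each one is at most the
  sum.\<close>

lemma le_spread:
  fixes p :: "'p \<Rightarrow> real"
  assumes "\<tau> \<subseteq> Field r" "\<And>i j. i \<in> \<tau> \<Longrightarrow> j \<in> \<tau> \<Longrightarrow> prec r i j \<Longrightarrow> p i \<le> p j"
    and "i \<in> \<tau>" "j \<in> \<tau>" "prec r i j"
  shows "p j - p i \<le> spread r \<tau> p"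
proof -
  have "(case (i, j) of (i, j) \<Rightarrow> p j - p i) \<le> spread r \<tau> p"
    unfolding spread_def
    by (rule member_le_sum) (use assms in \<open>auto simp: comparable_pairs_def finite_comparable_pairs[unfolded comparable_pairs_def]\<close>)
  then show ?thesis by simp
qed

text \<open>Any two elements are joined by a path of at most \<open>N ^ 2\<close> comparabilities,
  and along each of them \<open>p\<close> changes by at most the spread.\<close>

lemma diameter_le:
  fixes p :: "'p \<Rightarrow> real"
  assumes \<tau>: "\<tau> \<subseteq> Field r" "cut_connected r \<tau>"
    and mono: "\<And>i j. i \<in> \<tau> \<Longrightarrow> j \<in> \<tau> \<Longrightarrow> prec r i j \<Longrightarrow> p i \<le> p j"
    and M: "spread r \<tau> p \<le> M" "0 \<le> M" and ij: "i \<in> \<tau>" "j \<in> \<tau>"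
  shows "p i \<le> p j + N ^ 2 * M"
proof -
  let ?R = "{(x, y). x \<in> \<tau> \<and> y \<in> \<tau> \<and> comparable r x y}"
  have "finite ?R" by (rule finite_subset[of _ "\<tau> \<times> \<tau>"]) (use \<tau> finite_Field finite_subset in auto)
  moreover have "(i, j) \<in> ?R\<^sup>*" by (rule cut_connected_rtrancl[OF \<tau>(2) ij])
  moreover have "p x \<le> p y + M" if "(x, y) \<in> ?R" for x y
  proof -
    have xy: "x \<in> \<tau>" "y \<in> \<tau>" "prec r x y \<or> prec r y x" using that by (auto simp: comparable_def)
    then show ?thesis
    proof (elim disjE)
      assume "prec r x y"
      then show ?thesis using mono[OF xy(1,2)] M(2) by linarith
    next
      assume "prec r y x"
      then have "p x - p y \<le> spread r \<tau> p" using xy mono \<tau>(1) by (intro le_spread)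
      then show ?thesis using M(1) by linarith
    qed
  qed
  ultimately have "p i \<le> p j + real (card ?R) * M" using M(2) by (intro rtrancl_drift_le)
  moreover have "real (card ?R) * M \<le> N ^ 2 * M"
    by (rule mult_right_mono[OF card_square_le[OF \<tau>(1)] M(2)]) auto
  ultimately show ?thesis by linarith
qed

text \<open>A covering pair is itself a pipe with positive threshold, which forces a strict
  increase; longer relations are composed of coverings.\<close>

lemma strictly_monotone_on_pipe:
  fixes p :: "'p \<Rightarrow> real"
  assumes \<tau>: "poset_convex r \<tau>"
    and p: "\<And>\<sigma>. pipe r \<sigma> \<Longrightarrow> \<sigma> \<subseteq> \<tau> \<Longrightarrow> threshold \<sigma> \<le> spread r \<sigma> p"
    and ij: "i \<in> \<tau>" "j \<in> \<tau>" "prec r i j"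
  shows "p i < p j"
  using ij(3,1,2)
proof (induction rule: prec_induct)
  case (cover x y)
  have xy: "prec r x y" "x \<noteq> y" using cover(1) by (auto simp: covered_by_def prec_def)
  then have "comparable_pairs r {x, y} = {(x, y)}"
    using prec_asym prec_irrefl by (auto simp: comparable_pairs_def)
  then have "spread r {x, y} p = p y - p x" by (simp add: spread_def)
  moreover have "threshold {x, y} > 0" using xy(2) growth_gt by (simp add: threshold_def)
  moreover have "threshold {x, y} \<le> spread r {x, y} p"
    using p[OF pipe_cover[OF cover(1)]] cover(2,3) by simp
  ultimately show ?case by linarith
next
  case (trans x y z)
  then have "y \<in> \<tau>" using poset_convexD[OF \<tau>] by blast
  then show ?case using trans by fastforce
qed

text \<open>Plays the two scales against each other: the convex closure of \<open>U\<close> is a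
  pipe with more than \<open>m\<close> elements, so feasibility makes its spread at least
  \<open>growth ^ Suc m\<close>, while values within \<open>M\<close> of each other allow at most
  \<open>N ^ 2 * M\<close>.\<close>

lemma spread_merge:
  fixes p :: "'p \<Rightarrow> real"
  assumes p: "\<And>\<sigma>. pipe r \<sigma> \<Longrightarrow> threshold \<sigma> \<le> spread r \<sigma> p"
    and U: "U \<subseteq> Field r" "U \<noteq> {}" "cut_connected r (convex_closure r U)"
    and M: "\<And>x y. x \<in> U \<Longrightarrow> y \<in> U \<Longrightarrow> p x \<le> p y + M"
    and m: "1 \<le> m" "m < card U"
  shows "growth ^ Suc m \<le> N ^ 2 * M"
proof -
  let ?\<rho> = "convex_closure r U"
  have \<rho>: "?\<rho> \<subseteq> Field r" using convex_closure_subset_Field[OF U(1)] .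
  have pipe: "pipe r ?\<rho>"
    unfolding pipe_iff using \<rho> U convex_convex_closure by (auto simp: convex_closure_def)
  have mono: "p i < p j" if "prec r i j" for i j
    using strictly_monotone_on_pipe[OF poset_convex_Field p _ _ that] prec_Field[OF that] by blast
  \<comment> \<open>Taking the convex closure does not enlarge the range of \<open>p\<close>: each
    added element lies between two elements of \<open>U\<close>, and \<open>p\<close> is
    monotone.\<close>
  have above: "\<exists>x'\<in>U. p x \<le> p x'" and below: "\<exists>x'\<in>U. p x' \<le> p x" if "x \<in> ?\<rho>" for x
    using that mono unfolding convex_closure_def by (auto intro: less_imp_le)
  have bound: "p x \<le> p y + M" if xy: "x \<in> ?\<rho>" "y \<in> ?\<rho>" for x y
  proof -
    obtain x' y' where "x' \<in> U" "p x \<le> p x'" "y' \<in> U" "p y' \<le> p y"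
      using above[OF xy(1)] below[OF xy(2)] by blast
    then show ?thesis using M[of x' y'] by linarith
  qed
  obtain u where "u \<in> U" using U(2) by blast
  then have "0 \<le> M" using M[of u u] by simp
  have "p j - p i \<le> M" if "i \<in> ?\<rho>" "j \<in> ?\<rho>" for i j using bound[OF that(2,1)] by simp
  then have "spread r ?\<rho> p \<le> N ^ 2 * M" using \<rho> \<open>0 \<le> M\<close> by (intro spread_le) auto
  moreover have "Suc m \<le> card ?\<rho>"
    using card_mono[of ?\<rho> U] finite_subset[OF \<rho> finite_Field] m by (auto simp: convex_closure_def)
  then have "growth ^ Suc m \<le> growth ^ card ?\<rho>"
    using growth_gt(1) by (intro power_increasing) auto
  then have "growth ^ Suc m \<le> threshold ?\<rho>"
    using m \<open>Suc m \<le> card ?\<rho>\<close> by (simp add: threshold_def)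
  ultimately show ?thesis using p[OF pipe] by linarith
qed

lemma closed_subset_of_union:
  assumes \<S>: "\<And>\<sigma>. \<sigma> \<in> \<S> \<Longrightarrow> cut_connected r \<sigma>"
    and X: "\<And>i j. i \<in> X \<Longrightarrow> j \<in> convex_closure r (\<Union>\<S>) \<Longrightarrow> comparable r i j \<Longrightarrow> j \<in> X"
    and \<sigma>: "\<sigma> \<in> \<S>" "i \<in> \<sigma>" "i \<in> X"
  shows "\<sigma> \<subseteq> X"
proof (rule ccontr)
  assume "\<not> \<sigma> \<subseteq> X"
  then obtain x y where "x \<in> X" "y \<in> \<sigma>" "y \<notin> X" "comparable r x y"
    using cut_connected_crossing[OF \<S>[OF \<sigma>(1)] \<sigma>(2,3)] by metis
  moreover have "y \<in> convex_closure r (\<Union>\<S>)" using \<open>y \<in> \<sigma>\<close> \<sigma>(1) by (auto simp: convex_closure_def)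
  ultimately show False using X by blast
qed

text \<open>Every element added by the convex closure is comparable to one of the union, so only the
  union itself has to be reached.\<close>

lemma cut_connected_convex_closure:
  assumes "\<And>X. X \<subseteq> convex_closure r (\<Union>\<S>) \<Longrightarrow> X \<inter> \<Union>\<S> \<noteq> {} \<Longrightarrow>
      (\<And>i j. i \<in> X \<Longrightarrow> j \<in> convex_closure r (\<Union>\<S>) \<Longrightarrow> comparable r i j \<Longrightarrow> j \<in> X) \<Longrightarrow> \<Union>\<S> \<subseteq> X"
  shows "cut_connected r (convex_closure r (\<Union>\<S>))"
proof (rule cut_connectedI)
  fix X assume X: "X \<subseteq> convex_closure r (\<Union>\<S>)" "X \<noteq> {}"
    and cl: "\<And>i j. i \<in> X \<Longrightarrow> j \<in> convex_closure r (\<Union>\<S>) \<Longrightarrow> comparable r i j \<Longrightarrow> j \<in> X"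
  have near: "\<exists>i\<in>\<Union>\<S>. i = j \<or> comparable r i j" if "j \<in> convex_closure r (\<Union>\<S>)" for j
    using that by (auto simp: convex_closure_def comparable_def)
  obtain x where x: "x \<in> X" using X(2) by blast
  obtain i where i: "i \<in> \<Union>\<S>" "i = x \<or> comparable r i x" using near x X(1) by blast
  then have "i \<in> convex_closure r (\<Union>\<S>)" by (simp add: convex_closure_def)
  then have "i \<in> X" using cl[OF x, of i] i(2) x comparable_sym[of r i x] by auto
  then have "X \<inter> \<Union>\<S> \<noteq> {}" using i(1) by blast
  then have sub: "\<Union>\<S> \<subseteq> X" using cl by (rule assms[OF X(1)])
  show "convex_closure r (\<Union>\<S>) \<subseteq> X"
  proof
    fix j assume j: "j \<in> convex_closure r (\<Union>\<S>)"
    then obtain i where "i \<in> \<Union>\<S>" "i = j \<or> comparable r i j" using near by blast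
    then show "j \<in> X" using cl[OF _ j, of i] sub by auto
  qed
qed

text \<open>
  If all the spreads are at least their thresholds, then a family of pipes that meets its thresholds
  and violates the definition of a piping lies in a larger pipe of comparable spread, which is
  impossible because the thresholds grow fast.
\<close>

lemma piping_of_tight_pipes:
  fixes p :: "'p \<Rightarrow> real"
  assumes p: "\<And>\<sigma>. pipe r \<sigma> \<Longrightarrow> threshold \<sigma> \<le> spread r \<sigma> p"
    and T: "\<And>\<sigma>. \<sigma> \<in> T \<Longrightarrow> pipe r \<sigma> \<and> 1 < card \<sigma> \<and> spread r \<sigma> p = threshold \<sigma>"
  shows "piping r T"
proof (rule pipingI)
  have mono: "p i < p j" if "prec r i j" for i j
    using strictly_monotone_on_pipe[OF poset_convex_Field p _ _ that] prec_Field[OF that] by blast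
  have pipe: "pipe r \<sigma>" "1 < card \<sigma>" "\<sigma> \<subseteq> Field r" "cut_connected r \<sigma>" if "\<sigma> \<in> T" for \<sigma>
    using T[OF that] by (auto simp: pipe_iff)
  show "pipe r \<sigma>" if "\<sigma> \<in> T" for \<sigma> using pipe(1) that .
  have diam: "p i \<le> p j + N ^ 2 * growth ^ m" if "\<sigma> \<in> T" "card \<sigma> \<le> m" "i \<in> \<sigma>" "j \<in> \<sigma>" for \<sigma> m i j
    using pipe[OF that(1)] T[OF that(1)] threshold_le[OF that(2)] mono that(3,4) growth_gt
    by (intro diameter_le) (auto intro: less_imp_le)
  have "T \<subseteq> Pow (Field r)" using pipe by blast
  then have card_T: "real (card T) \<le> N" and fin_T: "finite T"
    using card_pipings_le finite_subset finite_Field by blast+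
  show "\<tau> \<subseteq> \<tau>' \<or> \<tau>' \<subseteq> \<tau> \<or> \<tau> \<inter> \<tau>' = {}" if \<tau>: "\<tau> \<in> T" "\<tau>' \<in> T" for \<tau> \<tau>'
  proof (rule ccontr)
    assume "\<not> ?thesis"
    then have *: "\<not> \<tau> \<subseteq> \<tau>'" "\<not> \<tau>' \<subseteq> \<tau>" "\<tau> \<inter> \<tau>' \<noteq> {}" by blast+
    then obtain z where z: "z \<in> \<tau>" "z \<in> \<tau>'" by blast
    define m where "m = max (card \<tau>) (card \<tau>')"
    let ?U = "\<Union>{\<tau>, \<tau>'}"
    have conn: "cut_connected r (convex_closure r ?U)"
    proof (rule cut_connected_convex_closure)
      fix X assume X: "X \<inter> ?U \<noteq> {}"
        and cl: "\<And>i j. i \<in> X \<Longrightarrow> j \<in> convex_closure r ?U \<Longrightarrow> comparable r i j \<Longrightarrow> j \<in> X"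
      have sub: "\<sigma> \<subseteq> X" if "\<sigma> \<in> {\<tau>, \<tau>'}" "i \<in> \<sigma>" "i \<in> X" for \<sigma> i
        by (rule closed_subset_of_union[OF _ cl that]) (use pipe \<tau> in auto)
      have "z \<in> X" using sub X z by blast
      then show "?U \<subseteq> X" using sub[of \<tau> z] sub[of \<tau>' z] z by blast
    qed
    \<comment> \<open>Going through the common element \<open>z\<close> costs one diameter for each
      of the two pipes.\<close>
    have "growth ^ Suc m \<le> N ^ 2 * (2 * (N ^ 2 * growth ^ m))"
    proof (rule spread_merge[OF p _ _ conn])
      show "p x \<le> p y + 2 * (N ^ 2 * growth ^ m)" if "x \<in> ?U" "y \<in> ?U" for x y
      proof -
        have "p x \<le> p z + N ^ 2 * growth ^ m" "p z \<le> p y + N ^ 2 * growth ^ m"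
          using diam[OF \<tau>(1), of m] diam[OF \<tau>(2), of m] that z by (auto simp: m_def)
        then show ?thesis by linarith
      qed
      show "1 \<le> m" using pipe[OF \<tau>(1)] by (simp add: m_def)
      have "finite ?U" using pipe_finite pipe(1) \<tau> by simp
      moreover have "\<tau> \<subset> ?U" "\<tau>' \<subset> ?U" using * by auto
      ultimately have "card \<tau> < card ?U" "card \<tau>' < card ?U" by (meson psubset_card_mono)+
      then show "m < card ?U" by (simp add: m_def)
    qed (use pipe \<tau> z in auto)
    then have "growth * growth ^ m \<le> (2 * N ^ 4) * growth ^ m" by (simp add: power_add[symmetric] algebra_simps)
    then have "growth \<le> 2 * N ^ 4" using growth_gt by (simp add: mult_le_cancel_right)
    moreover have "0 \<le> N ^ 3" "0 \<le> N ^ 5" using N_ge_1 by simp_all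
    ultimately show False using growth_gt(3) by linarith
  qed
  show "acyclic (piping_digraph r T)"
  proof (rule ccontr)
    let ?E = "piping_digraph r T"
    assume "\<not> acyclic ?E"
    then obtain \<tau> where \<tau>: "(\<tau>, \<tau>) \<in> ?E\<^sup>+" by (auto simp: acyclic_def)
    \<comment> \<open>The strongly connected component of \<open>\<tau>\<close>, taken instead of a
      single cycle so that membership is a reachability condition and every member reaches every
      other.\<close>
    define \<S> where "\<S> = {\<sigma>. (\<tau>, \<sigma>) \<in> ?E\<^sup>* \<and> (\<sigma>, \<tau>) \<in> ?E\<^sup>*}"
    have E_T: "\<sigma> \<in> T \<and> \<sigma>' \<in> T" if "(\<sigma>, \<sigma>') \<in> ?E" for \<sigma> \<sigma>'
      using that by (simp add: piping_digraph_def)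
    have step: "\<exists>\<sigma>'\<in>\<S>. (\<sigma>, \<sigma>') \<in> ?E" if \<sigma>: "\<sigma> \<in> \<S>" for \<sigma>
    proof -
      have "(\<sigma>, \<sigma>) \<in> ?E\<^sup>+" using \<sigma> \<tau> unfolding \<S>_def by (auto intro: rtrancl_trancl_trancl trancl_rtrancl_trancl)
      then obtain \<sigma>' where "(\<sigma>, \<sigma>') \<in> ?E" "(\<sigma>', \<sigma>) \<in> ?E\<^sup>*" by (metis tranclD)
      moreover from this have "\<sigma>' \<in> \<S>" using \<sigma> unfolding \<S>_def
        by (auto intro: rtrancl_into_rtrancl rtrancl_trans)
      ultimately show ?thesis by blast
    qed
    have \<S>_T: "\<S> \<subseteq> T" using step E_T by blast
    then have fin: "finite \<S>" using fin_T finite_subset by blast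
    have "\<tau> \<in> \<S>" by (simp add: \<S>_def)
    define m where "m = Max (card ` \<S>)"
    have m: "card \<sigma> \<le> m" if "\<sigma> \<in> \<S>" for \<sigma> using that fin by (simp add: m_def)
    have "m \<in> card ` \<S>" unfolding m_def using fin \<open>\<tau> \<in> \<S>\<close> by (intro Max_in) auto
    then obtain \<mu> where \<mu>: "\<mu> \<in> \<S>" "card \<mu> = m" by auto
    \<comment> \<open>The value at an arbitrary element represents a pipe; the choice costs one
      diameter, at most \<open>?D\<close>.\<close>
    define f where "f \<sigma> = p (SOME x. x \<in> \<sigma>)" for \<sigma>
    let ?D = "N ^ 2 * growth ^ m"
    have D: "0 \<le> ?D" using N_ge_1 growth_gt by simp
    let ?F = "?E \<inter> \<S> \<times> \<S>"
    have near: "p x \<le> f \<sigma> + ?D" "f \<sigma> \<le> p x + ?D" if "\<sigma> \<in> \<S>" "x \<in> \<sigma>" for \<sigma> x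
    proof -
      have "(SOME x. x \<in> \<sigma>) \<in> \<sigma>" using that(2) by (rule someI)
      then show "p x \<le> f \<sigma> + ?D" "f \<sigma> \<le> p x + ?D"
        using diam[OF _ m[OF that(1)]] that \<S>_T unfolding f_def by blast+
    qed
    have walk: "(\<sigma>, \<sigma>') \<in> ?F\<^sup>*" if "\<sigma> \<in> \<S>" "\<sigma>' \<in> \<S>" for \<sigma> \<sigma>'
    proof -
      have "(\<sigma>, \<sigma>') \<in> ?E\<^sup>*" using that by (auto simp: \<S>_def intro: rtrancl_trans)
      moreover have "(\<sigma>', \<sigma>) \<in> ?E\<^sup>*" using that by (auto simp: \<S>_def intro: rtrancl_trans)
      ultimately show ?thesis
      proof (induction rule: rtrancl_induct)
        case (step \<rho> \<rho>')
        then have "(\<rho>, \<sigma>) \<in> ?E\<^sup>*" "(\<sigma>, \<rho>') \<in> ?E\<^sup>*" "(\<sigma>, \<rho>) \<in> ?E\<^sup>*"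
          by (auto intro: converse_rtrancl_into_rtrancl)
        then have "\<rho> \<in> \<S>" "\<rho>' \<in> \<S>" "(\<sigma>, \<rho>) \<in> ?F\<^sup>*"
          using step that(1) by (auto simp: \<S>_def intro: rtrancl_trans)
        then show ?case using step(2) by (auto intro: rtrancl_into_rtrancl)
      qed simp
    qed
    \<comment> \<open>Along an edge the representative value drops by at most two diameters, since
      \<open>p i < p j\<close> for the pair that gives the edge.\<close>
    have "f \<sigma> \<le> f \<sigma>' + 2 * ?D" if \<sigma>\<sigma>': "(\<sigma>, \<sigma>') \<in> ?F" for \<sigma> \<sigma>'
    proof -
      obtain i j where "i \<in> \<sigma>" "j \<in> \<sigma>'" "prec r i j" using \<sigma>\<sigma>' by (auto simp: piping_digraph_def)
      then have "f \<sigma> \<le> p i + ?D" "p j \<le> f \<sigma>' + ?D" "p i < p j" using near \<sigma>\<sigma>' mono by auto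
      then show ?thesis by linarith
    qed
    moreover have "finite ?F" using fin by simp
    ultimately have drift: "f \<sigma> \<le> f \<sigma>' + real (card ?F) * (2 * ?D)" if "\<sigma> \<in> \<S>" "\<sigma>' \<in> \<S>" for \<sigma> \<sigma>'
      using D walk[OF that] by (intro rtrancl_drift_le) auto
    have "card ?F \<le> card (T \<times> T)" using fin_T \<S>_T by (intro card_mono) auto
    then have "real (card ?F) \<le> real (card T) * real (card T)"
      by (simp add: card_cartesian_product flip: of_nat_mult)
    also have "\<dots> \<le> N * N" using card_T N_ge_1 by (intro mult_mono) auto
    finally have "real (card ?F) * (2 * ?D) \<le> N * N * (2 * ?D)" using D by (intro mult_right_mono) auto
    \<comment> \<open>Lets the error at the two end points be absorbed into the error of the
      walk.\<close>
    moreover have "1 \<le> N * N" using mult_mono[of 1 N 1 N] N_ge_1 by simp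
    then have "1 * (2 * ?D) \<le> N * N * (2 * ?D)" using D by (intro mult_right_mono) auto
    then have "2 * ?D \<le> N * N * (2 * ?D)" by (simp only: mult_1)
    ultimately have total: "p x \<le> p y + 4 * N ^ 2 * ?D" if xy: "x \<in> \<Union>\<S>" "y \<in> \<Union>\<S>" for x y
    proof -
      obtain \<sigma> \<sigma>' where "\<sigma> \<in> \<S>" "\<sigma>' \<in> \<S>" "x \<in> \<sigma>" "y \<in> \<sigma>'" using xy by blast
      then have "p x \<le> f \<sigma> + ?D" "f \<sigma>' \<le> p y + ?D" "f \<sigma> \<le> f \<sigma>' + real (card ?F) * (2 * ?D)"
        using near drift by blast+
      then have "p x \<le> p y + N * N * (2 * ?D) + N * N * (2 * ?D)"
        using \<open>real (card ?F) * (2 * ?D) \<le> N * N * (2 * ?D)\<close> \<open>2 * ?D \<le> N * N * (2 * ?D)\<close> by linarith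
      then show ?thesis by (simp add: power2_eq_square)
    qed
    have conn: "cut_connected r (convex_closure r (\<Union>\<S>))"
    proof (rule cut_connected_convex_closure)
      fix X assume X: "X \<inter> \<Union>\<S> \<noteq> {}"
        and cl: "\<And>i j. i \<in> X \<Longrightarrow> j \<in> convex_closure r (\<Union>\<S>) \<Longrightarrow> comparable r i j \<Longrightarrow> j \<in> X"
      have sub: "\<sigma> \<subseteq> X" if "\<sigma> \<in> \<S>" "i \<in> \<sigma>" "i \<in> X" for \<sigma> i
        by (rule closed_subset_of_union[OF _ cl that]) (use pipe \<S>_T in auto)
      obtain \<sigma> where \<sigma>: "\<sigma> \<in> \<S>" "\<sigma> \<subseteq> X" using X sub by blast
      have "\<sigma>' \<subseteq> X" if "\<sigma>' \<in> \<S>" for \<sigma>'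
        using walk[OF \<sigma>(1) that]
      proof (induction rule: rtrancl_induct)
        case (step \<rho> \<rho>')
        then obtain i j where "i \<in> \<rho>" "j \<in> \<rho>'" "prec r i j" "\<rho>' \<in> \<S>" by (auto simp: piping_digraph_def)
        moreover from this have "j \<in> convex_closure r (\<Union>\<S>)" by (auto simp: convex_closure_def)
        ultimately have "j \<in> X" using cl[of i j] step.IH by (auto simp: comparable_def)
        then show ?case using sub \<open>j \<in> \<rho>'\<close> \<open>\<rho>' \<in> \<S>\<close> by blast
      qed (rule \<sigma>(2))
      then show "\<Union>\<S> \<subseteq> X" by blast
    qed
    have "growth ^ Suc m \<le> N ^ 2 * (4 * N ^ 2 * ?D)"
    proof (rule spread_merge[OF p _ _ conn total])
      show "\<Union>\<S> \<subseteq> Field r" using \<S>_T pipe(3) by blast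
      show "\<Union>\<S> \<noteq> {}" using \<open>\<tau> \<in> \<S>\<close> \<S>_T pipe(1) pipe_nonempty by blast
      show "1 \<le> m" using \<mu> pipe(2) \<S>_T by force
      \<comment> \<open>The largest pipe \<open>\<mu>\<close> of the component has a successor in
        it, which is disjoint from \<open>\<mu>\<close>, so the union has more than \<open>m\<close>
        elements.\<close>
      obtain \<mu>' where \<mu>': "\<mu>' \<in> \<S>" "(\<mu>, \<mu>') \<in> ?E" using step \<mu>(1) by blast
      then have "\<mu> \<inter> \<mu>' = {}" "\<mu>' \<noteq> {}" by (auto simp: piping_digraph_def)
      then have "\<mu> \<subset> \<Union>\<S>" using \<mu>(1) \<mu>'(1) by blast
      moreover have "finite (\<Union>\<S>)" using fin pipe_finite pipe(1) \<S>_T by blast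
      ultimately show "m < card (\<Union>\<S>)" using psubset_card_mono \<mu>(2) by blast
    qed auto
    then have "growth * growth ^ m \<le> (4 * N ^ 6) * growth ^ m"
      by (simp add: power_add[symmetric] algebra_simps)
    then have "growth \<le> 4 * N ^ 6" using growth_gt by (simp add: mult_le_cancel_right)
    then show False using growth_gt by simp
  qed
qed

end

section \<open>Points at which exactly the pipes of a given piping are tight\<close>

context finite_poset
begin

text \<open>With \<open>a\<close> the spread of the ranks and \<open>b\<close> the spread of the
  offsets inside the children, the quotient is the common spacing. It exceeds one threshold plus
  twice the diameter bound of a child, which is the most by which the offsets can shrink a
  gap.\<close>

lemma threshold_step:
  assumes "0 < a" "a \<le> N ^ 3" "b \<le> 2 * N ^ 4 * growth ^ m"
  shows "growth ^ m + 2 * (N ^ 2 * growth ^ m) < (growth ^ Suc m - b) / a"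
proof -
  let ?g = "growth ^ m"
  have g: "0 < ?g" using growth_gt by simp
  have "(?g + 2 * (N ^ 2 * ?g)) * a \<le> (?g + 2 * (N ^ 2 * ?g)) * N ^ 3"
    using assms(2) g N_ge_1 by (intro mult_left_mono) auto
  also have "\<dots> = (N ^ 3 + 2 * N ^ 5) * ?g" by (simp add: algebra_simps flip: power_add)
  also have "\<dots> < (growth - 2 * N ^ 4) * ?g" using growth_gt(3) g by (intro mult_strict_right_mono) auto
  also have "\<dots> \<le> growth ^ Suc m - b" using assms(3) by (simp add: algebra_simps)
  finally show ?thesis using assms(1) by (simp add: pos_less_divide_eq)
qed

lemma piping_digraph_rank:
  assumes T: "piping r T"
  obtains h :: "'p set \<Rightarrow> nat"
  where "\<And>\<sigma> \<sigma>'. (\<sigma>, \<sigma>') \<in> piping_digraph r T \<Longrightarrow> h \<sigma> < h \<sigma>'" "\<And>\<sigma>. real (h \<sigma>) \<le> N"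
proof -
  have "T \<subseteq> Pow (Field r)" using piping_pipe[OF T] pipe_subset by blast
  then have N: "real (card T) \<le> N" by (rule card_pipings_le)
  obtain h :: "'p set \<Rightarrow> nat" where h: "\<And>\<sigma> \<sigma>'. (\<sigma>, \<sigma>') \<in> piping_digraph r T \<Longrightarrow> h \<sigma> < h \<sigma>'"
    "\<And>\<sigma>. h \<sigma> \<le> card T"
    by (rule acyclic_rank[OF piping_acyclic[OF T] piping_digraph_Times finite_pipings[OF T]]) (rule that)
  have "real (h \<sigma>) \<le> N" for \<sigma> using h(2)[of \<sigma>] N by (meson of_nat_le_iff order_trans)
  then show ?thesis using h(1) by (rule that[rotated])
qed

text \<open>
  The point is assembled from points for the children of \<open>\<tau>\<close>, spaced far apart according to a rank
  function of the digraph of the piping; the common spacing is then adjusted so that the spread of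
  \<open>\<tau>\<close> meets its threshold.
\<close>

lemma exact_point:
  assumes T: "full_piping T" and "\<tau> \<in> T"
  shows "\<exists>p :: 'p \<Rightarrow> real. (\<forall>\<sigma>\<in>T. \<sigma> \<subseteq> \<tau> \<longrightarrow> spread r \<sigma> p = threshold \<sigma>) \<and>
    (\<forall>\<sigma>. pipe r \<sigma> \<and> \<sigma> \<subseteq> \<tau> \<and> \<sigma> \<notin> T \<longrightarrow> threshold \<sigma> < spread r \<sigma> p)"
  using assms(2)
proof (induction "card \<tau>" arbitrary: \<tau> rule: less_induct)
  case less
  have piping: "piping r T" using T by (simp add: full_piping_def)
  have pipe: "pipe r \<tau>" using piping_pipe[OF piping less.prems] .
  note \<tau> = pipe_subset[OF pipe] pipe_finite[OF pipe] pipe_nonempty[OF pipe]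
  show ?case
  proof (cases "1 < card \<tau>")
    case False
    moreover have "card \<tau> \<noteq> 0" using \<tau>(2,3) by simp
    ultimately have "card \<tau> = 1" by simp
    then obtain x where x: "\<tau> = {x}" by (auto simp: card_1_singleton_iff)
    have "spread r \<tau> (\<lambda>_. 0 :: real) = threshold \<tau>" by (simp add: spread_def threshold_def x)
    moreover have "\<sigma> = \<tau>" if "pipe r \<sigma>" "\<sigma> \<subseteq> \<tau>" for \<sigma>
      using that(2) pipe_nonempty[OF that(1)] x by (simp add: subset_singleton_iff)
    ultimately show ?thesis
      using less.prems piping_pipe[OF piping] by (intro exI[of _ "\<lambda>_. 0"]) metis
  next
    case True
    obtain C where C: "\<And>i. i \<in> \<tau> \<Longrightarrow> C i \<in> T \<and> i \<in> C i \<and> C i \<subset> \<tau>"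
      and C_max: "\<And>i \<sigma>. i \<in> \<sigma> \<Longrightarrow> \<sigma> \<in> T \<Longrightarrow> \<sigma> \<subset> \<tau> \<Longrightarrow> \<sigma> \<subseteq> C i"
      and C_eq: "\<And>i j. i \<in> \<tau> \<Longrightarrow> j \<in> C i \<Longrightarrow> C j = C i"
      by (rule full_piping_children[OF T less.prems True]) (rule that)
    define m where "m = card \<tau> - 1"
    have m: "card \<tau> = Suc m" "1 \<le> m" using True by (simp_all add: m_def)
    have small: "card \<sigma> \<le> m" if "\<sigma> \<subset> \<tau>" for \<sigma>
      using psubset_card_mono[OF \<tau>(2) that] m(1) by simp
    have "\<forall>\<rho>\<in>C ` \<tau>. \<exists>p :: 'p \<Rightarrow> real. (\<forall>\<sigma>\<in>T. \<sigma> \<subseteq> \<rho> \<longrightarrow> spread r \<sigma> p = threshold \<sigma>) \<and>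
        (\<forall>\<sigma>. pipe r \<sigma> \<and> \<sigma> \<subseteq> \<rho> \<and> \<sigma> \<notin> T \<longrightarrow> threshold \<sigma> < spread r \<sigma> p)"
    proof
      fix \<rho> assume "\<rho> \<in> C ` \<tau>"
      then have "\<rho> \<in> T" "\<rho> \<subset> \<tau>" using C by auto
      then show "\<exists>p :: 'p \<Rightarrow> real. (\<forall>\<sigma>\<in>T. \<sigma> \<subseteq> \<rho> \<longrightarrow> spread r \<sigma> p = threshold \<sigma>) \<and>
        (\<forall>\<sigma>. pipe r \<sigma> \<and> \<sigma> \<subseteq> \<rho> \<and> \<sigma> \<notin> T \<longrightarrow> threshold \<sigma> < spread r \<sigma> p)"
        by (intro less.hyps psubset_card_mono[OF \<tau>(2)])
    qed
    from bchoice[OF this] obtain P :: "'p set \<Rightarrow> 'p \<Rightarrow> real" where P: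
      "\<forall>\<rho>\<in>C ` \<tau>. (\<forall>\<sigma>\<in>T. \<sigma> \<subseteq> \<rho> \<longrightarrow> spread r \<sigma> (P \<rho>) = threshold \<sigma>) \<and>
        (\<forall>\<sigma>. pipe r \<sigma> \<and> \<sigma> \<subseteq> \<rho> \<and> \<sigma> \<notin> T \<longrightarrow> threshold \<sigma> < spread r \<sigma> (P \<rho>))" ..
    have P_tight: "spread r \<sigma> (P (C i)) = threshold \<sigma>" if "i \<in> \<tau>" "\<sigma> \<in> T" "\<sigma> \<subseteq> C i" for i \<sigma>
      using P that by blast
    have P_loose: "threshold \<sigma> < spread r \<sigma> (P (C i))"
      if "i \<in> \<tau>" "pipe r \<sigma>" "\<sigma> \<notin> T" "\<sigma> \<subseteq> C i" for i \<sigma>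
      using P that by blast
    have P_ge: "threshold \<sigma> \<le> spread r \<sigma> (P (C i))" if "i \<in> \<tau>" "pipe r \<sigma>" "\<sigma> \<subseteq> C i" for i \<sigma>
      using P_tight[OF that(1) _ that(3)] P_loose[OF that(1,2) _ that(3)] by fastforce
    have C_pipe: "pipe r (C i)" if "i \<in> \<tau>" for i using piping_pipe[OF piping] C[OF that] by blast
    have P_mono: "P (C i) x < P (C i) y" if "i \<in> \<tau>" "x \<in> C i" "y \<in> C i" "prec r x y" for i x y
      using strictly_monotone_on_pipe[OF pipe_convex[OF C_pipe[OF that(1)]] P_ge[OF that(1)] that(2-4)] by blast
    let ?g = "growth ^ m"
    let ?D = "N ^ 2 * ?g"
    have D: "0 \<le> ?D" using growth_gt by simp
    have P_diam: "P (C i) x \<le> P (C i) y + ?D" if "i \<in> \<tau>" "x \<in> C i" "y \<in> C i" for i x y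
    proof (rule diameter_le[OF pipe_subset[OF C_pipe[OF that(1)]] pipe_cut_connected[OF C_pipe[OF that(1)]] _ _ _ that(2,3)])
      have "spread r (C i) (P (C i)) = threshold (C i)" using P_tight[OF that(1)] C[OF that(1)] by blast
      then show "spread r (C i) (P (C i)) \<le> ?g" using threshold_le[OF small] C[OF that(1)] by simp
    qed (use P_mono[OF that(1)] growth_gt in \<open>auto intro: less_imp_le\<close>)
    \<comment> \<open>The point of each child is normalized to vanish at a chosen element, so that
      the diameter bounds all its values on the child.\<close>
    define q where "q i = P (C i) i - P (C i) (SOME x. x \<in> C i)" for i
    have q: "\<bar>q i\<bar> \<le> ?D" if "i \<in> \<tau>" for i
    proof -
      have "i \<in> C i" using C[OF that] by blast
      then have "(SOME x. x \<in> C i) \<in> C i" by (rule someI)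
      then show ?thesis using P_diam[OF that \<open>i \<in> C i\<close>] P_diam[OF that _ \<open>i \<in> C i\<close>] by (force simp: q_def abs_le_iff)
    qed
    obtain h :: "'p set \<Rightarrow> nat" where h: "\<And>\<sigma> \<sigma>'. (\<sigma>, \<sigma>') \<in> piping_digraph r T \<Longrightarrow> h \<sigma> < h \<sigma>'"
      and h_le: "\<And>\<sigma>. real (h \<sigma>) \<le> N"
      by (rule piping_digraph_rank[OF piping]) (rule that)
    \<comment> \<open>Constant on each child, and larger by at least 1 along a relation between
      different children.\<close>
    define g where "g i = real (h (C i))" for i
    have gap: "g i + 1 \<le> g j" if ij: "i \<in> \<tau>" "j \<in> \<tau>" "prec r i j" "C i \<noteq> C j" for i j
    proof -
      have "C i \<inter> C j = {}" using C_eq[OF ij(1)] C_eq[OF ij(2)] ij(4) by blast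
      then have "(C i, C j) \<in> piping_digraph r T"
        unfolding piping_digraph_def using C[OF ij(1)] C[OF ij(2)] ij(3) by blast
      then have "h (C i) < h (C j)" by (rule h)
      then show ?thesis by (simp add: g_def)
    qed
    have g_mono: "g i \<le> g j" if "i \<in> \<tau>" "j \<in> \<tau>" "prec r i j" for i j
      using gap[OF that] by (cases "C i = C j") (auto simp: g_def)
    have crossing: "\<exists>x\<in>\<sigma>. \<exists>y\<in>\<sigma>. prec r x y \<and> C x \<noteq> C y"
      if \<sigma>: "pipe r \<sigma>" "\<sigma> \<subseteq> \<tau>" "\<And>i. i \<in> \<tau> \<Longrightarrow> \<not> \<sigma> \<subseteq> C i" for \<sigma>
    proof -
      obtain i where i: "i \<in> \<sigma>" using pipe_nonempty[OF \<sigma>(1)] by blast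
      then have "i \<in> \<tau>" "i \<in> C i" using \<sigma>(2) C by blast+
      then obtain x y where xy: "x \<in> \<sigma>" "x \<in> C i" "y \<in> \<sigma>" "y \<notin> C i" "comparable r x y"
        using cut_connected_crossing[OF pipe_cut_connected[OF \<sigma>(1)] i] \<sigma>(3) by metis
      have "y \<in> C y" using xy(3) \<sigma>(2) C by blast
      then have "C x \<noteq> C y" using C_eq[OF \<open>i \<in> \<tau>\<close> xy(2)] xy(4) by blast
      then show ?thesis using xy unfolding comparable_def by metis
    qed
    define a where "a = spread r \<tau> g"
    define b where "b = spread r \<tau> q"
    have "1 \<le> a"
    proof -
      obtain x y where xy: "x \<in> \<tau>" "y \<in> \<tau>" "prec r x y" "C x \<noteq> C y"
        using crossing[OF pipe order_refl] C by blast
      have "g y - g x \<le> a" unfolding a_def using g_mono \<tau>(1) xy by (intro le_spread)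
      then show ?thesis using gap[OF xy] by linarith
    qed
    moreover have "a \<le> N ^ 3"
    proof -
      have "g j - g i \<le> N" for i j using h_le[of "C j"] by (simp add: g_def)
      then have "a \<le> N ^ 2 * N" unfolding a_def using N_ge_1 \<tau>(1) by (intro spread_le) auto
      then show ?thesis by (simp add: eval_nat_numeral)
    qed
    moreover have "b \<le> 2 * N ^ 4 * ?g"
    proof -
      have "q j - q i \<le> 2 * ?D" if "i \<in> \<tau>" "j \<in> \<tau>" for i j
        using q[OF that(1)] q[OF that(2)] by linarith
      then have "b \<le> N ^ 2 * (2 * ?D)" unfolding b_def using D \<tau>(1) by (intro spread_le) auto
      then show ?thesis by (simp add: algebra_simps flip: power_add)
    qed
    ultimately have a: "0 < a" and s: "?g + 2 * ?D < (growth ^ Suc m - b) / a"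
      using threshold_step by simp_all
    \<comment> \<open>Solves \<open>s * a + b = threshold \<tau>\<close>, the equation for the
      tightness of \<open>\<tau>\<close> itself.\<close>
    define s where "s = (growth ^ Suc m - b) / a"
    define p where "p i = s * g i + q i" for i
    have s_gt: "?g + 2 * ?D < s" "0 < s"
      using s D growth_gt(1) unfolding s_def by (simp, smt (verit) zero_less_power)
    have far: "?g < p j - p i" if "i \<in> \<tau>" "j \<in> \<tau>" "prec r i j" "C i \<noteq> C j" for i j
    proof -
      have "s * 1 \<le> s * (g j - g i)" using gap[OF that] s_gt(2) by (intro mult_left_mono) auto
      then have "s \<le> s * g j - s * g i" by (simp add: algebra_simps)
      then show ?thesis using q[OF that(1)] q[OF that(2)] s_gt(1) unfolding p_def by linarith
    qed
    \<comment> \<open>On a child, \<open>p\<close> is a translate of the point of that child, so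
      spreads inside the child are inherited.\<close>
    have p_child: "spread r \<sigma> p = spread r \<sigma> (P (C i))" if "i \<in> \<tau>" "\<sigma> \<subseteq> C i" for i \<sigma>
    proof (rule spread_cong_shift)
      fix x assume "x \<in> \<sigma>"
      then have "C x = C i" using that C_eq by blast
      then show "p x = P (C i) x + (s * g i - P (C i) (SOME x. x \<in> C i))" by (simp add: p_def q_def g_def)
    qed
    have p_mono: "p i \<le> p j" if "i \<in> \<tau>" "j \<in> \<tau>" "prec r i j" for i j
    proof (cases "C i = C j")
      case True
      then have "P (C i) i < P (C i) j" using P_mono[OF that(1) _ _ that(3)] C that by metis
      then show ?thesis using True by (simp add: p_def q_def g_def)
    next
      case False
      then show ?thesis using far[OF that False] growth_gt(1) by (smt (verit) zero_less_power)
    qed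
    have "spread r \<tau> p = s * a + b"
      unfolding p_def a_def b_def by (simp add: spread_add spread_scale)
    also have "\<dots> = threshold \<tau>" using a m by (simp add: s_def threshold_def)
    finally have tight: "spread r \<tau> p = threshold \<tau>" .
    show ?thesis
    proof (intro exI[of _ p] conjI ballI allI impI)
      fix \<sigma> assume \<sigma>: "\<sigma> \<in> T" "\<sigma> \<subseteq> \<tau>"
      show "spread r \<sigma> p = threshold \<sigma>"
      proof (cases "\<sigma> = \<tau>")
        case False
        obtain i where "i \<in> \<sigma>" using piping_pipe[OF piping \<sigma>(1)] pipe_nonempty by blast
        then have "i \<in> \<tau>" "\<sigma> \<subseteq> C i" using \<sigma> False C_max by blast+
        then show ?thesis using p_child P_tight \<sigma>(1) by simp
      qed (use tight in simp)
    next
      fix \<sigma> assume \<sigma>: "pipe r \<sigma> \<and> \<sigma> \<subseteq> \<tau> \<and> \<sigma> \<notin> T"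
      show "threshold \<sigma> < spread r \<sigma> p"
      proof (cases "\<exists>i\<in>\<tau>. \<sigma> \<subseteq> C i")
        case True
        then show ?thesis using p_child P_loose \<sigma> by fastforce
      next
        case False
        then obtain x y where xy: "x \<in> \<sigma>" "y \<in> \<sigma>" "prec r x y" "C x \<noteq> C y"
          using crossing \<sigma> by blast
        \<comment> \<open>A single pair in different children already exceeds the threshold of
          \<open>\<sigma>\<close>, which has fewer elements than \<open>\<tau>\<close>.\<close>
        have "\<sigma> \<subset> \<tau>" using \<sigma> less.prems by blast
        then have "threshold \<sigma> \<le> ?g" by (intro threshold_le small)
        also have "?g < p y - p x" using far xy \<sigma> by blast
        also have "p y - p x \<le> spread r \<sigma> p"
          using \<sigma> p_mono xy \<tau>(1) by (intro le_spread) blast+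
        finally show ?thesis .
      qed
    qed
  qed
qed

text \<open>The piping is completed by the singletons, which are tight anyway, and by the whole
  poset, whose tightness is the equation defining the affine space.\<close>

lemma exact_point_proper_piping:
  assumes conn: "pipe r (Field r)" and T: "T \<in> proper_pipings r"
  obtains p :: "'p \<Rightarrow> real" where "spread r (Field r) p = threshold (Field r)"
    "\<And>\<sigma>. \<sigma> \<in> T \<Longrightarrow> spread r \<sigma> p = threshold \<sigma>"
    "\<And>\<sigma>. \<sigma> \<in> proper_pipes r \<Longrightarrow> \<sigma> \<notin> T \<Longrightarrow> threshold \<sigma> < spread r \<sigma> p"
proof -
  let ?T = "insert (Field r) (T \<union> (\<lambda>x. {x}) ` Field r)"
  have "full_piping ?T" using T conn by (intro full_piping_completion) (auto simp: proper_pipings_def)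
  then obtain p :: "'p \<Rightarrow> real" where p: "\<forall>\<sigma>\<in>?T. \<sigma> \<subseteq> Field r \<longrightarrow> spread r \<sigma> p = threshold \<sigma>"
    "\<forall>\<sigma>. pipe r \<sigma> \<and> \<sigma> \<subseteq> Field r \<and> \<sigma> \<notin> ?T \<longrightarrow> threshold \<sigma> < spread r \<sigma> p"
    using exact_point[of ?T "Field r"] by blast
  have "T \<subseteq> proper_pipes r" using T by (simp add: proper_pipings_def)
  then have 2: "\<sigma> \<subseteq> Field r" if "\<sigma> \<in> T" for \<sigma>
    using that by (auto simp: proper_pipes_def dest: pipe_subset)
  have 3: "pipe r \<sigma> \<and> \<sigma> \<subseteq> Field r \<and> \<sigma> \<notin> ?T" if "\<sigma> \<in> proper_pipes r" "\<sigma> \<notin> T" for \<sigma>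
    using that pipe_subset by (auto simp: proper_pipes_def)
  show ?thesis by (rule that[of p]) (use p 2 3 in auto)
qed

end

section \<open>Existence of poset associahedra\<close>

context finite_poset
begin

text \<open>A minimal element \<open>m\<close> can only be the lower end of a comparable pair, so
  the spread is affine in the value at \<open>m\<close>, with minus the number of these pairs as
  slope. The spread equation can therefore be solved for that value.\<close>

lemma spread_change_minimal:
  fixes p q :: "'p \<Rightarrow> 'b::real_vector"
  assumes "\<And>i. i \<in> \<tau> \<Longrightarrow> i \<noteq> m \<Longrightarrow> p i = q i" and "\<And>i. \<not> prec r i m" and \<tau>: "\<tau> \<subseteq> Field r"
  shows "spread r \<tau> p = spread r \<tau> q -
    real (card {e \<in> comparable_pairs r \<tau>. fst e = m}) *\<^sub>R (p m - q m)"
proof -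
  let ?E = "comparable_pairs r \<tau>"
  have "spread r \<tau> p - spread r \<tau> q = (\<Sum>e\<in>?E. if fst e = m then - (p m - q m) else 0)"
    unfolding spread_def sum_subtractf[symmetric]
  proof (rule sum.cong[OF refl])
    fix e assume "e \<in> ?E"
    then obtain i j where e: "e = (i, j)" "i \<in> \<tau>" "j \<in> \<tau>" "prec r i j" by (auto simp: comparable_pairs_def)
    then have "j \<noteq> m" using assms(2) by blast
    then show "(case e of (i, j) \<Rightarrow> p j - p i) - (case e of (i, j) \<Rightarrow> q j - q i) =
        (if fst e = m then - (p m - q m) else 0)"
      using assms(1) e by auto
  qed
  also have "\<dots> = (\<Sum>e\<in>{e \<in> ?E. fst e = m}. - (p m - q m))"
    by (rule sum.inter_filter[OF finite_comparable_pairs[OF \<tau>], symmetric])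
  also have "\<dots> = - (real (card {e \<in> ?E. fst e = m}) *\<^sub>R (p m - q m))"
    by (simp add: sum_constant_scaleR scaleR_diff_right)
  finally show ?thesis by (simp add: algebra_simps)
qed

text \<open>Functions modulo constants with prescribed spread of the whole poset form an affine
  space of dimension two less than the poset. Two values are given up: the one at \<open>y\<close>
  fixes the additive constant, the one at a minimal element \<open>m\<close> is determined by the
  spread equation. The remaining elements, forming \<open>J\<close>, get distinct basis vectors, and
  \<open>b i\<close> is the gradient of the value at \<open>i\<close>.\<close>

lemma realization_coordinates:
  assumes conn: "cut_connected r (Field r)" and card: "2 \<le> card (Field r)" "card (Field r) \<le> DIM('a) + 2"
  obtains b :: "'p \<Rightarrow> 'a::euclidean_space" and S J i0 where
    "spread r (Field r) b = 0" "J \<subseteq> Field r" "i0 \<in> Field r"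
    "b ` J \<subseteq> Basis" "S = span (b ` J)" "dim S = card (Field r) - 2" "\<And>i. i \<in> Field r \<Longrightarrow> b i \<in> S"
    "\<And>p0 q :: 'p \<Rightarrow> real. spread r (Field r) p0 = spread r (Field r) q \<Longrightarrow>
       \<exists>x\<in>S. \<exists>k. \<forall>i\<in>Field r. p0 i + x \<bullet> b i = q i + k"
    "b i0 = 0"
proof -
  let ?F = "Field r"
  have ne: "?F \<noteq> {}" using card(1) by auto
  obtain m where m: "m \<in> ?F" "\<And>i. \<not> prec r i m"
  proof -
    have E: "{(i, j). prec r i j} \<subseteq> ?F \<times> ?F" by (auto dest: prec_Field)
    have "trans {(i, j). prec r i j}" unfolding trans_def using prec_trans by blast
    then have "acyclic {(i, j). prec r i j}" using prec_irrefl by (simp add: acyclic_def trancl_id)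
    then obtain h :: "'p \<Rightarrow> nat" where h: "\<And>i j. (i, j) \<in> {(i, j). prec r i j} \<Longrightarrow> h i < h j"
      by (rule acyclic_rank[OF _ E finite_Field]) (rule that)
    define m where "m = arg_min_on h ?F"
    have m: "m \<in> ?F" "\<not> (\<exists>y\<in>?F. h y < h m)"
      unfolding m_def by (rule arg_min_if_finite[OF finite_Field ne])+
    have "\<not> prec r i m" for i using h[of i m] m(2) prec_Field[of r i m] by auto
    then show thesis using m(1) by (rule that[rotated])
  qed
  \<comment> \<open>An element above \<open>m\<close> makes the coefficient \<open>k\<close> of the
    value at \<open>m\<close> nonzero.\<close>
  obtain y where y: "y \<in> ?F" "prec r m y"
  proof -
    have "\<not> ?F \<subseteq> {m}" using card(1) card_mono[of "{m}" ?F] by auto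
    then obtain x y where "x \<in> {m}" "y \<in> ?F" "comparable r x y"
      by (rule cut_connected_crossing[OF conn m(1) singletonI]) (rule that)
    then have "prec r m y" using m(2) by (simp add: comparable_def)
    then show thesis using \<open>y \<in> ?F\<close> by (rule that[rotated])
  qed
  define k where "k = real (card {e \<in> comparable_pairs r ?F. fst e = m})"
  have k: "k > 0"
  proof -
    have "(m, y) \<in> {e \<in> comparable_pairs r ?F. fst e = m}" using y m(1) by (simp add: comparable_pairs_def)
    then show ?thesis unfolding k_def using finite_comparable_pairs[of ?F] by (auto simp: card_gt_0_iff)
  qed
  have y_m: "y \<noteq> m" using y m(2) by blast
  define J where "J = ?F - {y, m}"
  have J: "finite J" "card J = card ?F - 2" using finite_Field y(1) m(1) y_m by (simp_all add: J_def card_Diff_subset)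
  then have "card J \<le> card (Basis :: 'a set)" using card(2) by simp
  then obtain e where e: "e ` J \<subseteq> (Basis :: 'a set)" "inj_on e J"
    using card_le_inj[OF J(1) finite_Basis] by blast
  define b0 where "b0 i = (if i \<in> J then e i else 0)" for i
  \<comment> \<open>The vector at \<open>m\<close> is chosen to make the spread of \<open>b\<close>
    vanish, so that moving along \<open>S\<close> preserves the spread equation.\<close>
  define b where "b = b0(m := (1 / k) *\<^sub>R spread r ?F b0)"
  have bJ: "b i = e i" if "i \<in> J" for i using that by (auto simp: b_def b0_def J_def)
  have b_y: "b y = 0" using y_m by (simp add: b_def b0_def J_def)
  define S where "S = span (b ` J)"
  have eq: "b ` J = e ` J" using bJ by auto
  have spread0: "spread r ?F b = 0"
  proof -
    have "spread r ?F b = spread r ?F b0 - k *\<^sub>R (b m - b0 m)"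
      unfolding k_def by (rule spread_change_minimal) (use m in \<open>auto simp: b_def\<close>)
    then show ?thesis using k by (simp add: b_def b0_def J_def)
  qed
  have b0S: "b0 i \<in> S" for i by (auto simp: b0_def S_def span_zero eq intro: span_base)
  have "spread r ?F b0 \<in> S"
    unfolding spread_def S_def
    by (intro span_sum) (auto simp: case_prod_unfold intro!: span_diff b0S[unfolded S_def])
  then have bS: "b i \<in> S" for i using b0S by (auto simp: b_def S_def span_mul)
  have dim: "dim S = card ?F - 2"
  proof -
    have "independent (e ` J)" using e(1) independent_Basis independent_mono by blast
    then show ?thesis unfolding S_def eq using e(2) J by (simp add: dim_eq_card_independent card_image)
  qed
  have surj: "\<exists>x\<in>S. \<exists>c. \<forall>i\<in>?F. p0 i + x \<bullet> b i = q i + c"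
    if spread: "spread r ?F p0 = spread r ?F q" for p0 q :: "'p \<Rightarrow> real"
  proof -
    define c where "c = p0 y - q y"
    define x where "x = (\<Sum>i\<in>J. (q i + c - p0 i) *\<^sub>R e i)"
    define p where "p i = p0 i + x \<bullet> b i" for i
    have "x \<in> S" unfolding x_def S_def eq by (intro span_sum span_mul span_base imageI)
    have xe: "x \<bullet> e j = q j + c - p0 j" if j: "j \<in> J" for j
    proof -
      have "e i \<bullet> e j = (if i = j then 1 else 0)" if "i \<in> J" for i
      proof -
        have "e i \<in> Basis" "e j \<in> Basis" using e(1) j that by blast+
        moreover have "e i = e j \<longleftrightarrow> i = j" using inj_on_eq_iff[OF e(2) that j] .
        ultimately show ?thesis by (simp add: inner_Basis)
      qed
      then have "x \<bullet> e j = (\<Sum>i\<in>J. if i = j then q i + c - p0 i else 0)"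
        unfolding x_def inner_sum_left by (intro sum.cong) auto
      then show ?thesis using j J(1) by simp
    qed
    have off: "p i = q i + c" if "i \<in> ?F" "i \<noteq> m" for i
    proof (cases "i = y")
      case False
      then have "i \<in> J" using that by (simp add: J_def)
      then show ?thesis using xe bJ by (simp add: p_def)
    qed (simp add: p_def b_y c_def)
    have "spread r ?F p = spread r ?F p0"
      unfolding p_def using spread0 by (simp add: spread_add spread_inner)
    moreover have "spread r ?F (\<lambda>i. q i + c) = spread r ?F q" by (rule spread_cong_shift) simp
    moreover have "spread r ?F p = spread r ?F (\<lambda>i. q i + c) - k *\<^sub>R (p m - (q m + c))"
      unfolding k_def by (rule spread_change_minimal) (use off m in auto)
    \<comment> \<open>Both sides agree off \<open>m\<close> and have equal spread, so they agree at
      \<open>m\<close> as well because \<open>k\<close> is nonzero.\<close>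
    ultimately have "p m = q m + c" using k spread by simp
    then have "\<forall>i\<in>?F. p0 i + x \<bullet> b i = q i + c" using off by (metis p_def)
    then show ?thesis using \<open>x \<in> S\<close> by blast
  qed
  show ?thesis
    by (rule that[of b J y S]) (use spread0 y(1) eq e(1) dim bS surj b_y in \<open>auto simp: S_def J_def\<close>)
qed

text \<open>The origin is placed at a point \<open>p0\<close> realizing the empty piping, where all
  inequalities are strict; dividing each by its slack there makes the right-hand sides 1.\<close>

lemma realization_system:
  assumes conn: "cut_connected r (Field r)" and card: "2 \<le> card (Field r)" "card (Field r) \<le> DIM('a) + 2"
  obtains S and v :: "'p set \<Rightarrow> 'a::euclidean_space"
  where "simple_system S (proper_pipes r) v (proper_pipings r)" "dim S = card (Field r) - 2"
proof -
  let ?F = "Field r"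
  let ?I = "proper_pipes r"
  obtain b :: "'p \<Rightarrow> 'a" and S J i0 where b0: "spread r ?F b = 0" and J: "J \<subseteq> ?F" and i0: "i0 \<in> ?F" "b i0 = 0"
    and basis: "b ` J \<subseteq> Basis" and S: "S = span (b ` J)" "dim S = card ?F - 2"
    and bS: "\<And>i. i \<in> ?F \<Longrightarrow> b i \<in> S"
    and surj: "\<And>p0 q :: 'p \<Rightarrow> real. spread r ?F p0 = spread r ?F q \<Longrightarrow>
       \<exists>x\<in>S. \<exists>k. \<forall>i\<in>?F. p0 i + x \<bullet> b i = q i + k"
    by (rule realization_coordinates[OF assms]) (rule that; assumption)
  have pipe_F: "pipe r ?F" using conn i0 poset_convex_Field by (auto simp: pipe_iff)
  have empty: "{} \<in> proper_pipings r"
    by (simp add: proper_pipings_def piping_def piping_digraph_def acyclic_def)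
  obtain p0 :: "'p \<Rightarrow> real" where p0: "spread r ?F p0 = threshold ?F"
    "\<And>\<sigma>. \<sigma> \<in> ?I \<Longrightarrow> threshold \<sigma> < spread r \<sigma> p0"
    by (rule exact_point_proper_piping[OF pipe_F empty]) (rule that; blast)
  define slack where "slack \<tau> = spread r \<tau> p0 - threshold \<tau>" for \<tau>
  have slack: "slack \<tau> > 0" if "\<tau> \<in> ?I" for \<tau> using p0(2)[OF that] by (simp add: slack_def)
  \<comment> \<open>Negated because spreads are bounded from below while the system has upper
    bounds.\<close>
  define v where "v \<tau> = - (1 / slack \<tau>) *\<^sub>R spread r \<tau> b" for \<tau>
  define p where "p x i = p0 i + x \<bullet> b i" for x i
  have spread_p: "spread r \<tau> (p x) = spread r \<tau> p0 + x \<bullet> spread r \<tau> b" for \<tau> x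
    unfolding p_def by (simp add: spread_add spread_inner)
  have v_le: "v \<tau> \<bullet> x \<le> 1 \<longleftrightarrow> threshold \<tau> \<le> spread r \<tau> (p x)"
    and v_eq: "v \<tau> \<bullet> x = 1 \<longleftrightarrow> spread r \<tau> (p x) = threshold \<tau>" if "\<tau> \<in> ?I" for \<tau> x
    using slack[OF that] unfolding spread_p v_def slack_def
    by (auto simp: divide_simps inner_commute)
  let ?A = "{x \<in> S. \<forall>\<tau>\<in>?I. v \<tau> \<bullet> x \<le> 1}"
  have feasible: "threshold \<sigma> \<le> spread r \<sigma> (p x)" if x: "x \<in> ?A" and \<sigma>: "pipe r \<sigma>" for x \<sigma>
  proof -
    have "finite \<sigma>" "\<sigma> \<noteq> {}" using \<sigma> pipe_finite pipe_nonempty by blast+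
    then have "card \<sigma> \<noteq> 0" by simp
    moreover have "card \<sigma> = card ?F \<Longrightarrow> \<sigma> = ?F" "card \<sigma> \<le> card ?F"
      using card_subset_eq[OF finite_Field] card_mono[OF finite_Field] pipe_subset[OF \<sigma>] by blast+
    ultimately consider "card \<sigma> = 1" | "\<sigma> = ?F" | "1 < card \<sigma>" "card \<sigma> < card ?F" by linarith
    then show ?thesis
    proof cases
      case 1
      then obtain y where "\<sigma> = {y}" by (auto simp: card_1_singleton_iff)
      then have "comparable_pairs r \<sigma> = {}" using prec_irrefl by (auto simp: comparable_pairs_def)
      then show ?thesis using 1 by (simp add: spread_def threshold_def)
    next
      case 2
      then show ?thesis using spread_p p0(1) b0 by simp
    next
      case 3
      then have "\<sigma> \<in> ?I" using \<sigma> by (simp add: proper_pipes_def)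
      then show ?thesis using x v_le by blast
    qed
  qed
  have "simple_system S ?I v (proper_pipings r)"
  proof
    show "subspace S" by (simp add: S)
    show "finite ?I" by (rule finite_proper_pipes)
    show "v \<tau> \<in> S" if "\<tau> \<in> ?I" for \<tau>
    proof -
      have "\<tau> \<subseteq> ?F" using that pipe_subset by (auto simp: proper_pipes_def)
      then have "spread r \<tau> b \<in> S"
        unfolding spread_def using bS \<open>subspace S\<close>
        by (intro subspace_sum) (auto simp: comparable_pairs_def intro!: subspace_diff)
      then show ?thesis using \<open>subspace S\<close> by (simp add: v_def subspace_scale subspace_neg)
    qed
    show "bounded ?A"
    proof -
      define B where "B = N ^ 2 * threshold ?F + (\<Sum>i\<in>?F. \<bar>p0 i - p0 i0\<bar>)"
      \<comment> \<open>The spread of the whole poset is fixed, so \<open>diameter_le\<close> bounds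
        all differences of values; comparison with \<open>i0\<close>, where \<open>b\<close>
        vanishes, bounds the coordinates themselves.\<close>
      have coord: "\<bar>x \<bullet> b i\<bar> \<le> B" if x: "x \<in> ?A" and i: "i \<in> J" for x i
      proof -
        have mono: "p x i \<le> p x j" if "prec r i j" for i j
          using strictly_monotone_on_pipe[OF poset_convex_Field feasible[OF x] _ _ that] prec_Field[OF that]
          by fastforce
        have "spread r ?F (p x) \<le> threshold ?F" using spread_p p0(1) b0 by simp
        then have d: "p x j \<le> p x l + N ^ 2 * threshold ?F" if "j \<in> ?F" "l \<in> ?F" for j l
          using mono that conn threshold_ge_0 by (intro diameter_le) auto
        have "i \<in> ?F" using i J by blast
        then have "\<bar>p0 i - p0 i0\<bar> \<le> (\<Sum>i\<in>?F. \<bar>p0 i - p0 i0\<bar>)"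
          using finite_Field by (intro member_le_sum) auto
        moreover have "\<bar>p x i - p x i0\<bar> \<le> N ^ 2 * threshold ?F"
          using d[OF \<open>i \<in> ?F\<close> i0(1)] d[OF i0(1) \<open>i \<in> ?F\<close>] by (simp add: abs_le_iff)
        ultimately show ?thesis unfolding B_def p_def using i0(2) by (simp add: abs_le_iff)
      qed
      have "norm x \<le> real DIM('a) * max B 0" if x: "x \<in> ?A" for x
      proof -
        have "\<bar>x \<bullet> d\<bar> \<le> max B 0" if d: "d \<in> Basis" for d
        proof (cases "d \<in> b ` J")
          case False
          have "b ` J \<subseteq> {z. d \<bullet> z = 0}"
          proof
            fix z assume "z \<in> b ` J"
            then have "z \<in> Basis" "d \<noteq> z" using basis False by blast+
            then show "z \<in> {z. d \<bullet> z = 0}" using inner_not_same_Basis[OF d] by simp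
          qed
          then have "S \<subseteq> {z. d \<bullet> z = 0}" unfolding S by (intro span_minimal subspace_hyperplane)
          then have "d \<bullet> x = 0" using x by blast
          then show ?thesis by (simp add: inner_commute)
        qed (use coord[OF x] in fastforce)
        then have "(\<Sum>d\<in>Basis. \<bar>x \<bullet> d\<bar>) \<le> real DIM('a) * max B 0" by (rule sum_bounded_above)
        then show ?thesis using norm_le_l1[of x] by linarith
      qed
      then show ?thesis unfolding bounded_iff by blast
    qed
    show "proper_pipings r = (\<lambda>x. {\<tau> \<in> ?I. v \<tau> \<bullet> x = 1}) ` ?A"
    proof (intro equalityI subsetI)
      fix T assume T: "T \<in> proper_pipings r"
      then have TI: "T \<subseteq> ?I" by (simp add: proper_pipings_def)
      obtain q :: "'p \<Rightarrow> real" where q: "spread r ?F q = threshold ?F"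
        "\<And>\<sigma>. \<sigma> \<in> T \<Longrightarrow> spread r \<sigma> q = threshold \<sigma>"
        "\<And>\<sigma>. \<sigma> \<in> ?I \<Longrightarrow> \<sigma> \<notin> T \<Longrightarrow> threshold \<sigma> < spread r \<sigma> q"
        by (rule exact_point_proper_piping[OF pipe_F T]) (rule that; assumption)
      \<comment> \<open>The point built for \<open>T\<close> is reached by some \<open>x\<close> up
        to an additive constant, which spreads do not see.\<close>
      obtain x k where x: "x \<in> S" "\<forall>i\<in>?F. p x i = q i + k"
        using surj[of p0 q] p0(1) q(1) unfolding p_def by auto
      have "spread r \<tau> (p x) = spread r \<tau> q" if "\<tau> \<in> ?I" for \<tau>
        using x(2) that pipe_subset by (intro spread_cong_shift) (auto simp: proper_pipes_def)
      then have "x \<in> ?A" "T = {\<tau> \<in> ?I. v \<tau> \<bullet> x = 1}"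
        using x(1) q(2,3) TI v_le v_eq by (fastforce, force)
      then show "T \<in> (\<lambda>x. {\<tau> \<in> ?I. v \<tau> \<bullet> x = 1}) ` ?A" by blast
    next
      fix T assume "T \<in> (\<lambda>x. {\<tau> \<in> ?I. v \<tau> \<bullet> x = 1}) ` ?A"
      then obtain x where x: "x \<in> ?A" "T = {\<tau> \<in> ?I. v \<tau> \<bullet> x = 1}" by blast
      then have "pipe r \<sigma> \<and> 1 < card \<sigma> \<and> spread r \<sigma> (p x) = threshold \<sigma>" if "\<sigma> \<in> T" for \<sigma>
        using that v_eq by (auto simp: proper_pipes_def)
      then have "piping r T" by (intro piping_of_tight_pipes[of "p x"] feasible[OF x(1)])
      then show "T \<in> proper_pipings r" using x(2) by (auto simp: proper_pipings_def)
    qed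
    show "T' \<in> proper_pipings r" if "T \<in> proper_pipings r" "T' \<subseteq> T" for T T'
      using proper_pipings_subset that .
    show "{\<tau>} \<in> proper_pipings r" if "\<tau> \<in> ?I" for \<tau> by (rule singleton_proper_piping[OF that])
  qed
  then show ?thesis by (rule that) (rule S(2))
qed

end

theorem poset_associahedron_exists:
  fixes r :: "'p rel"
  assumes "finite_connected_poset r" "2 \<le> card (Field r)" "card (Field r) \<le> DIM('a) + 2"
  shows "\<exists>(A :: 'a::euclidean_space set) f. poset_associahedron r A f"
proof -
  interpret finite_poset r using assms(1) by (rule finite_poset_if_connected)
  have "cut_connected r (Field r)" using assms(1) by (simp add: finite_connected_poset_iff)
  then obtain S and v :: "'p set \<Rightarrow> 'a" where
    sys: "simple_system S (proper_pipes r) v (proper_pipings r)" and dim: "dim S = card (Field r) - 2"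
    by (rule realization_system[OF _ assms(2,3)]) (rule that; assumption)
  interpret simple_system S "proper_pipes r" v "proper_pipings r" by (rule sys)
  have "poset_associahedron_dual r dual v"
    unfolding poset_associahedron_dual_def
    using simplicial_polytope_dual aff_dim_dual rel_interior_dual simplicial_iso_dual dim assms(2) by simp
  then show ?thesis unfolding poset_associahedron_def by blast
qed

section \<open>The faces of a poset associahedron\<close>

text \<open>Applies to every realization, with the vertices \<open>f \<tau>\<close> of the dual as
  normals; from here on the concrete construction matters only for existence.\<close>

lemma poset_associahedron_system:
  fixes A :: "'a::euclidean_space set"
  assumes "finite_connected_poset r" "poset_associahedron r A f"
  obtains S where "simple_system S (proper_pipes r) f (proper_pipings r)"
    "int (dim S) = int (card (Field r)) - 2"
    "A = inequality_system.sol S (proper_pipes r) f (\<lambda>_. 1)"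
proof -
  interpret finite_poset r using assms(1) by (rule finite_poset_if_connected)
  obtain D where D: "simplicial_polytope D" "aff_dim D = int (card (Field r)) - 2" "0 \<in> rel_interior D"
    "simplicial_iso f (proper_pipings r) (boundary_complex D)" "A = polar_dual D"
    using assms(2) unfolding poset_associahedron_def poset_associahedron_dual_def by blast
  have fin: "finite (\<Union>(proper_pipings r))" by (simp add: Union_proper_pipings finite_proper_pipes)
  have sys: "simple_system (span D) (proper_pipes r) f (proper_pipings r)"
    using simple_system_of_simplicial_polytope(1)[OF D(1,3,4) _ fin] proper_pipings_subset
    unfolding Union_proper_pipings by metis
  have A: "A = {y \<in> span D. \<forall>\<tau>\<in>proper_pipes r. f \<tau> \<bullet> y \<le> 1}"
    using simple_system_of_simplicial_polytope(2)[OF D(1,3,4) _ fin] proper_pipings_subset D(5)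
    unfolding Union_proper_pipings by metis
  interpret simple_system "span D" "proper_pipes r" f "proper_pipings r" by (rule sys)
  have "0 \<in> D" using D(3) rel_interior_subset[of D] by auto
  then have "affine hull D = span D" by (simp add: affine_hull_span_0 hull_inc)
  then have "aff_dim D = aff_dim (span D)" by (metis aff_dim_affine_hull)
  then have "aff_dim D = int (dim (span D))" using aff_dim_subspace[OF subspace_span] by simp
  then show ?thesis
    using that[of "span D"] D(2) sys A by (simp add: sol_def)
qed

text \<open>Translates the facts on simple systems into the vocabulary of pipings;
  \<open>dual_face_sol\<close> identifies \<open>piping_face\<close> with
  \<open>tight_face\<close>.\<close>

lemma poset_associahedron_piping_face:
  fixes A :: "'a::euclidean_space set"
  assumes "finite_connected_poset r" "poset_associahedron r A f"
  shows "polytope A" "aff_dim A = int (card (Field r)) - 2" "simple_polytope A"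
    and "bij_betw (piping_face A f) (proper_pipings r) (nonempty_faces A)"
    and "\<And>T T'. T \<in> proper_pipings r \<Longrightarrow> T' \<in> proper_pipings r \<Longrightarrow>
      piping_face A f T \<subseteq> piping_face A f T' \<longleftrightarrow> T' \<subseteq> T"
    and "\<And>T. T \<in> proper_pipings r \<Longrightarrow>
      aff_dim (piping_face A f T) = int (card (Field r)) - int (card T) - 2"
    and "bij_betw (piping_face A f) {T \<in> proper_pipings r. card T = card (Field r) - 2}
      {{x} |x. x extreme_point_of A}"
    and "bij_betw (\<lambda>\<tau>. piping_face A f {\<tau>}) (proper_pipes r) {F. F facet_of A}"
    and "simplicial_polytope (polar_dual A)"
    and "boundary_complex (polar_dual A) = (\<lambda>T. f ` T) ` proper_pipings r"
    and "inj_on f (proper_pipes r)"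
    and "piping_face A f {} = A"
proof -
  obtain S where sys: "simple_system S (proper_pipes r) f (proper_pipings r)"
    and dim: "int (dim S) = int (card (Field r)) - 2"
    and A: "A = inequality_system.sol S (proper_pipes r) f (\<lambda>_. 1)"
    by (rule poset_associahedron_system[OF assms]) (rule that; assumption)
  interpret simple_system S "proper_pipes r" f "proper_pipings r" by (rule sys)
  have face: "piping_face A f = tight_face"
    unfolding piping_face_def A by (rule ext) (rule dual_face_sol)
  have dim': "dim S = card (Field r) - 2" using dim by simp
  show "polytope A" unfolding A by (rule polytope_sol[OF bounded_sol])
  show "aff_dim A = int (card (Field r)) - 2" unfolding A using aff_dim_sol dim by simp
  show "simple_polytope A" unfolding A by (rule simple_polytope_sol)
  show "bij_betw (piping_face A f) (proper_pipings r) (nonempty_faces A)"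
    unfolding face nonempty_faces_def unfolding A by (rule bij_betw_tight_face_K)
  show "piping_face A f T \<subseteq> piping_face A f T' \<longleftrightarrow> T' \<subseteq> T"
    if "T \<in> proper_pipings r" "T' \<in> proper_pipings r" for T T'
    unfolding face by (rule tight_face_subset_iff_K[OF that])
  show "aff_dim (piping_face A f T) = int (card (Field r)) - int (card T) - 2"
    if "T \<in> proper_pipings r" for T
    unfolding face using aff_dim_tight_face[OF that] dim by simp
  show "bij_betw (piping_face A f) {T \<in> proper_pipings r. card T = card (Field r) - 2}
      {{x} |x. x extreme_point_of A}"
    using bij_betw_tight_face_vertices unfolding face dim' unfolding A .
  show "bij_betw (\<lambda>\<tau>. piping_face A f {\<tau>}) (proper_pipes r) {F. F facet_of A}"
    using bij_betw_tight_face_facets unfolding face unfolding A .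
  show "simplicial_polytope (polar_dual A)"
    unfolding A polar_dual_sol by (rule simplicial_polytope_dual)
  show "boundary_complex (polar_dual A) = (\<lambda>T. f ` T) ` proper_pipings r"
    unfolding A polar_dual_sol by (rule boundary_complex_dual)
  show "inj_on f (proper_pipes r)" by (rule inj_v)
  show "piping_face A f {} = A" unfolding face by (simp add: tight_face_empty A)
qed

section \<open>Restriction and contraction of a pipe\<close>

text \<open>The block \<open>\<tau>\<close> of the quotient poset is represented by one of its elements \<open>t\<close>.\<close>

definition contract :: "'p rel \<Rightarrow> 'p set \<Rightarrow> 'p \<Rightarrow> 'p rel" where
  "contract r \<tau> t = {(i, j). i \<in> insert t (Field r - \<tau>) \<and> j \<in> insert t (Field r - \<tau>) \<and>
     ((i, j) \<in> r \<or> (\<exists>a\<in>\<tau>. (i, a) \<in> r) \<and> (\<exists>b\<in>\<tau>. (b, j) \<in> r))}"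

locale poset_pipe = finite_poset r for r :: "'p rel" +
  fixes \<tau> :: "'p set" and t :: 'p
  assumes pipe_\<tau>: "pipe r \<tau>" and t_in: "t \<in> \<tau>"
begin

lemma \<tau>_Field: "\<tau> \<subseteq> Field r"
  by (rule pipe_subset[OF pipe_\<tau>])

lemma rel_refl: "i \<in> Field r \<Longrightarrow> (i, i) \<in> r"
  using partial_order by (auto simp: partial_order_on_def preorder_on_def refl_on_def)

lemma rel_trans: "(i, j) \<in> r \<Longrightarrow> (j, k) \<in> r \<Longrightarrow> (i, k) \<in> r"
  using partial_order by (auto simp: partial_order_on_def preorder_on_def elim: transE)

lemma rel_antisym: "(i, j) \<in> r \<Longrightarrow> (j, i) \<in> r \<Longrightarrow> i = j"
  using partial_order by (auto simp: partial_order_on_def dest: antisymD)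

lemma rel_Field: "(i, j) \<in> r \<Longrightarrow> i \<in> Field r \<and> j \<in> Field r"
  by (auto simp: Field_def)

lemma prec_iff: "prec r i j \<longleftrightarrow> (i, j) \<in> r \<and> i \<noteq> j"
  by (simp add: prec_def)

lemma between_\<tau>:
  assumes "(i, a) \<in> r" "a \<in> \<tau>" "(b, i) \<in> r" "b \<in> \<tau>" shows "i \<in> \<tau>"
  using assms poset_convexD[OF pipe_convex[OF pipe_\<tau>] assms(4,2)] by (auto simp: prec_iff)

section \<open>Restriction to the pipe\<close>

abbreviation r\<tau> :: "'p rel" where "r\<tau> \<equiv> Restr r \<tau>"

lemma Field_restrict: "Field r\<tau> = \<tau>"
proof -
  have "i \<in> Field r\<tau>" if "i \<in> \<tau>" for i
    using that rel_refl[of i] \<tau>_Field by (auto simp: Field_def)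
  then show ?thesis by (auto simp: Field_def)
qed

lemma prec_restrict: "prec r\<tau> i j \<longleftrightarrow> i \<in> \<tau> \<and> j \<in> \<tau> \<and> prec r i j"
  by (auto simp: prec_def)

lemma finite_poset_restrict: "finite_poset r\<tau>"
proof
  show "Partial_order r\<tau>" by (rule Partial_order_Restr[OF partial_order])
  show "finite (Field r\<tau>)" unfolding Field_restrict by (rule pipe_finite[OF pipe_\<tau>])
qed

text \<open>Since \<open>\<tau>\<close> is convex, an element between two elements of a subset of
  \<open>\<tau>\<close> lies in \<open>\<tau>\<close>, so convexity may be tested in either
  poset.\<close>

lemma pipe_restrict: "pipe r\<tau> \<sigma> \<longleftrightarrow> pipe r \<sigma> \<and> \<sigma> \<subseteq> \<tau>"
proof -
  have cut: "cut_connected r\<tau> \<sigma> \<longleftrightarrow> cut_connected r \<sigma>" if "\<sigma> \<subseteq> \<tau>"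
  proof -
    have "comparable r\<tau> i j \<longleftrightarrow> comparable r i j" if "i \<in> \<sigma>" "j \<in> \<sigma>" for i j
      using that \<open>\<sigma> \<subseteq> \<tau>\<close> by (auto simp: comparable_def prec_restrict)
    then show ?thesis unfolding cut_connected_def by (metis subsetD)
  qed
  have conv: "poset_convex r\<tau> \<sigma> \<longleftrightarrow> poset_convex r \<sigma>" if \<sigma>: "\<sigma> \<subseteq> \<tau>"
  proof
    assume "poset_convex r\<tau> \<sigma>"
    then show "poset_convex r \<sigma>"
      using poset_convexD[OF pipe_convex[OF pipe_\<tau>]] \<sigma>
      unfolding poset_convex_def prec_restrict by blast
  next
    assume "poset_convex r \<sigma>"
    then show "poset_convex r\<tau> \<sigma>" unfolding poset_convex_def prec_restrict by blast
  qed
  show ?thesis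
    unfolding pipe_iff finite_poset.pipe_iff[OF finite_poset_restrict] Field_restrict
    using cut conv \<tau>_Field by auto
qed

lemma finite_connected_poset_restrict: "finite_connected_poset r\<tau>"
  unfolding finite_connected_poset_iff Field_restrict
  using finite_poset_restrict pipe_restrict[of \<tau>] pipe_\<tau> finite_poset.pipe_cut_connected by blast

lemma piping_restrict: "piping r\<tau> T \<longleftrightarrow> piping r T \<and> (\<forall>\<sigma>\<in>T. \<sigma> \<subseteq> \<tau>)"
proof -
  have "piping_digraph r\<tau> T = piping_digraph r T" if "\<forall>\<sigma>\<in>T. \<sigma> \<subseteq> \<tau>"
    using that unfolding piping_digraph_def prec_restrict by blast
  then show ?thesis unfolding piping_def pipe_restrict by auto
qed

lemma proper_pipes_restrict: "\<sigma> \<in> proper_pipes r\<tau> \<longleftrightarrow> pipe r \<sigma> \<and> 1 < card \<sigma> \<and> \<sigma> \<subset> \<tau>"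
proof -
  have "finite \<tau>" by (rule pipe_finite[OF pipe_\<tau>])
  then have "\<sigma> \<subseteq> \<tau> \<and> card \<sigma> < card \<tau> \<longleftrightarrow> \<sigma> \<subset> \<tau>"
    using psubset_card_mono[of \<tau> \<sigma>] by auto
  then show ?thesis unfolding proper_pipes_def pipe_restrict Field_restrict by auto
qed

section \<open>Contraction of the pipe\<close>

abbreviation F' :: "'p set" where "F' \<equiv> insert t (Field r - \<tau>)"
abbreviation r' :: "'p rel" where "r' \<equiv> contract r \<tau> t"

text \<open>The quotient map onto the contracted poset. \<open>lift\<close> is the full preimage, so
  a set containing \<open>t\<close> lifts to one containing all of \<open>\<tau>\<close>.\<close>

definition q :: "'p \<Rightarrow> 'p" where "q i = (if i \<in> \<tau> then t else i)"
definition lift :: "'p set \<Rightarrow> 'p set" where "lift \<sigma> = {i \<in> Field r. q i \<in> \<sigma>}"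

definition below_\<tau> :: "'p \<Rightarrow> bool" where "below_\<tau> i \<longleftrightarrow> (\<exists>a\<in>\<tau>. (i, a) \<in> r)"
definition above_\<tau> :: "'p \<Rightarrow> bool" where "above_\<tau> j \<longleftrightarrow> (\<exists>b\<in>\<tau>. (b, j) \<in> r)"

lemma contract_iff: "(i, j) \<in> r' \<longleftrightarrow> i \<in> F' \<and> j \<in> F' \<and> ((i, j) \<in> r \<or> below_\<tau> i \<and> above_\<tau> j)"
  by (simp add: contract_def below_\<tau>_def above_\<tau>_def)

lemma t_Field: "t \<in> Field r"
  using t_in \<tau>_Field by blast

lemma in_\<tau>_below_above: "i \<in> \<tau> \<Longrightarrow> below_\<tau> i" "i \<in> \<tau> \<Longrightarrow> above_\<tau> i"
  using rel_refl \<tau>_Field unfolding below_\<tau>_def above_\<tau>_def by blast+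

lemma below_above: "below_\<tau> i \<Longrightarrow> above_\<tau> i \<Longrightarrow> i \<in> \<tau>"
  unfolding below_\<tau>_def above_\<tau>_def using between_\<tau> by blast

lemma below_above_F': "below_\<tau> i \<Longrightarrow> above_\<tau> i \<Longrightarrow> i \<in> F' \<Longrightarrow> i = t"
  using below_above by blast

lemma below_down: "(i, j) \<in> r \<Longrightarrow> below_\<tau> j \<Longrightarrow> below_\<tau> i"
  unfolding below_\<tau>_def using rel_trans by blast

lemma above_up: "(i, j) \<in> r \<Longrightarrow> above_\<tau> i \<Longrightarrow> above_\<tau> j"
  unfolding above_\<tau>_def using rel_trans by blast

lemma F'_Field: "i \<in> F' \<Longrightarrow> i \<in> Field r"
  using t_Field by blast

lemma Field_contract: "Field r' = F'"
proof
  show "Field r' \<subseteq> F'" by (auto simp: Field_def contract_iff)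
  show "F' \<subseteq> Field r'"
  proof
    fix i assume "i \<in> F'"
    then have "(i, i) \<in> r'" using rel_refl[OF F'_Field] by (simp add: contract_iff)
    then show "i \<in> Field r'" by (auto simp: Field_def)
  qed
qed

text \<open>Antisymmetry is where convexity of \<open>\<tau>\<close> enters: two elements related in
  both directions with the help of \<open>\<tau>\<close> lie both below and above elements of
  \<open>\<tau>\<close>, hence in it, and \<open>t\<close> is the only element of
  \<open>\<tau>\<close> left.\<close>

lemma finite_poset_contract: "finite_poset r'"
proof
  have "refl_on (Field r') r'"
    unfolding refl_on_def Field_contract using rel_refl F'_Field by (auto simp: contract_iff)
  moreover have "trans r'"
  proof (rule transI)
    fix i j k assume "(i, j) \<in> r'" "(j, k) \<in> r'"
    then show "(i, k) \<in> r'"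
      unfolding contract_iff using rel_trans below_down above_up by blast
  qed
  moreover have "antisym r'"
  proof (rule antisymI)
    fix i j assume ij: "(i, j) \<in> r'" "(j, i) \<in> r'"
    show "i = j"
    proof (cases "(i, j) \<in> r \<and> (j, i) \<in> r")
      case False
      then have "below_\<tau> i" "above_\<tau> i" "below_\<tau> j" "above_\<tau> j"
        using ij below_down above_up unfolding contract_iff by blast+
      then show ?thesis using below_above_F' ij unfolding contract_iff by blast
    qed (use rel_antisym in blast)
  qed
  moreover have "r' \<subseteq> Field r' \<times> Field r'" by (auto simp: Field_def)
  ultimately show "Partial_order r'" by (simp add: partial_order_on_def preorder_on_def)
  show "finite (Field r')" unfolding Field_contract using finite_Field by simp
qed

lemma q_in_F': "i \<in> Field r \<Longrightarrow> q i \<in> F'"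
  by (simp add: q_def)

lemma q_F': "i \<in> F' \<Longrightarrow> q i = i"
  using t_in by (auto simp: q_def)

lemma q_eq_iff: "q i = q j \<Longrightarrow> i = j \<or> i \<in> \<tau> \<and> j \<in> \<tau>"
  using t_in by (auto simp: q_def split: if_splits)

lemma q_mono: "(i, j) \<in> r \<Longrightarrow> (q i, q j) \<in> r'"
proof -
  assume ij: "(i, j) \<in> r"
  then have "q i \<in> F'" "q j \<in> F'" using rel_Field q_in_F' by blast+
  moreover have "(q i, q j) \<in> r \<or> below_\<tau> (q i) \<and> above_\<tau> (q j)"
  proof (cases "i \<in> \<tau> \<or> j \<in> \<tau>")
    case True
    then have "below_\<tau> i" "above_\<tau> j" using ij below_down above_up in_\<tau>_below_above by blast+
    then show ?thesis using in_\<tau>_below_above t_in by (simp add: q_def)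
  qed (use ij in \<open>simp add: q_def\<close>)
  ultimately show ?thesis by (simp add: contract_iff)
qed

lemma lift_subset: "lift \<sigma> \<subseteq> Field r"
  by (auto simp: lift_def)

lemma subset_lift: "\<sigma> \<subseteq> F' \<Longrightarrow> \<sigma> \<subseteq> lift \<sigma>"
  using q_F' F'_Field by (force simp: lift_def)

lemma \<tau>_lift: "t \<in> \<sigma> \<Longrightarrow> \<tau> \<subseteq> lift \<sigma>"
  using \<tau>_Field by (auto simp: lift_def q_def)

lemma \<tau>_disjoint_lift: "t \<notin> \<sigma> \<Longrightarrow> \<tau> \<inter> lift \<sigma> = {}"
  by (auto simp: lift_def q_def)

lemma q_lift: "\<sigma> \<subseteq> F' \<Longrightarrow> q ` lift \<sigma> = \<sigma>"
proof -
  assume \<sigma>: "\<sigma> \<subseteq> F'"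
  then have "s \<in> q ` lift \<sigma>" if "s \<in> \<sigma>" for s
    using subset_lift[OF \<sigma>] that q_F'[of s] by (intro image_eqI[of s q s]) auto
  then show ?thesis by (auto simp: lift_def)
qed

lemma lift_q: "\<sigma> \<subseteq> Field r \<Longrightarrow> \<tau> \<subseteq> \<sigma> \<or> \<sigma> \<inter> \<tau> = {} \<Longrightarrow> lift (q ` \<sigma>) = \<sigma>"
  unfolding lift_def using q_eq_iff by blast

text \<open>For connectedness, a subset \<open>X\<close> of the preimage that is closed under
  comparability contains \<open>\<tau>\<close> as soon as it meets it, since \<open>\<tau>\<close>
  is connected; hence its image under \<open>q\<close> is closed in \<open>\<sigma>\<close>.\<close>

lemma pipe_lift:
  assumes "pipe r' \<sigma>" shows "pipe r (lift \<sigma>)"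
  unfolding pipe_iff
proof (intro conjI lift_subset)
  have \<sigma>: "\<sigma> \<noteq> {}" "\<sigma> \<subseteq> F'" "poset_convex r' \<sigma>" "cut_connected r' \<sigma>"
    using assms unfolding finite_poset.pipe_iff[OF finite_poset_contract] Field_contract by auto
  have conv: "j \<in> \<sigma>" if "i \<in> \<sigma>" "k \<in> \<sigma>" "(i, j) \<in> r'" "(j, k) \<in> r'" for i j k
    using poset_convexD[OF \<sigma>(3) that(1,2)] that by (auto simp: prec_def)
  show "lift \<sigma> \<noteq> {}" using \<sigma>(1) subset_lift[OF \<sigma>(2)] by blast
  show "poset_convex r (lift \<sigma>)"
    unfolding poset_convex_def
  proof (intro ballI allI impI)
    fix i k j assume "i \<in> lift \<sigma>" "k \<in> lift \<sigma>" "prec r i j \<and> prec r j k"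
    then have "q i \<in> \<sigma>" "q k \<in> \<sigma>" "(i, j) \<in> r" "(j, k) \<in> r" by (auto simp: lift_def prec_iff)
    then have "q j \<in> \<sigma>" using conv[of "q i" "q k" "q j"] q_mono by blast
    then show "j \<in> lift \<sigma>" using rel_Field \<open>(i, j) \<in> r\<close> by (simp add: lift_def)
  qed
  show "cut_connected r (lift \<sigma>)"
  proof (rule cut_connectedI)
    fix X assume X: "X \<subseteq> lift \<sigma>" "X \<noteq> {}"
      and cl: "\<And>i j. i \<in> X \<Longrightarrow> j \<in> lift \<sigma> \<Longrightarrow> comparable r i j \<Longrightarrow> j \<in> X"
    have cl': "j \<in> X" if "i \<in> X" "j \<in> lift \<sigma>" "(i, j) \<in> r \<or> (j, i) \<in> r" for i j
      using cl[OF that(1,2)] that by (auto simp: comparable_def prec_iff)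
    have \<tau>X: "\<tau> \<subseteq> X" if x: "x \<in> X" "x \<in> \<tau>" for x
    proof (rule ccontr)
      assume "\<not> \<tau> \<subseteq> X"
      then obtain a b where "a \<in> X" "b \<in> \<tau>" "b \<notin> X" "comparable r a b"
        by (rule cut_connected_crossing[OF pipe_cut_connected[OF pipe_\<tau>] x(2,1)]) (rule that)
      moreover have "t \<in> \<sigma>" using x X(1) by (auto simp: lift_def q_def)
      ultimately show False using cl \<tau>_lift by blast
    qed
    have "q ` X = \<sigma>"
    proof (rule cut_connectedD[OF \<sigma>(4)])
      show "q ` X \<subseteq> \<sigma>" using X(1) by (auto simp: lift_def)
      show "q ` X \<noteq> {}" using X(2) by blast
      fix s s' assume s: "s \<in> q ` X" and s': "s' \<in> \<sigma>" "comparable r' s s'"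
      obtain x where x: "x \<in> X" "s = q x" using s by blast
      have "s \<in> X" using \<tau>X[OF x(1)] x t_in by (auto simp: q_def)
      have "s \<in> \<sigma>" using x X(1) by (auto simp: lift_def)
      have "s' \<in> lift \<sigma>" "s' \<in> F'" using s'(1) subset_lift[OF \<sigma>(2)] \<sigma>(2) by blast+
      have "s' \<in> X"
      proof (cases "(s, s') \<in> r \<or> (s', s) \<in> r")
        case False
        have t': "(u, t) \<in> r' \<and> (t, v) \<in> r'" if "below_\<tau> u" "above_\<tau> v" "u \<in> F'" "v \<in> F'" for u v
          using that in_\<tau>_below_above[OF t_in] by (auto simp: contract_iff)
        have "s \<in> F'" using \<open>s \<in> \<sigma>\<close> \<sigma>(2) by blast
        have "below_\<tau> s \<and> above_\<tau> s' \<or> below_\<tau> s' \<and> above_\<tau> s"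
          using False s'(2) by (auto simp: comparable_def prec_def contract_iff)
        \<comment> \<open>A relation that holds only through \<open>\<tau>\<close> has
          \<open>t\<close> between its ends, so convexity brings \<open>t\<close> into
          \<open>\<sigma>\<close>, and the path from \<open>s\<close> to \<open>s'\<close> can run
          through \<open>\<tau>\<close>.\<close>
        then have "t \<in> \<sigma>"
          using conv[OF \<open>s \<in> \<sigma>\<close> s'(1)] conv[OF s'(1) \<open>s \<in> \<sigma>\<close>] t' \<open>s \<in> F'\<close> \<open>s' \<in> F'\<close> by blast
        then have "\<tau> \<subseteq> lift \<sigma>" by (rule \<tau>_lift)
        obtain a b where ab: "a \<in> \<tau>" "b \<in> \<tau>" "(s, a) \<in> r \<or> (a, s) \<in> r" "(s', b) \<in> r \<or> (b, s') \<in> r"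
          using \<open>below_\<tau> s \<and> above_\<tau> s' \<or> below_\<tau> s' \<and> above_\<tau> s\<close> unfolding below_\<tau>_def above_\<tau>_def by blast
        have "a \<in> X" using cl'[OF \<open>s \<in> X\<close> _ ab(3)] ab(1) \<open>\<tau> \<subseteq> lift \<sigma>\<close> by blast
        then have "b \<in> X" using \<tau>X ab(1,2) by blast
        then show ?thesis using cl'[OF _ \<open>s' \<in> lift \<sigma>\<close>] ab(4) by blast
      qed (use cl'[OF \<open>s \<in> X\<close> \<open>s' \<in> lift \<sigma>\<close>] in blast)
      then show "s' \<in> q ` X" using q_F'[OF \<open>s' \<in> F'\<close>] by (metis imageI)
    qed
    then show "lift \<sigma> \<subseteq> X" using \<tau>X q_eq_iff unfolding lift_def by blast
  qed
qed

text \<open>The side condition is what convexity of the image requires: a set that avoids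
  \<open>\<tau>\<close> but has elements both below and above it would have \<open>t\<close> in
  between.\<close>

lemma pipe_project:
  assumes \<sigma>: "pipe r \<sigma>" and \<tau>: "\<tau> \<subseteq> \<sigma> \<or> \<sigma> \<inter> \<tau> = {} \<and> \<not> ((\<exists>i\<in>\<sigma>. below_\<tau> i) \<and> (\<exists>j\<in>\<sigma>. above_\<tau> j))"
  shows "pipe r' (q ` \<sigma>)"
  unfolding finite_poset.pipe_iff[OF finite_poset_contract] Field_contract
proof (intro conjI)
  have sub: "\<sigma> \<subseteq> Field r" by (rule pipe_subset[OF \<sigma>])
  have conv: "j \<in> \<sigma>" if "i \<in> \<sigma>" "k \<in> \<sigma>" "(i, j) \<in> r" "(j, k) \<in> r" for i j k
    using poset_convexD[OF pipe_convex[OF \<sigma>] that(1,2)] that by (auto simp: prec_def)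
  show "q ` \<sigma> \<noteq> {}" using pipe_nonempty[OF \<sigma>] by simp
  show "q ` \<sigma> \<subseteq> F'" using sub q_in_F' by blast
  have q\<sigma>: "i \<in> \<sigma>" if "i \<in> q ` \<sigma>" for i using that \<tau> t_in by (auto simp: q_def split: if_splits)
  show "poset_convex r' (q ` \<sigma>)"
    unfolding poset_convex_def
  proof (intro ballI allI impI)
    fix i k j assume ik: "i \<in> q ` \<sigma>" "k \<in> q ` \<sigma>" and "prec r' i j \<and> prec r' j k"
    then have ij: "(i, j) \<in> r'" "(j, k) \<in> r'" by (auto simp: prec_def)
    have "i \<in> \<sigma>" "k \<in> \<sigma>" using q\<sigma> ik by blast+
    have "j \<in> F'" using ij by (simp add: contract_iff)
    have "j \<in> \<sigma>"
    proof (cases "\<tau> \<subseteq> \<sigma>")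
      case True
      have "\<exists>x\<in>\<sigma>. (x, j) \<in> r" "\<exists>y\<in>\<sigma>. (j, y) \<in> r"
        using ij True \<open>i \<in> \<sigma>\<close> \<open>k \<in> \<sigma>\<close> unfolding contract_iff below_\<tau>_def above_\<tau>_def by blast+
      then show ?thesis using conv by blast
    next
      case False
      then have "\<not> (below_\<tau> i \<and> above_\<tau> k)" using \<tau> \<open>i \<in> \<sigma>\<close> \<open>k \<in> \<sigma>\<close> by blast
      then have "(i, j) \<in> r" "(j, k) \<in> r"
        using ij below_down above_up unfolding contract_iff by blast+
      then show ?thesis using conv \<open>i \<in> \<sigma>\<close> \<open>k \<in> \<sigma>\<close> by blast
    qed
    then show "j \<in> q ` \<sigma>" using q_F'[OF \<open>j \<in> F'\<close>] by (metis imageI)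
  qed
  show "cut_connected r' (q ` \<sigma>)"
  proof (rule cut_connectedI)
    fix X assume X: "X \<subseteq> q ` \<sigma>" "X \<noteq> {}"
      and cl: "\<And>i j. i \<in> X \<Longrightarrow> j \<in> q ` \<sigma> \<Longrightarrow> comparable r' i j \<Longrightarrow> j \<in> X"
    have "{i \<in> \<sigma>. q i \<in> X} = \<sigma>"
    proof (rule cut_connectedD[OF pipe_cut_connected[OF \<sigma>]])
      show "{i \<in> \<sigma>. q i \<in> X} \<noteq> {}" using X by blast
      fix i j assume ij: "i \<in> {i \<in> \<sigma>. q i \<in> X}" "j \<in> \<sigma>" "comparable r i j"
      then have "(q i, q j) \<in> r' \<or> (q j, q i) \<in> r'" using q_mono by (auto simp: comparable_def prec_def)
      then have "q i = q j \<or> comparable r' (q i) (q j)" by (auto simp: comparable_def prec_def)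
      then have "q j \<in> X" using cl[of "q i" "q j"] ij by auto
      then show "j \<in> {i \<in> \<sigma>. q i \<in> X}" using ij by simp
    qed blast
    then show "q ` \<sigma> \<subseteq> X" by blast
  qed
qed

lemma pipe_contract_F': "pipe r (Field r) \<Longrightarrow> pipe r' F'"
proof -
  assume "pipe r (Field r)"
  then have "pipe r' (q ` Field r)" using pipe_project \<tau>_Field by blast
  moreover have "q ` Field r = F'"
  proof
    show "q ` Field r \<subseteq> F'" using q_in_F' by blast
    show "F' \<subseteq> q ` Field r" using q_F' F'_Field by (metis imageI subsetI)
  qed
  ultimately show ?thesis by simp
qed

lemma finite_connected_poset_contract: "finite_connected_poset r \<Longrightarrow> finite_connected_poset r'"
proof -
  assume "finite_connected_poset r"
  then have "pipe r (Field r)" using pipe_Field t_Field by blast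
  then have "pipe r' F'" by (rule pipe_contract_F')
  then show ?thesis
    unfolding finite_connected_poset_iff Field_contract
    using finite_poset_contract finite_poset.pipe_cut_connected by blast
qed

lemma card_F': "card F' = card (Field r) - card \<tau> + 1"
  using finite_Field t_in \<tau>_Field pipe_finite[OF pipe_\<tau>] by (simp add: card_Diff_subset)

section \<open>Pipings through a fixed pipe as pairs of pipings\<close>

text \<open>For proper pipings, \<open>T1\<close> lives strictly inside \<open>\<tau>\<close>, and
  each lift of a member of \<open>T2\<close> surrounds \<open>\<tau>\<close> or avoids it.\<close>

definition merge :: "'p set set \<times> 'p set set \<Rightarrow> 'p set set" where
  "merge = (\<lambda>(T1, T2). insert \<tau> (T1 \<union> lift ` T2))"

text \<open>The last fact keeps lifted pipes apart from those inside \<open>\<tau>\<close>: a lift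
  inside \<open>\<tau>\<close> could only come from \<open>{t}\<close>, which is too small.\<close>

lemma proper_pipes_contractD:
  assumes "\<sigma> \<in> proper_pipes r'"
  shows "pipe r' \<sigma>" "\<sigma> \<subseteq> F'" "\<sigma> \<noteq> F'" "1 < card \<sigma>" "\<not> lift \<sigma> \<subseteq> \<tau>"
proof -
  show \<sigma>: "pipe r' \<sigma>" "1 < card \<sigma>" using assms by (auto simp: proper_pipes_def)
  show sub: "\<sigma> \<subseteq> F'" using pipe_subset[OF \<sigma>(1)] unfolding Field_contract .
  show "\<sigma> \<noteq> F'" using assms by (auto simp: proper_pipes_def Field_contract)
  have "\<not> \<sigma> \<subseteq> {t}" using \<sigma>(2) card_mono[of "{t}" \<sigma>] by auto
  then show "\<not> lift \<sigma> \<subseteq> \<tau>" using subset_lift[OF sub] sub by blast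
qed

lemma disjoint_lift: "\<sigma> \<inter> \<sigma>' = {} \<Longrightarrow> lift \<sigma> \<inter> lift \<sigma>' = {}"
  by (auto simp: lift_def)

lemma lift_mono: "\<sigma> \<subseteq> \<sigma>' \<Longrightarrow> lift \<sigma> \<subseteq> lift \<sigma>'"
  by (auto simp: lift_def)

lemma proper_pipe_lift:
  assumes "\<sigma> \<in> proper_pipes r'" shows "lift \<sigma> \<in> proper_pipes r"
proof -
  note \<sigma> = proper_pipes_contractD[OF assms]
  have fin: "finite (lift \<sigma>)" using lift_subset finite_Field finite_subset by blast
  have "card \<sigma> \<le> card (lift \<sigma>)" by (rule card_mono[OF fin subset_lift[OF \<sigma>(2)]])
  moreover obtain x where "x \<in> F'" "x \<notin> \<sigma>" using \<sigma>(2,3) by blast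
  then have "x \<in> Field r" "x \<notin> lift \<sigma>" using F'_Field q_F'[of x] by (auto simp: lift_def)
  then have "lift \<sigma> \<subset> Field r" using lift_subset by blast
  then have "card (lift \<sigma>) < card (Field r)" by (rule psubset_card_mono[OF finite_Field])
  ultimately show ?thesis using pipe_lift[OF \<sigma>(1)] \<sigma>(4) by (simp add: proper_pipes_def)
qed

lemma merge_proper_piping:
  assumes \<tau>: "\<tau> \<in> proper_pipes r" and T1: "T1 \<in> proper_pipings r\<tau>" and T2: "T2 \<in> proper_pipings r'"
  shows "merge (T1, T2) \<in> proper_pipings r"
proof -
  let ?T = "insert \<tau> (T1 \<union> lift ` T2)"
  have P1: "piping r T1" "\<And>\<sigma>. \<sigma> \<in> T1 \<Longrightarrow> pipe r \<sigma> \<and> 1 < card \<sigma> \<and> \<sigma> \<subset> \<tau>"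
    using T1 proper_pipes_restrict unfolding proper_pipings_def piping_restrict by auto
  have P2: "piping r' T2" "\<And>\<sigma>. \<sigma> \<in> T2 \<Longrightarrow> \<sigma> \<in> proper_pipes r'"
    using T2 unfolding proper_pipings_def by auto
  have card_\<tau>: "card \<tau> < card (Field r)" using \<tau> by (simp add: proper_pipes_def)
  have proper: "\<sigma> \<in> proper_pipes r" if "\<sigma> \<in> ?T" for \<sigma>
  proof -
    have "\<sigma> \<in> proper_pipes r" if "\<sigma> \<in> T1"
      using P1(2)[OF that] psubset_card_mono[OF pipe_finite[OF pipe_\<tau>]] card_\<tau>
      by (auto simp: proper_pipes_def intro: less_trans)
    moreover have "\<sigma> \<in> proper_pipes r" if "\<sigma> \<in> lift ` T2"
      using that P2(2) proper_pipe_lift by blast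
    ultimately show ?thesis using that \<tau> by blast
  qed
  have "piping r ?T"
  proof (rule pipingI)
    show "pipe r \<sigma>" if "\<sigma> \<in> ?T" for \<sigma> using proper[OF that] by (simp add: proper_pipes_def)
    have cases: "\<sigma> \<subseteq> \<tau> \<or> (\<exists>\<rho>\<in>T2. \<sigma> = lift \<rho>)" if "\<sigma> \<in> ?T" for \<sigma> using that P1(2) by blast
    \<comment> \<open>A lift contains all of \<open>\<tau>\<close> or nothing of it, according to
      whether \<open>t\<close> belongs to \<open>\<rho>\<close>.\<close>
    have mixed: "\<sigma> \<subseteq> lift \<rho> \<or> \<sigma> \<inter> lift \<rho> = {}" if "\<sigma> \<subseteq> \<tau>" for \<sigma> \<rho>
      using that \<tau>_lift[of \<rho>] \<tau>_disjoint_lift[of \<rho>] by blast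
    show "\<sigma> \<subseteq> \<sigma>' \<or> \<sigma>' \<subseteq> \<sigma> \<or> \<sigma> \<inter> \<sigma>' = {}" if *: "\<sigma> \<in> ?T" "\<sigma>' \<in> ?T" for \<sigma> \<sigma>'
    proof (cases "\<sigma> \<subseteq> \<tau>")
      case True
      show ?thesis
      proof (cases "\<sigma>' \<subseteq> \<tau>")
        case True
        have "\<rho> \<in> insert \<tau> T1" if "\<rho> \<in> ?T" "\<rho> \<subseteq> \<tau>" for \<rho>
          using that P2(2) proper_pipes_contractD(5) by blast
        then have "\<sigma> \<in> insert \<tau> T1" "\<sigma>' \<in> insert \<tau> T1" using * True \<open>\<sigma> \<subseteq> \<tau>\<close> by blast+
        then show ?thesis using piping_laminar[OF P1(1), of \<sigma> \<sigma>'] True \<open>\<sigma> \<subseteq> \<tau>\<close> by auto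
      next
        case False
        then obtain \<rho> where "\<sigma>' = lift \<rho>" using cases[OF *(2)] by blast
        then show ?thesis using mixed[OF \<open>\<sigma> \<subseteq> \<tau>\<close>] by blast
      qed
    next
      case False
      then obtain \<rho> where \<rho>: "\<rho> \<in> T2" "\<sigma> = lift \<rho>" using cases[OF *(1)] by blast
      show ?thesis
      proof (cases "\<sigma>' \<subseteq> \<tau>")
        case True
        then show ?thesis using mixed[OF True] \<rho>(2) by blast
      next
        case False
        then obtain \<rho>' where \<rho>': "\<rho>' \<in> T2" "\<sigma>' = lift \<rho>'" using cases[OF *(2)] by blast
        show ?thesis
          using piping_laminar[OF P2(1) \<rho>(1) \<rho>'(1)] lift_mono[of \<rho> \<rho>'] lift_mono[of \<rho>' \<rho>] disjoint_lift[of \<rho> \<rho>'] \<rho>(2) \<rho>'(2) by blast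
      qed
    qed
    \<comment> \<open>Edges inside \<open>\<tau>\<close> are ranked by the restriction, all others by the contraction with \<open>{t}\<close> added.\<close>
    have P2': "piping r' (insert {t} T2)"
      by (rule finite_poset.piping_insert_singleton[OF finite_poset_contract P2(1)]) (simp add: Field_contract)
    obtain h1 :: "'p set \<Rightarrow> nat" where h1: "\<And>\<sigma> \<sigma>'. (\<sigma>, \<sigma>') \<in> piping_digraph r T1 \<Longrightarrow> h1 \<sigma> < h1 \<sigma>'"
      "\<And>\<sigma>. h1 \<sigma> \<le> card T1"
      by (rule acyclic_rank[OF piping_acyclic[OF P1(1)] piping_digraph_Times finite_pipings[OF P1(1)]]) (rule that)
    obtain h2 :: "'p set \<Rightarrow> nat" where h2: "\<And>\<sigma> \<sigma>'. (\<sigma>, \<sigma>') \<in> piping_digraph r' (insert {t} T2) \<Longrightarrow> h2 \<sigma> < h2 \<sigma>'"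
      by (rule acyclic_rank[OF piping_acyclic[OF P2'] finite_poset.piping_digraph_Times[OF finite_poset_contract]
            finite_poset.finite_pipings[OF finite_poset_contract P2']]) (rule that)
    have q_in: "q ` \<sigma> \<in> insert {t} T2" if \<sigma>: "\<sigma> \<in> ?T" for \<sigma>
    proof (cases "\<sigma> \<subseteq> \<tau>")
      case True
      have "\<sigma> \<noteq> {}" using proper[OF \<sigma>] by (auto simp: proper_pipes_def)
      then have "q ` \<sigma> = {t}" using True by (auto simp: q_def)
      then show ?thesis by simp
    next
      case False
      then obtain \<rho> where "\<rho> \<in> T2" "\<sigma> = lift \<rho>" using cases[OF \<sigma>] by blast
      then show ?thesis using q_lift[OF proper_pipes_contractD(2)[OF P2(2)]] by simp
    qed
    \<comment> \<open>All values of \<open>h1\<close> are below \<open>?M\<close>, so the combined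
      rank is lexicographic: \<open>h2\<close> first, then \<open>h1\<close>.\<close>
    let ?M = "Suc (card T1)"
    show "acyclic (piping_digraph r ?T)"
    proof (rule acyclic_if_rank)
      fix \<sigma> \<sigma>' assume "(\<sigma>, \<sigma>') \<in> piping_digraph r ?T"
      then obtain i j where *: "\<sigma> \<in> ?T" "\<sigma>' \<in> ?T" "\<sigma> \<inter> \<sigma>' = {}" "i \<in> \<sigma>" "j \<in> \<sigma>'" "prec r i j"
        by (auto simp: piping_digraph_def)
      show "h2 (q ` \<sigma>) * ?M + h1 \<sigma> < h2 (q ` \<sigma>') * ?M + h1 \<sigma>'"
      proof (cases "\<sigma> \<subseteq> \<tau> \<and> \<sigma>' \<subseteq> \<tau>")
        case True
        have "\<sigma> \<noteq> \<tau>" "\<sigma>' \<noteq> \<tau>" using True *(3-5) by blast+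
        moreover have "\<rho> \<in> insert \<tau> T1" if "\<rho> \<in> ?T" "\<rho> \<subseteq> \<tau>" for \<rho>
          using that P2(2) proper_pipes_contractD(5) by blast
        ultimately have "(\<sigma>, \<sigma>') \<in> piping_digraph r T1"
          using * True unfolding piping_digraph_def by blast
        then have "h1 \<sigma> < h1 \<sigma>'" by (rule h1(1))
        moreover have "q ` \<sigma> = {t}" "q ` \<sigma>' = {t}" using True *(4,5) by (auto simp: q_def)
        ultimately show ?thesis by simp
      next
        case False
        have disj: "q ` \<sigma> \<inter> q ` \<sigma>' = {}"
        proof (rule ccontr)
          assume "\<not> ?thesis"
          then obtain x y where "x \<in> \<sigma>" "y \<in> \<sigma>'" "q x = q y" by auto
          then have xy: "x \<in> \<tau>" "y \<in> \<tau>" "x \<in> \<sigma>" "y \<in> \<sigma>'" using q_eq_iff *(3) by blast+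
          have "\<tau> \<subseteq> \<rho>" if "\<rho> \<in> ?T" "\<not> \<rho> \<subseteq> \<tau>" "z \<in> \<rho>" "z \<in> \<tau>" for \<rho> z
            using cases[OF that(1)] that(2-4) \<tau>_lift \<tau>_disjoint_lift by blast
          then show False using False xy *(1-3) by blast
        qed
        have "(q i, q j) \<in> r'" using *(6) q_mono by (simp add: prec_iff)
        moreover have "q i \<noteq> q j" using disj *(4,5) by blast
        ultimately have "prec r' (q i) (q j)" by (simp add: prec_def)
        then have "(q ` \<sigma>, q ` \<sigma>') \<in> piping_digraph r' (insert {t} T2)"
          unfolding piping_digraph_def using q_in[OF *(1)] q_in[OF *(2)] disj *(4,5) by blast
        then have "h2 (q ` \<sigma>) < h2 (q ` \<sigma>')" by (rule h2)
        then have "Suc (h2 (q ` \<sigma>)) * ?M \<le> h2 (q ` \<sigma>') * ?M" by (intro mult_le_mono1) simp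
        then show ?thesis using h1(2)[of \<sigma>] by simp
      qed
    qed
  qed
  then show ?thesis using proper by (auto simp: merge_def proper_pipings_def)
qed

text \<open>Both parts can be recovered from the merge: its members strictly inside
  \<open>\<tau>\<close> come from \<open>T1\<close>, those not inside \<open>\<tau>\<close> from
  \<open>T2\<close>, and \<open>q\<close> undoes \<open>lift\<close>.\<close>

lemma merge_subset_iff:
  assumes "T1 \<in> proper_pipings r\<tau>" "T2 \<in> proper_pipings r'" "T1' \<in> proper_pipings r\<tau>" "T2' \<in> proper_pipings r'"
  shows "merge (T1, T2) \<subseteq> merge (T1', T2') \<longleftrightarrow> T1 \<subseteq> T1' \<and> T2 \<subseteq> T2'"
proof
  have sub: "\<sigma> \<subset> \<tau>" if "\<sigma> \<in> T" "T \<in> proper_pipings r\<tau>" for \<sigma> T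
  proof -
    have "\<sigma> \<in> proper_pipes r\<tau>" using that by (auto simp: proper_pipings_def)
    then show ?thesis by (simp add: proper_pipes_restrict)
  qed
  have not_sub: "\<not> lift \<sigma> \<subseteq> \<tau>" "\<sigma> \<subseteq> F'" if "\<sigma> \<in> T" "T \<in> proper_pipings r'" for \<sigma> T
  proof -
    have "\<sigma> \<in> proper_pipes r'" using that by (auto simp: proper_pipings_def)
    then show "\<not> lift \<sigma> \<subseteq> \<tau>" "\<sigma> \<subseteq> F'" using proper_pipes_contractD by blast+
  qed
  assume L: "merge (T1, T2) \<subseteq> merge (T1', T2')"
  show "T1 \<subseteq> T1' \<and> T2 \<subseteq> T2'"
  proof
    show "T1 \<subseteq> T1'"
    proof
      fix \<sigma> assume "\<sigma> \<in> T1"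
      then have "\<sigma> \<in> insert \<tau> (T1' \<union> lift ` T2')" "\<sigma> \<subset> \<tau>" using L sub assms(1) by (auto simp: merge_def)
      then show "\<sigma> \<in> T1'" using not_sub(1)[OF _ assms(4)] by blast
    qed
    show "T2 \<subseteq> T2'"
    proof
      fix \<sigma> assume \<sigma>: "\<sigma> \<in> T2"
      then have "lift \<sigma> \<in> insert \<tau> (T1' \<union> lift ` T2')" using L by (auto simp: merge_def)
      moreover have "lift \<sigma> \<noteq> \<tau>" using not_sub(1)[OF \<sigma> assms(2)] by auto
      moreover have "lift \<sigma> \<notin> T1'" using not_sub(1)[OF \<sigma> assms(2)] sub[of "lift \<sigma>", OF _ assms(3)] by auto
      ultimately have "lift \<sigma> \<in> lift ` T2'" by blast
      then obtain \<sigma>' where \<sigma>': "lift \<sigma> = lift \<sigma>'" "\<sigma>' \<in> T2'" by (rule imageE)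
      have "\<sigma> = q ` lift \<sigma>" by (rule sym[OF q_lift[OF not_sub(2)[OF \<sigma> assms(2)]]])
      also have "\<dots> = \<sigma>'" unfolding \<sigma>'(1) by (rule q_lift[OF not_sub(2)[OF \<sigma>'(2) assms(4)]])
      finally show "\<sigma> \<in> T2'" using \<sigma>'(2) by simp
    qed
  qed
qed (auto simp: merge_def)

text \<open>Acyclicity of \<open>T\<close> is used twice. A member disjoint from
  \<open>\<tau>\<close> cannot have elements both below and above \<open>\<tau>\<close>, as this
  would be a cycle of length two, so its projection is a pipe. And an edge of the contracted digraph
  comes from an edge of the old one or from a path of two edges with \<open>\<tau>\<close> in the
  middle, so old ranks still increase.\<close>

lemma split_proper_piping:
  assumes T: "T \<in> proper_pipings r" "\<tau> \<in> T"
  shows "{\<sigma> \<in> T. \<sigma> \<subset> \<tau>} \<in> proper_pipings r\<tau>" (is "?T1 \<in> _")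
    and "(`) q ` {\<sigma> \<in> T. \<not> \<sigma> \<subseteq> \<tau>} \<in> proper_pipings r'" (is "?T2 \<in> _")
    and "merge ({\<sigma> \<in> T. \<sigma> \<subset> \<tau>}, (`) q ` {\<sigma> \<in> T. \<not> \<sigma> \<subseteq> \<tau>}) = T"
proof -
  have P: "piping r T" "\<And>\<sigma>. \<sigma> \<in> T \<Longrightarrow> pipe r \<sigma> \<and> 1 < card \<sigma> \<and> card \<sigma> < card (Field r)"
    using T by (auto simp: proper_pipings_def proper_pipes_def)
  have "piping r ?T1" by (rule piping_mono[OF P(1)]) blast
  then show "?T1 \<in> proper_pipings r\<tau>"
    unfolding proper_pipings_def piping_restrict using P(2) proper_pipes_restrict by auto
  let ?U = "{\<sigma> \<in> T. \<not> \<sigma> \<subseteq> \<tau>}"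
  have U: "\<sigma> \<in> T" "pipe r \<sigma>" "\<sigma> \<subseteq> Field r" "\<tau> \<subseteq> \<sigma> \<or> \<sigma> \<inter> \<tau> = {}" "\<not> \<sigma> \<subseteq> \<tau>" if "\<sigma> \<in> ?U" for \<sigma>
    using that P(2)[of \<sigma>] pipe_subset[of r \<sigma>] piping_laminar[OF P(1) _ T(2), of \<sigma>] by blast+
  obtain h :: "'p set \<Rightarrow> nat" where h: "\<And>\<sigma> \<sigma>'. (\<sigma>, \<sigma>') \<in> piping_digraph r T \<Longrightarrow> h \<sigma> < h \<sigma>'"
    by (rule acyclic_rank[OF piping_acyclic[OF P(1)] piping_digraph_Times finite_pipings[OF P(1)]]) (rule that)
  have edge: "h \<sigma> < h \<sigma>'" if "\<sigma> \<in> T" "\<sigma>' \<in> T" "\<sigma> \<inter> \<sigma>' = {}" "(i, j) \<in> r" "i \<in> \<sigma>" "j \<in> \<sigma>'" for \<sigma> \<sigma>' i j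
  proof (rule h)
    have "i \<noteq> j" using that by blast
    then show "(\<sigma>, \<sigma>') \<in> piping_digraph r T" using that by (auto simp: piping_digraph_def prec_iff)
  qed
  have lq: "lift (q ` \<sigma>) = \<sigma>" if "\<sigma> \<in> ?U" for \<sigma> by (rule lift_q[OF U(3,4)[OF that]])
  have proj: "pipe r' (q ` \<sigma>)" if \<sigma>: "\<sigma> \<in> ?U" for \<sigma>
  proof (rule pipe_project[OF U(2)[OF \<sigma>]])
    have "\<not> ((\<exists>i\<in>\<sigma>. below_\<tau> i) \<and> (\<exists>j\<in>\<sigma>. above_\<tau> j))" if "\<sigma> \<inter> \<tau> = {}"
    proof
      assume "(\<exists>i\<in>\<sigma>. below_\<tau> i) \<and> (\<exists>j\<in>\<sigma>. above_\<tau> j)"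
      then obtain i j a b where "i \<in> \<sigma>" "a \<in> \<tau>" "(i, a) \<in> r" "j \<in> \<sigma>" "b \<in> \<tau>" "(b, j) \<in> r"
        unfolding below_\<tau>_def above_\<tau>_def by blast
      then have "h \<sigma> < h \<tau>" "h \<tau> < h \<sigma>"
        using edge[OF U(1)[OF \<sigma>] T(2) that] edge[OF T(2) U(1)[OF \<sigma>]] that by blast+
      then show False by simp
    qed
    then show "\<tau> \<subseteq> \<sigma> \<or> \<sigma> \<inter> \<tau> = {} \<and> \<not> ((\<exists>i\<in>\<sigma>. below_\<tau> i) \<and> (\<exists>j\<in>\<sigma>. above_\<tau> j))"
      using U(4)[OF \<sigma>] by blast
  qed
  have disj: "q ` \<sigma> \<inter> q ` \<sigma>' = {}" if "\<sigma> \<in> ?U" "\<sigma>' \<in> ?U" "\<sigma> \<inter> \<sigma>' = {}" for \<sigma> \<sigma>'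
  proof (rule ccontr)
    assume "\<not> ?thesis"
    then obtain x y where "x \<in> \<sigma>" "y \<in> \<sigma>'" "q x = q y" by auto
    then have "x \<in> \<tau>" "y \<in> \<tau>" "x \<in> \<sigma>" "y \<in> \<sigma>'" using q_eq_iff that(3) by blast+
    then have "\<tau> \<subseteq> \<sigma>" "\<tau> \<subseteq> \<sigma>'" using U(4)[OF that(1)] U(4)[OF that(2)] by blast+
    then show False using that(3) t_in by blast
  qed
  have "piping r' ?T2"
  proof (rule pipingI)
    show "pipe r' \<rho>" if "\<rho> \<in> ?T2" for \<rho> using that proj by blast
    show "\<rho> \<subseteq> \<rho>' \<or> \<rho>' \<subseteq> \<rho> \<or> \<rho> \<inter> \<rho>' = {}" if \<rho>: "\<rho> \<in> ?T2" "\<rho>' \<in> ?T2" for \<rho> \<rho>'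
    proof -
      obtain \<sigma> \<sigma>' where \<sigma>: "\<sigma> \<in> ?U" "\<sigma>' \<in> ?U" "\<rho> = q ` \<sigma>" "\<rho>' = q ` \<sigma>'" using \<rho> by blast
      have "\<sigma> \<subseteq> \<sigma>' \<or> \<sigma>' \<subseteq> \<sigma> \<or> \<sigma> \<inter> \<sigma>' = {}"
        by (rule piping_laminar[OF P(1) U(1)[OF \<sigma>(1)] U(1)[OF \<sigma>(2)]])
      then show ?thesis using disj[OF \<sigma>(1,2)] unfolding \<sigma>(3,4) by (meson image_mono)
    qed
    show "acyclic (piping_digraph r' ?T2)"
    proof (rule acyclic_if_rank)
      fix \<rho> \<rho>' assume "(\<rho>, \<rho>') \<in> piping_digraph r' ?T2"
      then obtain s s' where e: "\<rho> \<in> ?T2" "\<rho>' \<in> ?T2" "\<rho> \<inter> \<rho>' = {}" "s \<in> \<rho>" "s' \<in> \<rho>'" "(s, s') \<in> r'"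
        unfolding piping_digraph_def prec_def by blast
      then obtain \<sigma> \<sigma>' where \<sigma>: "\<sigma> \<in> ?U" "\<sigma>' \<in> ?U" "\<rho> = q ` \<sigma>" "\<rho>' = q ` \<sigma>'" by blast
      have lift: "lift \<rho> = \<sigma>" "lift \<rho>' = \<sigma>'" unfolding \<sigma>(3,4) using lq \<sigma>(1,2) by blast+
      have dj: "\<sigma> \<inter> \<sigma>' = {}" using e(3) unfolding \<sigma>(3,4) by blast
      \<comment> \<open>The sets in \<open>?U\<close> contain all of \<open>\<tau>\<close> or none
        of it, so their images under \<open>q\<close> are subsets of them.\<close>
      have mem: "x \<in> \<pi>" if "\<pi> \<in> ?U" "x \<in> q ` \<pi>" for \<pi> x
        using that(2) U(4)[OF that(1)] t_in by (auto simp: q_def split: if_splits)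
      have s: "s \<in> \<sigma>" "s' \<in> \<sigma>'" using mem[OF \<sigma>(1)] mem[OF \<sigma>(2)] e(4,5) unfolding \<sigma>(3,4) by blast+
      have "h \<sigma> < h \<sigma>'"
      proof (cases "(s, s') \<in> r")
        case True
        then show ?thesis using edge[OF U(1)[OF \<sigma>(1)] U(1)[OF \<sigma>(2)] dj] s by blast
      next
        case False
        then obtain a b where ab: "a \<in> \<tau>" "(s, a) \<in> r" "b \<in> \<tau>" "(b, s') \<in> r"
          using e(6) unfolding contract_iff below_\<tau>_def above_\<tau>_def by blast
        show ?thesis
        proof (cases "\<tau> \<subseteq> \<sigma> \<or> \<tau> \<subseteq> \<sigma>'")
          case True
          then show ?thesis using edge[OF U(1)[OF \<sigma>(1)] U(1)[OF \<sigma>(2)] dj] s ab by blast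
        next
          case False
          then have d: "\<sigma> \<inter> \<tau> = {}" "\<tau> \<inter> \<sigma>' = {}" using U(4)[OF \<sigma>(1)] U(4)[OF \<sigma>(2)] by blast+
          have "h \<sigma> < h \<tau>" using edge[OF U(1)[OF \<sigma>(1)] T(2) d(1) ab(2) s(1) ab(1)] .
          also have "h \<tau> < h \<sigma>'" using edge[OF T(2) U(1)[OF \<sigma>(2)] d(2) ab(4,3) s(2)] .
          finally show ?thesis .
        qed
      qed
      then show "h (lift \<rho>) < h (lift \<rho>')" unfolding lift .
    qed
  qed
  moreover have "?T2 \<subseteq> proper_pipes r'"
  proof
    fix \<rho> assume "\<rho> \<in> ?T2"
    then obtain \<sigma> where \<sigma>: "\<sigma> \<in> ?U" "\<rho> = q ` \<sigma>" by blast
    have fin: "finite \<sigma>" using U(2)[OF \<sigma>(1)] by (rule pipe_finite)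
    have "1 < card (q ` \<sigma>)"
    proof (cases "\<tau> \<subseteq> \<sigma>")
      case True
      obtain x where "x \<in> \<sigma>" "x \<notin> \<tau>" using U(5)[OF \<sigma>(1)] by blast
      then have "t \<noteq> x" "{t, x} \<subseteq> q ` \<sigma>" using True t_in by (auto simp: q_def image_iff)
      then show ?thesis using card_mono[of "q ` \<sigma>" "{t, x}"] fin by simp
    next
      case False
      then have "\<sigma> \<inter> \<tau> = {}" using U(4)[OF \<sigma>(1)] by blast
      then have "q ` \<sigma> = \<sigma>" by (force simp: q_def)
      then show ?thesis using P(2)[OF U(1)[OF \<sigma>(1)]] by simp
    qed
    moreover have "card (q ` \<sigma>) < card F'"
    proof (rule psubset_card_mono)
      have "q ` \<sigma> \<noteq> F'"
      proof
        assume "q ` \<sigma> = F'"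
        then have "lift F' = \<sigma>" using lq[OF \<sigma>(1)] by simp
        moreover have "lift F' = Field r" using q_in_F' by (auto simp: lift_def)
        ultimately show False using P(2)[OF U(1)[OF \<sigma>(1)]] by simp
      qed
      moreover have "q ` \<sigma> \<subseteq> F'" using U(3)[OF \<sigma>(1)] q_in_F' by blast
      ultimately show "q ` \<sigma> \<subset> F'" by blast
    qed (use finite_Field in simp)
    ultimately show "\<rho> \<in> proper_pipes r'"
      using proj[OF \<sigma>(1)] by (simp add: \<sigma>(2) proper_pipes_def Field_contract)
  qed
  ultimately show "?T2 \<in> proper_pipings r'" by (simp add: proper_pipings_def)
  have "lift ` ?T2 = ?U" using lq by (force simp: image_image)
  then show "merge (?T1, ?T2) = T" using T(2) by (auto simp: merge_def)
qed

text \<open>In topological terms, the link of \<open>\<tau>\<close> in the complex of proper pipings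
  is the join of the complexes of the restriction and of the contraction.\<close>

lemma bij_betw_merge:
  assumes "\<tau> \<in> proper_pipes r"
  shows "bij_betw merge (proper_pipings r\<tau> \<times> proper_pipings r') {T \<in> proper_pipings r. \<tau> \<in> T}"
  unfolding bij_betw_def
proof
  show "inj_on merge (proper_pipings r\<tau> \<times> proper_pipings r')"
  proof (rule inj_onI, clarify)
    fix T1 T2 T1' T2' assume T: "T1 \<in> proper_pipings r\<tau>" "T2 \<in> proper_pipings r'"
      "T1' \<in> proper_pipings r\<tau>" "T2' \<in> proper_pipings r'" "merge (T1, T2) = merge (T1', T2')"
    then show "T1 = T1' \<and> T2 = T2'"
      using merge_subset_iff[OF T(1-4)] merge_subset_iff[OF T(3,4,1,2)] by auto
  qed
  show "merge ` (proper_pipings r\<tau> \<times> proper_pipings r') = {T \<in> proper_pipings r. \<tau> \<in> T}"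
  proof (intro equalityI subsetI)
    fix T assume "T \<in> merge ` (proper_pipings r\<tau> \<times> proper_pipings r')"
    then obtain T1 T2 where "T = merge (T1, T2)" "T1 \<in> proper_pipings r\<tau>" "T2 \<in> proper_pipings r'" by auto
    then show "T \<in> {T \<in> proper_pipings r. \<tau> \<in> T}"
      using merge_proper_piping[OF assms] by (simp add: merge_def)
  next
    fix T assume "T \<in> {T \<in> proper_pipings r. \<tau> \<in> T}"
    then have T: "T \<in> proper_pipings r" "\<tau> \<in> T" by auto
    show "T \<in> merge ` (proper_pipings r\<tau> \<times> proper_pipings r')"
    proof (subst split_proper_piping(3)[OF T, symmetric], rule imageI)
      show "({\<sigma> \<in> T. \<sigma> \<subset> \<tau>}, (`) q ` {\<sigma> \<in> T. \<not> \<sigma> \<subseteq> \<tau>}) \<in> proper_pipings r\<tau> \<times> proper_pipings r'"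
        using split_proper_piping(1,2)[OF T] by simp
    qed
  qed
qed

text \<open>The nonempty faces of the facet correspond to the pipings containing
  \<open>\<tau>\<close>, hence to pairs of pipings, and these index the nonempty faces of the
  product.\<close>

lemma facet_product:
  fixes A A1 A2 :: "'a::euclidean_space set"
  assumes conn: "finite_connected_poset r" and \<tau>: "\<tau> \<in> proper_pipes r"
    and A: "poset_associahedron r A f" and A1: "poset_associahedron r\<tau> A1 f1" and A2: "poset_associahedron r' A2 f2"
  shows "combinatorially_equivalent (piping_face A f {\<tau>}) (A1 \<times> A2)"
proof -
  note faces = poset_associahedron_piping_face[OF conn A]
  note faces1 = poset_associahedron_piping_face[OF finite_connected_poset_restrict A1]
  note faces2 = poset_associahedron_piping_face[OF finite_connected_poset_contract[OF conn] A2]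
  let ?F = "piping_face A f {\<tau>}"
  let ?X = "proper_pipings r\<tau> \<times> proper_pipings r'"
  have \<tau>1: "{\<tau>} \<in> proper_pipings r" by (rule singleton_proper_piping[OF \<tau>])
  then have F: "?F face_of A" using bij_betwE[OF faces(4)] by (simp add: mem_nonempty_faces)
  have "piping_face A f ` {T \<in> proper_pipings r. \<tau> \<in> T} = nonempty_faces ?F"
  proof (intro equalityI subsetI)
    fix G assume "G \<in> piping_face A f ` {T \<in> proper_pipings r. \<tau> \<in> T}"
    then obtain T where "T \<in> proper_pipings r" "\<tau> \<in> T" "G = piping_face A f T" by blast
    then show "G \<in> nonempty_faces ?F"
      unfolding nonempty_faces_subset_iff[OF F] using bij_betwE[OF faces(4)] faces(5)[OF _ \<tau>1] by simp
  next
    fix G assume "G \<in> nonempty_faces ?F"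
    then have G: "G \<in> nonempty_faces A" "G \<subseteq> ?F" unfolding nonempty_faces_subset_iff[OF F] by auto
    then have "G \<in> piping_face A f ` proper_pipings r" using faces(4) unfolding bij_betw_def by blast
    then obtain T where "T \<in> proper_pipings r" "G = piping_face A f T" by blast
    then show "G \<in> piping_face A f ` {T \<in> proper_pipings r. \<tau> \<in> T}" using faces(5)[OF _ \<tau>1] G(2) by simp
  qed
  moreover have "inj_on (piping_face A f) {T \<in> proper_pipings r. \<tau> \<in> T}"
    using faces(4) unfolding bij_betw_def by (auto intro: inj_on_subset)
  ultimately have "bij_betw (piping_face A f) {T \<in> proper_pipings r. \<tau> \<in> T} (nonempty_faces ?F)"
    by (simp add: bij_betw_def)
  from bij_betw_trans[OF bij_betw_merge[OF \<tau>] this]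
  have bij: "bij_betw (piping_face A f \<circ> merge) ?X (nonempty_faces ?F)" .
  show ?thesis
  proof (rule combinatorially_equivalentI[OF _ _ bij bij_betw_nonempty_faces_Times(1)[OF faces1(4) faces2(4)]])
    show "polytope ?F" by (rule face_of_polytope_polytope[OF faces(1) F])
    show "polytope (A1 \<times> A2)" by (rule polytope_Times[OF faces1(1) faces2(1)])
    fix x y assume "x \<in> ?X" "y \<in> ?X"
    then obtain T1 T2 T1' T2' where xy: "x = (T1, T2)" "y = (T1', T2')" and
      T: "T1 \<in> proper_pipings r\<tau>" "T2 \<in> proper_pipings r'" "T1' \<in> proper_pipings r\<tau>" "T2' \<in> proper_pipings r'"
      by auto
    have "piping_face A f (merge x) \<subseteq> piping_face A f (merge y) \<longleftrightarrow> merge y \<subseteq> merge x"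
      unfolding xy by (rule faces(5)[OF merge_proper_piping[OF \<tau> T(1,2)] merge_proper_piping[OF \<tau> T(3,4)]])
    also have "\<dots> \<longleftrightarrow> T1' \<subseteq> T1 \<and> T2' \<subseteq> T2" unfolding xy by (rule merge_subset_iff[OF T(3,4,1,2)])
    also have "\<dots> \<longleftrightarrow> piping_face A1 f1 T1 \<subseteq> piping_face A1 f1 T1' \<and> piping_face A2 f2 T2 \<subseteq> piping_face A2 f2 T2'"
      using faces1(5)[OF T(1,3)] faces2(5)[OF T(2,4)] by simp
    also have "\<dots> \<longleftrightarrow> piping_face A1 f1 T1 \<times> piping_face A2 f2 T2 \<subseteq> piping_face A1 f1 T1' \<times> piping_face A2 f2 T2'"
      using bij_betw_nonempty_faces_Times(2)[OF faces1(4) faces2(4) T] by simp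
    finally show "(piping_face A f \<circ> merge) x \<subseteq> (piping_face A f \<circ> merge) y \<longleftrightarrow>
        (case x of (T1, T2) \<Rightarrow> piping_face A1 f1 T1 \<times> piping_face A2 f2 T2) \<subseteq>
        (case y of (T1, T2) \<Rightarrow> piping_face A1 f1 T1 \<times> piping_face A2 f2 T2)"
      unfolding xy by simp
  qed
qed

end

section \<open>Relabelling\<close>

text \<open>Restriction and contraction stay in the type \<open>'p\<close>, whereas the factors in
  (vi) are posets on \<open>nat\<close>; relabelling once at the start lets the whole recursion run
  on \<open>nat\<close>.\<close>

locale poset_relabelling = finite_poset r for r :: "'p rel" +
  fixes g :: "'p \<Rightarrow> 'q"
  assumes inj_g: "inj_on g (Field r)"
begin

abbreviation s :: "'q rel" where "s \<equiv> dir_image r g"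

lemma g_eq_iff: "i \<in> Field r \<Longrightarrow> j \<in> Field r \<Longrightarrow> g i = g j \<longleftrightarrow> i = j"
  using inj_on_eq_iff[OF inj_g] .

lemma prec_relabel: "prec s x y \<longleftrightarrow> (\<exists>i j. x = g i \<and> y = g j \<and> prec r i j)"
proof
  assume "prec s x y"
  then obtain i j where "x = g i" "y = g j" "(i, j) \<in> r" "x \<noteq> y" by (auto simp: prec_def dir_image_def)
  then show "\<exists>i j. x = g i \<and> y = g j \<and> prec r i j" by (auto simp: prec_def)
next
  assume "\<exists>i j. x = g i \<and> y = g j \<and> prec r i j"
  then obtain i j where *: "x = g i" "y = g j" "prec r i j" by blast
  then have "g i \<noteq> g j" using prec_Field[OF *(3)] g_eq_iff by (auto simp: prec_def)
  then show "prec s x y" using * by (auto simp: prec_def dir_image_def)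
qed

lemma prec_relabel_iff: "i \<in> Field r \<Longrightarrow> j \<in> Field r \<Longrightarrow> prec s (g i) (g j) \<longleftrightarrow> prec r i j"
  unfolding prec_relabel using g_eq_iff prec_Field by metis

lemma finite_poset_relabel: "finite_poset s"
proof
  show "Partial_order s" by (rule Partial_order_dir_image[OF partial_order inj_g])
  show "finite (Field s)" using finite_Field by (simp add: dir_image_Field)
qed

lemma pipe_relabel:
  assumes "pipe r \<sigma>" shows "pipe s (g ` \<sigma>)"
  unfolding finite_poset.pipe_iff[OF finite_poset_relabel]
proof (intro conjI)
  have \<sigma>: "\<sigma> \<noteq> {}" "\<sigma> \<subseteq> Field r" "poset_convex r \<sigma>" "cut_connected r \<sigma>"
    using assms by (auto simp: pipe_iff)
  show "g ` \<sigma> \<noteq> {}" using \<sigma>(1) by simp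
  show "g ` \<sigma> \<subseteq> Field s" using \<sigma>(2) by (auto simp: dir_image_Field)
  show "poset_convex s (g ` \<sigma>)"
    unfolding poset_convex_def
  proof (intro ballI allI impI)
    fix x z y assume "x \<in> g ` \<sigma>" "z \<in> g ` \<sigma>" and y: "prec s x y \<and> prec s y z"
    then obtain i k where ik: "x = g i" "z = g k" "i \<in> \<sigma>" "k \<in> \<sigma>" by blast
    obtain j where j: "y = g j" "j \<in> Field r" using y prec_relabel prec_Field by metis
    then have "prec r i j" "prec r j k" using y ik \<sigma>(2) prec_relabel_iff by auto
    then have "j \<in> \<sigma>" using poset_convexD[OF \<sigma>(3) ik(3,4)] by blast
    then show "y \<in> g ` \<sigma>" using j by blast
  qed
  show "cut_connected s (g ` \<sigma>)"
  proof (rule cut_connectedI)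
    fix X assume X: "X \<subseteq> g ` \<sigma>" "X \<noteq> {}"
      and cl: "\<And>x y. x \<in> X \<Longrightarrow> y \<in> g ` \<sigma> \<Longrightarrow> comparable s x y \<Longrightarrow> y \<in> X"
    have "{i \<in> \<sigma>. g i \<in> X} = \<sigma>"
    proof (rule cut_connectedD[OF \<sigma>(4)])
      show "{i \<in> \<sigma>. g i \<in> X} \<noteq> {}" using X by blast
      fix i j assume *: "i \<in> {i \<in> \<sigma>. g i \<in> X}" "j \<in> \<sigma>" "comparable r i j"
      then have "comparable s (g i) (g j)" using \<sigma>(2) prec_relabel by (auto simp: comparable_def)
      then show "j \<in> {i \<in> \<sigma>. g i \<in> X}" using cl[of "g i" "g j"] * by auto
    qed blast
    then show "g ` \<sigma> \<subseteq> X" by blast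
  qed
qed

lemma proper_pipes_relabel:
  assumes "\<sigma> \<in> proper_pipes r" shows "g ` \<sigma> \<in> proper_pipes s"
proof -
  have \<sigma>: "pipe r \<sigma>" "\<sigma> \<subseteq> Field r" using assms pipe_subset by (auto simp: proper_pipes_def)
  have "card (g ` \<sigma>) = card \<sigma>" "card (g ` Field r) = card (Field r)"
    using inj_g inj_on_subset[OF inj_g \<sigma>(2)] by (simp_all add: card_image)
  then show ?thesis using assms pipe_relabel[OF \<sigma>(1)] by (simp add: proper_pipes_def dir_image_Field)
qed

lemma proper_pipings_relabel:
  assumes "T \<in> proper_pipings r" shows "(`) g ` T \<in> proper_pipings s"
proof -
  let ?T = "(`) g ` T" and ?k = "(`) (inv_into (Field r) g)"
  have T: "piping r T" "T \<subseteq> proper_pipes r" using assms by (auto simp: proper_pipings_def)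
  have sub: "\<sigma> \<subseteq> Field r" if "\<sigma> \<in> T" for \<sigma> using that piping_pipe[OF T(1)] pipe_subset by blast
  have k: "?k (g ` \<sigma>) = \<sigma>" if "\<sigma> \<in> T" for \<sigma> by (rule inv_into_image_cancel[OF inj_g sub[OF that]])
  have disj: "g ` \<sigma> \<inter> g ` \<sigma>' = g ` (\<sigma> \<inter> \<sigma>')" if "\<sigma> \<in> T" "\<sigma>' \<in> T" for \<sigma> \<sigma>'
    by (rule inj_on_image_Int[OF inj_g sub[OF that(1)] sub[OF that(2)], symmetric])
  obtain h :: "'p set \<Rightarrow> nat" where h: "\<And>\<sigma> \<sigma>'. (\<sigma>, \<sigma>') \<in> piping_digraph r T \<Longrightarrow> h \<sigma> < h \<sigma>'"
    by (rule acyclic_rank[OF piping_acyclic[OF T(1)] piping_digraph_Times finite_pipings[OF T(1)]]) (rule that)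
  have "piping s ?T"
  proof (rule pipingI)
    show "pipe s \<rho>" if "\<rho> \<in> ?T" for \<rho> using that pipe_relabel piping_pipe[OF T(1)] by blast
    show "\<rho> \<subseteq> \<rho>' \<or> \<rho>' \<subseteq> \<rho> \<or> \<rho> \<inter> \<rho>' = {}" if \<rho>: "\<rho> \<in> ?T" "\<rho>' \<in> ?T" for \<rho> \<rho>'
    proof -
      obtain \<sigma> \<sigma>' where \<sigma>: "\<sigma> \<in> T" "\<sigma>' \<in> T" "\<rho> = g ` \<sigma>" "\<rho>' = g ` \<sigma>'" using \<rho> by blast
      show ?thesis
        using piping_laminar[OF T(1) \<sigma>(1,2)] disj[OF \<sigma>(1,2)] unfolding \<sigma>(3,4) by auto
    qed
    show "acyclic (piping_digraph s ?T)"
    proof (rule acyclic_if_rank)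
      fix \<rho> \<rho>' assume "(\<rho>, \<rho>') \<in> piping_digraph s ?T"
      then obtain x y where e: "\<rho> \<in> ?T" "\<rho>' \<in> ?T" "\<rho> \<inter> \<rho>' = {}" "x \<in> \<rho>" "y \<in> \<rho>'" "prec s x y"
        unfolding piping_digraph_def by blast
      then obtain \<sigma> \<sigma>' where \<sigma>: "\<sigma> \<in> T" "\<sigma>' \<in> T" "\<rho> = g ` \<sigma>" "\<rho>' = g ` \<sigma>'" by blast
      obtain i j where ij: "i \<in> \<sigma>" "j \<in> \<sigma>'" "x = g i" "y = g j" using e(4,5) \<sigma>(3,4) by blast
      have "i \<in> Field r" "j \<in> Field r" using ij(1,2) sub \<sigma>(1,2) by blast+
      then have "prec r i j" using e(6) ij(3,4) prec_relabel_iff by simp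
      moreover have "\<sigma> \<inter> \<sigma>' = {}" using e(3) disj[OF \<sigma>(1,2)] unfolding \<sigma>(3,4) by simp
      ultimately have "(\<sigma>, \<sigma>') \<in> piping_digraph r T"
        unfolding piping_digraph_def using \<sigma>(1,2) ij(1,2) by blast
      then show "h (?k \<rho>) < h (?k \<rho>')" unfolding \<sigma>(3,4) k[OF \<sigma>(1)] k[OF \<sigma>(2)] by (rule h)
    qed
  qed
  then show ?thesis using T(2) proper_pipes_relabel by (auto simp: proper_pipings_def)
qed

text \<open>Makes the inverse of \<open>g\<close> a relabelling from \<open>s\<close> back to
  \<open>r\<close>, so that surjectivity on pipings follows from the forward direction applied to
  it.\<close>

lemma relabel_inverse: "dir_image s (inv_into (Field r) g) = r"
proof -
  have "inv_into (Field r) g (g i) = i" if "i \<in> Field r" for i using inj_g that by simp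
  then have "(i, j) \<in> dir_image s (inv_into (Field r) g) \<longleftrightarrow> (i, j) \<in> r" for i j
    unfolding dir_image_def by (auto simp: Field_def) (metis Domain.DomainI Range.RangeI Un_iff)+
  then show ?thesis by auto
qed

lemma poset_relabelling_inverse: "poset_relabelling s (inv_into (Field r) g)"
proof -
  have "inj_on (inv_into (Field r) g) (Field s)" by (simp add: dir_image_Field inj_on_inv_into)
  then show ?thesis
    by (simp add: poset_relabelling_def poset_relabelling_axioms_def finite_poset_relabel)
qed

lemma proper_pipings_relabel_eq: "proper_pipings s = (\<lambda>T. (`) g ` T) ` proper_pipings r"
proof (intro equalityI subsetI)
  fix T assume T: "T \<in> proper_pipings s"
  let ?k = "inv_into (Field r) g"
  have inv: "(`) ?k ` T \<in> proper_pipings r"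
    using poset_relabelling.proper_pipings_relabel[OF poset_relabelling_inverse T] unfolding relabel_inverse .
  have "g ` ?k ` \<rho> = \<rho>" if "\<rho> \<in> T" for \<rho>
  proof -
    have "pipe s \<rho>" using T that by (auto simp: proper_pipings_def proper_pipes_def)
    then have "\<rho> \<subseteq> g ` Field r" using pipe_subset[of s \<rho>] by (simp add: dir_image_Field)
    then show ?thesis by (rule image_inv_into_cancel[OF refl])
  qed
  then have "(`) g ` (`) ?k ` T = T" by (simp add: image_image)
  then show "T \<in> (\<lambda>T. (`) g ` T) ` proper_pipings r" using inv by (intro image_eqI) auto
qed (use proper_pipings_relabel in blast)

lemma finite_connected_poset_relabel:
  assumes "finite_connected_poset r" "Field r \<noteq> {}" shows "finite_connected_poset s"
proof -
  have "pipe s (g ` Field r)" by (rule pipe_relabel[OF pipe_Field[OF assms]])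
  then have "cut_connected s (Field s)"
    using finite_poset.pipe_cut_connected[OF finite_poset_relabel] by (simp add: dir_image_Field)
  then show ?thesis using finite_poset_relabel by (simp add: finite_connected_poset_iff)
qed

text \<open>The polytope is unchanged; only the labels of its dual vertices are transported.\<close>

lemma poset_associahedron_relabel:
  fixes A :: "'a::euclidean_space set"
  assumes "poset_associahedron r A f"
  shows "poset_associahedron s A (f \<circ> (`) (inv_into (Field r) g))"
proof -
  let ?k = "(`) (inv_into (Field r) g)"
  obtain D where D: "simplicial_polytope D" "aff_dim D = int (card (Field r)) - 2" "0 \<in> rel_interior D"
    "simplicial_iso f (proper_pipings r) (boundary_complex D)" "A = polar_dual D"
    using assms unfolding poset_associahedron_def poset_associahedron_dual_def by blast
  have sub: "\<sigma> \<subseteq> Field r" if "\<sigma> \<in> proper_pipes r" for \<sigma>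
    using that pipe_subset by (auto simp: proper_pipes_def)
  have k: "?k (g ` \<sigma>) = \<sigma>" if "\<sigma> \<in> proper_pipes r" for \<sigma>
    by (rule inv_into_image_cancel[OF inj_g sub[OF that]])
  have U: "\<Union>(proper_pipings s) = (`) g ` proper_pipes r"
  proof -
    have "\<Union>(proper_pipings s) = (`) g ` \<Union>(proper_pipings r)"
      unfolding proper_pipings_relabel_eq by blast
    then show ?thesis by (simp add: Union_proper_pipings)
  qed
  have iso: "bij_betw f (proper_pipes r) (\<Union>(boundary_complex D)) \<and>
      boundary_complex D = (\<lambda>T. f ` T) ` proper_pipings r"
    using D(4) unfolding simplicial_iso_def Union_proper_pipings .
  note bij = iso[THEN conjunct1] and bc = iso[THEN conjunct2]
  have "bij_betw ?k ((`) g ` proper_pipes r) (proper_pipes r)"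
    by (rule bij_betw_byWitness[where f' = "(`) g"]) (use k in auto)
  then have "bij_betw (f \<circ> ?k) (\<Union>(proper_pipings s)) (\<Union>(boundary_complex D))"
    unfolding U using bij by (rule bij_betw_trans)
  moreover have "boundary_complex D = (\<lambda>T. (f \<circ> ?k) ` T) ` proper_pipings s"
  proof -
    have *: "(f \<circ> ?k) ` (`) g ` T = f ` T" if "T \<in> proper_pipings r" for T
    proof -
      have "\<sigma> \<in> T \<Longrightarrow> (f \<circ> ?k) (g ` \<sigma>) = f \<sigma>" for \<sigma> using that k by (auto simp: proper_pipings_def)
      then show ?thesis by (simp add: image_image)
    qed
    have "(\<lambda>T. (f \<circ> ?k) ` T) ` proper_pipings s =
        ((\<lambda>T. (f \<circ> ?k) ` T) \<circ> (\<lambda>T. (`) g ` T)) ` proper_pipings r"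
      unfolding proper_pipings_relabel_eq by (rule image_comp)
    also have "\<dots> = (\<lambda>T. f ` T) ` proper_pipings r"
    proof (rule image_cong[OF refl])
      fix T assume "T \<in> proper_pipings r"
      then show "((\<lambda>T. (f \<circ> ?k) ` T) \<circ> (\<lambda>T. (`) g ` T)) T = f ` T"
        using * unfolding o_apply[of "\<lambda>T. (f \<circ> ?k) ` T"] by blast
    qed
    finally show ?thesis using bc by simp
  qed
  ultimately have "simplicial_iso (f \<circ> ?k) (proper_pipings s) (boundary_complex D)"
    unfolding simplicial_iso_def by (intro conjI)
  moreover have "card (Field s) = card (Field r)" using inj_g by (simp add: dir_image_Field card_image)
  ultimately have "poset_associahedron_dual s D (f \<circ> ?k)"
    unfolding poset_associahedron_dual_def using D(1-3) by simp
  then show ?thesis unfolding poset_associahedron_def using D(5) by blast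
qed

end

section \<open>Faces as products of poset associahedra\<close>

text \<open>A face other than \<open>A\<close> lies in the facet of some proper pipe, which is a
  product of associahedra of two smaller posets; a face of a product is a product of faces of the
  factors, to which induction applies.\<close>

lemma face_associahedra_product_nat:
  fixes r :: "nat rel" and A F :: "'a::euclidean_space set"
  assumes "finite_connected_poset r" "2 \<le> card (Field r)" "poset_associahedron r A f"
    "F face_of A" "F \<noteq> {}"
  shows "\<exists>rs :: nat rel list. (\<forall>r'\<in>set rs. finite_connected_poset r' \<and> 2 \<le> card (Field r')) \<and>
    associahedra_product rs F"
  using assms
proof (induction "card (Field r)" arbitrary: r A f F rule: less_induct)
  case less
  interpret finite_poset r by (rule finite_poset_if_connected[OF less.prems(1)])
  note faces = poset_associahedron_piping_face[OF less.prems(1,3)]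
  have F: "F \<in> nonempty_faces A" using less.prems by (simp add: mem_nonempty_faces)
  then have "F \<in> piping_face A f ` proper_pipings r" using faces(4) unfolding bij_betw_def by blast
  then obtain T where T: "F = piping_face A f T" "T \<in> proper_pipings r" by (rule imageE)
  show ?case
  proof (cases "T = {}")
    case True
    then have "F = A" using T(1) faces(12) by simp
    \<comment> \<open>The list \<open>[r]\<close> stands for \<open>A\<close> times the empty
      product, which is a point.\<close>
    have "combinatorially_equivalent A (A \<times> {0 :: 'a})"
    proof -
      have "bij_betw (\<lambda>(x, y). x \<times> y) (nonempty_faces A \<times> {{0 :: 'a}}) (nonempty_faces (A \<times> {0 :: 'a}))"
        using bij_betw_nonempty_faces_Times(1)[OF bij_betw_ident bij_betw_ident[of "nonempty_faces {0 :: 'a}"]]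
        by (simp add: nonempty_faces_singleton)
      moreover have "bij_betw (\<lambda>G. (G, {0 :: 'a})) (nonempty_faces A) (nonempty_faces A \<times> {{0 :: 'a}})"
        by (rule bij_betw_byWitness[where f' = fst]) auto
      ultimately have "bij_betw (\<lambda>G. G \<times> {0 :: 'a}) (nonempty_faces A) (nonempty_faces (A \<times> {0 :: 'a}))"
        using bij_betw_trans by (fastforce simp: comp_def)
      then show ?thesis
        by (intro combinatorially_equivalentI[OF faces(1) _ bij_betw_ident])
          (auto simp: polytope_Times polytope_sing faces(1))
    qed
    then have "associahedra_product [r] F" using less.prems(3) \<open>F = A\<close> by auto
    then show ?thesis using less.prems(1,2) by (intro exI[of _ "[r]"]) simp
  next
    case False
    then obtain \<tau> where "\<tau> \<in> T" by blast
    then have \<tau>: "\<tau> \<in> proper_pipes r" using T(2) by (auto simp: proper_pipings_def)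
    then have pipe: "pipe r \<tau>" "1 < card \<tau>" "card \<tau> < card (Field r)" by (auto simp: proper_pipes_def)
    then obtain t where "t \<in> \<tau>" by fastforce
    then interpret poset_pipe r \<tau> t using pipe(1) by unfold_locales
    note conn1 = finite_connected_poset_restrict
    note conn2 = finite_connected_poset_contract[OF less.prems(1)]
    have card1: "2 \<le> card (Field r\<tau>)" "card (Field r\<tau>) < card (Field r)"
      using pipe by (simp_all add: Field_restrict)
    have card2: "2 \<le> card (Field r')" "card (Field r') < card (Field r)"
      using pipe(2,3) card_F' by (simp_all add: Field_contract)
    \<comment> \<open>Since \<open>A\<close> fits into \<open>'a\<close>, so do realizations of the
      two smaller posets.\<close>
    have "int (card (Field r)) - 2 \<le> int DIM('a)" using faces(2) aff_dim_le_DIM[of A] by simp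
    then have dim: "card (Field r) \<le> DIM('a) + 2" by linarith
    have "card (Field r\<tau>) \<le> DIM('a) + 2" "card (Field r') \<le> DIM('a) + 2"
      using card1(2) card2(2) dim by linarith+
    then obtain A1 A2 :: "'a set" and f1 f2
      where A1: "poset_associahedron r\<tau> A1 f1" and A2: "poset_associahedron r' A2 f2"
      using poset_associahedron_exists[where ?'a = 'a, OF conn1 card1(1)]
        poset_associahedron_exists[where ?'a = 'a, OF conn2 card2(1)] by metis
    have eq: "combinatorially_equivalent (piping_face A f {\<tau>}) (A1 \<times> A2)"
      by (rule facet_product[OF less.prems(1) \<tau> less.prems(3) A1 A2])
    have \<tau>1: "{\<tau>} \<in> proper_pipings r" by (rule singleton_proper_piping[OF \<tau>])
    have "F \<subseteq> piping_face A f {\<tau>}" using faces(5)[OF T(2) \<tau>1] \<open>\<tau> \<in> T\<close> by (simp add: T(1))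
    moreover have "piping_face A f {\<tau>} face_of A"
      using bij_betwE[OF faces(4)] \<tau>1 by (simp add: mem_nonempty_faces)
    ultimately have "F face_of piping_face A f {\<tau>}" using less.prems(4) by (simp add: face_of_face)
    then obtain G where G: "G face_of A1 \<times> A2" "G \<noteq> {}" "combinatorially_equivalent F G"
      by (rule combinatorially_equivalent_face[OF eq _ less.prems(5)]) (rule that)
    then obtain F1 F2 where F12: "F1 face_of A1" "F2 face_of A2" "G = F1 \<times> F2"
      unfolding face_of_Times_decomp by (elim exE conjE)
    then have ne: "F1 \<noteq> {}" "F2 \<noteq> {}" using G(2) by auto
    obtain rs1 :: "nat rel list" where rs1: "\<forall>r'\<in>set rs1. finite_connected_poset r' \<and> 2 \<le> card (Field r')"
      "associahedra_product rs1 F1"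
      using less.hyps[OF card1(2) conn1 card1(1) A1 F12(1) ne(1)] by blast
    obtain rs2 :: "nat rel list" where rs2: "\<forall>r'\<in>set rs2. finite_connected_poset r' \<and> 2 \<le> card (Field r')"
      "associahedra_product rs2 F2"
      using less.hyps[OF card2(2) conn2 card2(1) A2 F12(2) ne(2)] by blast
    have "associahedra_product (rs1 @ rs2) F"
      by (rule associahedra_product_append[OF rs1(2) rs2(2) G(3)[unfolded F12(3)]])
    then show ?thesis using rs1(1) rs2(1) by (intro exI[of _ "rs1 @ rs2"]) auto
  qed
qed

lemma face_associahedra_product:
  fixes r :: "'p rel" and A F :: "'a::euclidean_space set"
  assumes r: "finite_connected_poset r" "2 \<le> card (Field r)" and A: "poset_associahedron r A f"
    and F: "F face_of A" "F \<noteq> {}"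
  shows "\<exists>rs :: nat rel list. (\<forall>r'\<in>set rs. finite_connected_poset r' \<and> 2 \<le> card (Field r')) \<and>
    associahedra_product rs F"
proof -
  interpret finite_poset r by (rule finite_poset_if_connected[OF r(1)])
  obtain g :: "'p \<Rightarrow> nat" where "inj_on g (Field r)"
    using finite_imp_inj_to_nat_seg[OF finite_Field] by blast
  then interpret poset_relabelling r g by unfold_locales
  have "Field r \<noteq> {}" using r(2) by auto
  moreover have "card (Field s) = card (Field r)" using inj_g by (simp add: dir_image_Field card_image)
  ultimately show ?thesis
    using face_associahedra_product_nat[OF finite_connected_poset_relabel[OF r(1)] _
        poset_associahedron_relabel[OF A] F] r(2) by simp
qed

section \<open>A poset associahedron whose dual is not flag\<close>

context finite_poset
begin

lemma piping_two_disjoint: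
  assumes "pipe r \<sigma>" "pipe r \<sigma>'" "\<sigma> \<inter> \<sigma>' = {}" "\<And>i j. i \<in> \<sigma>' \<Longrightarrow> j \<in> \<sigma> \<Longrightarrow> \<not> prec r i j"
  shows "piping r {\<sigma>, \<sigma>'}"
proof (rule pipingI)
  show "acyclic (piping_digraph r {\<sigma>, \<sigma>'})"
  proof (rule acyclic_if_rank)
    fix \<rho> \<rho>' assume "(\<rho>, \<rho>') \<in> piping_digraph r {\<sigma>, \<sigma>'}"
    then have *: "\<rho> \<in> {\<sigma>, \<sigma>'}" "\<rho>' \<in> {\<sigma>, \<sigma>'}" "\<rho> \<inter> \<rho>' = {}" "\<exists>i\<in>\<rho>. \<exists>j\<in>\<rho>'. prec r i j"
      by (auto simp: piping_digraph_def)
    then have "\<rho> = \<sigma>" "\<rho>' \<noteq> \<sigma>" using assms(3,4) by blast+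
    then show "(if \<rho> = \<sigma> then 0 else 1 :: nat) < (if \<rho>' = \<sigma> then 0 else 1)" by simp
  qed
qed (use assms in auto)

end

text \<open>The elements 0, 1, 2 are minimal, 3, 4, 5 are maximal, and the Hasse diagram is a
  hexagon.\<close>

definition crown_edges :: "nat rel" where
  "crown_edges = {(0, 3), (0, 4), (1, 4), (1, 5), (2, 5), (2, 3)}"

definition crown :: "nat rel" where
  "crown = Id_on {0, 1, 2, 3, 4, 5} \<union> crown_edges"

lemma Field_crown: "Field crown = {0, 1, 2, 3, 4, 5}"
  by (auto simp: crown_def crown_edges_def Field_def)

lemma prec_crown: "prec crown i j \<longleftrightarrow> (i, j) \<in> crown_edges"
  by (auto simp: prec_def crown_def crown_edges_def)

lemma finite_poset_crown: "finite_poset crown"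
proof
  have "refl_on (Field crown) crown" unfolding Field_crown by (auto simp: refl_on_def crown_def crown_edges_def)
  moreover have "trans crown" by (rule transI) (auto simp: crown_def crown_edges_def)
  moreover have "antisym crown" by (rule antisymI) (auto simp: crown_def crown_edges_def)
  moreover have "crown \<subseteq> Field crown \<times> Field crown" by (auto simp: Field_def)
  ultimately show "Partial_order crown" by (simp add: partial_order_on_def preorder_on_def)
  show "finite (Field crown)" by (simp add: Field_crown)
qed

lemma finite_connected_poset_crown: "finite_connected_poset crown"
  unfolding finite_connected_poset_iff
proof (intro conjI finite_poset_crown cut_connectedI)
  fix X :: "nat set" assume X: "X \<subseteq> Field crown" "X \<noteq> {}"
    and cl: "\<And>i j. i \<in> X \<Longrightarrow> j \<in> Field crown \<Longrightarrow> comparable crown i j \<Longrightarrow> j \<in> X"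
  have iff: "i \<in> X \<longleftrightarrow> j \<in> X" if "(i, j) \<in> crown_edges" for i j
  proof -
    have "i \<in> Field crown" "j \<in> Field crown" using that by (auto simp: crown_edges_def Field_crown)
    then show ?thesis using cl[of i j] cl[of j i] that by (auto simp: comparable_def prec_crown)
  qed
  have "0 \<in> X \<longleftrightarrow> 3 \<in> X" "0 \<in> X \<longleftrightarrow> 4 \<in> X" "1 \<in> X \<longleftrightarrow> 4 \<in> X" "1 \<in> X \<longleftrightarrow> 5 \<in> X" "2 \<in> X \<longleftrightarrow> 5 \<in> X"
    by (rule iff; simp add: crown_edges_def)+
  then show "Field crown \<subseteq> X" using X unfolding Field_crown by blast
qed

lemma proper_pipe_crown:
  assumes "(i, j) \<in> crown_edges" shows "{i, j} \<in> proper_pipes crown"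
proof -
  interpret finite_poset crown by (rule finite_poset_crown)
  have "covered_by crown i j" using assms by (auto simp: covered_by_def prec_crown crown_edges_def)
  then have "pipe crown {i, j}" by (rule pipe_cover)
  moreover have "i \<noteq> j" using assms by (auto simp: crown_edges_def)
  ultimately show ?thesis by (simp add: proper_pipes_def Field_crown)
qed

text \<open>The perfect matching \<open>{0, 3}\<close>, \<open>{1, 4}\<close>, \<open>{2, 5}\<close>
  of the hexagon consists of disjoint pipes. Any two of them are joined in one direction only and
  hence form a piping, but the three directions make up a cycle.\<close>

lemma crown_not_flag:
  fixes A :: "'a::euclidean_space set"
  assumes "poset_associahedron crown A f"
  shows "\<not> flag_complex (boundary_complex (polar_dual A))"
proof
  assume flag: "flag_complex (boundary_complex (polar_dual A))"
  interpret finite_poset crown by (rule finite_poset_crown)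
  note faces = poset_associahedron_piping_face[OF finite_connected_poset_crown assms]
  let ?T = "{{0, 3}, {1, 4}, {2, 5}} :: nat set set"
  have T: "?T \<subseteq> proper_pipes crown"
    using proper_pipe_crown[of 0 3] proper_pipe_crown[of 1 4] proper_pipe_crown[of 2 5]
    by (simp add: crown_edges_def)
  have pipes: "pipe crown {0, 3}" "pipe crown {1, 4}" "pipe crown {2, 5}"
    using T by (simp_all add: proper_pipes_def)
  have "piping crown {{0, 3}, {1, 4}}"
    by (rule piping_two_disjoint[OF pipes(1,2)]) (auto simp: prec_crown crown_edges_def)
  moreover have "piping crown {{1, 4}, {2, 5}}"
    by (rule piping_two_disjoint[OF pipes(2,3)]) (auto simp: prec_crown crown_edges_def)
  moreover have "piping crown {{2, 5}, {0, 3}}"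
    by (rule piping_two_disjoint[OF pipes(3,1)]) (auto simp: prec_crown crown_edges_def)
  ultimately have piping: "piping crown {\<sigma>, \<sigma>'}" if "\<sigma> \<in> ?T" "\<sigma>' \<in> ?T" "\<sigma> \<noteq> \<sigma>'" for \<sigma> \<sigma>'
    using that by (elim insertE emptyE) (simp_all add: insert_commute)
  have pairs: "{\<sigma>, \<sigma>'} \<in> proper_pipings crown" if "\<sigma> \<in> ?T" "\<sigma>' \<in> ?T" "\<sigma> \<noteq> \<sigma>'" for \<sigma> \<sigma>'
    using piping[OF that] subsetD[OF T that(1)] subsetD[OF T that(2)] by (simp add: proper_pipings_def)
  have "f ` ?T \<in> boundary_complex (polar_dual A)"
  proof (rule flag[unfolded flag_complex_def, rule_format], intro conjI ballI impI)
    have "f ` {\<sigma>} \<in> boundary_complex (polar_dual A)" if "\<sigma> \<in> ?T" for \<sigma>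
      unfolding faces(10) using singleton_proper_piping T that by blast
    then show "f ` ?T \<subseteq> \<Union>(boundary_complex (polar_dual A))" by blast
    fix u v assume uv: "u \<in> f ` ?T" "v \<in> f ` ?T" "u \<noteq> v"
    obtain \<sigma> where \<sigma>: "u = f \<sigma>" "\<sigma> \<in> ?T" using uv(1) by (rule imageE)
    obtain \<sigma>' where \<sigma>': "v = f \<sigma>'" "\<sigma>' \<in> ?T" using uv(2) by (rule imageE)
    have "\<sigma> \<noteq> \<sigma>'" using uv(3) \<sigma>(1) \<sigma>'(1) by metis
    then have "f ` {\<sigma>, \<sigma>'} \<in> (\<lambda>T. f ` T) ` proper_pipings crown" by (intro imageI pairs[OF \<sigma>(2) \<sigma>'(2)])
    then show "{u, v} \<in> boundary_complex (polar_dual A)"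
      unfolding faces(10) \<sigma>(1) \<sigma>'(1) image_insert image_empty .
  qed
  then obtain T where T': "f ` ?T = f ` T" "T \<in> proper_pipings crown" unfolding faces(10) by (rule imageE)
  then have "T \<subseteq> proper_pipes crown" by (simp add: proper_pipings_def)
  then have "?T = T" using inj_on_image_eq_iff[OF faces(11) T, of T] T'(1) by (metis)
  then have "acyclic (piping_digraph crown ?T)" using T'(2) by (simp add: proper_pipings_def piping_def)
  moreover have "({0, 3}, {1, 4}) \<in> piping_digraph crown ?T" "({1, 4}, {2, 5}) \<in> piping_digraph crown ?T"
    "({2, 5}, {0, 3}) \<in> piping_digraph crown ?T"
    by (auto simp: piping_digraph_def prec_crown crown_edges_def)
  then have "({0, 3}, {0, 3}) \<in> (piping_digraph crown ?T)\<^sup>+" by (meson trancl.r_into_trancl trancl_into_trancl)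
  ultimately show False unfolding acyclic_def by blast
qed

section \<open>Claws and permutohedra\<close>

text \<open>Sums are doubled to avoid division by two. Removing the maximum, which is at least
  \<open>card A\<close>, reduces to a smaller set, and equality forces the maximum to be
  \<open>card A\<close> at each stage.\<close>

lemma two_times_sum_ge:
  fixes A :: "nat set"
  assumes "finite A" "0 \<notin> A"
  shows "card A * (card A + 1) \<le> 2 * \<Sum>A"
    and "2 * \<Sum>A = card A * (card A + 1) \<Longrightarrow> A = {1..card A}"
proof -
  have "card A * (card A + 1) \<le> 2 * \<Sum>A \<and> (2 * \<Sum>A = card A * (card A + 1) \<longrightarrow> A = {1..card A})"
    using assms
  proof (induction "card A" arbitrary: A)
    case 0
    then show ?case by simp
  next
    case (Suc n)
    define M where "M = Max A"
    have "A \<noteq> {}" using Suc by auto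
    then have M: "M \<in> A" "A \<subseteq> {1..M}" using Suc.prems unfolding M_def
      by (auto simp: Suc_le_eq intro!: Max_in gr0I)
    let ?B = "A - {M}"
    have cB: "card ?B = n" using M(1) Suc by simp
    then have IH: "n * (n + 1) \<le> 2 * \<Sum>?B" "2 * \<Sum>?B = n * (n + 1) \<Longrightarrow> ?B = {1..n}"
      using Suc.hyps(1)[of ?B] Suc.prems by auto
    have sum: "\<Sum>A = M + \<Sum>?B" using M(1) Suc.prems by (simp add: sum.remove)
    have "Suc n \<le> M" using card_mono[OF _ M(2)] Suc.hyps(2) by simp
    then have le: "card A * (card A + 1) \<le> 2 * \<Sum>A"
      using IH(1) sum by (simp add: Suc.hyps(2)[symmetric])
    moreover have "A = {1..card A}" if "2 * \<Sum>A = card A * (card A + 1)"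
    proof -
      have "2 * M + 2 * \<Sum>?B = n * (n + 1) + 2 * Suc n" using that sum by (simp add: Suc.hyps(2)[symmetric])
      moreover define a b where "a = n * (n + 1)" and "b = \<Sum>?B"
      ultimately have ab: "2 * M + 2 * b = a + 2 * Suc n" "a \<le> 2 * b" using IH(1) by simp_all
      then have M_eq: "M = Suc n" using \<open>Suc n \<le> M\<close> by presburger
      then have "2 * b = a" using ab(1) by presburger
      then have "2 * \<Sum>?B = n * (n + 1)" by (simp only: a_def b_def)
      then have "A = insert (Suc n) {1..n}" using IH(2) M(1) M_eq by blast
      then show ?thesis by (simp add: Suc.hyps(2)[symmetric] atLeastAtMostSuc_conv)
    qed
    ultimately show ?case by blast
  qed
  then show "card A * (card A + 1) \<le> 2 * \<Sum>A"
    and "2 * \<Sum>A = card A * (card A + 1) \<Longrightarrow> A = {1..card A}" by blast+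
qed

text \<open>Turns an injective key \<open>\<kappa>\<close> into the permutation that sorts by
  it.\<close>

definition rank_of :: "('k::finite \<Rightarrow> nat) \<Rightarrow> 'k \<Rightarrow> nat" where
  "rank_of \<kappa> i = card {j. \<kappa> j \<le> \<kappa> i}"

lemma rank_of_less_iff: "rank_of \<kappa> i < rank_of \<kappa> j \<longleftrightarrow> \<kappa> i < \<kappa> j"
proof
  assume "\<kappa> i < \<kappa> j"
  then have "{k. \<kappa> k \<le> \<kappa> i} \<subseteq> {k. \<kappa> k \<le> \<kappa> j}" "j \<in> {k. \<kappa> k \<le> \<kappa> j}" "j \<notin> {k. \<kappa> k \<le> \<kappa> i}"
    by auto
  then have "{k. \<kappa> k \<le> \<kappa> i} \<subset> {k. \<kappa> k \<le> \<kappa> j}" by blast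
  then show "rank_of \<kappa> i < rank_of \<kappa> j" unfolding rank_of_def by (intro psubset_card_mono) auto
next
  assume "rank_of \<kappa> i < rank_of \<kappa> j"
  then show "\<kappa> i < \<kappa> j"
  proof (rule contrapos_pp)
    assume "\<not> \<kappa> i < \<kappa> j"
    then have "{k. \<kappa> k \<le> \<kappa> j} \<subseteq> {k. \<kappa> k \<le> \<kappa> i}" by auto
    then show "\<not> rank_of \<kappa> i < rank_of \<kappa> j"
      unfolding rank_of_def using card_mono[of "{k. \<kappa> k \<le> \<kappa> i}"] by (simp add: not_less)
  qed
qed

lemma rank_of_bounds: "1 \<le> rank_of \<kappa> i" "rank_of \<kappa> (i :: 'k::finite) \<le> CARD('k)"
proof -
  have "card {i} \<le> rank_of \<kappa> i" unfolding rank_of_def by (intro card_mono) auto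
  then show "1 \<le> rank_of \<kappa> i" by simp
  show "rank_of \<kappa> i \<le> CARD('k)" unfolding rank_of_def by (intro card_mono) auto
qed

lemma inj_rank_of: "inj \<kappa> \<Longrightarrow> inj (rank_of \<kappa>)"
proof (rule injI)
  fix i j assume "inj \<kappa>" "rank_of \<kappa> i = rank_of \<kappa> j"
  then have "\<kappa> i = \<kappa> j" using rank_of_less_iff[of \<kappa> i j] rank_of_less_iff[of \<kappa> j i] by simp
  then show "i = j" using \<open>inj \<kappa>\<close> by (simp add: inj_eq)
qed

lemma bij_betw_rank_of: "inj \<kappa> \<Longrightarrow> bij_betw (rank_of \<kappa>) (UNIV :: 'k::finite set) {1..CARD('k)}"
proof -
  assume "inj \<kappa>"
  then have "inj (rank_of \<kappa>)" by (rule inj_rank_of)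
  moreover have "range (rank_of \<kappa>) \<subseteq> {1..CARD('k)}" using rank_of_bounds[of \<kappa>] by auto
  ultimately show ?thesis
    unfolding bij_betw_def by (intro conjI card_subset_eq) (auto simp: card_image)
qed

text \<open>Tells at which sets the permutation sorting by \<open>\<kappa>\<close> will be tight,
  namely the initial segments of the order given by \<open>\<kappa>\<close>.\<close>

lemma rank_of_image_iff:
  assumes "inj \<kappa>"
  shows "rank_of \<kappa> ` S = {1..card S} \<longleftrightarrow> (\<forall>i\<in>S. \<forall>j. j \<notin> S \<longrightarrow> \<kappa> i < \<kappa> j)"
proof
  assume L: "rank_of \<kappa> ` S = {1..card S}"
  show "\<forall>i\<in>S. \<forall>j. j \<notin> S \<longrightarrow> \<kappa> i < \<kappa> j"
  proof (intro ballI allI impI)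
    fix i j assume "i \<in> S" "j \<notin> S"
    then have "rank_of \<kappa> i \<le> card S" using L by (metis atLeastAtMost_iff imageI)
    moreover have "rank_of \<kappa> j \<notin> rank_of \<kappa> ` S" using \<open>j \<notin> S\<close> inj_rank_of[OF assms] by (simp add: inj_image_mem_iff)
    then have "card S < rank_of \<kappa> j" using L rank_of_bounds(1)[of \<kappa> j] by simp
    ultimately show "\<kappa> i < \<kappa> j" using rank_of_less_iff[of \<kappa> i j] by simp
  qed
next
  have card: "card (rank_of \<kappa> ` S) = card S"
    using inj_rank_of[OF assms] by (simp add: card_image inj_on_subset)
  assume R: "\<forall>i\<in>S. \<forall>j. j \<notin> S \<longrightarrow> \<kappa> i < \<kappa> j"
  have "rank_of \<kappa> i \<le> card S" if "i \<in> S" for i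
  proof -
    have "{j. \<kappa> j \<le> \<kappa> i} \<subseteq> S" using R that by (auto simp: not_less[symmetric])
    then show ?thesis unfolding rank_of_def by (intro card_mono) auto
  qed
  then have "rank_of \<kappa> ` S \<subseteq> {1..card S}" using rank_of_bounds(1)[of \<kappa>] by auto
  then show "rank_of \<kappa> ` S = {1..card S}" using card by (intro card_subset_eq) auto
qed

section \<open>The permutohedron as the solution set of inequalities\<close>

definition tri :: "nat \<Rightarrow> real" where "tri m = real (m * (m + 1)) / 2"

definition coord_sum :: "'k::finite set \<Rightarrow> real ^ 'k \<Rightarrow> real" where
  "coord_sum S x = (\<Sum>i\<in>S. x $ i)"

definition indicator_vec :: "'k::finite set \<Rightarrow> real ^ 'k" where
  "indicator_vec S = (\<chi> i. if i \<in> S then 1 else 0)"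

definition proper_sets :: "'k::finite set set" where
  "proper_sets = {S. S \<noteq> {} \<and> S \<noteq> UNIV}"

definition proper_chains :: "'k::finite set set set" where
  "proper_chains = {\<C>. \<C> \<subseteq> proper_sets \<and> (\<forall>S\<in>\<C>. \<forall>S'\<in>\<C>. S \<subseteq> S' \<or> S' \<subseteq> S)}"

definition perm_vec :: "('k::finite \<Rightarrow> nat) \<Rightarrow> real ^ 'k" where
  "perm_vec \<sigma> = (\<chi> i. real (\<sigma> i))"

lemma inner_indicator_vec: "indicator_vec S \<bullet> x = coord_sum S x"
proof -
  have "indicator_vec S \<bullet> x = (\<Sum>i\<in>UNIV. if i \<in> S then x $ i else 0)"
    unfolding inner_vec_def indicator_vec_def by (intro sum.cong) auto
  then show ?thesis by (simp add: coord_sum_def sum.If_cases)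
qed

text \<open>The classical facet description: the coordinates in \<open>S\<close> sum to at least the
  triangular number of \<open>card S\<close>, with equality for the set of all coordinates. Signs
  are flipped to fit upper bounds. The fixed total makes the ambient space an affine hyperplane off
  the origin, so the locale without polarity is used.\<close>

interpretation perm: inequality_system "{x :: real ^ 'k::finite. indicator_vec UNIV \<bullet> x = tri (CARD('k))}"
  proper_sets "\<lambda>S. - indicator_vec S" "\<lambda>S. - tri (card S)"
  by unfold_locales (auto simp: affine_hyperplane)

lemma perm_sol_iff:
  "x \<in> perm.sol \<longleftrightarrow> coord_sum UNIV x = tri (CARD('k)) \<and> (\<forall>S. tri (card S) \<le> coord_sum S x)"
  for x :: "real ^ 'k::finite"
proof -
  have iff: "x \<in> perm.sol \<longleftrightarrow> coord_sum UNIV x = tri (CARD('k)) \<and>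
      (\<forall>S\<in>proper_sets. tri (card S) \<le> coord_sum S x)"
    unfolding perm.sol_def by (simp add: inner_indicator_vec)
  have all: "tri (card S) \<le> coord_sum S x"
    if "coord_sum UNIV x = tri (CARD('k))" "\<forall>S\<in>proper_sets. tri (card S) \<le> coord_sum S x" for S
  proof -
    consider "S = {}" | "S = UNIV" | "S \<in> proper_sets" by (auto simp: proper_sets_def)
    then show ?thesis using that by cases (simp_all add: coord_sum_def tri_def)
  qed
  show ?thesis unfolding iff using all by blast
qed

lemma perm_tight_iff: "S \<in> perm.tight x \<longleftrightarrow> S \<in> proper_sets \<and> coord_sum S x = tri (card S)"
  by (simp add: perm.tight_def inner_indicator_vec)

text \<open>The values of \<open>\<sigma>\<close> on \<open>S\<close> are distinct positive
  integers, so their sum is least exactly when they are the first \<open>card S\<close> of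
  them.\<close>

lemma coord_sum_perm_vec:
  assumes "bij_betw \<sigma> (UNIV :: 'k::finite set) {1..CARD('k)}"
  shows "tri (card S) \<le> coord_sum S (perm_vec \<sigma>)"
    and "coord_sum S (perm_vec \<sigma>) = tri (card S) \<longleftrightarrow> \<sigma> ` S = {1..card S}"
proof -
  have inj: "inj_on \<sigma> S" using assms unfolding bij_betw_def by (auto intro: inj_on_subset)
  have card: "card (\<sigma> ` S) = card S" by (rule card_image[OF inj])
  have "\<sigma> i \<in> {1..CARD('k)}" for i using bij_betwE[OF assms] by blast
  then have "\<sigma> i \<noteq> 0" for i by (metis atLeastAtMost_iff not_one_le_zero)
  then have A: "finite (\<sigma> ` S)" "0 \<notin> \<sigma> ` S" by (simp, metis imageE)
  have sum: "2 * coord_sum S (perm_vec \<sigma>) = real (2 * \<Sum>(\<sigma> ` S))"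
    by (simp add: coord_sum_def perm_vec_def sum.reindex[OF inj])
  have tri: "2 * tri (card S) = real (card (\<sigma> ` S) * (card (\<sigma> ` S) + 1))" by (simp add: tri_def card)
  show "tri (card S) \<le> coord_sum S (perm_vec \<sigma>)"
    using two_times_sum_ge(1)[OF A] sum tri by linarith
  have "coord_sum S (perm_vec \<sigma>) = tri (card S) \<longleftrightarrow> 2 * \<Sum>(\<sigma> ` S) = card (\<sigma> ` S) * (card (\<sigma> ` S) + 1)"
    using sum tri by (metis mult_cancel_left of_nat_eq_iff zero_neq_numeral)
  also have "\<dots> \<longleftrightarrow> \<sigma> ` S = {1..card S}"
  proof
    assume "\<sigma> ` S = {1..card S}"
    then have "\<Sum>(\<sigma> ` S) = \<Sum>{1..card S}" by simp
    then show "2 * \<Sum>(\<sigma> ` S) = card (\<sigma> ` S) * (card (\<sigma> ` S) + 1)"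
      unfolding card using gauss_sum_from_Suc_0[of "card S"] double_gauss_sum_from_Suc_0[of "card S", where ?'a = nat] by simp
  qed (use two_times_sum_ge(2)[OF A] card in simp)
  finally show "coord_sum S (perm_vec \<sigma>) = tri (card S) \<longleftrightarrow> \<sigma> ` S = {1..card S}" .
qed

lemma perm_vec_in_sol:
  assumes "bij_betw \<sigma> (UNIV :: 'k::finite set) {1..CARD('k)}" shows "perm_vec \<sigma> \<in> perm.sol"
  unfolding perm_sol_iff
  using coord_sum_perm_vec[OF assms] coord_sum_perm_vec(2)[OF assms, of UNIV] assms
  by (auto simp: bij_betw_def)

text \<open>Tight sets are nested because the triangular numbers are strictly convex.\<close>

lemma perm_tight_chain:
  fixes x :: "real ^ 'k::finite"
  assumes x: "x \<in> perm.sol" shows "perm.tight x \<in> proper_chains"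
proof -
  have "S \<subseteq> S' \<or> S' \<subseteq> S" if S: "S \<in> perm.tight x" "S' \<in> perm.tight x" for S S'
  proof (rule ccontr)
    assume "\<not> ?thesis"
    then have "S \<subset> S \<union> S'" "S' \<subset> S \<union> S'" by blast+
    then have lt: "card S < card (S \<union> S')" "card S' < card (S \<union> S')" by (simp_all add: psubset_card_mono)
    have add: "card S + card S' = card (S \<union> S') + card (S \<inter> S')" by (rule card_Un_Int) simp_all
    define d where "d = card (S \<union> S') - card S"
    have d: "card (S \<union> S') = card S + d" "d > 0" using lt(1) by (simp_all add: d_def)
    then have d': "card S' = card (S \<inter> S') + d" using add by simp
    have "card (S \<inter> S') < card S" using lt(2) d d' by simp
    then have strict: "tri (card S) + tri (card S') < tri (card (S \<union> S')) + tri (card (S \<inter> S'))"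
      using d(2) unfolding tri_def d(1) d' by (simp add: field_simps)
    have "coord_sum (S \<union> S') x + coord_sum (S \<inter> S') x = coord_sum S x + coord_sum S' x"
      unfolding coord_sum_def by (simp add: sum.union_inter)
    moreover have "tri (card (S \<union> S')) \<le> coord_sum (S \<union> S') x" "tri (card (S \<inter> S')) \<le> coord_sum (S \<inter> S') x"
      using x by (auto simp: perm_sol_iff)
    ultimately show False using S strict by (simp add: perm_tight_iff)
  qed
  then show ?thesis by (auto simp: proper_chains_def perm_tight_iff)
qed

text \<open>
  A permutation that respects the chain \<open>\<C>\<close> and has the elements outside \<open>S\<close> first within each
  block: it is tight on \<open>\<C>\<close>, and on \<open>S\<close> only if \<open>S\<close> is in \<open>\<C>\<close>.
\<close>

lemma perm_vec_of_chain:
  fixes \<C> :: "'k::finite set set"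
  assumes \<C>: "\<C> \<in> proper_chains"
  shows "\<exists>x\<in>perm.sol. \<C> \<subseteq> perm.tight x \<and> (S \<in> perm.tight x \<longrightarrow> S \<in> \<C>)"
proof -
  have chain: "D \<subseteq> C \<or> C \<subseteq> D" if "C \<in> \<C>" "D \<in> \<C>" for C D using \<C> that by (auto simp: proper_chains_def)
  define level where "level i = card {D \<in> \<C>. i \<notin> D}" for i
  have level_less: "level i < level j" if C: "C \<in> \<C>" "i \<in> C" "j \<notin> C" for C i j
  proof -
    have "{D \<in> \<C>. i \<notin> D} \<subset> {D \<in> \<C>. j \<notin> D}" using chain[OF C(1)] C by blast
    then show ?thesis unfolding level_def by (intro psubset_card_mono) auto
  qed
  obtain idx :: "'k \<Rightarrow> nat" where idx: "bij_betw idx UNIV {0..<CARD('k)}"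
    using ex_bij_betw_finite_nat[of "UNIV :: 'k set"] by auto
  \<comment> \<open>A lexicographic key in radix \<open>CARD('k)\<close>: level, then membership in
    \<open>S\<close>, then the arbitrary enumeration \<open>idx\<close> to break ties.\<close>
  define \<kappa> where "\<kappa> i = (2 * level i + (if i \<in> S then 1 else 0)) * CARD('k) + idx i" for i
  have idx_less: "idx i < CARD('k)" for i using bij_betwE[OF idx] by fastforce
  have \<kappa>_less: "\<kappa> i < \<kappa> j"
    if "2 * level i + (if i \<in> S then 1 else 0) < 2 * level j + (if j \<in> S then 1 else 0)" for i j
  proof -
    let ?e = "\<lambda>i. 2 * level i + (if i \<in> S then 1 else 0 :: nat)"
    have "Suc (?e i) * CARD('k) \<le> ?e j * CARD('k)" using that by (intro mult_le_mono1) simp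
    then show ?thesis using idx_less[of i] by (simp add: \<kappa>_def)
  qed
  have "inj \<kappa>"
  proof (rule injI)
    fix i j assume "\<kappa> i = \<kappa> j"
    then have "\<kappa> i mod CARD('k) = \<kappa> j mod CARD('k)" by simp
    then have "idx i = idx j" using idx_less by (simp add: \<kappa>_def)
    then show "i = j" using idx by (simp add: bij_betw_def inj_eq)
  qed
  let ?\<sigma> = "rank_of \<kappa>"
  note bij = bij_betw_rank_of[OF \<open>inj \<kappa>\<close>]
  have tight: "C \<in> perm.tight (perm_vec ?\<sigma>) \<longleftrightarrow> C \<in> proper_sets \<and> (\<forall>i\<in>C. \<forall>j. j \<notin> C \<longrightarrow> \<kappa> i < \<kappa> j)" for C
    unfolding perm_tight_iff coord_sum_perm_vec(2)[OF bij] rank_of_image_iff[OF \<open>inj \<kappa>\<close>] ..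
  show ?thesis
  proof (intro bexI[of _ "perm_vec ?\<sigma>"] conjI impI subsetI)
    fix C assume C: "C \<in> \<C>"
    have "\<kappa> i < \<kappa> j" if "i \<in> C" "j \<notin> C" for i j
      using level_less[OF C that] by (intro \<kappa>_less) auto
    then show "C \<in> perm.tight (perm_vec ?\<sigma>)" using \<C> C by (auto simp: tight proper_chains_def)
  next
    assume "S \<in> perm.tight (perm_vec ?\<sigma>)"
    then have *: "S \<in> proper_sets \<and> (\<forall>i\<in>S. \<forall>j. j \<notin> S \<longrightarrow> \<kappa> i < \<kappa> j)" unfolding tight .
    then have S: "S \<noteq> {}" "S \<noteq> UNIV" and less: "\<And>i j. i \<in> S \<Longrightarrow> j \<notin> S \<Longrightarrow> \<kappa> i < \<kappa> j"
      by (simp_all add: proper_sets_def)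
    have lev: "level i < level j" if "i \<in> S" "j \<notin> S" for i j
    proof (rule ccontr)
      assume "\<not> level i < level j"
      then have "\<kappa> j < \<kappa> i" using that by (intro \<kappa>_less) auto
      then show False using less[OF that] by simp
    qed
    \<comment> \<open>The last level inside \<open>S\<close> precedes the first level outside, so
      some \<open>D\<close> in the chain contains \<open>i\<close> but not \<open>j\<close>; by the
      choice of \<open>i\<close> and \<open>j\<close> it contains all of \<open>S\<close> and
      nothing else.\<close>
    have "Max (level ` S) \<in> level ` S" "Min (level ` (- S)) \<in> level ` (- S)"
      using S by (auto intro!: Max_in Min_in)
    then obtain i j where i: "i \<in> S" "level i = Max (level ` S)" and j: "j \<notin> S" "level j = Min (level ` (- S))"
      by (auto elim!: imageE)
    have i_max: "level k \<le> level i" if "k \<in> S" for k using that by (simp add: i(2))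
    have j_min: "level j \<le> level k" if "k \<notin> S" for k using that by (simp add: j(2))
    have "\<not> {D \<in> \<C>. j \<notin> D} \<subseteq> {D \<in> \<C>. i \<notin> D}"
      using lev[OF i(1) j(1)] card_mono[of "{D \<in> \<C>. i \<notin> D}" "{D \<in> \<C>. j \<notin> D}"] unfolding level_def by auto
    then obtain D where D: "D \<in> \<C>" "j \<notin> D" "i \<in> D" by blast
    have "k \<in> D" if "k \<in> S" for k using level_less[OF D(1,3)] i_max[OF that] by fastforce
    moreover have "k \<notin> D" if "k \<notin> S" for k using level_less[OF D(1) _ D(2)] j_min[OF that] by fastforce
    ultimately have "S = D" by blast
    then show "S \<in> \<C>" using D(1) by simp
  qed (rule perm_vec_in_sol[OF bij])
qed

lemma coord_sum_average:
  "coord_sum S ((1 / c) *\<^sub>R (\<Sum>k\<in>J. y k)) = (\<Sum>k\<in>J. coord_sum S (y k)) / c"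
  unfolding coord_sum_def by (simp add: sum_divide_distrib[symmetric] sum.swap[of _ J])

text \<open>To realize a chain, the points of \<open>perm_vec_of_chain\<close> are averaged over all
  sets \<open>S\<close>. An average of solutions is tight exactly where all of them are, and each
  \<open>S\<close> outside the chain is slack at its own point.\<close>

lemma perm_tight_sets: "perm.tight ` perm.sol = (proper_chains :: 'k::finite set set set)"
proof (intro equalityI subsetI)
  fix \<C> :: "'k set set" assume \<C>: "\<C> \<in> proper_chains"
  have "\<forall>S. \<exists>x. x \<in> perm.sol \<and> \<C> \<subseteq> perm.tight x \<and> (S \<in> perm.tight x \<longrightarrow> S \<in> \<C>)"
    using perm_vec_of_chain[OF \<C>] by blast
  then obtain y :: "'k set \<Rightarrow> real ^ 'k" where y: "\<And>S. y S \<in> perm.sol" "\<And>S. \<C> \<subseteq> perm.tight (y S)"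
    "\<And>S. S \<in> perm.tight (y S) \<Longrightarrow> S \<in> \<C>" by metis
  let ?c = "real (card (UNIV :: 'k set set))"
  define x where "x = (1 / ?c) *\<^sub>R (\<Sum>S\<in>UNIV. y S)"
  have c: "?c > 0" using card_gt_0_iff[of "UNIV :: 'k set set"] by simp
  have x: "coord_sum S x = (\<Sum>S'\<in>UNIV. coord_sum S (y S')) / ?c" for S
    unfolding x_def by (rule coord_sum_average)
  have ge: "tri (card S) \<le> coord_sum S (y S')" for S S' using y(1) by (simp add: perm_sol_iff)
  have UNIV: "coord_sum UNIV (y S') = tri CARD('k)" for S' using y(1) by (simp add: perm_sol_iff)
  have const: "(\<Sum>S'\<in>(UNIV :: 'k set set). d) = ?c * d" for d :: real by simp
  have "coord_sum UNIV x = tri CARD('k)" unfolding x UNIV const using c by simp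
  moreover have "tri (card S) \<le> coord_sum S x" for S
  proof -
    have "?c * tri (card S) \<le> (\<Sum>S'\<in>UNIV. coord_sum S (y S'))"
      unfolding const[symmetric] by (rule sum_mono) (rule ge)
    then show ?thesis unfolding x using c by (simp add: pos_le_divide_eq mult.commute)
  qed
  ultimately have sol: "x \<in> perm.sol" by (simp add: perm_sol_iff)
  have "perm.tight x = \<C>"
  proof (intro equalityI subsetI)
    fix S assume "S \<in> \<C>"
    then have "S \<in> perm.tight (y S')" for S' using y(2) by blast
    then have "S \<in> proper_sets" "\<And>S'. coord_sum S (y S') = tri (card S)"
      by (simp_all add: perm_tight_iff)
    then show "S \<in> perm.tight x" unfolding perm_tight_iff x const using c by simp
  next
    fix S assume S: "S \<in> perm.tight x"
    show "S \<in> \<C>"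
    proof (rule ccontr)
      assume "S \<notin> \<C>"
      then have "coord_sum S (y S) \<noteq> tri (card S)" using y(3)[of S] S by (auto simp: perm_tight_iff)
      then have "tri (card S) < coord_sum S (y S)" using ge[of S S] by simp
      then have "(\<Sum>S'\<in>(UNIV :: 'k set set). tri (card S)) < (\<Sum>S'\<in>UNIV. coord_sum S (y S'))"
        using ge by (intro sum_strict_mono_ex1) auto
      then have "tri (card S) < coord_sum S x" unfolding x const using c by (simp add: pos_less_divide_eq mult.commute)
      then show False using S by (simp add: perm_tight_iff)
    qed
  qed
  then show "\<C> \<in> perm.tight ` perm.sol" using sol by blast
qed (use perm_tight_chain in blast)

lemma bounded_perm_sol: "bounded (perm.sol :: (real ^ 'k::finite) set)"
proof -
  have "norm x \<le> real CARD('k) * tri CARD('k)" if x: "x \<in> perm.sol" for x :: "real ^ 'k"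
  proof -
    have ge: "0 \<le> coord_sum S x" for S
    proof -
      have "0 \<le> tri (card S)" by (simp add: tri_def)
      also have "\<dots> \<le> coord_sum S x" using x by (simp add: perm_sol_iff)
      finally show ?thesis .
    qed
    have "\<bar>x $ i\<bar> \<le> tri CARD('k)" for i
    proof -
      have "coord_sum UNIV x = x $ i + coord_sum (UNIV - {i}) x"
        unfolding coord_sum_def by (rule sum.remove) auto
      moreover have "coord_sum {i} x = x $ i" by (simp add: coord_sum_def)
      ultimately show ?thesis using ge[of "{i}"] ge[of "UNIV - {i}"] x by (simp add: perm_sol_iff)
    qed
    then have "(\<Sum>i\<in>UNIV. \<bar>x $ i\<bar>) \<le> real CARD('k) * tri CARD('k)" by (rule sum_bounded_above)
    then show ?thesis using norm_le_l1_cart[of x] by linarith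
  qed
  then show ?thesis unfolding bounded_iff by blast
qed

text \<open>If no tight set separates \<open>i\<close> from \<open>j\<close>, shifting a small
  amount between the two coordinates stays feasible in either direction, which makes
  \<open>x\<close> the midpoint of a segment.\<close>

lemma extreme_point_perm_separated:
  fixes x :: "real ^ 'k::finite"
  assumes x: "x extreme_point_of perm.sol" and ij: "i \<noteq> j"
  shows "\<exists>S\<in>perm.tight x. i \<in> S \<longleftrightarrow> j \<notin> S"
proof (rule ccontr)
  assume neg: "\<not> ?thesis"
  have sol: "x \<in> perm.sol" using x by (simp add: extreme_point_of_def)
  define d :: "real ^ 'k" where "d = axis i 1 - axis j 1"
  have d: "coord_sum S d = (if i \<in> S then 1 else 0) - (if j \<in> S then 1 else 0)" for S
    unfolding coord_sum_def d_def axis_def by (simp add: sum_subtractf)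
  have lin: "coord_sum S (x + c *\<^sub>R d) = coord_sum S x + c * coord_sum S d" for S c
    by (simp add: coord_sum_def sum.distrib sum_distrib_left)
  \<comment> \<open>The least slack among the inequalities not tight at \<open>x\<close>, capped at
    1 so that the minimum is over a nonempty set.\<close>
  define e where "e = Min (insert 1 ((\<lambda>S. coord_sum S x - tri (card S)) ` (proper_sets - perm.tight x)))"
  have e_le: "e \<le> coord_sum S x - tri (card S)" if "S \<in> proper_sets - perm.tight x" for S
    unfolding e_def using that by (intro Min_le) auto
  have "0 < e"
    unfolding e_def using sol by (subst Min_gr_iff) (auto simp: perm_tight_iff perm_sol_iff less_le)
  have in_sol: "x + c *\<^sub>R d \<in> perm.sol" if c: "\<bar>c\<bar> \<le> e" for c
    unfolding perm_sol_iff
  proof (intro conjI allI)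
    show "coord_sum UNIV (x + c *\<^sub>R d) = tri CARD('k)" using sol by (simp add: lin d perm_sol_iff)
    fix S :: "'k set"
    show "tri (card S) \<le> coord_sum S (x + c *\<^sub>R d)"
    proof (cases "coord_sum S d = 0")
      case True
      then show ?thesis using sol by (simp add: lin perm_sol_iff)
    next
      case False
      then have "i \<in> S \<longleftrightarrow> j \<notin> S" by (auto simp: d split: if_splits)
      then have "S \<notin> perm.tight x" "S \<in> proper_sets" using neg by (auto simp: proper_sets_def)
      then have "e \<le> coord_sum S x - tri (card S)" using e_le by blast
      moreover have "\<bar>c * coord_sum S d\<bar> \<le> e" using c \<open>0 < e\<close> by (simp add: d abs_mult)
      ultimately show ?thesis by (simp add: lin abs_le_iff)
    qed
  qed
  have "d \<noteq> 0"
  proof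
    assume "d = 0"
    then have "coord_sum {i} d = 0" by (simp add: coord_sum_def)
    then show False using ij by (simp add: d)
  qed
  have "x = midpoint (x + e *\<^sub>R d) (x + (- e) *\<^sub>R d)" by (simp add: midpoint_def flip: scaleR_2)
  moreover have "x + e *\<^sub>R d \<noteq> x + (- e) *\<^sub>R d"
    using \<open>d \<noteq> 0\<close> \<open>0 < e\<close> by (simp add: eq_neg_iff_add_eq_0 flip: scaleR_add_left)
  ultimately have "x \<in> open_segment (x + e *\<^sub>R d) (x + (- e) *\<^sub>R d)" by (metis midpoint_in_open_segment)
  then show False
    using x in_sol[of e] in_sol[of "- e"] \<open>0 < e\<close> unfolding extreme_point_of_def by auto
qed

text \<open>The tight sets and \<open>UNIV\<close> form a chain that separates any two coordinates,
  hence a complete flag; the differences of consecutive triangular numbers are then the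
  coordinates.\<close>

lemma extreme_point_perm:
  fixes x :: "real ^ 'k::finite"
  assumes x: "x extreme_point_of perm.sol"
  shows "\<exists>\<sigma>. bij_betw \<sigma> (UNIV :: 'k set) {1..CARD('k)} \<and> x = perm_vec \<sigma>"
proof -
  have sol: "x \<in> perm.sol" using x by (simp add: extreme_point_of_def)
  let ?T = "insert UNIV (perm.tight x)"
  have chain: "S \<subseteq> S' \<or> S' \<subseteq> S" if "S \<in> ?T" "S' \<in> ?T" for S S'
    using perm_tight_chain[OF sol] that by (auto simp: proper_chains_def)
  have tight: "coord_sum S x = tri (card S)" if "S \<in> ?T" for S
    using that sol by (auto simp: perm_tight_iff perm_sol_iff)
  \<comment> \<open>The smallest member of the chain containing \<open>i\<close>; its size turns out
    to be the coordinate of \<open>x\<close> at \<open>i\<close>.\<close>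
  define U where "U i = \<Inter>{S \<in> ?T. i \<in> S}" for i
  have U: "U i \<in> ?T" "i \<in> U i" for i
  proof -
    have "subset.chain UNIV {S \<in> ?T. i \<in> S}" unfolding subset_chain_def using chain by blast
    then have "\<Inter>{S \<in> ?T. i \<in> S} \<in> {S \<in> ?T. i \<in> S}" by (intro Inter_in_chain) auto
    then show "U i \<in> ?T" "i \<in> U i" unfolding U_def by blast+
  qed
  have U_sub: "U i \<subseteq> S" if "S \<in> ?T" "i \<in> S" for S i using that by (auto simp: U_def)
  have inj: "inj (\<lambda>i. card (U i))"
  proof (rule injI, rule ccontr)
    fix i j assume "card (U i) = card (U j)" "i \<noteq> j"
    then have "U i = U j" using chain[OF U(1) U(1)] card_subset_eq[of "U i" "U j"] card_subset_eq[of "U j" "U i"] by auto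
    obtain S where "S \<in> perm.tight x" "i \<in> S \<longleftrightarrow> j \<notin> S"
      using extreme_point_perm_separated[OF x \<open>i \<noteq> j\<close>] by blast
    then show False using U_sub[of S i] U_sub[of S j] U(2)[of i] U(2)[of j] \<open>U i = U j\<close> by auto
  qed
  let ?\<sigma> = "rank_of (\<lambda>i. card (U i))"
  have U_eq: "U i = {j. card (U j) \<le> card (U i)}" for i
  proof (intro equalityI subsetI)
    fix j assume "j \<in> U i"
    then have "U j \<subseteq> U i" by (rule U_sub[OF U(1)])
    then show "j \<in> {j. card (U j) \<le> card (U i)}" by (simp add: card_mono)
  next
    fix j assume "j \<in> {j. card (U j) \<le> card (U i)}"
    then have "U j \<subseteq> U i"
      using chain[OF U(1)[of i] U(1)[of j]] card_seteq[of "U j" "U i"] by auto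
    then show "j \<in> U i" using U(2) by blast
  qed
  have rank: "?\<sigma> i = card (U i)" for i unfolding rank_of_def U_eq[of i, symmetric] ..
  note bij = bij_betw_rank_of[OF inj]
  have seg: "coord_sum {j. ?\<sigma> j \<le> m} x = tri m" if "m \<le> CARD('k)" for m
  proof (cases "m = 0")
    case True
    moreover have "0 < ?\<sigma> j" for j using rank_of_bounds(1)[of "\<lambda>i. card (U i)" j] by simp
    ultimately have none: "{j. ?\<sigma> j \<le> m} = {}" by (auto simp: not_le)
    show ?thesis unfolding none unfolding True by (simp add: coord_sum_def tri_def)
  next
    case False
    then have "m \<in> range ?\<sigma>" using bij that by (simp add: bij_betw_def)
    then obtain i where i: "m = ?\<sigma> i" by blast
    then have "{j. ?\<sigma> j \<le> m} = U i" using rank U_eq by auto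
    then show ?thesis using tight[OF U(1)[of i]] i rank by simp
  qed
  have "x $ i = real (?\<sigma> i)" for i
  proof -
    define m where "m = ?\<sigma> i - 1"
    have m: "?\<sigma> i = Suc m" using rank_of_bounds(1)[of "\<lambda>i. card (U i)" i] by (simp add: m_def)
    have "Suc m \<le> CARD('k)" using rank_of_bounds(2)[of "\<lambda>i. card (U i)" i] m by simp
    have "{j. ?\<sigma> j \<le> Suc m} = insert i {j. ?\<sigma> j \<le> m}"
      using inj_rank_of[OF inj] m by (auto simp: le_Suc_eq inj_eq) (metis inj_eq)
    moreover have "i \<notin> {j. ?\<sigma> j \<le> m}" using m by simp
    ultimately have "coord_sum {j. ?\<sigma> j \<le> Suc m} x = x $ i + coord_sum {j. ?\<sigma> j \<le> m} x"
      by (simp add: coord_sum_def)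
    then have "x $ i = tri (Suc m) - tri m" using seg[of m] seg[of "Suc m"] \<open>Suc m \<le> CARD('k)\<close> by simp
    then show ?thesis using m by (simp add: tri_def field_simps)
  qed
  then have "x = perm_vec ?\<sigma>" by (simp add: perm_vec_def vec_eq_iff)
  then show ?thesis using bij by blast
qed

lemma permutohedron_eq: "(permutohedron :: (real ^ 'k::finite) set) = perm.sol"
proof
  have eq: "(permutohedron :: (real ^ 'k) set) =
      convex hull {perm_vec \<sigma> |\<sigma>. bij_betw \<sigma> (UNIV :: 'k set) {1..CARD('k)}}"
    unfolding permutohedron_def perm_vec_def ..
  show "permutohedron \<subseteq> (perm.sol :: (real ^ 'k) set)"
    unfolding eq by (rule hull_minimal) (use perm_vec_in_sol perm.convex_sol in auto)
  have "perm.sol = convex hull {x :: real ^ 'k. x extreme_point_of perm.sol}"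
    using perm.polytope_sol[OF bounded_perm_sol]
    by (intro Krein_Milman_Minkowski polytope_imp_compact polytope_imp_convex)
  also have "\<dots> \<subseteq> permutohedron"
    unfolding eq by (rule hull_mono) (use extreme_point_perm in blast)
  finally show "(perm.sol :: (real ^ 'k) set) \<subseteq> permutohedron" .
qed

lemma bij_betw_permutohedron_faces:
  "bij_betw perm.tight_face proper_chains (nonempty_faces (permutohedron :: (real ^ 'k::finite) set))"
  using perm.bij_betw_tight_face unfolding perm_tight_sets permutohedron_eq nonempty_faces_def .

text \<open>The minimum belongs to every pipe with at least two elements. Proper pipes therefore
  consist of the minimum and a proper nonempty set of other elements, any two of them meet, the
  digraph has no edges, and a proper piping is a chain of such sets. The type \<open>'k\<close>
  plays the part of the elements above the minimum.\<close>

lemma claw_proper_pipings: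
  fixes r :: "'p rel"
  assumes r: "finite_connected_poset r" "2 \<le> card (Field r)" and claw: "claw_poset r"
    and card_k: "CARD('k) = card (Field r) - 1"
  obtains \<psi> :: "'k::finite set \<Rightarrow> 'p set" where "inj \<psi>"
    "bij_betw (\<lambda>\<C>. \<psi> ` \<C>) proper_chains (proper_pipings r)"
proof -
  interpret finite_poset r by (rule finite_poset_if_connected[OF r(1)])
  obtain n g where g: "bij_betw g {0..n::nat} (Field r)"
    and cov: "\<And>x y. covered_by r x y \<longleftrightarrow> (\<exists>i\<in>{1..n}. x = g 0 \<and> y = g i)"
    using claw unfolding claw_poset_def by blast
  let ?m = "g 0"
  have g_image: "g ` {0..n} = Field r" and g_inj: "inj_on g {0..n}" using g by (auto simp: bij_betw_def)
  have g0: "g i \<noteq> ?m" if "i \<in> {1..n}" for i using inj_onD[OF g_inj, of i 0] that by auto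
  have leaves: "g ` {1..n} = Field r - {?m}"
  proof -
    have "{0..n} = insert 0 {1..n}" by auto
    then have "Field r = insert ?m (g ` {1..n})" using g_image by (metis image_insert)
    then show ?thesis using g0 by auto
  qed
  have prec: "prec r x y \<longleftrightarrow> x = ?m \<and> y \<in> Field r - {?m}" for x y
  proof
    assume "prec r x y"
    then show "x = ?m \<and> y \<in> Field r - {?m}"
      by (induction rule: prec_induct) (use leaves in \<open>auto simp: cov\<close>)
  next
    assume "x = ?m \<and> y \<in> Field r - {?m}"
    then have "covered_by r x y" unfolding cov leaves[symmetric] by auto
    then show "prec r x y" by (simp add: covered_by_def)
  qed
  have m: "?m \<in> Field r" using g_image by auto
  have "card (UNIV :: 'k set) = card (Field r - {?m})" using card_k m finite_Field by simp
  then obtain \<beta> :: "'k \<Rightarrow> 'p" where \<beta>: "bij_betw \<beta> UNIV (Field r - {?m})"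
    using finite_same_card_bij[of "UNIV :: 'k set" "Field r - {?m}"] finite_Field by auto
  have \<beta>_inj: "inj \<beta>" and \<beta>_range: "range \<beta> = Field r - {?m}" using \<beta> by (auto simp: bij_betw_def)
  define \<psi> where "\<psi> S = insert ?m (\<beta> ` S)" for S
  have m_notin: "?m \<notin> \<beta> ` S" for S using \<beta>_range by blast
  have sub_iff: "\<psi> S \<subseteq> \<psi> S' \<longleftrightarrow> S \<subseteq> S'" for S S'
  proof -
    have "\<psi> S \<subseteq> \<psi> S' \<longleftrightarrow> \<beta> ` S \<subseteq> \<beta> ` S'" 
      unfolding \<psi>_def by (simp add: insert_subset subset_insert[OF m_notin])
    then show ?thesis by (simp add: inj_image_subset_iff[OF \<beta>_inj])
  qed
  have inj: "inj \<psi>"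
  proof (rule injI)
    fix S S' assume "\<psi> S = \<psi> S'"
    then show "S = S'" using sub_iff[of S S'] sub_iff[of S' S] by simp
  qed
  have card_\<psi>: "card (\<psi> S) = Suc (card S)" for S
    unfolding \<psi>_def using m_notin[of S] by (simp add: card_image inj_on_subset[OF \<beta>_inj])
  have sub_Field: "\<psi> S \<subseteq> Field r" for S unfolding \<psi>_def using m \<beta>_range by blast
  have card_F: "card (Field r) = Suc CARD('k)" using card_k r(2) by simp
  have pipes: "proper_pipes r = \<psi> ` proper_sets"
  proof (intro equalityI subsetI)
    fix \<sigma> assume "\<sigma> \<in> \<psi> ` proper_sets"
    then obtain S where S: "S \<in> proper_sets" "\<sigma> = \<psi> S" by blast
    have "poset_convex r \<sigma>" unfolding poset_convex_def prec by blast
    moreover have "cut_connected r \<sigma>"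
    proof (rule cut_connectedI)
      fix X assume X: "X \<subseteq> \<sigma>" "X \<noteq> {}"
        and cl: "\<And>i j. i \<in> X \<Longrightarrow> j \<in> \<sigma> \<Longrightarrow> comparable r i j \<Longrightarrow> j \<in> X"
      have cmp: "comparable r ?m x" "comparable r x ?m" if "x \<in> \<sigma>" "x \<noteq> ?m" for x
        using that S(2) sub_Field[of S] by (auto simp: comparable_def prec)
      have m\<sigma>: "?m \<in> \<sigma>" using S(2) by (simp add: \<psi>_def)
      obtain x where "x \<in> X" using X(2) by blast
      then have "?m \<in> X" using cl[OF _ m\<sigma>, of x] cmp(2)[of x] X(1) by blast
      then show "\<sigma> \<subseteq> X" using cl cmp(1) by blast
    qed
    ultimately have "pipe r \<sigma>" using S(2) sub_Field by (simp add: pipe_iff \<psi>_def)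
    moreover have "0 < card S" "card S < CARD('k)"
      using S(1) by (auto simp: proper_sets_def card_gt_0_iff intro!: psubset_card_mono)
    ultimately show "\<sigma> \<in> proper_pipes r" by (simp add: proper_pipes_def S(2) card_\<psi> card_F)
  next
    fix \<sigma> assume \<sigma>: "\<sigma> \<in> proper_pipes r"
    then have pipe: "pipe r \<sigma>" "1 < card \<sigma>" "card \<sigma> < card (Field r)" by (auto simp: proper_pipes_def)
    have "?m \<in> \<sigma>"
    proof -
      obtain x where x: "x \<in> \<sigma>" using pipe_nonempty[OF pipe(1)] by blast
      have "\<not> \<sigma> \<subseteq> {x}" using pipe(2) card_mono[of "{x}" \<sigma>] by auto
      then obtain y z where "y \<in> \<sigma>" "z \<in> \<sigma>" "comparable r y z"
        by (rule cut_connected_crossing[OF pipe_cut_connected[OF pipe(1)] x singletonI]) (rule that)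
      then show ?thesis by (auto simp: comparable_def prec)
    qed
    moreover define S where "S = \<beta> -` \<sigma>"
    have "\<beta> ` S = \<sigma> - {?m}" unfolding S_def image_vimage_eq \<beta>_range using pipe_subset[OF pipe(1)] by blast
    ultimately have \<sigma>_eq: "\<sigma> = \<psi> S" by (auto simp: \<psi>_def)
    then have "S \<noteq> {}" "S \<noteq> UNIV" using pipe(2,3) card_\<psi>[of S] card_F by auto
    then show "\<sigma> \<in> \<psi> ` proper_sets" using \<sigma>_eq by (auto simp: proper_sets_def)
  qed
  have pipings: "\<psi> ` \<C> \<in> proper_pipings r \<longleftrightarrow> \<C> \<in> proper_chains" for \<C>
  proof -
    have nested: "\<psi> S \<inter> \<psi> S' \<noteq> {}" for S S' by (auto simp: \<psi>_def)
    then have "piping_digraph r (\<psi> ` \<C>) = {}" by (auto simp: piping_digraph_def)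
    then have "piping r (\<psi> ` \<C>) \<longleftrightarrow>
        (\<forall>S\<in>\<C>. pipe r (\<psi> S)) \<and> (\<forall>S\<in>\<C>. \<forall>S'\<in>\<C>. S \<subseteq> S' \<or> S' \<subseteq> S)"
      unfolding piping_def by (simp add: nested sub_iff acyclic_def)
    moreover have "\<psi> ` \<C> \<subseteq> proper_pipes r \<longleftrightarrow> \<C> \<subseteq> proper_sets"
      unfolding pipes by (rule inj_image_subset_iff[OF inj])
    moreover have "pipe r (\<psi> S)" if "S \<in> proper_sets" for S
    proof -
      have "\<psi> S \<in> proper_pipes r" unfolding pipes using that by (rule imageI)
      then show ?thesis by (simp add: proper_pipes_def)
    qed
    ultimately show ?thesis unfolding proper_pipings_def proper_chains_def by auto
  qed
  have "bij_betw (\<lambda>\<C>. \<psi> ` \<C>) proper_chains (proper_pipings r)"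
    unfolding bij_betw_def
  proof
    show "inj_on (\<lambda>\<C>. \<psi> ` \<C>) proper_chains" by (rule inj_onI) (simp add: inj_image_eq_iff[OF inj])
    show "(\<lambda>\<C>. \<psi> ` \<C>) ` proper_chains = proper_pipings r"
    proof (intro equalityI subsetI)
      fix T assume T: "T \<in> proper_pipings r"
      then have "T \<subseteq> \<psi> ` proper_sets" unfolding pipes[symmetric] by (simp add: proper_pipings_def)
      then obtain \<C> where "T = \<psi> ` \<C>" by (meson subset_imageE)
      then show "T \<in> (\<lambda>\<C>. \<psi> ` \<C>) ` proper_chains" using T pipings by blast
    qed (use pipings in blast)
  qed
  then show ?thesis using inj that by blast
qed

lemma claw_permutohedron:
  fixes r :: "'p rel" and A :: "'a::euclidean_space set"
  assumes r: "finite_connected_poset r" "2 \<le> card (Field r)" and A: "poset_associahedron r A f"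
    and claw: "claw_poset r" and card_k: "CARD('k) = card (Field r) - 1"
  shows "combinatorially_equivalent A (permutohedron :: (real ^ 'k::finite) set)"
proof -
  note faces = poset_associahedron_piping_face[OF r(1) A]
  obtain \<psi> :: "'k set \<Rightarrow> 'p set" where \<psi>: "inj \<psi>"
    "bij_betw (\<lambda>\<C>. \<psi> ` \<C>) proper_chains (proper_pipings r)"
    using claw_proper_pipings[OF r claw card_k] by metis
  have bij: "bij_betw (piping_face A f \<circ> (\<lambda>\<C>. \<psi> ` \<C>)) proper_chains (nonempty_faces A)"
    using \<psi>(2) faces(4) by (rule bij_betw_trans)
  show ?thesis
  proof (rule combinatorially_equivalentI[OF faces(1) _ bij bij_betw_permutohedron_faces])
    show "polytope (permutohedron :: (real ^ 'k) set)"
      unfolding permutohedron_eq by (rule perm.polytope_sol[OF bounded_perm_sol])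
    fix \<C> \<C>' :: "'k set set" assume C: "\<C> \<in> proper_chains" "\<C>' \<in> proper_chains"
    then have "\<psi> ` \<C> \<in> proper_pipings r" "\<psi> ` \<C>' \<in> proper_pipings r" using bij_betwE[OF \<psi>(2)] by blast+
    then have "piping_face A f (\<psi> ` \<C>) \<subseteq> piping_face A f (\<psi> ` \<C>') \<longleftrightarrow> \<C>' \<subseteq> \<C>"
      using faces(5) inj_image_subset_iff[OF \<psi>(1)] by simp
    moreover have "perm.tight_face \<C> \<subseteq> perm.tight_face \<C>' \<longleftrightarrow> \<C>' \<subseteq> \<C>"
      using C unfolding perm_tight_sets[symmetric] by (rule perm.tight_face_subset_iff)
    ultimately show "(piping_face A f \<circ> (\<lambda>\<C>. \<psi> ` \<C>)) \<C> \<subseteq> (piping_face A f \<circ> (\<lambda>\<C>. \<psi> ` \<C>)) \<C>' \<longleftrightarrow>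
        perm.tight_face \<C> \<subseteq> perm.tight_face \<C>'" by simp
  qed
qed

section \<open>Chains and plane trees\<close>

text \<open>
  A non-leaf vertex above the leaves \<open>l\<close>, \dots, \<open>h - 1\<close> is recorded as the pair \<open>(l, h)\<close>; the
  leaves of the tree are numbered from \<open>a\<close> on.
\<close>

fun tree_intervals :: "nat \<Rightarrow> plane_tree \<Rightarrow> (nat \<times> nat) set"
  and forest_intervals :: "nat \<Rightarrow> plane_tree list \<Rightarrow> (nat \<times> nat) set" where
  "tree_intervals a Leaf = {}"
| "tree_intervals a (Node ts) = insert (a, a + num_leaves (Node ts)) (forest_intervals a ts)"
| "forest_intervals a [] = {}"
| "forest_intervals a (t # ts) = tree_intervals a t \<union> forest_intervals (a + num_leaves t) ts"

abbreviation forest_leaves :: "plane_tree list \<Rightarrow> nat" where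
  "forest_leaves ts \<equiv> sum_list (map num_leaves ts)"

text \<open>Nested or disjoint, for pairs read as half-open intervals \<open>[l, h)\<close>.\<close>

definition compatible :: "nat \<times> nat \<Rightarrow> nat \<times> nat \<Rightarrow> bool" where
  "compatible x y \<longleftrightarrow> (fst x \<le> fst y \<and> snd y \<le> snd x) \<or> (fst y \<le> fst x \<and> snd x \<le> snd y) \<or>
     snd x \<le> fst y \<or> snd y \<le> fst x"

text \<open>The images of the trees with \<open>n\<close> leaves: \<open>l + 2 \<le> h\<close> says
  that a non-leaf vertex carries at least two leaves, and \<open>(0, n)\<close> is the root.\<close>

definition laminar_families :: "nat \<Rightarrow> (nat \<times> nat) set set" where
  "laminar_families n = {X. X \<subseteq> {(l, h). l + 2 \<le> h \<and> h \<le> n} \<and> (0, n) \<in> X \<and>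
     (\<forall>x\<in>X. \<forall>y\<in>X. compatible x y)}"

lemma compatible_sym: "compatible x y \<Longrightarrow> compatible y x"
  by (auto simp: compatible_def)

lemma length_le_forest_leaves:
  "(\<And>t. t \<in> set ts \<Longrightarrow> 1 \<le> num_leaves t) \<Longrightarrow> length ts \<le> forest_leaves ts"
proof (induction ts)
  case (Cons t ts)
  have "1 \<le> num_leaves t" "length ts \<le> forest_leaves ts" using Cons by auto
  then show ?case by simp
qed simp

lemma num_leaves_pos: "branching t \<Longrightarrow> 1 \<le> num_leaves t"
proof (induction t)
  case (Node ts)
  then have "length ts \<le> forest_leaves ts" by (intro length_le_forest_leaves) auto
  moreover have "2 \<le> length ts" using Node.prems by simp
  ultimately show ?case by simp
qed simp

lemma forest_leaves_ge: "\<forall>t\<in>set ts. branching t \<Longrightarrow> length ts \<le> forest_leaves ts"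
  by (rule length_le_forest_leaves) (use num_leaves_pos in blast)

lemma intervals_range:
  shows "branching t \<Longrightarrow> x \<in> tree_intervals a t \<Longrightarrow>
      a \<le> fst x \<and> fst x + 2 \<le> snd x \<and> snd x \<le> a + num_leaves t"
    and "\<forall>t\<in>set ts. branching t \<Longrightarrow> x \<in> forest_intervals a ts \<Longrightarrow>
      a \<le> fst x \<and> fst x + 2 \<le> snd x \<and> snd x \<le> a + forest_leaves ts"
proof (induction a t and a ts rule: tree_intervals_forest_intervals.induct)
  case (2 a ts)
  then have "2 \<le> length ts" "length ts \<le> forest_leaves ts" using forest_leaves_ge by auto
  then show ?case using 2 by auto
next
  case (4 a t ts)
  show ?case
  proof (cases "x \<in> tree_intervals a t")
    case True
    then show ?thesis using 4 by auto
  next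
    case False
    then have "x \<in> forest_intervals (a + num_leaves t) ts" using 4 by auto
    then show ?thesis using 4 by auto
  qed
qed auto

lemma forest_intervals_append:
  "forest_intervals a (us @ vs) = forest_intervals a us \<union> forest_intervals (a + forest_leaves us) vs"
  by (induction us arbitrary: a) (simp_all add: Un_assoc add.assoc)

lemma intervals_compatible:
  shows "branching t \<Longrightarrow> x \<in> tree_intervals a t \<Longrightarrow> y \<in> tree_intervals a t \<Longrightarrow> compatible x y"
    and "\<forall>t\<in>set ts. branching t \<Longrightarrow> x \<in> forest_intervals a ts \<Longrightarrow> y \<in> forest_intervals a ts \<Longrightarrow> compatible x y"
proof (induction a t and a ts rule: tree_intervals_forest_intervals.induct)
  case (2 a ts)
  have br: "\<forall>t\<in>set ts. branching t" using 2 by simp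
  have root: "compatible (a, a + num_leaves (Node ts)) z" if "z \<in> tree_intervals a (Node ts)" for z
    using intervals_range(1)[OF 2(2) that] by (simp add: compatible_def)
  show ?case
  proof (cases "x = (a, a + num_leaves (Node ts)) \<or> y = (a, a + num_leaves (Node ts))")
    case True
    then show ?thesis using root[of x] root[of y] 2(3,4) compatible_sym by metis
  next
    case False
    then show ?thesis using 2 br by simp
  qed
next
  case (4 a t ts)
  have br: "branching t" "\<forall>t\<in>set ts. branching t" using 4(3) by simp_all
  have cross: "compatible u w" if "u \<in> tree_intervals a t" "w \<in> forest_intervals (a + num_leaves t) ts" for u w
    using intervals_range(1)[OF br(1) that(1)] intervals_range(2)[OF br(2) that(2)] by (simp add: compatible_def)
  consider "x \<in> tree_intervals a t" "y \<in> tree_intervals a t"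
    | "x \<in> tree_intervals a t" "y \<in> forest_intervals (a + num_leaves t) ts"
    | "y \<in> tree_intervals a t" "x \<in> forest_intervals (a + num_leaves t) ts"
    | "x \<in> forest_intervals (a + num_leaves t) ts" "y \<in> forest_intervals (a + num_leaves t) ts"
    using 4(4,5) by auto
  then show ?case
  proof cases
    case 1
    then show ?thesis by (rule 4(1)[OF br(1)])
  next
    case 2
    then show ?thesis by (rule cross)
  next
    case 3
    then show ?thesis using cross compatible_sym by blast
  next
    case 4
    then show ?thesis by (rule "4.IH"(2)[OF br(2)])
  qed
qed simp_all

text \<open>Each of the at least two trees has a leaf, so none of them covers all leaves.\<close>

lemma root_notin_forest_intervals:
  assumes "\<forall>t\<in>set ts. branching t" "2 \<le> length ts"
  shows "(a, a + forest_leaves ts) \<notin> forest_intervals a ts"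
proof
  assume root: "(a, a + forest_leaves ts) \<in> forest_intervals a ts"
  obtain t u us where ts: "ts = t # u # us" using assms(2) by (metis Suc_le_length_iff numeral_2_eq_2)
  have br: "branching t" "\<forall>t\<in>set (u # us). branching t" using assms(1) ts by auto
  have fl: "forest_leaves ts = num_leaves t + forest_leaves (u # us)" using ts by simp
  have "length (u # us) \<le> forest_leaves (u # us)" by (rule forest_leaves_ge[OF br(2)])
  then have pos: "1 \<le> num_leaves t" "1 \<le> forest_leaves (u # us)"
    using num_leaves_pos[OF br(1)] unfolding length_Cons by linarith+
  have "(a, a + forest_leaves ts) \<in> tree_intervals a t \<union> forest_intervals (a + num_leaves t) (u # us)"
    using root unfolding ts forest_intervals.simps(2)[of a t] .
  then show False
  proof
    assume "(a, a + forest_leaves ts) \<in> tree_intervals a t"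
    from intervals_range(1)[OF br(1) this] show False using fl pos unfolding fst_conv snd_conv by linarith
  next
    assume "(a, a + forest_leaves ts) \<in> forest_intervals (a + num_leaves t) (u # us)"
    from intervals_range(2)[OF br(2) this] show False using pos unfolding fst_conv snd_conv by linarith
  qed
qed

text \<open>If \<open>u\<close> had more leaves than \<open>t\<close>, its root interval would start
  in \<open>t\<close> and end beyond it, so it could not occur in the forest starting with
  \<open>t\<close>. Applied both ways, this recovers the size of the first tree from the
  intervals.\<close>

lemma first_tree_le:
  assumes "\<forall>t\<in>set (t # ts). branching t" "\<forall>t\<in>set (u # us). branching t"
    and eq: "forest_intervals a (t # ts) = forest_intervals a (u # us)"
  shows "num_leaves u \<le> num_leaves t"
proof (rule ccontr)
  assume "\<not> num_leaves u \<le> num_leaves t"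
  then have lt: "num_leaves t < num_leaves u" by simp
  have br: "branching t" "\<forall>t\<in>set ts. branching t" using assms(1) by simp_all
  have pos: "1 \<le> num_leaves t" by (rule num_leaves_pos[OF br(1)])
  let ?x = "(a, a + num_leaves u)"
  obtain ws where "u = Node ws" using lt pos by (cases u) auto
  then have "?x \<in> forest_intervals a (t # ts)" unfolding eq by simp
  then have "?x \<in> tree_intervals a t \<union> forest_intervals (a + num_leaves t) ts" by simp
  then show False
  proof
    assume "?x \<in> tree_intervals a t"
    from intervals_range(1)[OF br(1) this] show False using lt unfolding fst_conv snd_conv by linarith
  next
    assume "?x \<in> forest_intervals (a + num_leaves t) ts"
    from intervals_range(2)[OF br(2) this] show False using pos unfolding fst_conv snd_conv by linarith
  qed
qed

text \<open>A forest splits back into its first tree and the rest: once the size of the first tree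
  is known, the intervals of that tree are those that end within it.\<close>

lemma intervals_inject:
  shows "branching t \<Longrightarrow> branching t' \<Longrightarrow> num_leaves t = num_leaves t' \<Longrightarrow>
      tree_intervals a t = tree_intervals a t' \<Longrightarrow> t = t'"
    and "\<forall>t\<in>set ts. branching t \<Longrightarrow> \<forall>t\<in>set us. branching t \<Longrightarrow> forest_leaves ts = forest_leaves us \<Longrightarrow>
      forest_intervals a ts = forest_intervals a us \<Longrightarrow> ts = us"
proof (induction a t and a ts arbitrary: t' and us rule: tree_intervals_forest_intervals.induct)
  case (1 a)
  then show ?case by (cases t') auto
next
  case (2 a ts)
  then obtain us where t': "t' = Node us" by (cases t') auto
  have br: "\<forall>t\<in>set ts. branching t" "2 \<le> length ts" "\<forall>t\<in>set us. branching t" "2 \<le> length us"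
    using 2(2,3) t' by simp_all
  have leaves: "forest_leaves ts = forest_leaves us" using 2(4) t' by simp
  have "insert (a, a + forest_leaves ts) (forest_intervals a ts) =
      insert (a, a + forest_leaves ts) (forest_intervals a us)"
    using 2(5) t' leaves by simp
  moreover have "(a, a + forest_leaves ts) \<notin> forest_intervals a ts"
    by (rule root_notin_forest_intervals[OF br(1,2)])
  moreover have "(a, a + forest_leaves ts) \<notin> forest_intervals a us"
    unfolding leaves by (rule root_notin_forest_intervals[OF br(3,4)])
  ultimately have "forest_intervals a ts = forest_intervals a us" by (simp add: insert_ident)
  then show ?case using 2(1)[OF br(1,3) leaves] t' by simp
next
  case (3 a)
  have "length us \<le> forest_leaves []" using forest_leaves_ge[OF 3(2)] 3(3) by metis
  then show ?case by simp
next
  case (4 a t ts)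
  have br: "branching t" "\<forall>t\<in>set ts. branching t" using 4(3) by simp_all
  have "us \<noteq> []" using 4(5) num_leaves_pos[OF br(1)] by auto
  then obtain u vs where us: "us = u # vs" by (cases us) auto
  have bru: "branching u" "\<forall>t\<in>set vs. branching t" using 4(4) us by simp_all
  have eq: "forest_intervals a (t # ts) = forest_intervals a (u # vs)" using 4(6) us by simp
  have n: "num_leaves t = num_leaves u"
    using first_tree_le[OF 4(3) _ eq] first_tree_le[OF _ 4(3) eq[symmetric]] 4(4) us by (intro antisym) auto
  have split: "tree_intervals a w = {x \<in> forest_intervals a (w # ws). snd x \<le> a + num_leaves w}"
    "forest_intervals (a + num_leaves w) ws = {x \<in> forest_intervals a (w # ws). \<not> snd x \<le> a + num_leaves w}"
    if "branching w" "\<forall>t\<in>set ws. branching t" for w ws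
  proof -
    have 1: "snd x \<le> a + num_leaves w" if "x \<in> tree_intervals a w" for x
      using intervals_range(1)[OF \<open>branching w\<close> that] by simp
    have 2: "\<not> snd x \<le> a + num_leaves w" if "x \<in> forest_intervals (a + num_leaves w) ws" for x
      using intervals_range(2)[OF \<open>\<forall>t\<in>set ws. branching t\<close> that] by simp
    show "tree_intervals a w = {x \<in> forest_intervals a (w # ws). snd x \<le> a + num_leaves w}"
      using 1 2 by auto
    show "forest_intervals (a + num_leaves w) ws = {x \<in> forest_intervals a (w # ws). \<not> snd x \<le> a + num_leaves w}"
      using 1 2 by auto
  qed
  have "tree_intervals a t = tree_intervals a u"
    unfolding split(1)[OF br] split(1)[OF bru] eq n ..
  then have "t = u" by (rule 4(1)[OF br(1) bru(1) n])
  moreover have "forest_intervals (a + num_leaves t) ts = forest_intervals (a + num_leaves t) vs"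
    unfolding split(2)[OF br] using split(2)[OF bru] eq n by simp
  then have "ts = vs" using 4(2)[OF br(2) bru(2)] 4(5) us n by simp
  ultimately show ?case by (simp add: us)
qed

section \<open>Edge contraction as removal of an interval\<close>

lemma contract_edge_intervals:
  assumes "contract_edge t t'"
  shows "num_leaves t' = num_leaves t" "branching t \<Longrightarrow> branching t'" "tree_intervals a t' \<subseteq> tree_intervals a t"
proof -
  have "num_leaves t' = num_leaves t \<and> (branching t \<longrightarrow> branching t') \<and>
      (\<forall>a. tree_intervals a t' \<subseteq> tree_intervals a t)"
    using assms
  proof (induction rule: contract_edge.induct)
    case (1 us ts vs)
    then show ?case by (auto simp: forest_intervals_append add.assoc)
  next
    case (2 t t' us vs)
    then show ?case by (auto simp: forest_intervals_append)
  qed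
  then show "num_leaves t' = num_leaves t" "branching t \<Longrightarrow> branching t'" "tree_intervals a t' \<subseteq> tree_intervals a t"
    by blast+
qed

lemma rtranclp_contract_edge_intervals: "contract_edge\<^sup>*\<^sup>* t t' \<Longrightarrow> tree_intervals a t' \<subseteq> tree_intervals a t"
  by (induction rule: rtranclp_induct) (use contract_edge_intervals(3) in blast)+

text \<open>Contracting the edge from a vertex to its parent deletes its interval. The statement for
  forests stops at the tree \<open>u\<close> containing \<open>x\<close>: if \<open>x\<close> is the
  root of \<open>u\<close>, the edge leads to the parent and is only available in the statement for
  trees.\<close>

lemma remove_interval:
  shows "branching t \<Longrightarrow> x \<in> tree_intervals a t \<Longrightarrow> x \<noteq> (a, a + num_leaves t) \<Longrightarrow>
      \<exists>t'. contract_edge t t' \<and> tree_intervals a t' = tree_intervals a t - {x}"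
    and "\<forall>t\<in>set ts. branching t \<Longrightarrow> x \<in> forest_intervals a ts \<Longrightarrow>
      \<exists>us u vs. ts = us @ u # vs \<and> x \<in> tree_intervals (a + forest_leaves us) u \<and>
        (x \<noteq> (a + forest_leaves us, a + forest_leaves us + num_leaves u) \<longrightarrow>
          (\<exists>u'. contract_edge u u' \<and>
            tree_intervals (a + forest_leaves us) u' = tree_intervals (a + forest_leaves us) u - {x}))"
proof (induction a t and a ts rule: tree_intervals_forest_intervals.induct)
  case (2 a ts)
  have br: "\<forall>t\<in>set ts. branching t" using 2(2) by simp
  have x: "x \<in> forest_intervals a ts" "x \<noteq> (a, a + forest_leaves ts)" using 2(3,4) by auto
  obtain us u vs where ts: "ts = us @ u # vs" and xu: "x \<in> tree_intervals (a + forest_leaves us) u"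
    and inner: "x \<noteq> (a + forest_leaves us, a + forest_leaves us + num_leaves u) \<longrightarrow>
          (\<exists>u'. contract_edge u u' \<and>
            tree_intervals (a + forest_leaves us) u' = tree_intervals (a + forest_leaves us) u - {x})"
    using 2(1)[OF br x(1)] by (elim exE conjE)
  let ?b = "a + forest_leaves us"
  have brs: "\<forall>t\<in>set us. branching t" "branching u" "\<forall>t\<in>set vs. branching t" using br ts by auto
  note range = intervals_range(1)[OF brs(2) xu]
  have x_us: "x \<notin> forest_intervals a us" using intervals_range(2)[OF brs(1), of x a] range by auto
  have x_vs: "x \<notin> forest_intervals (?b + num_leaves u) vs"
    using intervals_range(2)[OF brs(3), of x "?b + num_leaves u"] range by auto
  show ?case
  proof (cases "x = (?b, ?b + num_leaves u)")
    case True
    obtain ws where u: "u = Node ws" using xu by (cases u) auto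
    have "x \<notin> forest_intervals ?b ws"
      using root_notin_forest_intervals[of ws ?b] brs(2) u True by simp
    then have "tree_intervals a (Node (us @ ws @ vs)) = tree_intervals a (Node ts) - {x}"
      using x_us x_vs x(2) True unfolding ts u
      by (auto simp: forest_intervals_append add.assoc)
    moreover have "contract_edge (Node ts) (Node (us @ ws @ vs))"
      unfolding ts u by (rule contract_edge.intros(1))
    ultimately show ?thesis by blast
  next
    case False
    then obtain u' where u': "contract_edge u u'" "tree_intervals ?b u' = tree_intervals ?b u - {x}"
      using inner by blast
    have "tree_intervals a (Node (us @ u' # vs)) = tree_intervals a (Node ts) - {x}"
      using x_us x_vs x(2) u'(2) contract_edge_intervals(1)[OF u'(1)] unfolding ts
      by (auto simp: forest_intervals_append)
    moreover have "contract_edge (Node ts) (Node (us @ u' # vs))"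
      unfolding ts by (rule contract_edge.intros(2)[OF u'(1)])
    ultimately show ?thesis by blast
  qed
next
  case (4 a t ts)
  show ?case
  proof (cases "x \<in> tree_intervals a t")
    case True
    then show ?thesis using 4(1,3) by (intro exI[of _ "[]"] exI[of _ t] exI[of _ ts]) simp
  next
    case False
    then have "x \<in> forest_intervals (a + num_leaves t) ts" using 4(4) by simp
    then obtain us u vs where *: "ts = us @ u # vs" "x \<in> tree_intervals (a + num_leaves t + forest_leaves us) u"
      "x \<noteq> (a + num_leaves t + forest_leaves us, a + num_leaves t + forest_leaves us + num_leaves u) \<longrightarrow>
          (\<exists>u'. contract_edge u u' \<and> tree_intervals (a + num_leaves t + forest_leaves us) u' =
            tree_intervals (a + num_leaves t + forest_leaves us) u - {x})"
      using 4(2,3) by (metis list.set_intros(2))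
    then show ?thesis by (intro exI[of _ "t # us"] exI[of _ u] exI[of _ vs]) (simp add: add.assoc)
  qed
qed auto

lemma finite_intervals:
  shows "finite (tree_intervals a t)" and "finite (forest_intervals a ts)"
  by (induction a t and a ts rule: tree_intervals_forest_intervals.induct) auto

lemma rtranclp_contract_edgeI:
  assumes "branching t" "branching t'" "num_leaves t' = num_leaves t" "tree_intervals a t' \<subseteq> tree_intervals a t"
  shows "contract_edge\<^sup>*\<^sup>* t t'"
  using assms
proof (induction "card (tree_intervals a t - tree_intervals a t')" arbitrary: t rule: less_induct)
  case less
  show ?case
  proof (cases "tree_intervals a t \<subseteq> tree_intervals a t'")
    case True
    then have "t = t'" using intervals_inject(1)[OF less.prems(1,2)] less.prems(3,4) by (metis subset_antisym)
    then show ?thesis by simp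
  next
    case False
    then obtain x where x: "x \<in> tree_intervals a t" "x \<notin> tree_intervals a t'" by blast
    have "x \<noteq> (a, a + num_leaves t)"
    proof
      assume root: "x = (a, a + num_leaves t)"
      then have "2 \<le> num_leaves t" using intervals_range(1)[OF less.prems(1) x(1)] by simp
      then obtain ts where "t' = Node ts" using less.prems(3) by (cases t') auto
      then have "x \<in> tree_intervals a t'" using root less.prems(3) by simp
      then show False using x(2) by simp
    qed
    then obtain t'' where t'': "contract_edge t t''" "tree_intervals a t'' = tree_intervals a t - {x}"
      using remove_interval(1)[OF less.prems(1) x(1)] by blast
    have "tree_intervals a t'' - tree_intervals a t' \<subset> tree_intervals a t - tree_intervals a t'"
      unfolding t''(2) using x by blast
    then have "card (tree_intervals a t'' - tree_intervals a t') < card (tree_intervals a t - tree_intervals a t')"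
      by (intro psubset_card_mono) (simp add: finite_intervals)
    then have "contract_edge\<^sup>*\<^sup>* t'' t'"
      using less.hyps[of t''] contract_edge_intervals(1,2)[OF t''(1)] less.prems t''(2) x(2) by auto
    then show ?thesis by (rule converse_rtranclp_into_rtranclp[of contract_edge, OF t''(1)])
  qed
qed

section \<open>Plane trees from laminar families\<close>

text \<open>An interval that starts to the left of the forest and is compatible with the root of
  each tree cannot end strictly inside a tree, so \<open>h\<close> lies on a boundary between
  trees.\<close>

lemma forest_prefix:
  assumes "\<forall>t\<in>set ts. branching t" "l < b" "b \<le> h" "h \<le> b + forest_leaves ts"
    and "\<And>y. y \<in> forest_intervals b ts \<Longrightarrow> compatible (l, h) y"
  shows "\<exists>ms vs. ts = ms @ vs \<and> h = b + forest_leaves ms"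
  using assms
proof (induction ts arbitrary: b)
  case Nil
  then show ?case by auto
next
  case (Cons t ts)
  consider "h = b" | "b < h" "h < b + num_leaves t" | "b + num_leaves t \<le> h" using Cons.prems(3) by linarith
  then show ?case
  proof cases
    case 1
    then show ?thesis by (intro exI[of _ "[]"] exI[of _ "t # ts"]) simp
  next
    case 2
    then obtain us where "t = Node us" by (cases t) auto
    then have "compatible (l, h) (b, b + num_leaves t)" by (intro Cons.prems(5)) simp
    then show ?thesis using 2 Cons.prems(2) by (auto simp: compatible_def)
  next
    case 3
    have "\<exists>ms vs. ts = ms @ vs \<and> h = b + num_leaves t + forest_leaves ms"
      using 3 Cons.prems by (intro Cons.IH) auto
    then obtain ms vs where "ts = ms @ vs" "h = b + num_leaves t + forest_leaves ms" by blast
    then show ?thesis by (intro exI[of _ "t # ms"] exI[of _ vs]) simp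
  qed
qed

text \<open>In a forest the new interval is either inserted inside one of the trees or covers a run
  \<open>ms\<close> of consecutive trees exactly; in the second case the enclosing node gathers
  \<open>ms\<close> under a new child.\<close>

lemma insert_interval:
  shows "branching t \<Longrightarrow> a \<le> l \<Longrightarrow> l + 2 \<le> h \<Longrightarrow> h \<le> a + num_leaves t \<Longrightarrow> (l, h) \<notin> tree_intervals a t \<Longrightarrow>
      (\<And>y. y \<in> tree_intervals a t \<Longrightarrow> compatible (l, h) y) \<Longrightarrow>
      \<exists>t'. branching t' \<and> num_leaves t' = num_leaves t \<and> tree_intervals a t' = insert (l, h) (tree_intervals a t)"
    and "\<forall>t\<in>set ts. branching t \<Longrightarrow> a \<le> l \<Longrightarrow> l + 2 \<le> h \<Longrightarrow> h \<le> a + forest_leaves ts \<Longrightarrow>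
      (l, h) \<notin> forest_intervals a ts \<Longrightarrow> (\<And>y. y \<in> forest_intervals a ts \<Longrightarrow> compatible (l, h) y) \<Longrightarrow>
      (\<exists>ts'. (\<forall>t\<in>set ts'. branching t) \<and> length ts' = length ts \<and> forest_leaves ts' = forest_leaves ts \<and>
        forest_intervals a ts' = insert (l, h) (forest_intervals a ts)) \<or>
      (\<exists>us ms vs. ts = us @ ms @ vs \<and> l = a + forest_leaves us \<and> h = l + forest_leaves ms)"
proof (induction a t and a ts rule: tree_intervals_forest_intervals.induct)
  case (1 a)
  then show ?case by simp
next
  case (2 a ts)
  have br: "\<forall>t\<in>set ts. branching t" "2 \<le> length ts" using 2(2) by simp_all
  have notroot: "(l, h) \<noteq> (a, a + forest_leaves ts)" "(l, h) \<notin> forest_intervals a ts" using 2(6) by auto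
  have "(\<exists>ts'. (\<forall>t\<in>set ts'. branching t) \<and> length ts' = length ts \<and> forest_leaves ts' = forest_leaves ts \<and>
        forest_intervals a ts' = insert (l, h) (forest_intervals a ts)) \<or>
      (\<exists>us ms vs. ts = us @ ms @ vs \<and> l = a + forest_leaves us \<and> h = l + forest_leaves ms)"
    using 2(3-5) notroot(2) 2(7) by (intro 2(1)[OF br(1)]) auto
  then show ?case
  proof (elim disjE exE conjE)
    fix ts' assume *: "\<forall>t\<in>set ts'. branching t" "length ts' = length ts" "forest_leaves ts' = forest_leaves ts"
      "forest_intervals a ts' = insert (l, h) (forest_intervals a ts)"
    then show ?thesis using br(2) by (intro exI[of _ "Node ts'"]) auto
  next
    fix us ms vs assume *: "ts = us @ ms @ vs" "l = a + forest_leaves us" "h = l + forest_leaves ms"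
    \<comment> \<open>A single tree filling the interval would already have it as its root
      interval.\<close>
    have "2 \<le> length ms"
    proof (rule ccontr)
      assume "\<not> 2 \<le> length ms"
      moreover have "ms \<noteq> []" using *(3) 2(4) by auto
      ultimately obtain u where u: "ms = [u]" by (cases ms) (auto simp: not_le less_Suc_eq numeral_2_eq_2)
      then have "2 \<le> num_leaves u" using *(3) 2(4) by simp
      then obtain ws where "u = Node ws" by (cases u) auto
      then have "(l, h) \<in> forest_intervals a ts" unfolding *(1) u
        using *(2,3) u by (simp add: forest_intervals_append)
      then show False using notroot(2) by simp
    qed
    \<comment> \<open>If \<open>ms\<close> were all of \<open>ts\<close>, the interval would be that
      of the enclosing node.\<close>
    moreover have "us \<noteq> [] \<or> vs \<noteq> []" using * notroot(1) by auto
    then have "2 \<le> length (us @ Node ms # vs)" by (cases us; cases vs) auto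
    ultimately have "branching (Node (us @ Node ms # vs))" using br(1) *(1) by auto
    moreover have "tree_intervals a (Node (us @ Node ms # vs)) = insert (l, h) (tree_intervals a (Node ts))"
      unfolding *(1) using *(2,3) by (auto simp: forest_intervals_append add.assoc)
    ultimately show ?thesis using *(1) by (intro exI[of _ "Node (us @ Node ms # vs)"]) auto
  qed
next
  case (3 a)
  then show ?case by simp
next
  case (4 a t ts)
  have br: "branching t" "\<forall>t\<in>set ts. branching t" using 4(3) by simp_all
  let ?b = "a + num_leaves t"
  have notin: "(l, h) \<notin> tree_intervals a t" "(l, h) \<notin> forest_intervals ?b ts" using 4(7) by auto
  have compat: "\<And>y. y \<in> tree_intervals a t \<Longrightarrow> compatible (l, h) y"
    "\<And>y. y \<in> forest_intervals ?b ts \<Longrightarrow> compatible (l, h) y" using 4(8) by auto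
  consider "h \<le> ?b" | "?b \<le> l" | "l < ?b" "?b < h" by linarith
  then show ?case
  proof cases
    case 1
    then obtain t' where "branching t'" "num_leaves t' = num_leaves t"
      "tree_intervals a t' = insert (l, h) (tree_intervals a t)"
      using 4(1)[OF br(1) 4(4,5) _ notin(1) compat(1)] by blast
    then show ?thesis using br(2) by (intro disjI1 exI[of _ "t' # ts"]) auto
  next
    case 2
    have "h \<le> ?b + forest_leaves ts" using 4(6) by simp
    then have "(\<exists>ts'. (\<forall>t\<in>set ts'. branching t) \<and> length ts' = length ts \<and> forest_leaves ts' = forest_leaves ts \<and>
        forest_intervals ?b ts' = insert (l, h) (forest_intervals ?b ts)) \<or>
      (\<exists>us ms vs. ts = us @ ms @ vs \<and> l = ?b + forest_leaves us \<and> h = l + forest_leaves ms)"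
      by (rule 4(2)[OF br(2) 2 4(5) _ notin(2) compat(2)])
    then show ?thesis
    proof (elim disjE exE conjE)
      fix ts' assume *: "\<forall>t\<in>set ts'. branching t" "length ts' = length ts" "forest_leaves ts' = forest_leaves ts"
        "forest_intervals ?b ts' = insert (l, h) (forest_intervals ?b ts)"
      then show ?thesis using br(1) by (intro disjI1 exI[of _ "t # ts'"]) auto
    next
      fix us ms vs assume "ts = us @ ms @ vs" "l = ?b + forest_leaves us" "h = l + forest_leaves ms"
      then show ?thesis by (intro disjI2 exI[of _ "t # us"] exI[of _ ms] exI[of _ vs]) simp
    qed
  next
    case 3
    \<comment> \<open>The interval straddles the end of the first tree, so compatibility with the
      root of that tree forces it to start at \<open>a\<close>.\<close>
    have "l = a"
    proof (cases t)
      case Leaf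
      then show ?thesis using 3 4(4) by simp
    next
      case (Node us)
      then have "compatible (l, h) (a, ?b)" by (intro compat(1)) simp
      then show ?thesis using 3 4(4) by (auto simp: compatible_def)
    qed
    obtain ms vs where "ts = ms @ vs" "h = ?b + forest_leaves ms"
      using forest_prefix[OF br(2) 3(1) _ _ compat(2)] 3(2) 4(6) by auto
    then show ?thesis using \<open>l = a\<close> by (intro disjI2 exI[of _ "[]"] exI[of _ "t # ms"] exI[of _ vs]) simp
  qed
qed

text \<open>Induction on the number of intervals: the root interval alone belongs to the tree with
  \<open>n\<close> leaves below its root, and otherwise some other interval is removed, the rest is
  realized, and the interval is inserted again.\<close>

lemma laminar_family_is_tree:
  assumes "2 \<le> n" "X \<in> laminar_families n"
  shows "\<exists>t\<in>plane_trees n. tree_intervals 0 t = X"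
  using assms(2)
proof (induction "card X" arbitrary: X rule: less_induct)
  case less
  have X: "X \<subseteq> {(l, h). l + 2 \<le> h \<and> h \<le> n}" "(0, n) \<in> X" "\<And>x y. x \<in> X \<Longrightarrow> y \<in> X \<Longrightarrow> compatible x y"
    using less.prems by (auto simp: laminar_families_def)
  have fin: "finite X" by (rule finite_subset[of _ "{..n} \<times> {..n}"]) (use X(1) in auto)
  show ?case
  proof (cases "X = {(0, n)}")
    case True
    have leaf: "forest_intervals a (replicate k Leaf) = {}" for a k by (induction k arbitrary: a) auto
    have leaves: "forest_leaves (replicate k Leaf) = k" for k by (induction k) auto
    have "tree_intervals 0 (Node (replicate n Leaf)) = X" using True leaf leaves by simp
    moreover have "Node (replicate n Leaf) \<in> plane_trees n" using assms(1) leaves by (simp add: plane_trees_def)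
    ultimately show ?thesis by blast
  next
    case False
    then have "\<not> X \<subseteq> {(0, n)}" using X(2) by blast
    then obtain x where "x \<in> X" "x \<noteq> (0, n)" by blast
    then obtain l h where x: "(l, h) \<in> X" "(l, h) \<noteq> (0, n)" by (cases x) auto
    have "X - {(l, h)} \<in> laminar_families n" using less.prems x(2) by (auto simp: laminar_families_def)
    moreover have "card (X - {(l, h)}) < card X" using x(1) fin by (intro psubset_card_mono) auto
    ultimately obtain t where t: "branching t" "num_leaves t = n" "tree_intervals 0 t = X - {(l, h)}"
      using less.hyps by (auto simp: plane_trees_def)
    have "l + 2 \<le> h" "h \<le> n" using X(1) x(1) by auto
    then obtain t' where "branching t'" "num_leaves t' = num_leaves t"
      "tree_intervals 0 t' = insert (l, h) (tree_intervals 0 t)"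
      using insert_interval(1)[OF t(1), of 0 l h] t(2,3) X(3) x(1) by auto
    then show ?thesis using t(2,3) x(1) by (intro bexI[of _ t']) (auto simp: plane_trees_def)
  qed
qed

lemma bij_betw_tree_intervals:
  assumes "2 \<le> n" shows "bij_betw (tree_intervals 0) (plane_trees n) (laminar_families n)"
  unfolding bij_betw_def
proof
  show "inj_on (tree_intervals 0) (plane_trees n)"
    by (rule inj_onI) (auto simp: plane_trees_def intro: intervals_inject(1))
  show "tree_intervals 0 ` plane_trees n = laminar_families n"
  proof (intro equalityI subsetI)
    fix X assume "X \<in> tree_intervals 0 ` plane_trees n"
    then obtain t where t: "branching t" "num_leaves t = n" "X = tree_intervals 0 t" by (auto simp: plane_trees_def)
    then obtain ts where "t = Node ts" using assms by (cases t) auto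
    then have "(0, n) \<in> X" using t by simp
    then show "X \<in> laminar_families n"
      using intervals_range(1)[OF t(1), of _ 0] intervals_compatible(1)[OF t(1)] t(2,3)
      by (fastforce simp: laminar_families_def)
  qed (use laminar_family_is_tree[OF assms] in blast)
qed

lemma contract_edge_iff_intervals:
  assumes "t \<in> plane_trees n" "t' \<in> plane_trees n"
  shows "contract_edge\<^sup>*\<^sup>* t t' \<longleftrightarrow> tree_intervals 0 t' \<subseteq> tree_intervals 0 t"
  using assms rtranclp_contract_edge_intervals rtranclp_contract_edgeI[of t t' 0] by (auto simp: plane_trees_def)

section \<open>Pipings of a chain\<close>

text \<open>Pipes of a chain are its nonempty intervals. Disjoint intervals are linearly ordered, so
  acyclicity is automatic and only laminarity remains. The pair of the whole chain lies in every
  laminar family but in no proper piping, hence its removal.\<close>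

lemma chain_proper_pipings:
  fixes r :: "'p rel"
  assumes r: "finite_connected_poset r" "2 \<le> card (Field r)" and chain: "chain_poset r"
  obtains \<pi> :: "nat \<times> nat \<Rightarrow> 'p set"
  where "bij_betw (\<lambda>X. \<pi> ` (X - {(0, card (Field r))})) (laminar_families (card (Field r))) (proper_pipings r)"
    "\<And>X Y. X \<in> laminar_families (card (Field r)) \<Longrightarrow> Y \<in> laminar_families (card (Field r)) \<Longrightarrow>
      \<pi> ` (X - {(0, card (Field r))}) \<subseteq> \<pi> ` (Y - {(0, card (Field r))}) \<longleftrightarrow> X \<subseteq> Y"
proof -
  interpret finite_poset r by (rule finite_poset_if_connected[OF r(1)])
  obtain n g where g: "bij_betw g {1..n::nat} (Field r)"
    and cov: "\<And>x y. covered_by r x y \<longleftrightarrow> (\<exists>i\<in>{1..<n}. x = g i \<and> y = g (Suc i))"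
    using chain unfolding chain_poset_def by blast
  have n: "n = card (Field r)" using bij_betw_same_card[OF g] by simp
  have g_inj: "inj_on g {1..n}" and g_image: "g ` {1..n} = Field r" using g by (auto simp: bij_betw_def)
  have g_eq: "g i = g j \<longleftrightarrow> i = j" if "i \<in> {1..n}" "j \<in> {1..n}" for i j
    using inj_on_eq_iff[OF g_inj that] .
  have prec_up: "prec r (g i) (g (i + Suc d))" if "1 \<le> i" "i + Suc d \<le> n" for i d
    using that(2)
  proof (induction d)
    case 0
    then have "covered_by r (g i) (g (i + Suc 0))" using that(1) unfolding cov by (intro bexI[of _ i]) auto
    then show ?case by (simp add: covered_by_def)
  next
    case (Suc d)
    have "covered_by r (g (i + Suc d)) (g (i + Suc (Suc d)))"
      using that(1) Suc.prems unfolding cov by (intro bexI[of _ "i + Suc d"]) auto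
    moreover have "prec r (g i) (g (i + Suc d))" using Suc by simp
    ultimately show ?case using prec_trans by (meson covered_by_def)
  qed
  have prec_less: "\<exists>i\<in>{1..n}. \<exists>j\<in>{1..n}. x = g i \<and> y = g j \<and> i < j" if "prec r x y" for x y
    using that
  proof (induction rule: prec_induct)
    case (cover x y)
    then obtain i where "i \<in> {1..<n}" "x = g i" "y = g (Suc i)" using cov by blast
    then show ?case by (intro bexI[of _ i] bexI[of _ "Suc i"]) auto
  next
    case (trans x y z)
    then obtain i j j' k where *: "i \<in> {1..n}" "j \<in> {1..n}" "x = g i" "y = g j" "i < j"
      "j' \<in> {1..n}" "k \<in> {1..n}" "y = g j'" "z = g k" "j' < k" by (elim bexE conjE)
    then have "j = j'" using g_eq by simp
    then show ?case using * by (intro bexI[of _ i] bexI[of _ k]) auto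
  qed
  have prec: "prec r (g i) (g j) \<longleftrightarrow> i < j" if ij: "i \<in> {1..n}" "j \<in> {1..n}" for i j
  proof
    assume "prec r (g i) (g j)"
    then obtain i' j' where "i' \<in> {1..n}" "j' \<in> {1..n}" "g i = g i'" "g j = g j'" "i' < j'"
      using prec_less by blast
    then show "i < j" using g_eq ij by simp
  next
    assume "i < j"
    then obtain d where "j = i + Suc d" using less_imp_Suc_add by fastforce
    then show "prec r (g i) (g j)" using prec_up ij by simp
  qed
  define I where "I = {(l, h). l + 2 \<le> h \<and> h \<le> n}"
  \<comment> \<open>The chain is numbered from 1 and leaves from 0, hence the successor at the left
    end.\<close>
  define \<pi> where "\<pi> x = g ` {Suc (fst x)..snd x}" for x
  have I_sub: "{Suc (fst x)..snd x} \<subseteq> {1..n}" "fst x + 2 \<le> snd x" if "x \<in> I" for x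
    using that by (auto simp: I_def)
  have sub_iff: "\<pi> x \<subseteq> \<pi> y \<longleftrightarrow> fst y \<le> fst x \<and> snd x \<le> snd y" if "x \<in> I" "y \<in> I" for x y
  proof -
    have "\<pi> x \<subseteq> \<pi> y \<longleftrightarrow> {Suc (fst x)..snd x} \<subseteq> {Suc (fst y)..snd y}"
      unfolding \<pi>_def by (rule inj_on_image_subset_iff[OF g_inj I_sub(1)[OF that(1)] I_sub(1)[OF that(2)]])
    then show ?thesis using I_sub(2)[OF that(1)] by auto
  qed
  have \<pi>_inj: "inj_on \<pi> I"
  proof (rule inj_onI)
    fix x y assume "x \<in> I" "y \<in> I" "\<pi> x = \<pi> y"
    then show "x = y" using sub_iff[of x y] sub_iff[of y x] by (simp add: prod_eq_iff)
  qed
  have disj_iff: "\<pi> x \<inter> \<pi> y = {} \<longleftrightarrow> snd x \<le> fst y \<or> snd y \<le> fst x" if "x \<in> I" "y \<in> I" for x y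
  proof -
    have "\<pi> x \<inter> \<pi> y = g ` ({Suc (fst x)..snd x} \<inter> {Suc (fst y)..snd y})"
      unfolding \<pi>_def by (rule inj_on_image_Int[OF g_inj I_sub(1)[OF that(1)] I_sub(1)[OF that(2)], symmetric])
    then have "\<pi> x \<inter> \<pi> y = {} \<longleftrightarrow> {Suc (fst x)..snd x} \<inter> {Suc (fst y)..snd y} = {}" by simp
    also have "\<dots> \<longleftrightarrow> snd x \<le> fst y \<or> snd y \<le> fst x"
      using I_sub(2)[OF that(1)] I_sub(2)[OF that(2)] unfolding Int_atLeastAtMost by auto
    finally show ?thesis .
  qed
  have compatible_iff: "compatible x y \<longleftrightarrow> \<pi> x \<subseteq> \<pi> y \<or> \<pi> y \<subseteq> \<pi> x \<or> \<pi> x \<inter> \<pi> y = {}"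
    if "x \<in> I" "y \<in> I" for x y
    unfolding compatible_def sub_iff[OF that] sub_iff[OF that(2,1)] disj_iff[OF that] by blast
  have card_\<pi>: "card (\<pi> x) = snd x - fst x" if "x \<in> I" for x
    unfolding \<pi>_def using inj_on_subset[OF g_inj I_sub(1)[OF that]] by (simp add: card_image)
  have \<pi>_pipe: "pipe r (\<pi> x)" if x: "x \<in> I" for x
    unfolding pipe_iff
  proof (intro conjI)
    show "\<pi> x \<noteq> {}" using I_sub(2)[OF x] by (simp add: \<pi>_def)
    show "\<pi> x \<subseteq> Field r" unfolding \<pi>_def g_image[symmetric] by (rule image_mono[OF I_sub(1)[OF x]])
    show "poset_convex r (\<pi> x)"
      unfolding poset_convex_def
    proof (intro ballI allI impI)
      fix u w v assume "u \<in> \<pi> x" "w \<in> \<pi> x" and v: "prec r u v \<and> prec r v w"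
      then obtain i k where ik: "u = g i" "w = g k" "i \<in> {Suc (fst x)..snd x}" "k \<in> {Suc (fst x)..snd x}"
        unfolding \<pi>_def by blast
      have "v \<in> g ` {1..n}" unfolding g_image using v prec_Field[of r u v] by simp
      then obtain j where j: "v = g j" "j \<in> {1..n}" by (rule imageE)
      have "i \<in> {1..n}" "k \<in> {1..n}" using ik I_sub(1)[OF x] by blast+
      then have "i < j" "j < k" using v ik(1,2) j prec by simp_all
      then show "v \<in> \<pi> x" using ik(3,4) unfolding \<pi>_def j(1) by (intro imageI) simp
    qed
    show "cut_connected r (\<pi> x)"
    proof (rule cut_connectedI, rule subsetI)
      fix X v assume X: "X \<subseteq> \<pi> x" "X \<noteq> {}" and v: "v \<in> \<pi> x"
        and cl: "\<And>i j. i \<in> X \<Longrightarrow> j \<in> \<pi> x \<Longrightarrow> comparable r i j \<Longrightarrow> j \<in> X"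
      obtain u where u: "u \<in> X" using X(2) by blast
      then obtain i j where ij: "u = g i" "v = g j" "i \<in> {Suc (fst x)..snd x}" "j \<in> {Suc (fst x)..snd x}"
        using X(1) v unfolding \<pi>_def by blast
      then have "i \<in> {1..n}" "j \<in> {1..n}" using I_sub(1)[OF x] by blast+
      then have "u = v \<or> comparable r u v"
        using prec[of i j] prec[of j i] unfolding ij(1,2) comparable_def by (metis linorder_neqE_nat)
      then show "v \<in> X" using cl u v by blast
    qed
  qed
  let ?x0 = "(0, n)"
  have "2 \<le> n" using r(2) n by simp
  then have x0: "?x0 \<in> I" by (simp add: I_def)
  have pipes: "proper_pipes r = \<pi> ` (I - {?x0})"
  proof (intro equalityI subsetI)
    fix \<sigma> assume "\<sigma> \<in> \<pi> ` (I - {?x0})"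
    then obtain x where x: "x \<in> I" "x \<noteq> ?x0" "\<sigma> = \<pi> x" by blast
    have "snd x - fst x < n" "1 < snd x - fst x" using x(1,2) by (cases x; auto simp: I_def)+
    then show "\<sigma> \<in> proper_pipes r" using \<pi>_pipe[OF x(1)] card_\<pi>[OF x(1)] x(3) n by (simp add: proper_pipes_def)
  next
    fix \<sigma> assume "\<sigma> \<in> proper_pipes r"
    then have \<sigma>: "pipe r \<sigma>" "1 < card \<sigma>" "card \<sigma> < n" by (auto simp: proper_pipes_def n)
    define J where "J = {i \<in> {1..n}. g i \<in> \<sigma>}"
    have "\<sigma> \<subseteq> g ` {1..n}" unfolding g_image by (rule pipe_subset[OF \<sigma>(1)])
    then have \<sigma>_eq: "\<sigma> = g ` J" unfolding J_def by auto
    have J: "finite J" "J \<noteq> {}" "J \<subseteq> {1..n}" using \<sigma>_eq pipe_nonempty[OF \<sigma>(1)] by (auto simp: J_def)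
    \<comment> \<open>Convexity fills the gap between the least and the greatest position.\<close>
    have "J = {Min J..Max J}"
    proof (intro equalityI subsetI)
      fix j assume j: "j \<in> {Min J..Max J}"
      have MM: "Min J \<in> J" "Max J \<in> J" using J by simp_all
      then have jn: "j \<in> {1..n}" using j J(3) by fastforce
      show "j \<in> J"
      proof (cases "j = Min J \<or> j = Max J")
        case False
        then have "prec r (g (Min J)) (g j)" "prec r (g j) (g (Max J))"
          using j jn MM J(3) prec by auto
        then have "g j \<in> \<sigma>"
          using poset_convexD[OF pipe_convex[OF \<sigma>(1)]] MM unfolding J_def by blast
        then show ?thesis using jn by (simp add: J_def)
      qed (use MM in auto)
    qed (use J in auto)
    moreover have "1 \<le> Min J" "Max J \<le> n" using J Min_in[OF J(1,2)] Max_in[OF J(1,2)] by auto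
    ultimately have J_eq: "J = {Suc (Min J - 1)..Max J}" by simp
    have "card \<sigma> = card J" unfolding \<sigma>_eq using inj_on_subset[OF g_inj J(3)] by (simp add: card_image)
    also have "\<dots> = Max J - (Min J - 1)" using J_eq by (metis card_atLeastAtMost diff_Suc_Suc)
    finally have c: "card \<sigma> = Max J - (Min J - 1)" .
    have "(Min J - 1, Max J) \<in> I" using c \<sigma>(2) \<open>Max J \<le> n\<close> by (auto simp: I_def)
    moreover have "(Min J - 1, Max J) \<noteq> ?x0" using c \<sigma>(3) by auto
    moreover have "\<sigma> = \<pi> (Min J - 1, Max J)" unfolding \<pi>_def fst_conv snd_conv \<sigma>_eq using J_eq by simp
    ultimately show "\<sigma> \<in> \<pi> ` (I - {?x0})" by blast
  qed
  \<comment> \<open>The left end of the interval is a rank, since an edge between disjoint intervals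
    goes from left to right.\<close>
  have acyclic: "acyclic (piping_digraph r (\<pi> ` Y))" if Y: "Y \<subseteq> I" for Y
  proof (rule acyclic_if_rank)
    fix \<rho> \<rho>' assume "(\<rho>, \<rho>') \<in> piping_digraph r (\<pi> ` Y)"
    then obtain u v where e: "\<rho> \<in> \<pi> ` Y" "\<rho>' \<in> \<pi> ` Y" "\<rho> \<inter> \<rho>' = {}" "u \<in> \<rho>" "v \<in> \<rho>'" "prec r u v"
      unfolding piping_digraph_def by blast
    obtain x where x: "\<rho> = \<pi> x" "x \<in> Y" using e(1) by (rule imageE)
    obtain y where y: "\<rho>' = \<pi> y" "y \<in> Y" using e(2) by (rule imageE)
    have xy: "x \<in> I" "y \<in> I" using x y Y by blast+
    obtain i j where ij: "u = g i" "v = g j" "i \<in> {Suc (fst x)..snd x}" "j \<in> {Suc (fst y)..snd y}"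
      using e(4,5) unfolding x(1) y(1) \<pi>_def by blast
    have "i \<in> {1..n}" "j \<in> {1..n}" using ij I_sub(1) xy by blast+
    then have "i < j" using e(6) ij(1,2) prec by simp
    then have "fst x < fst y"
      using e(3) disj_iff[OF xy] ij(3,4) unfolding x(1) y(1) by auto
    then show "fst (the_inv_into I \<pi> \<rho>) < fst (the_inv_into I \<pi> \<rho>')"
      unfolding x(1) y(1) using the_inv_into_f_f[OF \<pi>_inj] xy by simp
  qed
  have pipings: "\<pi> ` Y \<in> proper_pipings r \<longleftrightarrow> insert ?x0 Y \<in> laminar_families n" if Y: "Y \<subseteq> I - {?x0}" for Y
  proof -
    have YI: "Y \<subseteq> I" using Y by blast
    have compat0: "compatible ?x0 x" "compatible x ?x0" if "x \<in> I" for x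
      using that by (auto simp: compatible_def I_def)
    have "insert ?x0 Y \<in> laminar_families n \<longleftrightarrow> (\<forall>x\<in>Y. \<forall>y\<in>Y. compatible x y)"
      unfolding laminar_families_def I_def[symmetric] using YI x0 compat0 by auto
    also have "\<dots> \<longleftrightarrow> (\<forall>\<rho>\<in>\<pi> ` Y. \<forall>\<rho>'\<in>\<pi> ` Y. \<rho> \<subseteq> \<rho>' \<or> \<rho>' \<subseteq> \<rho> \<or> \<rho> \<inter> \<rho>' = {})"
    proof -
      have "compatible x y \<longleftrightarrow> \<pi> x \<subseteq> \<pi> y \<or> \<pi> y \<subseteq> \<pi> x \<or> \<pi> x \<inter> \<pi> y = {}" if "x \<in> Y" "y \<in> Y" for x y
        using compatible_iff that YI by blast
      then show ?thesis by simp
    qed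
    also have "\<dots> \<longleftrightarrow> \<pi> ` Y \<in> proper_pipings r"
    proof -
      have "\<forall>\<rho>\<in>\<pi> ` Y. pipe r \<rho>" using \<pi>_pipe YI by blast
      moreover have "\<pi> ` Y \<subseteq> proper_pipes r" unfolding pipes by (rule image_mono[OF Y])
      ultimately show ?thesis unfolding proper_pipings_def piping_def using acyclic[OF YI] by simp
    qed
    finally show ?thesis by simp
  qed
  have fam: "X - {?x0} \<subseteq> I - {?x0}" "insert ?x0 (X - {?x0}) = X" if "X \<in> laminar_families n" for X
    using that by (auto simp: laminar_families_def I_def)
  have mono: "\<pi> ` (X - {?x0}) \<subseteq> \<pi> ` (Y - {?x0}) \<longleftrightarrow> X \<subseteq> Y"
    if X: "X \<in> laminar_families n" and Y: "Y \<in> laminar_families n" for X Y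
  proof -
    have "\<pi> ` (X - {?x0}) \<subseteq> \<pi> ` (Y - {?x0}) \<longleftrightarrow> X - {?x0} \<subseteq> Y - {?x0}"
      using fam(1)[OF X] fam(1)[OF Y] by (intro inj_on_image_subset_iff[OF \<pi>_inj]) blast+
    also have "\<dots> \<longleftrightarrow> X \<subseteq> Y" using X Y by (auto simp: laminar_families_def)
    finally show ?thesis .
  qed
  have "bij_betw (\<lambda>X. \<pi> ` (X - {?x0})) (laminar_families n) (proper_pipings r)"
    unfolding bij_betw_def
  proof
    show "inj_on (\<lambda>X. \<pi> ` (X - {?x0})) (laminar_families n)"
    proof (rule inj_onI)
      fix X Y assume "X \<in> laminar_families n" "Y \<in> laminar_families n" "\<pi> ` (X - {?x0}) = \<pi> ` (Y - {?x0})"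
      then show "X = Y" using mono[of X Y] mono[of Y X] by simp
    qed
    show "(\<lambda>X. \<pi> ` (X - {?x0})) ` laminar_families n = proper_pipings r"
    proof (intro equalityI subsetI)
      fix T assume "T \<in> (\<lambda>X. \<pi> ` (X - {?x0})) ` laminar_families n"
      then obtain X where X: "T = \<pi> ` (X - {?x0})" "X \<in> laminar_families n" by (rule imageE)
      then show "T \<in> proper_pipings r" using pipings[OF fam(1)[OF X(2)]] fam(2)[OF X(2)] by simp
    next
      fix T assume T: "T \<in> proper_pipings r"
      then have "T \<subseteq> \<pi> ` (I - {?x0})" unfolding pipes[symmetric] by (simp add: proper_pipings_def)
      then obtain Y where Y: "Y \<subseteq> I - {?x0}" "T = \<pi> ` Y" by (rule subset_imageE)
      then have "insert ?x0 Y \<in> laminar_families n" using pipings[OF Y(1)] T by simp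
      moreover have "insert ?x0 Y - {?x0} = Y" using Y(1) by blast
      ultimately show "T \<in> (\<lambda>X. \<pi> ` (X - {?x0})) ` laminar_families n"
        using Y(2) by (intro image_eqI[of _ _ "insert ?x0 Y"]) simp_all
    qed
  qed
  then show ?thesis using mono unfolding n by (rule that)
qed

text \<open>Larger pipings give smaller faces and come from trees with more inner vertices, so the
  two order reversals cancel and inclusion of faces becomes contraction of trees.\<close>

lemma chain_associahedron:
  fixes r :: "'p rel" and A :: "'a::euclidean_space set"
  assumes r: "finite_connected_poset r" "2 \<le> card (Field r)" and A: "poset_associahedron r A f"
    and chain: "chain_poset r"
  shows "is_associahedron (card (Field r)) A"
proof -
  let ?n = "card (Field r)"
  note faces = poset_associahedron_piping_face[OF r(1) A]
  obtain \<pi> :: "nat \<times> nat \<Rightarrow> 'p set" where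
    \<pi>: "bij_betw (\<lambda>X. \<pi> ` (X - {(0, ?n)})) (laminar_families ?n) (proper_pipings r)"
    and mono: "\<And>X Y. X \<in> laminar_families ?n \<Longrightarrow> Y \<in> laminar_families ?n \<Longrightarrow>
      \<pi> ` (X - {(0, ?n)}) \<subseteq> \<pi> ` (Y - {(0, ?n)}) \<longleftrightarrow> X \<subseteq> Y"
    by (rule chain_proper_pipings[OF r chain]) (rule that)
  define \<Phi> where "\<Phi> t = piping_face A f (\<pi> ` (tree_intervals 0 t - {(0, ?n)}))" for t
  note trees = bij_betw_tree_intervals[OF r(2)]
  have bij: "bij_betw \<Phi> (plane_trees ?n) (nonempty_faces A)"
    using bij_betw_trans[OF trees bij_betw_trans[OF \<pi> faces(4)]] by (simp add: \<Phi>_def[abs_def] comp_def)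
  have order: "\<Phi> t \<subseteq> \<Phi> t' \<longleftrightarrow> contract_edge\<^sup>*\<^sup>* t t'" if t: "t \<in> plane_trees ?n" "t' \<in> plane_trees ?n" for t t'
  proof -
    have X: "tree_intervals 0 t \<in> laminar_families ?n" "tree_intervals 0 t' \<in> laminar_families ?n"
      using bij_betwE[OF trees] t by blast+
    have "\<Phi> t \<subseteq> \<Phi> t' \<longleftrightarrow> \<pi> ` (tree_intervals 0 t' - {(0, ?n)}) \<subseteq> \<pi> ` (tree_intervals 0 t - {(0, ?n)})"
      unfolding \<Phi>_def using bij_betwE[OF \<pi>] X by (intro faces(5)) blast+
    also have "\<dots> \<longleftrightarrow> tree_intervals 0 t' \<subseteq> tree_intervals 0 t" by (rule mono[OF X(2,1)])
    finally show ?thesis using contract_edge_iff_intervals[OF t] by simp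
  qed
  let ?\<phi> = "the_inv_into (plane_trees ?n) \<Phi>"
  have \<phi>: "bij_betw ?\<phi> (nonempty_faces A) (plane_trees ?n)" by (rule bij_betw_the_inv_into[OF bij])
  have \<Phi>\<phi>: "\<Phi> (?\<phi> F) = F" if "F \<in> nonempty_faces A" for F by (rule f_the_inv_into_f_bij_betw[OF bij that])
  have "F \<subseteq> F' \<longleftrightarrow> contract_edge\<^sup>*\<^sup>* (?\<phi> F) (?\<phi> F')"
    if F: "F face_of A \<and> F \<noteq> {} \<and> F' face_of A \<and> F' \<noteq> {}" for F F'
  proof -
    have FF: "F \<in> nonempty_faces A" "F' \<in> nonempty_faces A" using F by (simp_all add: mem_nonempty_faces)
    then have "?\<phi> F \<in> plane_trees ?n" "?\<phi> F' \<in> plane_trees ?n" using bij_betwE[OF \<phi>] by blast+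
    then show ?thesis using order[of "?\<phi> F" "?\<phi> F'"] \<Phi>\<phi>[OF FF(1)] \<Phi>\<phi>[OF FF(2)] by simp
  qed
  then show ?thesis
    unfolding is_associahedron_def using faces(1,2) \<phi> unfolding nonempty_faces_def by blast
qed

text \<open>The first conjunct supplies realizations in every Euclidean space of dimension at least
  \<open>|P| - 2\<close>, so the claims about all realizations are not vacuous. For claws the type
  \<open>'k\<close> has \<open>|P| - 1\<close> elements because the permutohedron lives in
  \<open>real ^ 'k\<close>, and the example that is not flag lives in \<open>real ^ 4\<close>
  because the crown has six elements.\<close>

theorem corollary2p7:
  fixes r :: "'p rel"
  assumes "finite_connected_poset r" and "2 \<le> card (Field r)"
  shows
    "(card (Field r) \<le> DIM('a) + 2 \<longrightarrow>
        (\<exists>(A :: 'a::euclidean_space set) f. poset_associahedron r A f)) \<and>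
     (\<forall>(A :: 'a set) f. poset_associahedron r A f \<longrightarrow>
        (simple_polytope A \<and> aff_dim A = int (card (Field r)) - 2) \<and>
        simplicial_polytope (polar_dual A) \<and>
        (\<forall>T\<in>proper_pipings r. piping_face A f T face_of A \<and>
           aff_dim (piping_face A f T) = int (card (Field r)) - int (card T) - 2) \<and>
        bij_betw (piping_face A f)
          {T \<in> proper_pipings r. card T = card (Field r) - 2}
          {{v} |v. v extreme_point_of A} \<and>
        bij_betw (\<lambda>\<tau>. piping_face A f {\<tau>}) (proper_pipes r) {F. F facet_of A} \<and>
        (\<forall>F. F face_of A \<and> F \<noteq> {} \<longrightarrow>
           (\<exists>rs :: nat rel list.
              (\<forall>r'\<in>set rs. finite_connected_poset r' \<and> 2 \<le> card (Field r')) \<and>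
              associahedra_product rs F)) \<and>
        (chain_poset r \<longrightarrow> is_associahedron (card (Field r)) A) \<and>
        (claw_poset r \<and> CARD('k::finite) = card (Field r) - 1 \<longrightarrow>
           combinatorially_equivalent A (permutohedron :: (real ^ 'k) set))) \<and>
     (\<exists>(r' :: nat rel) (A' :: (real ^ 4) set) f'.
        finite_connected_poset r' \<and> 2 \<le> card (Field r') \<and> poset_associahedron r' A' f' \<and>
        \<not> flag_complex (boundary_complex (polar_dual A')))"
proof (intro conjI allI impI ballI)
  assume "card (Field r) \<le> DIM('a) + 2"
  then show "\<exists>(A :: 'a set) f. poset_associahedron r A f" by (rule poset_associahedron_exists[OF assms])
next
  have crown: "card (Field crown) = 6" by (simp add: Field_crown)
  then obtain A' :: "(real ^ 4) set" and f' where A': "poset_associahedron crown A' f'"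
    using poset_associahedron_exists[where ?'a = "real ^ 4", OF finite_connected_poset_crown] by auto
  show "\<exists>(r' :: nat rel) (A' :: (real ^ 4) set) f'.
        finite_connected_poset r' \<and> 2 \<le> card (Field r') \<and> poset_associahedron r' A' f' \<and>
        \<not> flag_complex (boundary_complex (polar_dual A'))"
    using finite_connected_poset_crown crown A' crown_not_flag[OF A']
    by (intro exI[of _ crown] exI[of _ A'] exI[of _ f']) simp
next
  fix A :: "'a set" and f T assume A: "poset_associahedron r A f" and T: "T \<in> proper_pipings r"
  show "piping_face A f T face_of A"
    using bij_betwE[OF poset_associahedron_piping_face(4)[OF assms(1) A]] T by (simp add: mem_nonempty_faces)
  show "aff_dim (piping_face A f T) = int (card (Field r)) - int (card T) - 2"
    by (rule poset_associahedron_piping_face(6)[OF assms(1) A T])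
next
  fix A :: "'a set" and f assume A: "poset_associahedron r A f"
  note faces = poset_associahedron_piping_face[OF assms(1) A]
  show "simple_polytope A" by (rule faces(3))
  show "aff_dim A = int (card (Field r)) - 2" by (rule faces(2))
  show "simplicial_polytope (polar_dual A)" by (rule faces(9))
  show "bij_betw (piping_face A f) {T \<in> proper_pipings r. card T = card (Field r) - 2}
      {{v} |v. v extreme_point_of A}" by (rule faces(7))
  show "bij_betw (\<lambda>\<tau>. piping_face A f {\<tau>}) (proper_pipes r) {F. F facet_of A}" by (rule faces(8))
next
  fix A F :: "'a set" and f assume "poset_associahedron r A f" "F face_of A \<and> F \<noteq> {}"
  then show "\<exists>rs :: nat rel list. (\<forall>r'\<in>set rs. finite_connected_poset r' \<and> 2 \<le> card (Field r')) \<and>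
      associahedra_product rs F"
    using face_associahedra_product[OF assms] by blast
next
  fix A :: "'a set" and f assume "poset_associahedron r A f" "chain_poset r"
  then show "is_associahedron (card (Field r)) A" by (rule chain_associahedron[OF assms])
next
  fix A :: "'a set" and f
  assume "poset_associahedron r A f" "claw_poset r \<and> CARD('k) = card (Field r) - 1"
  then show "combinatorially_equivalent A (permutohedron :: (real ^ 'k) set)"
    using claw_permutohedron[OF assms] by blast
qed

end
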